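(* Let $\alpha:B\to B\otimes A$ be a faithful action of a compact quantum group $\mathcal{G}=(A,\Delta)$ on a unital $C^*$-algebra $B$. Suppose that one of the following two conditions is true: (1) every $\alpha$-invariant state on $B$ is tracial; (2) there exists a faithful tracial $\alpha$-invariant state on $B$. Then $\mathcal{G}$ is a Kac algebra.
   Context: $\otimes$ denotes the minimal tensor product of $C^*$-algebras. A compact quantum group $\mathcal{G}$ is a pair $(A,\Delta)$ with $A$ a unital $C^*$-algebra and $\Delta:A\to A\otimes A$ a unital $*$-homomorphism such that $(id\otimes\Delta)\Delta=(\Delta\otimes id)\Delta$ and the linear spans of $\Delta(A)(1\otimes A)$ and of $\Delta(A)(A\otimes 1)$ are dense in $A\otimes A$. Its Haar measure (Haar state) is the unique state $h$ on $A$ with $(h\otimes id)\Delta(a)=(id\otimes h)\Delta(a)=h(a)1_A$ for all $a\in A$. $\mathcal{G}$ is called a Kac algebra if $h$ is tracial, i.e. $h(ab)=h(ba)$ for all $a,b\in A$ (equivalently, the antipode $\kappa$ satisfies $\kappa^2=id$ on the dense Hopf $*$-algebra $\mathscr{A}\subseteq A$ spanned by the matrix coefficients of irreducible unitary representations). An action of $\mathcal{G}$ on a unital $C^*$-algebra $B$ is a unital $*$-homomorphism $\alpha:B\to B\otimes A$ with $(\alpha\otimes id)\alpha=(id\otimes\Delta)\alpha$ and such that the linear span of $\alpha(B)(1\otimes A)$ is dense in $B\otimes A$. A state $\mu$ on $B$ is $\alpha$-invariant if $(\mu\otimes id)\alpha(b)=\mu(b)1_A$ for all $b\in B$; it is faithful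 if $\mu(b^*b)=0$ implies $b=0$, and tracial if $\mu(ab)=\mu(ba)$ for all $a,b\in B$. A compact quantum quotient group of $\mathcal{G}$ is a unital $C^*$-subalgebra $Q\subseteq A$ with $\Delta(Q)\subseteq Q\otimes Q$ and with $\Delta(Q)(1\otimes Q)$ and $\Delta(Q)(Q\otimes 1)$ having dense linear span in $Q\otimes Q$; it is proper if $Q\neq A$. The action $\alpha$ is faithful if there is no proper compact quantum quotient group $Q$ of $\mathcal{G}$ for which there is an action $\alpha_q:B\to B\otimes Q$ of $(Q,\Delta|_Q)$ on $B$ with $\alpha(b)=\alpha_q(b)$ for all $b\in B$. *)

theory Defs
  imports "HOL-Analysis.Analysis"
begin

section \<open>Unital $C^*$-algebras\<close>

text \<open>The zero algebra is an instance; it is excluded by additionally requiring the class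
\<^class>\<open>zero_neq_one\<close>.\<close>

class cstar_algebra = banach + real_normed_algebra + monoid_mult +
  fixes scaleC :: "complex \<Rightarrow> 'a \<Rightarrow> 'a"  (infixr "*\<^sub>C" 75)
    and star :: "'a \<Rightarrow> 'a"
  assumes scaleC_add_right: "c *\<^sub>C (x + y) = c *\<^sub>C x + c *\<^sub>C y"
    and scaleC_add_left: "(c + d) *\<^sub>C x = c *\<^sub>C x + d *\<^sub>C x"
    and scaleC_scaleC: "c *\<^sub>C d *\<^sub>C x = (c * d) *\<^sub>C x"
    and scaleR_scaleC: "r *\<^sub>R x = complex_of_real r *\<^sub>C x"
    and mult_scaleC_left: "(c *\<^sub>C x) * y = c *\<^sub>C (x * y)"
    and mult_scaleC_right: "x * (c *\<^sub>C y) = c *\<^sub>C (x * y)"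
    and norm_scaleC: "norm (c *\<^sub>C x) = cmod c * norm x"
    and star_add: "star (x + y) = star x + star y"
    and star_scaleC: "star (c *\<^sub>C x) = cnj c *\<^sub>C star x"
    and star_mult: "star (x * y) = star y * star x"
    and star_star [simp]: "star (star x) = x"
    and cstar_identity: "norm (star x * x) = (norm x)\<^sup>2"

lemma scaleC_one [simp]: "1 *\<^sub>C x = (x :: 'a::cstar_algebra)"
  using scaleR_scaleC[of 1 x] by simp

lemma star_one [simp]: "star 1 = (1 :: 'a::cstar_algebra)"
  by (metis mult_1 mult_1_right star_mult star_star)

lemma norm_star [simp]: "norm (star x) = norm (x :: 'a::cstar_algebra)"
proof -
  have le: "norm y \<le> norm (star y)" for y :: 'a
  proof (cases "y = 0")
    case False
    have "norm y * norm y \<le> norm (star y) * norm y"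
      using cstar_identity[of y] norm_mult_ineq[of "star y" y] by (simp add: power2_eq_square)
    then show ?thesis using False by simp
  qed simp
  show ?thesis using le[of x] le[of "star x"] by simp
qed

text \<open>Positive functionals are automatically bounded, so the first conjunct merely makes
this available.\<close>

definition state :: "('a::cstar_algebra \<Rightarrow> complex) \<Rightarrow> bool" where
  "state \<phi> \<longleftrightarrow>
     bounded_linear \<phi> \<and> (\<forall>c x. \<phi> (c *\<^sub>C x) = c * \<phi> x) \<and>
     (\<forall>x. Im (\<phi> (star x * x)) = 0 \<and> 0 \<le> Re (\<phi> (star x * x))) \<and> \<phi> 1 = 1"

section \<open>The minimal tensor product\<close>

text \<open>A list of pairs \<open>(a\<^sub>i, b\<^sub>i)\<close> represents the element \<open>\<Sum>\<^sub>i a\<^sub>i \<otimes> b\<^sub>i\<close> of the algebraic tensor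
product; the following are the operations of that \<open>*\<close>-algebra on representatives.  For states
\<open>\<phi>\<close>, \<open>\<psi>\<close>, \<open>prod_fun \<phi> \<psi>\<close> is the product functional \<open>\<phi> \<otimes> \<psi>\<close>.\<close>

definition fs_mult :: "('a \<times> 'b) list \<Rightarrow> ('a \<times> 'b) list \<Rightarrow> ('a::cstar_algebra \<times> 'b::cstar_algebra) list" where
  "fs_mult xs ys = concat (map (\<lambda>(a, b). map (\<lambda>(c, d). (a * c, b * d)) ys) xs)"

definition fs_star :: "('a \<times> 'b) list \<Rightarrow> ('a::cstar_algebra \<times> 'b::cstar_algebra) list" where
  "fs_star xs = map (\<lambda>(a, b). (star a, star b)) xs"

definition fs_scale :: "complex \<Rightarrow> ('a \<times> 'b) list \<Rightarrow> ('a::cstar_algebra \<times> 'b::cstar_algebra) list" where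
  "fs_scale c xs = map (\<lambda>(a, b). (c *\<^sub>C a, b)) xs"

definition prod_fun :: "('a \<Rightarrow> complex) \<Rightarrow> ('b \<Rightarrow> complex) \<Rightarrow> ('a::cstar_algebra \<times> 'b::cstar_algebra) list \<Rightarrow> complex" where
  "prod_fun \<phi> \<psi> xs = (\<Sum>(a, b)\<leftarrow>xs. \<phi> a * \<psi> b)"

lemma fs_mult_Nil [simp]: "fs_mult [] ys = []"
  and fs_mult_Cons: "fs_mult (x # xs) ys = map (\<lambda>(c, d). (fst x * c, snd x * d)) ys @ fs_mult xs ys"
  and fs_mult_append: "fs_mult (xs @ zs) ys = fs_mult xs ys @ fs_mult zs ys"
  by (auto simp: fs_mult_def case_prod_unfold)

lemma fs_mult_map: "fs_mult (map (\<lambda>(c, d). (a * c, b * d)) xs) ys = map (\<lambda>(c, d). (a * c, b * d)) (fs_mult xs ys)"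
  by (induction xs) (auto simp: fs_mult_Cons mult.assoc)

lemma fs_mult_assoc: "fs_mult (fs_mult xs ys) zs = fs_mult xs (fs_mult ys zs)"
  by (induction xs) (auto simp: fs_mult_Cons fs_mult_append fs_mult_map)

lemma fs_mult_one_left: "fs_mult [(1, 1)] ys = ys"
  by (simp add: fs_mult_Cons case_prod_unfold)

lemma fs_mult_one_right: "fs_mult xs [(1, 1)] = xs"
  by (induction xs) (auto simp: fs_mult_Cons)

lemma fs_mult_scale_left: "fs_mult (fs_scale c xs) ys = fs_scale c (fs_mult xs ys)"
  by (induction xs) (auto simp: fs_mult_Cons fs_scale_def mult_scaleC_left)

lemma fs_mult_scale_right: "fs_mult xs (fs_scale c ys) = fs_scale c (fs_mult xs ys)"
  by (induction xs) (auto simp: fs_mult_Cons fs_scale_def mult_scaleC_right)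

lemma fs_star_star [simp]: "fs_star (fs_star xs) = xs"
  by (induction xs) (auto simp: fs_star_def)

lemma fs_star_append: "fs_star (xs @ ys) = fs_star xs @ fs_star ys"
  and fs_scale_append: "fs_scale c (xs @ ys) = fs_scale c xs @ fs_scale c ys"
  by (auto simp: fs_star_def fs_scale_def)

lemma fs_star_scale: "fs_star (fs_scale c xs) = fs_scale (cnj c) (fs_star xs)"
  by (induction xs) (auto simp: fs_star_def fs_scale_def star_scaleC)

lemma mset_fs_mult_Cons_right: "mset (fs_mult xs (y # ys)) = mset (map (\<lambda>(a, b). (a * fst y, b * snd y)) xs) + mset (fs_mult xs ys)"
  by (induction xs) (auto simp: fs_mult_Cons case_prod_unfold)

lemma fs_mult_Nil_right [simp]: "fs_mult xs [] = []"
  by (induction xs) (auto simp: fs_mult_Cons)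

lemma mset_fs_mult_append_right: "mset (fs_mult xs (ys @ zs)) = mset (fs_mult xs ys) + mset (fs_mult xs zs)"
  by (induction ys) (auto simp: mset_fs_mult_Cons_right)

lemma mset_fs_mult_cong_right: "mset ys = mset ys' \<Longrightarrow> mset (fs_mult xs ys) = mset (fs_mult xs ys')"
  by (induction xs) (auto simp: fs_mult_Cons)

lemma mset_fs_mult_cong_left: "mset xs = mset xs' \<Longrightarrow> mset (fs_mult xs ys) = mset (fs_mult xs' ys)"
  by (induction ys) (auto simp: mset_fs_mult_Cons_right)

lemma mset_fs_star_mult: "mset (fs_star (fs_mult xs ys)) = mset (fs_mult (fs_star ys) (fs_star xs))"
proof (induction xs)
  case (Cons x xs)
  have 1: "fs_star (map (\<lambda>(c, d). (fst x * c, snd x * d)) ys) =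
      map (\<lambda>(a, b). (a * star (fst x), b * star (snd x))) (fs_star ys)"
    by (auto simp: fs_star_def star_mult)
  have 2: "fs_star (x # xs) = (star (fst x), star (snd x)) # fs_star xs"
    by (auto simp: fs_star_def case_prod_unfold)
  show ?case unfolding fs_mult_Cons fs_star_append 1 2 mset_fs_mult_Cons_right
    using Cons by simp
qed (auto simp: fs_star_def)

lemma prod_fun_mset: "mset xs = mset ys \<Longrightarrow> prod_fun \<phi> \<psi> xs = prod_fun \<phi> \<psi> ys"
  unfolding prod_fun_def sum_mset_sum_list[symmetric] mset_map by simp

lemma prod_fun_append: "prod_fun \<phi> \<psi> (xs @ ys) = prod_fun \<phi> \<psi> xs + prod_fun \<phi> \<psi> ys"
  by (simp add: prod_fun_def)

lemma prod_fun_mult: "prod_fun \<phi> \<psi> (fs_mult xs ys) = (\<Sum>(a, b)\<leftarrow>xs. \<Sum>(c, d)\<leftarrow>ys. \<phi> (a * c) * \<psi> (b * d))"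
  by (induction xs) (auto simp: prod_fun_def fs_mult_Cons comp_def case_prod_unfold)

lemma state_add: "state \<phi> \<Longrightarrow> \<phi> (x + y) = \<phi> x + \<phi> y"
  by (auto simp: state_def linear_add bounded_linear.linear)

lemma state_scale: "state \<phi> \<Longrightarrow> \<phi> (c *\<^sub>C x) = c * \<phi> x"
  by (auto simp: state_def)

lemma state_sum: "state \<phi> \<Longrightarrow> \<phi> (sum f A) = (\<Sum>x\<in>A. \<phi> (f x))"
  by (auto simp: state_def linear_sum bounded_linear.linear)

lemma prod_fun_scale: "state \<phi> \<Longrightarrow> prod_fun \<phi> \<psi> (fs_scale c xs) = c * prod_fun \<phi> \<psi> xs"
  by (induction xs) (auto simp: prod_fun_def fs_scale_def state_scale algebra_simps)

lemma hermitian_aux: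
  fixes u v :: complex
  assumes "\<And>c. Im (c * u + cnj c * v) = 0"
  shows "v = cnj u"
  using assms[of 1] assms[of \<i>] by (auto simp: complex_eq_iff)

lemma state_star:
  assumes "state \<phi>" shows "\<phi> (star x) = cnj (\<phi> x)"
proof (rule hermitian_aux)
  fix c
  let ?y = "1 + c *\<^sub>C x"
  have "star ?y * ?y = 1 + (c *\<^sub>C x + cnj c *\<^sub>C star x) + star (c *\<^sub>C x) * (c *\<^sub>C x)"
    by (simp add: star_add star_scaleC distrib_left distrib_right)
  then have eq: "\<phi> (star ?y * ?y) =
      \<phi> 1 + (c * \<phi> x + cnj c * \<phi> (star x)) + \<phi> (star (c *\<^sub>C x) * (c *\<^sub>C x))"
    by (simp only: state_add[OF assms] state_scale[OF assms])
  have im: "Im (\<phi> (star y * y)) = 0" for y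
    using assms unfolding state_def by blast
  have one: "Im (\<phi> 1) = 0" using assms by (simp add: state_def)
  from arg_cong[OF eq, of Im] im[of ?y] im[of "c *\<^sub>C x"] one
  show "Im (c * \<phi> x + cnj c * \<phi> (star x)) = 0"
    unfolding plus_complex.simps by linarith
qed

lemma prod_fun_star: "state \<phi> \<Longrightarrow> state \<psi> \<Longrightarrow> prod_fun \<phi> \<psi> (fs_star xs) = cnj (prod_fun \<phi> \<psi> xs)"
  by (induction xs) (auto simp: prod_fun_def fs_star_def state_star)

lemma psd_factor:
  fixes P :: "nat \<Rightarrow> nat \<Rightarrow> complex"
  assumes "\<And>i j. i < n \<Longrightarrow> j < n \<Longrightarrow> P j i = cnj (P i j)"
    and "\<And>c. 0 \<le> Re (\<Sum>i<n. \<Sum>j<n. cnj (c i) * c j * P i j)"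
  shows "\<exists>v. \<forall>i<n. \<forall>j<n. P i j = (\<Sum>k<n. cnj (v k i) * v k j)"
  using assms
proof (induction n arbitrary: P)
  case (Suc n)
  have h: "P j i = cnj (P i j)" if "i \<le> n" "j \<le> n" for i j
    by (rule Suc.prems(1)) (use that in auto)
  define p where "p = Re (P n n)"
  have Pnn: "P n n = complex_of_real p"
    using arg_cong[OF h[of n n], of Im] by (intro complex_eqI) (auto simp: p_def)
  have exp: "(\<Sum>i<Suc n. \<Sum>j<Suc n. cnj (c i) * c j * P i j) =
     (\<Sum>i<n. \<Sum>j<n. cnj (c i) * c j * P i j) + (\<Sum>i<n. cnj (c i) * P i n) * c n
       + cnj (c n) * (\<Sum>j<n. c j * P n j) + cnj (c n) * c n * P n n" for c
    by (simp add: sum.distrib sum_distrib_left sum_distrib_right algebra_simps)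
  have p0: "0 \<le> p"
    using Suc.prems(2)[of "\<lambda>i. if i = n then 1 else 0"] unfolding exp by (simp add: p_def)
  have cs: "(\<Sum>j<n. c j * P n j) = cnj (\<Sum>i<n. cnj (c i) * P i n)" for c
    by (auto simp: h[of _ n] intro!: sum.cong)
  have main: "0 \<le> Re (\<Sum>i<n. \<Sum>j<n. cnj (c i) * c j * P i j) + 2 * Re (t * (\<Sum>i<n. cnj (c i) * P i n)) + (cmod t)\<^sup>2 * p" for c t
  proof -
    let ?S = "\<Sum>i<n. cnj (c i) * P i n"
    have "0 \<le> Re (\<Sum>i<Suc n. \<Sum>j<Suc n. cnj ((c(n := t)) i) * (c(n := t)) j * P i j)"
      by (rule Suc.prems(2))
    also have "(\<Sum>i<Suc n. \<Sum>j<Suc n. cnj ((c(n := t)) i) * (c(n := t)) j * P i j) =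
       (\<Sum>i<n. \<Sum>j<n. cnj (c i) * c j * P i j) + ?S * t + cnj t * cnj ?S + cnj t * t * P n n"
      unfolding exp cs[symmetric] by simp
    finally have fin: "0 \<le> Re ((\<Sum>i<n. \<Sum>j<n. cnj (c i) * c j * P i j) + ?S * t + cnj t * cnj ?S + cnj t * t * P n n)" .
    have aux: "Re (s * t) + Re (cnj t * cnj s) = 2 * Re (t * s)" for s by (simp add: algebra_simps)
    have re2: "Re (cnj t * t * complex_of_real p) = (cmod t)\<^sup>2 * p"
      unfolding cmod_power2 by (simp add: power2_eq_square algebra_simps)
    show ?thesis using fin aux[of ?S] re2 unfolding Pnn plus_complex.simps by linarith
  qed
  define R where "R i j = P i j - (if p = 0 then 0 else P i n * P n j / p)" for i j
  have R_h: "R j i = cnj (R i j)" if "i < n" "j < n" for i j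
    using that h[of i j] h[of i n] h[of n j] by (auto simp: R_def)
  have R_pos: "0 \<le> Re (\<Sum>i<n. \<Sum>j<n. cnj (c i) * c j * R i j)" for c
  proof -
    let ?S = "\<Sum>i<n. cnj (c i) * P i n"
    have prod: "(\<Sum>i<n. \<Sum>j<n. cnj (c i) * c j * (P i n * P n j / p)) = ?S * cnj ?S / p"
      unfolding cs[symmetric] sum_product sum_divide_distrib by (intro sum.cong) (auto simp: algebra_simps)
    have Req: "(\<Sum>i<n. \<Sum>j<n. cnj (c i) * c j * R i j) = (\<Sum>i<n. \<Sum>j<n. cnj (c i) * c j * P i j)
        - (if p = 0 then 0 else ?S * cnj ?S / p)"
      unfolding prod[symmetric] R_def by (auto simp: right_diff_distrib sum_subtractf)
    show ?thesis
    proof (cases "p = 0")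
      case True
      then show ?thesis using main[of c 0] Req by simp
    next
      case False
      have "Re (?S * cnj ?S / p) = (cmod ?S)\<^sup>2 / p"
        by (simp only: complex_norm_square[symmetric] flip: of_real_divide) simp
      moreover have "2 * Re ((- cnj ?S / p) * ?S) + (cmod (- cnj ?S / p))\<^sup>2 * p = - (cmod ?S)\<^sup>2 / p"
      proof -
        have "(- cnj ?S / p) * ?S = complex_of_real (- (cmod ?S)\<^sup>2 / p)"
          using complex_norm_square[of ?S] by (simp add: mult.commute)
        then have "Re ((- cnj ?S / p) * ?S) = - (cmod ?S)\<^sup>2 / p" by (metis Re_complex_of_real)
        moreover have "cmod (- cnj ?S / p) = cmod ?S / p"
          unfolding norm_divide norm_minus_cancel complex_mod_cnj using p0 by simp
        ultimately show ?thesis using False by (simp add: power2_eq_square)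
      qed
      ultimately show ?thesis using main[of c "- cnj ?S / p"] Req False by simp
    qed
  qed
  obtain v where v: "\<And>i j. i < n \<Longrightarrow> j < n \<Longrightarrow> R i j = (\<Sum>k<n. cnj (v k i) * v k j)"
    using Suc.IH[OF R_h R_pos] by blast
  have zero: "P i n = 0" if "p = 0" "i < n" for i
  proof (rule ccontr)
    assume nz: "P i n \<noteq> 0"
    define c :: "nat \<Rightarrow> complex" where "c = (\<lambda>k. if k = i then 1 else 0)"
    let ?A = "Re (\<Sum>i<n. \<Sum>j<n. cnj (c i) * c j * P i j)"
    have S: "(\<Sum>k<n. cnj (c k) * P k n) = P i n"
      using that by (simp add: c_def if_distrib if_distribR cong: if_cong)
    have "0 \<le> ?A + 2 * Re (t * P i n)" for t
      using main[of c t] S that by simp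
    from this[of "- complex_of_real (\<bar>?A\<bar> + 1) / P i n"] nz show False by simp
  qed
  define w where "w k j = (if k < n then (if j < n then v k j else 0) else
      (if p = 0 then 0 else P n j / sqrt p))" for k j
  have sq: "complex_of_real (sqrt p) * complex_of_real (sqrt p) = p"
    using p0 by (metis of_real_mult real_sqrt_mult_self abs_of_nonneg)
  have "P i j = (\<Sum>k<Suc n. cnj (w k i) * w k j)" if ij: "i < Suc n" "j < Suc n" for i j
  proof (cases "p = 0")
    case True
    consider "i < n" "j < n" | "i = n" "j = n" | "i = n" "j < n" | "i < n" "j = n"
      using ij by linarith
    then show ?thesis
    proof cases
      case 1 then show ?thesis using v[of i j] True by (simp add: w_def R_def)
    next
      case 2 then show ?thesis using Pnn True by (simp add: w_def)
    next
      case 3 then show ?thesis using h[of j n] zero[of j] True by (simp add: w_def)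
    next
      case 4 then show ?thesis using zero[of i] True by (simp add: w_def)
    qed
  next
    case False
    have last: "cnj (w n i) * w n j = P i n * P n j / p"
      using False p0 h[of n i] ij by (simp add: w_def sq field_simps flip: of_real_mult)
    consider "i < n" "j < n" | "i = n \<or> j = n"
      using ij by linarith
    then show ?thesis
    proof cases
      case 1 then show ?thesis using v[of i j] False unfolding sum.lessThan_Suc last by (simp add: R_def w_def eq_diff_eq diff_eq_eq)
    next
      case 2
      then have "(\<Sum>k<n. cnj (w k i) * w k j) = 0"
        by (intro sum.neutral) (auto simp: w_def)
      moreover have "P i n * P n j / p = P i j"
        using 2 Pnn False by auto
      ultimately show ?thesis using last by simp
    qed
  qed
  then show ?case by blast
qed auto

lemma gram_pos:
  fixes \<phi> :: "'a::cstar_algebra \<Rightarrow> complex"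
  assumes "state \<phi>"
  shows "(\<Sum>i<(n::nat). \<Sum>j<n. cnj (c i) * c j * \<phi> (star (a i) * a j)) = \<phi> (star (\<Sum>i<n. c i *\<^sub>C a i) * (\<Sum>i<n. c i *\<^sub>C a i))"
proof -
  have "star (\<Sum>i<n. f i) = (\<Sum>i<n. star (f i))" for f :: "nat \<Rightarrow> 'a" and n :: nat
  proof (induction n)
    case 0
    have "star (0::'a) = 0" using star_add[of "0::'a" 0] by simp
    then show ?case by simp
  qed (simp add: star_add)
  note star_sum = this
  have e: "\<phi> (star (c *\<^sub>C x) * (d *\<^sub>C y)) = cnj c * d * \<phi> (star x * y)" for c d x y
    unfolding star_scaleC mult_scaleC_left mult_scaleC_right state_scale[OF assms] by (simp only: mult.assoc mult.left_commute[of d])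
  show ?thesis
    unfolding star_sum sum_product state_sum[OF assms] e ..
qed

lemma state_pos: "state \<phi> \<Longrightarrow> 0 \<le> Re (\<phi> (star x * x))" "state \<phi> \<Longrightarrow> Im (\<phi> (star x * x)) = 0"
  by (auto simp: state_def)

text \<open>The inner product \<open>(\<phi> \<otimes> \<psi>)(z\<^sup>* y)\<close> of the GNS space of \<open>\<phi> \<otimes> \<psi>\<close>, that is of the Hilbert
tensor product of the GNS spaces of \<open>\<phi>\<close> and \<open>\<psi>\<close>, in which the algebraic tensor product is dense.\<close>

definition gns_inner where "gns_inner \<phi> \<psi> z y = prod_fun \<phi> \<psi> (fs_mult (fs_star z) y)"

lemma gns_inner_pos:
  fixes xs :: "('a::cstar_algebra \<times> 'b::cstar_algebra) list"
  assumes "state \<phi>" "state \<psi>"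
  shows "0 \<le> Re (gns_inner \<phi> \<psi> xs xs)"
proof -
  let ?n = "length xs"
  define a where "a i = fst (xs ! i)" for i
  define b where "b i = snd (xs ! i)" for i
  define P where "P i j = \<phi> (star (a i) * a j)" for i j
  define Q where "Q i j = \<psi> (star (b i) * b j)" for i j
  have eq: "gns_inner \<phi> \<psi> xs xs = (\<Sum>i<?n. \<Sum>j<?n. P i j * Q i j)"
    by (simp add: gns_inner_def prod_fun_mult fs_star_def comp_def case_prod_unfold sum_list_sum_nth atLeast0LessThan P_def Q_def a_def b_def)
  obtain v where v: "\<And>i j. i < ?n \<Longrightarrow> j < ?n \<Longrightarrow> P i j = (\<Sum>k<?n. cnj (v k i) * v k j)"
  proof -
    have "P j i = cnj (P i j)" for i j
      using state_star[OF assms(1), of "star (a i) * a j"] by (simp add: P_def star_mult)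
    moreover have "0 \<le> Re (\<Sum>i<?n. \<Sum>j<?n. cnj (c i) * c j * P i j)" for c
      unfolding P_def gram_pos[OF assms(1)] by (rule state_pos[OF assms(1)])
    ultimately show ?thesis using psd_factor[of ?n P] that by blast
  qed
  have "(\<Sum>i<?n. \<Sum>j<?n. P i j * Q i j) = (\<Sum>i<?n. \<Sum>j<?n. \<Sum>k<?n. cnj (v k i) * v k j * Q i j)"
    by (intro sum.cong) (auto simp: v sum_distrib_right)
  also have "\<dots> = (\<Sum>k<?n. \<Sum>i<?n. \<Sum>j<?n. cnj (v k i) * v k j * Q i j)"
  proof -
    have "(\<Sum>i<?n. \<Sum>j<?n. \<Sum>k<?n. g i j k) = (\<Sum>k<?n. \<Sum>i<?n. \<Sum>j<?n. g i j k)"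
      for g :: "nat \<Rightarrow> nat \<Rightarrow> nat \<Rightarrow> complex"
      by (rule trans[OF sum.cong[OF refl sum.swap] sum.swap])
    then show ?thesis .
  qed
  also have "Re \<dots> = (\<Sum>k<?n. Re (\<Sum>i<?n. \<Sum>j<?n. cnj (v k i) * v k j * Q i j))" by (rule Re_sum)
  also have "\<dots> \<ge> 0"
    unfolding Q_def gram_pos[OF assms(2)] by (intro sum_nonneg state_pos[OF assms(2)])
  finally show ?thesis unfolding eq .
qed

lemma gns_inner_append_right: "gns_inner \<phi> \<psi> z (x @ y) = gns_inner \<phi> \<psi> z x + gns_inner \<phi> \<psi> z y"
  unfolding gns_inner_def by (subst prod_fun_append[symmetric], rule prod_fun_mset) (simp add: mset_fs_mult_append_right)

lemma gns_inner_append_left: "gns_inner \<phi> \<psi> (x @ y) z = gns_inner \<phi> \<psi> x z + gns_inner \<phi> \<psi> y z"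
  by (simp add: gns_inner_def fs_star_append fs_mult_append prod_fun_append)

lemma gns_inner_scale_right: "state \<phi> \<Longrightarrow> gns_inner \<phi> \<psi> z (fs_scale c y) = c * gns_inner \<phi> \<psi> z y"
  by (simp add: gns_inner_def fs_mult_scale_right prod_fun_scale)

lemma gns_inner_scale_left: "state \<phi> \<Longrightarrow> gns_inner \<phi> \<psi> (fs_scale c z) y = cnj c * gns_inner \<phi> \<psi> z y"
  by (simp add: gns_inner_def fs_mult_scale_left fs_star_scale prod_fun_scale)

lemma gns_inner_sym: "state \<phi> \<Longrightarrow> state \<psi> \<Longrightarrow> gns_inner \<phi> \<psi> y z = cnj (gns_inner \<phi> \<psi> z y)"
  unfolding gns_inner_def
  by (subst prod_fun_star[symmetric], assumption+, rule prod_fun_mset) (simp add: mset_fs_star_mult)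

lemma gns_inner_adjoint: "gns_inner \<phi> \<psi> z (fs_mult x y) = gns_inner \<phi> \<psi> (fs_mult (fs_star x) z) y"
  unfolding gns_inner_def fs_mult_assoc[symmetric]
  by (rule prod_fun_mset, rule mset_fs_mult_cong_left) (simp add: mset_fs_star_mult)

definition gns_seminorm where "gns_seminorm \<phi> \<psi> y = sqrt (Re (gns_inner \<phi> \<psi> y y))"

lemma gns_seminorm_nonneg: "state \<phi> \<Longrightarrow> state \<psi> \<Longrightarrow> 0 \<le> gns_seminorm \<phi> \<psi> y"
  by (simp add: gns_seminorm_def gns_inner_pos)

lemma gns_seminorm_sq: "state \<phi> \<Longrightarrow> state \<psi> \<Longrightarrow> (gns_seminorm \<phi> \<psi> y)\<^sup>2 = Re (gns_inner \<phi> \<psi> y y)"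
  by (simp add: gns_seminorm_def gns_inner_pos)

lemma quad_disc:
  fixes p q :: real and r :: complex
  assumes "0 \<le> p" "0 \<le> q" and quad: "\<And>c. 0 \<le> p + 2 * Re (c * r) + (cmod c)\<^sup>2 * q"
  shows "(cmod r)\<^sup>2 \<le> p * q"
proof (cases "q = 0")
  case True
  have "r = 0"
  proof (rule ccontr)
    assume "r \<noteq> 0"
    then show False using quad[of "- complex_of_real (p + 1) / r"] True assms by simp
  qed
  then show ?thesis using assms by simp
next
  case False
  have 1: "- cnj r / q * r = complex_of_real (- (cmod r)\<^sup>2 / q)"
    using complex_norm_square[of r] by (simp add: mult.commute)
  have 2: "cmod (- cnj r / q) = cmod r / q"
    unfolding norm_divide norm_minus_cancel complex_mod_cnj using assms by simp
  have "0 \<le> p - (cmod r)\<^sup>2 / q"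
    using quad[of "- cnj r / q"] False unfolding 1 2 Re_complex_of_real by (simp add: power2_eq_square)
  then show ?thesis using False assms by (simp add: field_simps)
qed

lemma gns_inner_cs:
  assumes "state \<phi>" "state \<psi>"
  shows "cmod (gns_inner \<phi> \<psi> z y) \<le> gns_seminorm \<phi> \<psi> z * gns_seminorm \<phi> \<psi> y"
proof -
  have "(cmod (gns_inner \<phi> \<psi> z y))\<^sup>2 \<le> Re (gns_inner \<phi> \<psi> z z) * Re (gns_inner \<phi> \<psi> y y)"
  proof (rule quad_disc)
    fix c
    have eq: "gns_inner \<phi> \<psi> (z @ fs_scale c y) (z @ fs_scale c y) =
        gns_inner \<phi> \<psi> z z + (c * gns_inner \<phi> \<psi> z y + cnj (c * gns_inner \<phi> \<psi> z y)) + cnj c * c * gns_inner \<phi> \<psi> y y"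
      using assms by (simp add: gns_inner_append_left gns_inner_append_right gns_inner_scale_left gns_inner_scale_right gns_inner_sym[of \<phi> \<psi> y z] algebra_simps)
    have im: "Im (gns_inner \<phi> \<psi> y y) = 0"
      using arg_cong[OF gns_inner_sym[OF assms, of y y], of Im] by simp
    have "Re (cnj c * c * gns_inner \<phi> \<psi> y y) = (cmod c)\<^sup>2 * Re (gns_inner \<phi> \<psi> y y)"
      unfolding cmod_power2 by (simp add: im power2_eq_square algebra_simps)
    moreover have "Re (w + cnj w) = 2 * Re w" for w by simp
    ultimately show "0 \<le> Re (gns_inner \<phi> \<psi> z z) + 2 * Re (c * gns_inner \<phi> \<psi> z y) + (cmod c)\<^sup>2 * Re (gns_inner \<phi> \<psi> y y)"
      using gns_inner_pos[OF assms, of "z @ fs_scale c y"] unfolding eq by (metis plus_complex.simps(1))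
  qed (auto intro: gns_inner_pos assms)
  then have "(cmod (gns_inner \<phi> \<psi> z y))\<^sup>2 \<le> (gns_seminorm \<phi> \<psi> z * gns_seminorm \<phi> \<psi> y)\<^sup>2"
    using assms by (simp add: power_mult_distrib gns_seminorm_sq)
  then show ?thesis
    by (rule power2_le_imp_le) (use assms in \<open>simp add: gns_seminorm_nonneg\<close>)
qed

lemma power_le_imp_le_limit:
  fixes r s C :: real
  assumes "0 \<le> s" "0 \<le> r" and le: "\<And>n. r ^ (2 ^ n) \<le> C * s ^ (2 ^ n)"
  shows "r \<le> s"
proof (rule ccontr)
  assume "\<not> r \<le> s"
  then have rs: "s < r" by simp
  show False
  proof (cases "s = 0")
    case True then show False using le[of 0] rs by simp
  next
    case False
    then have s: "0 < s" using assms by simp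
    have b: "(r / s) ^ (2 ^ n) \<le> C" for n
      using le[of n] s by (simp add: power_divide field_simps)
    obtain k where k: "C < (r / s) ^ k"
      using real_arch_pow[of "r / s" C] rs s by auto
    have "(r / s) ^ k \<le> (r / s) ^ (2 ^ k)"
      using rs s by (intro power_increasing) (auto simp: less_imp_le)
    then show False using b[of k] k by simp
  qed
qed

lemma positive_functional_bound:
  fixes \<theta> :: "'a::cstar_algebra \<Rightarrow> complex"
  assumes bl: "bounded_linear \<theta>" and Q: "0 \<le> Q"
    and cs: "\<And>x. star x = x \<Longrightarrow> (Re (\<theta> x))\<^sup>2 \<le> Q * Re (\<theta> (x * x))"
    and pos: "0 \<le> Re (\<theta> (star a * a))"
  shows "Re (\<theta> (star a * a)) \<le> (norm a)\<^sup>2 * Q"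
proof (cases "Q = 0")
  case True
  then show ?thesis using cs[of "star a * a"] by (simp add: star_mult)
next
  case False
  then have Q: "0 < Q" using Q by simp
  define h where "h n = (star a * a) ^ (2 ^ n)" for n :: nat
  have h_Suc: "h (Suc n) = h n * h n" for n
    by (simp add: h_def mult_2 power_add)
  have h0: "h 0 = star a * a" by (simp add: h_def)
  have sa: "star (h n) = h n" for n
    by (induction n) (auto simp: h_Suc h0 star_mult)
  have nh: "norm (h n) \<le> norm (h 0) ^ (2 ^ n)" for n
  proof (induction n)
    case (Suc n)
    have "norm (h (Suc n)) \<le> norm (h n) * norm (h n)"
      unfolding h_Suc by (rule norm_mult_ineq)
    also have "\<dots> \<le> norm (h 0) ^ (2 ^ n) * norm (h 0) ^ (2 ^ n)"
      by (intro mult_mono Suc) auto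
    finally show ?case by (simp add: mult_2 power_add)
  qed simp
  obtain M where M: "\<And>x. cmod (\<theta> x) \<le> norm x * M" "0 < M"
    using bounded_linear.pos_bounded[OF bl] by blast
  define r where "r n = Re (\<theta> (h n)) / Q" for n
  have step: "(r n)\<^sup>2 \<le> r (Suc n)" for n
    using cs[OF sa[of n]] Q by (simp add: r_def h_Suc power2_eq_square field_simps)
  have r0: "0 \<le> r 0" using pos Q by (simp add: r_def h0)
  have r_ge: "r 0 ^ (2 ^ n) \<le> r n" for n
  proof (induction n)
    case (Suc n)
    have "r 0 ^ (2 ^ Suc n) = (r 0 ^ (2 ^ n))\<^sup>2"
      by (simp add: mult_2 power_add power2_eq_square)
    also have "\<dots> \<le> (r n)\<^sup>2" using Suc r0 by (intro power_mono) auto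
    finally show ?case using step[of n] by simp
  qed simp
  have "r 0 \<le> norm (h 0)"
  proof (rule power_le_imp_le_limit)
    fix n
    have "r 0 ^ (2 ^ n) \<le> r n" by (rule r_ge)
    also have "r n \<le> norm (h n) * M / Q"
      unfolding r_def using Q by (intro divide_right_mono order_trans[OF complex_Re_le_cmod M(1)]) auto
    also have "\<dots> \<le> norm (h 0) ^ (2 ^ n) * M / Q"
      using Q M nh by (intro divide_right_mono mult_right_mono) (auto simp: less_imp_le)
    finally show "r 0 ^ (2 ^ n) \<le> M / Q * norm (h 0) ^ (2 ^ n)" by (simp add: mult.commute)
  qed (use r0 in auto)
  then show ?thesis using Q by (simp add: r_def h0 cstar_identity field_simps)
qed

lemma bounded_linear_sum_list:
  assumes "\<And>x. x \<in> set xs \<Longrightarrow> bounded_linear (f x)"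
  shows "bounded_linear (\<lambda>c. \<Sum>x\<leftarrow>xs. f x c)"
  using assms by (induction xs) (auto intro: bounded_linear_add bounded_linear_zero)

lemma bounded_linear_state: "state \<phi> \<Longrightarrow> bounded_linear (\<lambda>c. \<phi> (a * (c * b)))"
  by (rule bounded_linear_compose[of \<phi>])
    (auto simp: state_def intro: bounded_linear_compose[OF bounded_linear_mult_right bounded_linear_mult_left])

lemma gns_seminorm_mult_left:
  assumes st: "state \<phi>" "state \<psi>"
  shows "gns_seminorm \<phi> \<psi> (fs_mult [(a, 1)] y) \<le> norm a * gns_seminorm \<phi> \<psi> y"
proof -
  define \<theta> where "\<theta> c = gns_inner \<phi> \<psi> y (fs_mult [(c, 1)] y)" for c
  have gram: "\<theta> (star c * c) = gns_inner \<phi> \<psi> (fs_mult [(c, 1)] y) (fs_mult [(c, 1)] y)" for c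
  proof -
    have "fs_mult (fs_star [(c, 1)]) [(c, 1)] = [(star c * c, 1 :: 'b)]" by (simp add: fs_star_def fs_mult_Cons)
    then show ?thesis using gns_inner_adjoint[of \<phi> \<psi> y "fs_star [(c, 1)]" "fs_mult [(c, 1)] y"]
      by (simp add: \<theta>_def flip: fs_mult_assoc)
  qed
  have "Re (\<theta> (star a * a)) \<le> (norm a)\<^sup>2 * Re (gns_inner \<phi> \<psi> y y)"
  proof (rule positive_functional_bound)
    show "bounded_linear \<theta>"
      unfolding \<theta>_def gns_inner_def prod_fun_mult fs_mult_Cons fs_mult_Nil append_Nil2 map_map case_prod_unfold comp_def fst_conv snd_conv
      by (intro bounded_linear_sum_list bounded_linear_mult_const bounded_linear_state st)
    show "0 \<le> Re (gns_inner \<phi> \<psi> y y)" "0 \<le> Re (\<theta> (star a * a))"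
      unfolding gram by (intro gns_inner_pos st)+
    fix x :: 'a assume x: "star x = x"
    have "(Re (\<theta> x))\<^sup>2 \<le> (cmod (\<theta> x))\<^sup>2" by (simp add: cmod_power2)
    also have "\<dots> \<le> (gns_seminorm \<phi> \<psi> y * gns_seminorm \<phi> \<psi> (fs_mult [(x, 1)] y))\<^sup>2"
      unfolding \<theta>_def by (intro power_mono gns_inner_cs st) auto
    also have "\<dots> = Re (gns_inner \<phi> \<psi> y y) * Re (\<theta> (x * x))"
      using gram[of x] x st by (simp add: power_mult_distrib gns_seminorm_sq)
    finally show "(Re (\<theta> x))\<^sup>2 \<le> Re (gns_inner \<phi> \<psi> y y) * Re (\<theta> (x * x))" .
  qed
  then have "(gns_seminorm \<phi> \<psi> (fs_mult [(a, 1)] y))\<^sup>2 \<le> (norm a * gns_seminorm \<phi> \<psi> y)\<^sup>2"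
    unfolding gram power_mult_distrib gns_seminorm_sq[OF st] .
  then show ?thesis by (rule power2_le_imp_le) (simp add: gns_seminorm_nonneg st)
qed

lemma gns_seminorm_mult_right:
  assumes st: "state \<phi>" "state \<psi>"
  shows "gns_seminorm \<phi> \<psi> (fs_mult [(1, a)] y) \<le> norm a * gns_seminorm \<phi> \<psi> y"
proof -
  define \<theta> where "\<theta> c = gns_inner \<phi> \<psi> y (fs_mult [(1, c)] y)" for c
  have gram: "\<theta> (star c * c) = gns_inner \<phi> \<psi> (fs_mult [(1, c)] y) (fs_mult [(1, c)] y)" for c
  proof -
    have "fs_mult (fs_star [(1, c)]) [(1, c)] = [(1 :: 'a, star c * c)]" by (simp add: fs_star_def fs_mult_Cons)
    then show ?thesis using gns_inner_adjoint[of \<phi> \<psi> y "fs_star [(1, c)]" "fs_mult [(1, c)] y"]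
      by (simp add: \<theta>_def flip: fs_mult_assoc)
  qed
  have "Re (\<theta> (star a * a)) \<le> (norm a)\<^sup>2 * Re (gns_inner \<phi> \<psi> y y)"
  proof (rule positive_functional_bound)
    show "bounded_linear \<theta>"
      unfolding \<theta>_def gns_inner_def prod_fun_mult fs_mult_Cons fs_mult_Nil append_Nil2 map_map case_prod_unfold comp_def fst_conv snd_conv
      by (intro bounded_linear_sum_list bounded_linear_const_mult bounded_linear_state st)
    show "0 \<le> Re (gns_inner \<phi> \<psi> y y)" "0 \<le> Re (\<theta> (star a * a))"
      unfolding gram by (intro gns_inner_pos st)+
    fix x :: 'b assume x: "star x = x"
    have "(Re (\<theta> x))\<^sup>2 \<le> (cmod (\<theta> x))\<^sup>2" by (simp add: cmod_power2)
    also have "\<dots> \<le> (gns_seminorm \<phi> \<psi> y * gns_seminorm \<phi> \<psi> (fs_mult [(1, x)] y))\<^sup>2"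
      unfolding \<theta>_def by (intro power_mono gns_inner_cs st) auto
    also have "\<dots> = Re (gns_inner \<phi> \<psi> y y) * Re (\<theta> (x * x))"
      using gram[of x] x st by (simp add: power_mult_distrib gns_seminorm_sq)
    finally show "(Re (\<theta> x))\<^sup>2 \<le> Re (gns_inner \<phi> \<psi> y y) * Re (\<theta> (x * x))" .
  qed
  then have "(gns_seminorm \<phi> \<psi> (fs_mult [(1, a)] y))\<^sup>2 \<le> (norm a * gns_seminorm \<phi> \<psi> y)\<^sup>2"
    unfolding gram power_mult_distrib gns_seminorm_sq[OF st] .
  then show ?thesis by (rule power2_le_imp_le) (simp add: gns_seminorm_nonneg st)
qed

lemma gns_inner_bounded:
  "\<exists>K. \<forall>\<phi> \<psi> y z. state \<phi> \<longrightarrow> state \<psi> \<longrightarrow> cmod (gns_inner \<phi> \<psi> z (fs_mult x y)) \<le> K * (gns_seminorm \<phi> \<psi> z * gns_seminorm \<phi> \<psi> y)"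
proof (induction x)
  case Nil
  show ?case by (intro exI[of _ 0]) (auto simp: gns_inner_def prod_fun_def)
next
  case (Cons p x)
  obtain a b where p: "p = (a, b)" by fastforce
  from Cons obtain K where K: "\<And>\<phi> \<psi> y z. state \<phi> \<Longrightarrow> state \<psi> \<Longrightarrow>
      cmod (gns_inner \<phi> \<psi> z (fs_mult x y)) \<le> K * (gns_seminorm \<phi> \<psi> z * gns_seminorm \<phi> \<psi> y)" by blast
  have "cmod (gns_inner \<phi> \<psi> z (fs_mult (p # x) y)) \<le> (norm a * norm b + K) * (gns_seminorm \<phi> \<psi> z * gns_seminorm \<phi> \<psi> y)"
    if st: "state \<phi>" "state \<psi>" for \<phi> \<psi> y z
  proof -
    have "fs_mult (p # x) y = fs_mult [(a, 1)] (fs_mult [(1, b)] y) @ fs_mult x y"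
      by (simp add: p fs_mult_Cons comp_def case_prod_unfold)
    then have "cmod (gns_inner \<phi> \<psi> z (fs_mult (p # x) y)) \<le>
        cmod (gns_inner \<phi> \<psi> z (fs_mult [(a, 1)] (fs_mult [(1, b)] y))) + cmod (gns_inner \<phi> \<psi> z (fs_mult x y))"
      by (simp add: gns_inner_append_right norm_triangle_ineq)
    also have "cmod (gns_inner \<phi> \<psi> z (fs_mult [(a, 1)] (fs_mult [(1, b)] y))) \<le>
        gns_seminorm \<phi> \<psi> z * (norm a * (norm b * gns_seminorm \<phi> \<psi> y))"
      by (intro order_trans[OF gns_inner_cs] mult_left_mono order_trans[OF gns_seminorm_mult_left] gns_seminorm_mult_right st gns_seminorm_nonneg) auto
    finally show ?thesis using K[OF st, of z y] by (simp add: algebra_simps)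
  qed
  then show ?case by blast
qed

text \<open>The minimal norm of \<open>x\<close> is the supremum, over all states \<open>\<phi>\<close> and \<open>\<psi>\<close>, of the operator norms
\<open>\<parallel>(\<pi>\<^sub>\<phi> \<otimes> \<pi>\<^sub>\<psi>)(x)\<parallel>\<close> for the GNS representations \<open>\<pi>\<^sub>\<phi>\<close>, \<open>\<pi>\<^sub>\<psi>\<close>.  Equivalently it is the supremum
norm of the function taking \<open>(\<phi>, \<psi>, y, z)\<close>, with \<open>y\<close>, \<open>z\<close> in the unit ball of the GNS space, to the
matrix coefficient \<open>(\<phi> \<otimes> \<psi>)(z\<^sup>* x y)\<close>.  The completion is therefore obtained as the closure of the
set of these functions in the Banach space of bounded functions; bounded functions are taken from
\<open>bcontfun\<close>, for the discrete metric on the index type.  The characterisation of the resulting norm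
is the theorem \<open>norm_tensor_sum_le_iff\<close> below.\<close>

datatype ('a, 'b) gns_pair =
  GNS_Pair "'a \<Rightarrow> complex" "'b \<Rightarrow> complex" "('a \<times> 'b) list" "('a \<times> 'b) list"

instantiation gns_pair :: (type, type) metric_space
begin

definition dist_gns_pair :: "('a, 'b) gns_pair \<Rightarrow> ('a, 'b) gns_pair \<Rightarrow> real" where
  "dist_gns_pair p q = (if p = q then 0 else 1)"

definition uniformity_gns_pair :: "(('a, 'b) gns_pair \<times> ('a, 'b) gns_pair) filter" where
  "uniformity_gns_pair = (INF e\<in>{0 <..}. principal {(x, y). dist x y < e})"

definition open_gns_pair :: "('a, 'b) gns_pair set \<Rightarrow> bool" where
  "open_gns_pair S = (\<forall>x\<in>S. \<forall>\<^sub>F (x', y) in uniformity. x' = x \<longrightarrow> y \<in> S)"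

instance
  by standard (auto simp: dist_gns_pair_def uniformity_gns_pair_def open_gns_pair_def)

end

fun matrix_coeff :: "('a \<times> 'b) list \<Rightarrow> ('a::cstar_algebra, 'b::cstar_algebra) gns_pair \<Rightarrow> complex" where
  "matrix_coeff xs (GNS_Pair \<phi> \<psi> y z) =
     (if state \<phi> \<and> state \<psi> \<and> Re (gns_inner \<phi> \<psi> y y) \<le> 1 \<and> Re (gns_inner \<phi> \<psi> z z) \<le> 1
      then gns_inner \<phi> \<psi> z (fs_mult xs y) else 0)"

lemma matrix_coeff_bcontfun:
  fixes xs :: "('a::cstar_algebra \<times> 'b::cstar_algebra) list"
  shows "matrix_coeff xs \<in> bcontfun"
proof -
  have dg: "open S" for S :: "('a, 'b) gns_pair set"
    unfolding open_dist by (auto simp: dist_gns_pair_def intro!: exI[of _ 1] split: if_splits)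
  obtain K where K: "\<And>\<phi> \<psi> y z. state \<phi> \<Longrightarrow> state \<psi> \<Longrightarrow>
      cmod (gns_inner \<phi> \<psi> z (fs_mult xs y)) \<le> K * (gns_seminorm \<phi> \<psi> z * gns_seminorm \<phi> \<psi> y)"
    using gns_inner_bounded[of xs] by blast
  show ?thesis
  proof (rule bcontfun_normI)
    show "continuous_on UNIV (matrix_coeff xs)"
      by (auto simp: continuous_on_open_vimage intro: dg)
    fix p :: "('a, 'b) gns_pair"
    obtain \<phi> \<psi> y z where p: "p = GNS_Pair \<phi> \<psi> y z" by (cases p)
    show "cmod (matrix_coeff xs p) \<le> \<bar>K\<bar>"
    proof (cases "state \<phi> \<and> state \<psi> \<and> Re (gns_inner \<phi> \<psi> y y) \<le> 1 \<and> Re (gns_inner \<phi> \<psi> z z) \<le> 1")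
      case True
      then have q: "gns_seminorm \<phi> \<psi> z * gns_seminorm \<phi> \<psi> y \<le> 1" "0 \<le> gns_seminorm \<phi> \<psi> z * gns_seminorm \<phi> \<psi> y"
        by (auto simp: gns_seminorm_nonneg gns_seminorm_def gns_inner_pos intro!: mult_le_one mult_nonneg_nonneg)
      have "K * (gns_seminorm \<phi> \<psi> z * gns_seminorm \<phi> \<psi> y) \<le> \<bar>K\<bar> * 1"
        using q by (intro mult_mono) auto
      then show ?thesis using K[of \<phi> \<psi> z y] True by (simp add: p)
    qed (auto simp: p)
  qed
qed

definition gns_coeffs :: "('a \<times> 'b) list \<Rightarrow> ('a::cstar_algebra, 'b::cstar_algebra) gns_pair \<Rightarrow>\<^sub>C complex" where
  "gns_coeffs xs = Bcontfun (matrix_coeff xs)"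

lemma apply_gns_coeffs [simp]: "apply_bcontfun (gns_coeffs xs) = matrix_coeff xs"
  by (simp add: gns_coeffs_def Bcontfun_inverse matrix_coeff_bcontfun)

lemma gns_coeffs_append: "gns_coeffs (xs @ ys) = gns_coeffs xs + gns_coeffs ys"
proof (rule bcontfun_eqI)
  fix p show "apply_bcontfun (gns_coeffs (xs @ ys)) p = apply_bcontfun (gns_coeffs xs + gns_coeffs ys) p"
    by (cases p) (simp add: fs_mult_append gns_inner_append_right)
qed

lemma gns_coeffs_Nil: "gns_coeffs [] = 0"
proof (rule bcontfun_eqI)
  fix p show "apply_bcontfun (gns_coeffs []) p = apply_bcontfun (0 :: ('a, 'b) gns_pair \<Rightarrow>\<^sub>C complex) p"
    by (cases p) (simp add: gns_inner_def prod_fun_def)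
qed

lemma matrix_coeff_scale: "matrix_coeff (fs_scale c xs) p = c * matrix_coeff xs p"
  by (cases p) (simp add: fs_mult_scale_left gns_inner_scale_right)

lemma gns_inner_mset_right: "mset x = mset y \<Longrightarrow> gns_inner \<phi> \<psi> z x = gns_inner \<phi> \<psi> z y"
  unfolding gns_inner_def by (intro prod_fun_mset mset_fs_mult_cong_right)

lemma gns_coeffs_mset:
  fixes xs ys :: "('a::cstar_algebra \<times> 'b::cstar_algebra) list"
  assumes "mset xs = mset ys" shows "gns_coeffs xs = gns_coeffs ys"
proof (rule bcontfun_eqI)
  fix p show "apply_bcontfun (gns_coeffs xs) p = apply_bcontfun (gns_coeffs ys) p"
    by (cases p) (simp add: gns_inner_mset_right[OF mset_fs_mult_cong_left[OF assms]])
qed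

lemma scale_bcontfun:
  "(\<lambda>p. c * apply_bcontfun f p) \<in> bcontfun" for f :: "'i::topological_space \<Rightarrow>\<^sub>C complex"
  by (rule bcontfun_normI[where b = "cmod c * norm f"])
    (auto intro!: continuous_intros mult_left_mono norm_bounded simp: norm_mult)

definition cscale :: "complex \<Rightarrow> ('i::topological_space \<Rightarrow>\<^sub>C complex) \<Rightarrow> 'i \<Rightarrow>\<^sub>C complex" where
  "cscale c f = Bcontfun (\<lambda>p. c * apply_bcontfun f p)"

lemma apply_cscale [simp]: "apply_bcontfun (cscale c f) p = c * apply_bcontfun f p"
  by (simp add: cscale_def Bcontfun_inverse scale_bcontfun)

lemma norm_cscale_le: "norm (cscale c f) \<le> cmod c * norm f"
  by (rule norm_bound) (auto simp: norm_mult intro!: mult_left_mono norm_bounded)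

lemma cscale_cscale: "cscale c (cscale d f) = cscale (c * d) f"
  by (rule bcontfun_eqI) simp

lemma cscale_add_right: "cscale c (f + g) = cscale c f + cscale c g"
  by (rule bcontfun_eqI) (simp add: algebra_simps)

lemma cscale_add_left: "cscale (c + d) f = cscale c f + cscale d f"
  by (rule bcontfun_eqI) (simp add: algebra_simps)

lemma cscale_of_real: "cscale (complex_of_real r) f = r *\<^sub>R f"
  by (rule bcontfun_eqI) (simp add: scaleR_conv_of_real)

lemma norm_cscale: "norm (cscale c f) = cmod c * norm f"
proof (cases "c = 0")
  case True then show ?thesis using norm_cscale_le[of c f] by simp
next
  case False
  have "f = cscale (inverse c) (cscale c f)"
    using False cscale_of_real[of 1 f] by (simp add: cscale_cscale)
  then have "norm f \<le> cmod (inverse c) * norm (cscale c f)"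
    by (metis norm_cscale_le)
  then have "cmod c * norm f \<le> norm (cscale c f)"
    using False by (simp add: norm_inverse norm_divide field_simps)
  then show ?thesis using norm_cscale_le[of c f] by simp
qed

lemma bounded_linear_cscale: "bounded_linear (cscale c)"
  by (rule bounded_linear_intro[where K = "cmod c"])
    (auto simp: cscale_add_right norm_cscale mult.commute cscale_cscale simp flip: cscale_of_real)

lemma gns_coeffs_scale: "gns_coeffs (fs_scale c xs) = cscale c (gns_coeffs xs)"
  by (rule bcontfun_eqI) (simp add: matrix_coeff_scale)

lemma gns_coeffs_diff: "gns_coeffs xs - gns_coeffs ys = gns_coeffs (xs @ fs_scale (-1) ys)"
proof -
  have "cscale (-1) f = - f" for f :: "('a, 'b) gns_pair \<Rightarrow>\<^sub>C complex"
    by (rule bcontfun_eqI) simp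
  then show ?thesis by (simp add: gns_coeffs_append gns_coeffs_scale)
qed

lemma gns_inner_gns_coeffs_le:
  assumes st: "state \<phi>" "state \<psi>"
  shows "cmod (gns_inner \<phi> \<psi> z (fs_mult x y)) \<le> norm (gns_coeffs x) * (gns_seminorm \<phi> \<psi> z * gns_seminorm \<phi> \<psi> y)"
proof -
  obtain K where K: "cmod (gns_inner \<phi> \<psi> z (fs_mult x y)) \<le> K * (gns_seminorm \<phi> \<psi> z * gns_seminorm \<phi> \<psi> y)"
    using gns_inner_bounded[of x] st by blast
  show ?thesis
  proof (cases "gns_seminorm \<phi> \<psi> z = 0 \<or> gns_seminorm \<phi> \<psi> y = 0")
    case True then show ?thesis using K by auto
  next
    case False
    define s t where "s = gns_seminorm \<phi> \<psi> z" and "t = gns_seminorm \<phi> \<psi> y"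
    have pos: "0 < s" "0 < t" using False gns_seminorm_nonneg[OF st] by (auto simp: s_def t_def less_le)
    define z' y' where "z' = fs_scale (1 / s) z" and "y' = fs_scale (1 / t) y"
    have n: "Re (gns_inner \<phi> \<psi> z' z') = 1" "Re (gns_inner \<phi> \<psi> y' y') = 1"
      using pos gns_seminorm_sq[OF st, of z] gns_seminorm_sq[OF st, of y] st
      by (auto simp: z'_def y'_def gns_inner_scale_left gns_inner_scale_right s_def[symmetric] t_def[symmetric] power2_eq_square)
    have "gns_inner \<phi> \<psi> z' (fs_mult x y') = gns_inner \<phi> \<psi> z (fs_mult x y) / complex_of_real (s * t)"
      using st by (simp add: z'_def y'_def gns_inner_scale_left fs_mult_scale_right gns_inner_scale_right)
    then have "cmod (gns_inner \<phi> \<psi> z' (fs_mult x y')) = cmod (gns_inner \<phi> \<psi> z (fs_mult x y)) / (s * t)"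
      using pos by (simp only: norm_divide norm_of_real) simp
    moreover have "cmod (gns_inner \<phi> \<psi> z' (fs_mult x y')) \<le> norm (gns_coeffs x)"
      using norm_bounded[of "gns_coeffs x" "GNS_Pair \<phi> \<psi> y' z'"] st n by simp
    ultimately have "cmod (gns_inner \<phi> \<psi> z (fs_mult x y)) / (s * t) \<le> norm (gns_coeffs x)" by simp
    then show ?thesis
      using pos unfolding s_def[symmetric] t_def[symmetric] by (simp add: pos_divide_le_eq)
  qed
qed

lemma gns_seminorm_mult_le:
  assumes st: "state \<phi>" "state \<psi>"
  shows "gns_seminorm \<phi> \<psi> (fs_mult x y) \<le> norm (gns_coeffs x) * gns_seminorm \<phi> \<psi> y"
proof (cases "gns_seminorm \<phi> \<psi> (fs_mult x y) = 0")
  case False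
  then have pos: "0 < gns_seminorm \<phi> \<psi> (fs_mult x y)" using gns_seminorm_nonneg[OF st, of "fs_mult x y"] by simp
  have "(gns_seminorm \<phi> \<psi> (fs_mult x y))\<^sup>2 \<le> cmod (gns_inner \<phi> \<psi> (fs_mult x y) (fs_mult x y))"
    unfolding gns_seminorm_sq[OF st] by (rule complex_Re_le_cmod)
  also have "\<dots> \<le> norm (gns_coeffs x) * (gns_seminorm \<phi> \<psi> (fs_mult x y) * gns_seminorm \<phi> \<psi> y)"
    by (rule gns_inner_gns_coeffs_le[OF st])
  finally show ?thesis using pos by (simp add: power2_eq_square)
qed (simp add: gns_seminorm_nonneg st)

lemma norm_gns_coeffs_leI:
  assumes "0 \<le> B" and "\<And>\<phi> \<psi> y z. state \<phi> \<Longrightarrow> state \<psi> \<Longrightarrow> gns_seminorm \<phi> \<psi> y \<le> 1 \<Longrightarrow> gns_seminorm \<phi> \<psi> z \<le> 1 \<Longrightarrow>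
      cmod (gns_inner \<phi> \<psi> z (fs_mult x y)) \<le> B"
  shows "norm (gns_coeffs x) \<le> B"
proof (rule norm_bound)
  fix p show "norm (apply_bcontfun (gns_coeffs x) p) \<le> B"
    using assms by (cases p) (auto simp: gns_seminorm_def)
qed

lemma norm_gns_coeffs_mult:
  fixes x :: "('a::cstar_algebra \<times> 'b::cstar_algebra) list"
  shows "norm (gns_coeffs (fs_mult x y)) \<le> norm (gns_coeffs x) * norm (gns_coeffs y)"
proof (rule norm_gns_coeffs_leI)
  fix \<phi> :: "'a \<Rightarrow> complex" and \<psi> :: "'b \<Rightarrow> complex" and u z :: "('a \<times> 'b) list" assume st: "state \<phi>" "state \<psi>" and le: "gns_seminorm \<phi> \<psi> u \<le> 1" "gns_seminorm \<phi> \<psi> z \<le> 1"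
  have "cmod (gns_inner \<phi> \<psi> z (fs_mult (fs_mult x y) u)) \<le> norm (gns_coeffs x) * (gns_seminorm \<phi> \<psi> z * gns_seminorm \<phi> \<psi> (fs_mult y u))"
    unfolding fs_mult_assoc by (rule gns_inner_gns_coeffs_le[OF st])
  also have "\<dots> \<le> norm (gns_coeffs x) * (1 * (norm (gns_coeffs y) * 1))"
    by (intro mult_mono mult_left_mono order_trans[OF gns_seminorm_mult_le[OF st]] le mult_nonneg_nonneg gns_seminorm_nonneg st) auto
  finally show "cmod (gns_inner \<phi> \<psi> z (fs_mult (fs_mult x y) u)) \<le> norm (gns_coeffs x) * norm (gns_coeffs y)" by simp
qed simp

lemma norm_gns_coeffs_star:
  fixes x :: "('a::cstar_algebra \<times> 'b::cstar_algebra) list"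
  shows "norm (gns_coeffs (fs_star x)) = norm (gns_coeffs x)"
proof -
  have "norm (gns_coeffs (fs_star x)) \<le> norm (gns_coeffs x)" for x :: "('a \<times> 'b) list"
  proof (rule norm_gns_coeffs_leI)
    fix \<phi> :: "'a \<Rightarrow> complex" and \<psi> :: "'b \<Rightarrow> complex" and y z :: "('a \<times> 'b) list" assume st: "state \<phi>" "state \<psi>" and le: "gns_seminorm \<phi> \<psi> y \<le> 1" "gns_seminorm \<phi> \<psi> z \<le> 1"
    have "gns_inner \<phi> \<psi> z (fs_mult (fs_star x) y) = cnj (gns_inner \<phi> \<psi> y (fs_mult x z))"
      using gns_inner_adjoint[of \<phi> \<psi> z "fs_star x" y] gns_inner_sym[OF st, of "fs_mult x z" y] by simp
    then have "cmod (gns_inner \<phi> \<psi> z (fs_mult (fs_star x) y)) \<le> norm (gns_coeffs x) * (gns_seminorm \<phi> \<psi> y * gns_seminorm \<phi> \<psi> z)"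
      using gns_inner_gns_coeffs_le[OF st] by simp
    also have "\<dots> \<le> norm (gns_coeffs x) * 1"
      by (intro mult_left_mono mult_le_one le gns_seminorm_nonneg st) auto
    finally show "cmod (gns_inner \<phi> \<psi> z (fs_mult (fs_star x) y)) \<le> norm (gns_coeffs x)" by simp
  qed simp
  from this[of x] this[of "fs_star x"] show ?thesis by simp
qed

lemma gns_coeffs_cstar:
  fixes x :: "('a::cstar_algebra \<times> 'b::cstar_algebra) list"
  shows "norm (gns_coeffs (fs_mult (fs_star x) x)) = (norm (gns_coeffs x))\<^sup>2"
proof (rule antisym)
  show "norm (gns_coeffs (fs_mult (fs_star x) x)) \<le> (norm (gns_coeffs x))\<^sup>2"
    using norm_gns_coeffs_mult[of "fs_star x" x] by (simp add: norm_gns_coeffs_star power2_eq_square)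
  let ?B = "norm (gns_coeffs (fs_mult (fs_star x) x))"
  have "norm (gns_coeffs x) \<le> sqrt ?B"
  proof (rule norm_gns_coeffs_leI)
    fix \<phi> :: "'a \<Rightarrow> complex" and \<psi> :: "'b \<Rightarrow> complex" and y z :: "('a \<times> 'b) list" assume st: "state \<phi>" "state \<psi>" and le: "gns_seminorm \<phi> \<psi> y \<le> 1" "gns_seminorm \<phi> \<psi> z \<le> 1"
    have "(gns_seminorm \<phi> \<psi> (fs_mult x y))\<^sup>2 \<le> cmod (gns_inner \<phi> \<psi> (fs_mult x y) (fs_mult x y))"
      unfolding gns_seminorm_sq[OF st] by (rule complex_Re_le_cmod)
    also have "gns_inner \<phi> \<psi> (fs_mult x y) (fs_mult x y) = gns_inner \<phi> \<psi> y (fs_mult (fs_mult (fs_star x) x) y)"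
      using gns_inner_adjoint[of \<phi> \<psi> y "fs_star x" "fs_mult x y"] by (simp add: fs_mult_assoc)
    also have "cmod \<dots> \<le> ?B * (gns_seminorm \<phi> \<psi> y * gns_seminorm \<phi> \<psi> y)" by (rule gns_inner_gns_coeffs_le[OF st])
    also have "\<dots> \<le> ?B * 1"
      by (intro mult_left_mono mult_le_one le gns_seminorm_nonneg st) auto
    finally have q: "gns_seminorm \<phi> \<psi> (fs_mult x y) \<le> sqrt ?B" by (intro real_le_rsqrt) simp
    have "cmod (gns_inner \<phi> \<psi> z (fs_mult x y)) \<le> gns_seminorm \<phi> \<psi> z * gns_seminorm \<phi> \<psi> (fs_mult x y)" by (rule gns_inner_cs[OF st])
    also have "\<dots> \<le> 1 * sqrt ?B" by (intro mult_mono le q gns_seminorm_nonneg st) auto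
    finally show "cmod (gns_inner \<phi> \<psi> z (fs_mult x y)) \<le> sqrt ?B" by simp
  qed simp
  then have "(norm (gns_coeffs x))\<^sup>2 \<le> (sqrt ?B)\<^sup>2" by (intro power_mono) auto
  then show "(norm (gns_coeffs x))\<^sup>2 \<le> ?B" by simp
qed

lemma gns_coeffs_mult_diff:
  "norm (gns_coeffs (fs_mult x y) - gns_coeffs (fs_mult x' y')) \<le>
     norm (gns_coeffs x - gns_coeffs x') * norm (gns_coeffs y) + norm (gns_coeffs x') * norm (gns_coeffs y - gns_coeffs y')"
proof -
  have 1: "gns_coeffs (fs_mult x y) - gns_coeffs (fs_mult x' y) = gns_coeffs (fs_mult (x @ fs_scale (-1) x') y)"
    by (simp add: gns_coeffs_diff fs_mult_append fs_mult_scale_left)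
  have 2: "gns_coeffs (fs_mult x' y) - gns_coeffs (fs_mult x' y') = gns_coeffs (fs_mult x' (y @ fs_scale (-1) y'))"
    unfolding gns_coeffs_diff by (rule gns_coeffs_mset) (simp add: mset_fs_mult_append_right fs_mult_scale_right)
  have "gns_coeffs (fs_mult x y) - gns_coeffs (fs_mult x' y') =
      (gns_coeffs (fs_mult x y) - gns_coeffs (fs_mult x' y)) + (gns_coeffs (fs_mult x' y) - gns_coeffs (fs_mult x' y'))" by simp
  also have "norm \<dots> \<le> norm (gns_coeffs (fs_mult (x @ fs_scale (-1) x') y)) + norm (gns_coeffs (fs_mult x' (y @ fs_scale (-1) y')))"
    unfolding 1 2 by (rule norm_triangle_ineq)
  also have "\<dots> \<le> norm (gns_coeffs x - gns_coeffs x') * norm (gns_coeffs y) + norm (gns_coeffs x') * norm (gns_coeffs y - gns_coeffs y')"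
    unfolding gns_coeffs_diff by (intro add_mono norm_gns_coeffs_mult)
  finally show ?thesis .
qed

lemma gns_coeffs_star_diff: "norm (gns_coeffs (fs_star x) - gns_coeffs (fs_star y)) = norm (gns_coeffs x - gns_coeffs y)"
  using norm_gns_coeffs_star[of "x @ fs_scale (-1) y"]
  by (simp add: gns_coeffs_diff fs_star_append fs_star_scale)

text \<open>Multiplication and involution are extended to the completion by continuity.\<close>

typedef (overloaded) ('a, 'b) ctensor (infixr "\<otimes>" 25) =
  "closure (range gns_coeffs) :: (('a::cstar_algebra, 'b::cstar_algebra) gns_pair \<Rightarrow>\<^sub>C complex) set"
  by (intro exI[of _ "gns_coeffs []"] closure_subset[THEN subsetD] rangeI)

definition approx :: "(nat \<Rightarrow> ('a \<times> 'b) list) \<Rightarrow> ('a::cstar_algebra) \<otimes> ('b::cstar_algebra) \<Rightarrow> bool" where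
  "approx s x \<longleftrightarrow> (\<lambda>n. gns_coeffs (s n)) \<longlonglongrightarrow> Rep_ctensor x"

lemma approx_ex: "\<exists>s. approx s x"
proof -
  have "\<exists>g. (\<forall>n. g n \<in> range gns_coeffs) \<and> g \<longlonglongrightarrow> Rep_ctensor x"
    using Rep_ctensor[of x] unfolding closure_sequential .
  then obtain g where g: "\<forall>n. g n \<in> range gns_coeffs" "g \<longlonglongrightarrow> Rep_ctensor x"
    by (elim exE conjE)
  define s where "s n = (SOME l. g n = gns_coeffs l)" for n
  have "g n = gns_coeffs (s n)" for n unfolding s_def by (rule someI_ex) (use g(1) in blast)
  then have "g = (\<lambda>n. gns_coeffs (s n))" by auto
  then show ?thesis using g(2) unfolding approx_def by blast
qed

lemma approx_unique: "approx s x \<Longrightarrow> approx s y \<Longrightarrow> x = y"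
  unfolding approx_def by (drule (1) LIMSEQ_unique) (simp add: Rep_ctensor_inject)

lemma approx_mset:
  assumes "approx s x" and "\<And>n. mset (s n) = mset (t n)"
  shows "approx t x"
proof -
  have "(\<lambda>n. gns_coeffs (s n)) = (\<lambda>n. gns_coeffs (t n))"
    by (rule ext) (rule gns_coeffs_mset[OF assms(2)])
  then show ?thesis using assms(1) by (simp add: approx_def)
qed

lemma limit_approx:
  assumes "(\<lambda>n. gns_coeffs (s n)) \<longlonglongrightarrow> f" shows "approx s (Abs_ctensor f)" "Rep_ctensor (Abs_ctensor f) = f"
proof -
  have "f \<in> closure (range gns_coeffs)"
    unfolding closure_sequential using assms by (intro exI[of _ "\<lambda>n. gns_coeffs (s n)"]) auto
  then show "Rep_ctensor (Abs_ctensor f) = f" by (rule Abs_ctensor_inverse)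
  then show "approx s (Abs_ctensor f)" using assms by (simp add: approx_def)
qed

instantiation ctensor :: (cstar_algebra, cstar_algebra) real_vector
begin

definition "0 = Abs_ctensor (gns_coeffs [])"
definition "x + y = Abs_ctensor (Rep_ctensor x + Rep_ctensor y)"
definition "- x = Abs_ctensor (- Rep_ctensor x)"
definition "x - y = Abs_ctensor (Rep_ctensor x - Rep_ctensor y)"
definition "r *\<^sub>R x = Abs_ctensor (r *\<^sub>R Rep_ctensor x)"

lemma Rep_zero: "Rep_ctensor (0 :: 'a \<otimes> 'b) = 0"
proof -
  have "gns_coeffs ([] :: ('a \<times> 'b) list) \<in> closure (range gns_coeffs)"
    by (rule subsetD[OF closure_subset rangeI])
  then have "Rep_ctensor (0 :: 'a \<otimes> 'b) = gns_coeffs []"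
    by (simp only: zero_ctensor_def Abs_ctensor_inverse)
  then show ?thesis by (simp only: gns_coeffs_Nil)
qed

lemma Rep_plus: "Rep_ctensor (x + y) = Rep_ctensor x + Rep_ctensor y" for x y :: "'a \<otimes> 'b"
proof -
  obtain s t where "approx s x" "approx t y" using approx_ex[of x] approx_ex[of y] by blast
  then have "(\<lambda>n. gns_coeffs (s n @ t n)) \<longlonglongrightarrow> Rep_ctensor x + Rep_ctensor y"
    unfolding approx_def gns_coeffs_append by (rule tendsto_add)
  from limit_approx(2)[OF this] show ?thesis by (simp add: plus_ctensor_def)
qed

lemma Rep_scaleR: "Rep_ctensor (r *\<^sub>R x) = r *\<^sub>R Rep_ctensor x" for x :: "'a \<otimes> 'b"
proof -
  obtain s where "approx s x" using approx_ex[of x] by blast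
  then have "(\<lambda>n. gns_coeffs (fs_scale (complex_of_real r) (s n))) \<longlonglongrightarrow> r *\<^sub>R Rep_ctensor x"
    unfolding approx_def gns_coeffs_scale cscale_of_real by (rule tendsto_scaleR[OF tendsto_const])
  from limit_approx(2)[OF this] show ?thesis by (simp add: scaleR_ctensor_def)
qed

lemma Rep_uminus: "Rep_ctensor (- x) = - Rep_ctensor x" for x :: "'a \<otimes> 'b"
  using Rep_scaleR[of "-1" x] by (simp add: scaleR_ctensor_def uminus_ctensor_def)

lemma Rep_minus: "Rep_ctensor (x - y) = Rep_ctensor x - Rep_ctensor y" for x y :: "'a \<otimes> 'b"
  using Rep_plus[of x "- y"] unfolding Rep_uminus by (simp add: plus_ctensor_def minus_ctensor_def Rep_uminus)

instance
  by standard (simp_all add: Rep_ctensor_inject[symmetric] Rep_zero Rep_plus Rep_uminus Rep_minus Rep_scaleR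
      algebra_simps)

end

instantiation ctensor :: (cstar_algebra, cstar_algebra) real_normed_vector
begin

definition "norm x = norm (Rep_ctensor x)"
definition "dist x y = dist (Rep_ctensor x) (Rep_ctensor y)"
definition "sgn x = x /\<^sub>R norm x" for x :: "'a \<otimes> 'b"
definition uniformity_ctensor :: "(('a \<otimes> 'b) \<times> ('a \<otimes> 'b)) filter" where
  "uniformity_ctensor = (INF e\<in>{0 <..}. principal {(x, y). dist x y < e})"
definition open_ctensor :: "('a \<otimes> 'b) set \<Rightarrow> bool" where
  "open_ctensor S = (\<forall>x\<in>S. \<forall>\<^sub>F (x', y) in uniformity. x' = x \<longrightarrow> y \<in> S)"

instance
proof
  fix x y :: "'a \<otimes> 'b" and r :: real
  show "norm x = 0 \<longleftrightarrow> x = 0"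
    by (simp add: norm_ctensor_def Rep_zero flip: Rep_ctensor_inject)
  show "norm (x + y) \<le> norm x + norm y"
    by (simp add: norm_ctensor_def Rep_plus norm_triangle_ineq)
  show "norm (r *\<^sub>R x) = \<bar>r\<bar> * norm x"
    by (simp add: norm_ctensor_def Rep_scaleR)
  show "dist x y = norm (x - y)"
    by (simp add: norm_ctensor_def dist_ctensor_def Rep_minus dist_norm)
qed (simp_all add: sgn_ctensor_def uniformity_ctensor_def open_ctensor_def)

end

lemma approx_tendsto: "approx s x \<Longrightarrow> (\<lambda>n. gns_coeffs (s n)) \<longlonglongrightarrow> Rep_ctensor x"
  by (simp add: approx_def)

instance ctensor :: (cstar_algebra, cstar_algebra) banach
proof
  fix X :: "nat \<Rightarrow> 'a \<otimes> 'b" assume "Cauchy X"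
  then have "Cauchy (\<lambda>n. Rep_ctensor (X n))"
    by (simp add: Cauchy_def dist_ctensor_def)
  then obtain f where f: "(\<lambda>n. Rep_ctensor (X n)) \<longlonglongrightarrow> f"
    by (metis Cauchy_convergent_iff convergent_def)
  have "f \<in> closure (range gns_coeffs)"
    by (rule closed_sequentially[OF closed_closure _ f]) (rule Rep_ctensor)
  then have "X \<longlonglongrightarrow> Abs_ctensor f"
    using f unfolding tendsto_iff dist_ctensor_def by (simp add: Abs_ctensor_inverse)
  then show "convergent X" by (rule convergentI)
qed

definition rep_seq :: "('a::cstar_algebra) \<otimes> ('b::cstar_algebra) \<Rightarrow> nat \<Rightarrow> ('a \<times> 'b) list" where
  "rep_seq x = (SOME s. approx s x)"

lemma approx_rep_seq: "approx (rep_seq x) x"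
  unfolding rep_seq_def by (rule someI_ex[OF approx_ex])

lemma Cauchy_mult:
  fixes s t :: "nat \<Rightarrow> ('a::cstar_algebra \<times> 'b::cstar_algebra) list"
  assumes "approx s x" "approx t y"
  shows "Cauchy (\<lambda>n. gns_coeffs (fs_mult (s n) (t n)))"
proof -
  have cs: "Cauchy (\<lambda>n. gns_coeffs (s n))" "Cauchy (\<lambda>n. gns_coeffs (t n))"
    using assms unfolding approx_def by (auto intro: LIMSEQ_imp_Cauchy)
  obtain B where B: "0 < B" "\<And>n. norm (gns_coeffs (s n)) \<le> B"
    using Cauchy_Bseq[OF cs(1)] unfolding Bseq_def by auto
  obtain C where C: "0 < C" "\<And>n. norm (gns_coeffs (t n)) \<le> C"
    using Cauchy_Bseq[OF cs(2)] unfolding Bseq_def by auto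
  show ?thesis
  proof (rule CauchyI)
    fix e :: real assume e: "0 < e"
    obtain M where M: "\<And>m n. m \<ge> M \<Longrightarrow> n \<ge> M \<Longrightarrow> norm (gns_coeffs (s m) - gns_coeffs (s n)) < e / (2 * C)"
      using CauchyD[OF cs(1), of "e / (2 * C)"] e C by auto
    obtain N where N: "\<And>m n. m \<ge> N \<Longrightarrow> n \<ge> N \<Longrightarrow> norm (gns_coeffs (t m) - gns_coeffs (t n)) < e / (2 * B)"
      using CauchyD[OF cs(2), of "e / (2 * B)"] e B by auto
    have "norm (gns_coeffs (fs_mult (s m) (t m)) - gns_coeffs (fs_mult (s n) (t n))) < e"
      if "m \<ge> max M N" "n \<ge> max M N" for m n
    proof -
      have "norm (gns_coeffs (fs_mult (s m) (t m)) - gns_coeffs (fs_mult (s n) (t n))) \<le>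
          norm (gns_coeffs (s m) - gns_coeffs (s n)) * norm (gns_coeffs (t m)) + norm (gns_coeffs (s n)) * norm (gns_coeffs (t m) - gns_coeffs (t n))"
        by (rule gns_coeffs_mult_diff)
      also have "\<dots> \<le> norm (gns_coeffs (s m) - gns_coeffs (s n)) * C + B * norm (gns_coeffs (t m) - gns_coeffs (t n))"
        by (intro add_mono mult_left_mono mult_right_mono B C) auto
      also have "\<dots> < e / (2 * C) * C + B * (e / (2 * B))"
        using that B C by (intro add_strict_mono mult_strict_right_mono mult_strict_left_mono M N) auto
      finally show ?thesis using B C by simp
    qed
    then show "\<exists>M. \<forall>m\<ge>M. \<forall>n\<ge>M. norm (gns_coeffs (fs_mult (s m) (t m)) - gns_coeffs (fs_mult (s n) (t n))) < e"
      by blast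
  qed
qed

instantiation ctensor :: (cstar_algebra, cstar_algebra) cstar_algebra
begin

definition "1 = Abs_ctensor (gns_coeffs [(1, 1)])"
definition "x * y = Abs_ctensor (lim (\<lambda>n. gns_coeffs (fs_mult (rep_seq x n) (rep_seq y n))))"
definition "star x = Abs_ctensor (lim (\<lambda>n. gns_coeffs (fs_star (rep_seq x n))))"
definition "c *\<^sub>C x = Abs_ctensor (cscale c (Rep_ctensor x))"

lemma approx_zero: "approx (\<lambda>_. []) (0 :: 'a \<otimes> 'b)"
  by (simp add: approx_def Rep_zero gns_coeffs_Nil)

lemma approx_plus: "approx s x \<Longrightarrow> approx t y \<Longrightarrow> approx (\<lambda>n. s n @ t n) (x + y)" for x y :: "'a \<otimes> 'b"
  unfolding approx_def gns_coeffs_append Rep_plus by (rule tendsto_add)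

lemma approx_one: "approx (\<lambda>_. [(1, 1)]) (1 :: 'a \<otimes> 'b)"
  unfolding one_ctensor_def by (rule limit_approx) simp

lemma approx_scaleC: "approx s x \<Longrightarrow> approx (\<lambda>n. fs_scale c (s n)) (c *\<^sub>C x)" for x :: "'a \<otimes> 'b"
  unfolding scaleC_ctensor_def approx_tendsto
  by (rule limit_approx) (auto simp: gns_coeffs_scale dest!: approx_tendsto intro: bounded_linear.tendsto[OF bounded_linear_cscale])

lemma approx_mult:
  fixes x y :: "'a \<otimes> 'b"
  assumes "approx s x" "approx t y"
  shows "approx (\<lambda>n. fs_mult (s n) (t n)) (x * y)"
proof -
  let ?s = "rep_seq x" and ?t = "rep_seq y"
  have "Cauchy (\<lambda>n. gns_coeffs (fs_mult (?s n) (?t n)))"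
    by (rule Cauchy_mult) (rule approx_rep_seq)+
  then have lim: "(\<lambda>n. gns_coeffs (fs_mult (?s n) (?t n))) \<longlonglongrightarrow> lim (\<lambda>n. gns_coeffs (fs_mult (?s n) (?t n)))"
    by (simp add: Cauchy_convergent_iff convergent_LIMSEQ_iff)
  have d: "(\<lambda>n. gns_coeffs (s n) - gns_coeffs (?s n)) \<longlonglongrightarrow> 0" "(\<lambda>n. gns_coeffs (t n) - gns_coeffs (?t n)) \<longlonglongrightarrow> 0"
    using tendsto_diff[OF approx_tendsto[OF assms(1)] approx_tendsto[OF approx_rep_seq[of x]]]
      tendsto_diff[OF approx_tendsto[OF assms(2)] approx_tendsto[OF approx_rep_seq[of y]]] by simp_all
  have "(\<lambda>n. norm (gns_coeffs (s n) - gns_coeffs (?s n)) * norm (gns_coeffs (t n)) +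
      norm (gns_coeffs (?s n)) * norm (gns_coeffs (t n) - gns_coeffs (?t n))) \<longlonglongrightarrow>
      norm (0 :: ('a, 'b) gns_pair \<Rightarrow>\<^sub>C complex) * norm (Rep_ctensor y) + norm (Rep_ctensor x) * norm (0 :: ('a, 'b) gns_pair \<Rightarrow>\<^sub>C complex)"
    by (rule tendsto_add[OF tendsto_mult[OF tendsto_norm[OF d(1)] tendsto_norm[OF approx_tendsto[OF assms(2)]]]
          tendsto_mult[OF tendsto_norm[OF approx_tendsto[OF approx_rep_seq]] tendsto_norm[OF d(2)]]])
  then have null: "(\<lambda>n. norm (gns_coeffs (s n) - gns_coeffs (?s n)) * norm (gns_coeffs (t n)) +
      norm (gns_coeffs (?s n)) * norm (gns_coeffs (t n) - gns_coeffs (?t n))) \<longlonglongrightarrow> 0" by simp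
  have "(\<lambda>n. gns_coeffs (fs_mult (s n) (t n)) - gns_coeffs (fs_mult (?s n) (?t n))) \<longlonglongrightarrow> 0"
    by (rule Lim_null_comparison[OF always_eventually[OF allI] null]) (rule gns_coeffs_mult_diff)
  from tendsto_add[OF this lim]
  have "(\<lambda>n. gns_coeffs (fs_mult (s n) (t n))) \<longlonglongrightarrow> lim (\<lambda>n. gns_coeffs (fs_mult (?s n) (?t n)))" by simp
  then show ?thesis unfolding times_ctensor_def by (rule limit_approx)
qed

lemma approx_star:
  fixes x :: "'a \<otimes> 'b"
  assumes "approx s x"
  shows "approx (\<lambda>n. fs_star (s n)) (star x)"
proof -
  let ?s = "rep_seq x"
  have "Cauchy (\<lambda>n. gns_coeffs (?s n))"
    using approx_rep_seq[of x] unfolding approx_def by (rule LIMSEQ_imp_Cauchy)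
  then have "Cauchy (\<lambda>n. gns_coeffs (fs_star (?s n)))"
    by (simp add: Cauchy_def dist_norm gns_coeffs_star_diff)
  then have lim: "(\<lambda>n. gns_coeffs (fs_star (?s n))) \<longlonglongrightarrow> lim (\<lambda>n. gns_coeffs (fs_star (?s n)))"
    by (simp add: Cauchy_convergent_iff convergent_LIMSEQ_iff)
  have "(\<lambda>n. norm (gns_coeffs (s n) - gns_coeffs (?s n))) \<longlonglongrightarrow> 0"
    using tendsto_norm[OF tendsto_diff[OF approx_tendsto[OF assms] approx_tendsto[OF approx_rep_seq[of x]]]] by simp
  then have "(\<lambda>n. norm (gns_coeffs (fs_star (s n)) - gns_coeffs (fs_star (?s n)))) \<longlonglongrightarrow> 0"
    by (simp only: gns_coeffs_star_diff)
  then have "(\<lambda>n. gns_coeffs (fs_star (s n)) - gns_coeffs (fs_star (?s n))) \<longlonglongrightarrow> 0"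
    by (rule tendsto_norm_zero_cancel)
  from tendsto_add[OF this lim]
  have "(\<lambda>n. gns_coeffs (fs_star (s n))) \<longlonglongrightarrow> lim (\<lambda>n. gns_coeffs (fs_star (?s n)))" by simp
  then show ?thesis unfolding star_ctensor_def by (rule limit_approx)
qed

lemma approx_norm: "approx s x \<Longrightarrow> (\<lambda>n. norm (gns_coeffs (s n))) \<longlonglongrightarrow> norm x" for x :: "'a \<otimes> 'b"
  unfolding norm_ctensor_def by (intro tendsto_norm approx_tendsto)

lemma Rep_scaleC: "Rep_ctensor (c *\<^sub>C x) = cscale c (Rep_ctensor x)" for x :: "'a \<otimes> 'b"
proof -
  obtain s where "approx s x" using approx_ex[of x] by blast
  then have "(\<lambda>n. gns_coeffs (fs_scale c (s n))) \<longlonglongrightarrow> cscale c (Rep_ctensor x)"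
    unfolding approx_def gns_coeffs_scale by (rule bounded_linear.tendsto[OF bounded_linear_cscale])
  from limit_approx(2)[OF this] show ?thesis by (simp add: scaleC_ctensor_def)
qed

instance
proof
  fix x y z :: "'a \<otimes> 'b" and r :: real and c d :: complex
  obtain s t u where s: "approx s x" and t: "approx t y" and u: "approx u z"
    using approx_ex[of x] approx_ex[of y] approx_ex[of z] by blast
  show "x * y * z = x * (y * z)"
    using approx_mult[OF approx_mult[OF s t] u] approx_mult[OF s approx_mult[OF t u]]
    unfolding fs_mult_assoc by (rule approx_unique)
  show "1 * x = x"
    using approx_mult[OF approx_one s] s unfolding fs_mult_one_left by (rule approx_unique)
  show "x * 1 = x"
    using approx_mult[OF s approx_one] s unfolding fs_mult_one_right by (rule approx_unique)
  show "(x + y) * z = x * z + y * z"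
    using approx_mult[OF approx_plus[OF s t] u] approx_plus[OF approx_mult[OF s u] approx_mult[OF t u]]
    unfolding fs_mult_append by (rule approx_unique)
  show "x * (y + z) = x * y + x * z"
    using approx_mult[OF s approx_plus[OF t u], THEN approx_mset] approx_plus[OF approx_mult[OF s t] approx_mult[OF s u]]
    by (rule approx_unique) (simp add: mset_fs_mult_append_right)
  show "c *\<^sub>C (x + y) = c *\<^sub>C x + c *\<^sub>C y" "(c + d) *\<^sub>C x = c *\<^sub>C x + d *\<^sub>C x"
    "c *\<^sub>C d *\<^sub>C x = (c * d) *\<^sub>C x" "r *\<^sub>R x = complex_of_real r *\<^sub>C x"
    by (simp_all add: Rep_scaleC Rep_plus Rep_scaleR cscale_add_right cscale_add_left cscale_cscale cscale_of_real
        flip: Rep_ctensor_inject)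
  have "(c *\<^sub>C x) * y = c *\<^sub>C (x * y)" for c
    using approx_mult[OF approx_scaleC[OF s] t] approx_scaleC[OF approx_mult[OF s t]]
    unfolding fs_mult_scale_left by (rule approx_unique)
  moreover have right: "x * (c *\<^sub>C y) = c *\<^sub>C (x * y)" for c
    using approx_mult[OF s approx_scaleC[OF t]] approx_scaleC[OF approx_mult[OF s t]]
    unfolding fs_mult_scale_right by (rule approx_unique)
  moreover have "r *\<^sub>R w = complex_of_real r *\<^sub>C w" for w :: "'a \<otimes> 'b"
    by (simp add: Rep_scaleC Rep_scaleR cscale_of_real flip: Rep_ctensor_inject)
  ultimately show "(c *\<^sub>C x) * y = c *\<^sub>C (x * y)" "x * (c *\<^sub>C y) = c *\<^sub>C (x * y)"
    "(r *\<^sub>R x) * y = r *\<^sub>R (x * y)" "x * (r *\<^sub>R y) = r *\<^sub>R (x * y)"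
    by simp_all
  show "norm (x * y) \<le> norm x * norm y"
    by (rule LIMSEQ_le[OF approx_norm[OF approx_mult[OF s t]] tendsto_mult[OF approx_norm[OF s] approx_norm[OF t]]])
      (auto intro: norm_gns_coeffs_mult)
  show "norm (c *\<^sub>C x) = cmod c * norm x"
    by (simp add: norm_ctensor_def Rep_scaleC norm_cscale)
  show "star (x + y) = star x + star y"
    using approx_star[OF approx_plus[OF s t]] approx_plus[OF approx_star[OF s] approx_star[OF t]]
    unfolding fs_star_append by (rule approx_unique)
  show "star (c *\<^sub>C x) = cnj c *\<^sub>C star x"
    using approx_star[OF approx_scaleC[OF s]] approx_scaleC[OF approx_star[OF s]]
    unfolding fs_star_scale by (rule approx_unique)
  show "star (x * y) = star y * star x"
    using approx_star[OF approx_mult[OF s t], THEN approx_mset] approx_mult[OF approx_star[OF t] approx_star[OF s]]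
    by (rule approx_unique) (simp add: mset_fs_star_mult)
  show "star (star x) = x"
    using approx_star[OF approx_star[OF s]] s unfolding fs_star_star by (rule approx_unique)
  show "norm (star x * x) = (norm x)\<^sup>2"
    using approx_norm[OF approx_mult[OF approx_star[OF s] s]] tendsto_power[OF approx_norm[OF s], of 2]
    unfolding gns_coeffs_cstar by (rule LIMSEQ_unique)
qed

end

definition tensor :: "'a::cstar_algebra \<Rightarrow> 'b::cstar_algebra \<Rightarrow> 'a \<otimes> 'b" (infixr "\<otimes>" 75) where
  "a \<otimes> b = Abs_ctensor (gns_coeffs [(a, b)])"

lemma Rep_tensor: "Rep_ctensor (a \<otimes> b) = gns_coeffs [(a, b)]"
  unfolding tensor_def by (rule Abs_ctensor_inverse) (rule subsetD[OF closure_subset rangeI])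

lemma approx_tensor: "approx (\<lambda>_. [(a, b)]) (a \<otimes> b)"
  by (simp add: approx_def Rep_tensor)

lemma sum_list_add: "(\<Sum>x\<leftarrow>xs. f x + g x) = (\<Sum>x\<leftarrow>xs. f x) + (\<Sum>x\<leftarrow>xs. g x :: complex)"
  by (induction xs) auto

lemma sum_list_mult: "(\<Sum>x\<leftarrow>xs. c * f x) = c * (\<Sum>x\<leftarrow>xs. f x :: complex)"
  by (induction xs) (auto simp: algebra_simps)

lemma gns_inner_single: "gns_inner \<phi> \<psi> z (fs_mult [(a, b)] y) =
    (\<Sum>p\<leftarrow>z. \<Sum>q\<leftarrow>y. \<phi> (star (fst p) * (a * fst q)) * \<psi> (star (snd p) * (b * snd q)))"
  by (simp add: gns_inner_def prod_fun_mult fs_mult_Cons fs_star_def comp_def case_prod_unfold)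

lemma tensor_add_left: "(a + a') \<otimes> b = a \<otimes> b + a' \<otimes> b"
proof -
  have "gns_coeffs [(a + a', b)] = gns_coeffs [(a, b)] + gns_coeffs [(a', b)]"
  proof (rule bcontfun_eqI)
    fix p show "apply_bcontfun (gns_coeffs [(a + a', b)]) p = apply_bcontfun (gns_coeffs [(a, b)] + gns_coeffs [(a', b)]) p"
      by (cases p) (simp add: gns_inner_single distrib_left distrib_right state_add sum_list_add)
  qed
  then show ?thesis by (simp add: Rep_plus Rep_tensor flip: Rep_ctensor_inject)
qed

lemma tensor_add_right: "a \<otimes> (b + b') = a \<otimes> b + a \<otimes> b'"
proof -
  have "gns_coeffs [(a, b + b')] = gns_coeffs [(a, b)] + gns_coeffs [(a, b')]"
  proof (rule bcontfun_eqI)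
    fix p show "apply_bcontfun (gns_coeffs [(a, b + b')]) p = apply_bcontfun (gns_coeffs [(a, b)] + gns_coeffs [(a, b')]) p"
      by (cases p) (simp add: gns_inner_single distrib_left distrib_right state_add sum_list_add)
  qed
  then show ?thesis by (simp add: Rep_plus Rep_tensor flip: Rep_ctensor_inject)
qed

lemma tensor_scaleC_left: "(c *\<^sub>C a) \<otimes> b = c *\<^sub>C (a \<otimes> b)"
  using approx_tensor[of "c *\<^sub>C a" b] approx_scaleC[OF approx_tensor[of a b], of c]
  by (intro approx_unique[of "\<lambda>_. [(c *\<^sub>C a, b)]"]) (auto simp: fs_scale_def)

lemma tensor_scaleC_right: "a \<otimes> (c *\<^sub>C b) = c *\<^sub>C (a \<otimes> b)"
proof -
  have "gns_coeffs [(a, c *\<^sub>C b)] = cscale c (gns_coeffs [(a, b)])"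
  proof (rule bcontfun_eqI)
    fix p show "apply_bcontfun (gns_coeffs [(a, c *\<^sub>C b)]) p = apply_bcontfun (cscale c (gns_coeffs [(a, b)])) p"
      by (cases p) (simp add: gns_inner_single mult_scaleC_left mult_scaleC_right state_scale mult.left_commute sum_list_mult)
  qed
  then show ?thesis by (simp add: Rep_scaleC Rep_tensor flip: Rep_ctensor_inject)
qed

lemma tensor_mult: "(a \<otimes> b) * (c \<otimes> d) = (a * c) \<otimes> (b * d)"
  using approx_mult[OF approx_tensor[of a b] approx_tensor[of c d]] approx_tensor[of "a * c" "b * d"]
  by (simp add: fs_mult_Cons approx_unique)

lemma tensor_star: "star (a \<otimes> b) = star a \<otimes> star b"
  using approx_star[OF approx_tensor[of a b]] approx_tensor[of "star a" "star b"]
  by (simp add: fs_star_def approx_unique)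

lemma tensor_one: "1 = 1 \<otimes> 1"
  by (rule approx_unique[OF approx_one approx_tensor])

lemma Rep_tensor_sum: "Rep_ctensor (\<Sum>(a, b)\<leftarrow>xs. a \<otimes> b) = gns_coeffs xs"
proof (induction xs)
  case (Cons p xs)
  have "gns_coeffs (p # xs) = gns_coeffs [p] + gns_coeffs xs"
    using gns_coeffs_append[of "[p]" xs] by simp
  then show ?case using Cons by (cases p) (simp add: Rep_plus Rep_tensor)
qed (simp add: Rep_zero gns_coeffs_Nil)

theorem norm_tensor_sum_le_iff:
  assumes "0 \<le> B"
  shows "norm (\<Sum>(a, b)\<leftarrow>xs. a \<otimes> b) \<le> B \<longleftrightarrow>
    (\<forall>\<phi> \<psi> y. state \<phi> \<longrightarrow> state \<psi> \<longrightarrow> gns_seminorm \<phi> \<psi> (fs_mult xs y) \<le> B * gns_seminorm \<phi> \<psi> y)"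
proof
  assume "norm (\<Sum>(a, b)\<leftarrow>xs. a \<otimes> b) \<le> B"
  then have le: "norm (gns_coeffs xs) \<le> B" by (simp add: norm_ctensor_def Rep_tensor_sum)
  have "gns_seminorm \<phi> \<psi> (fs_mult xs y) \<le> B * gns_seminorm \<phi> \<psi> y" if st: "state \<phi>" "state \<psi>" for \<phi> \<psi> y
    using gns_seminorm_mult_le[OF st, of xs y] mult_right_mono[OF le gns_seminorm_nonneg[OF st, of y]] by linarith
  then show "\<forall>\<phi> \<psi> y. state \<phi> \<longrightarrow> state \<psi> \<longrightarrow> gns_seminorm \<phi> \<psi> (fs_mult xs y) \<le> B * gns_seminorm \<phi> \<psi> y"
    by blast
next
  assume *: "\<forall>\<phi> \<psi> y. state \<phi> \<longrightarrow> state \<psi> \<longrightarrow> gns_seminorm \<phi> \<psi> (fs_mult xs y) \<le> B * gns_seminorm \<phi> \<psi> y"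
  have "norm (gns_coeffs xs) \<le> B"
  proof (rule norm_gns_coeffs_leI[OF assms])
    fix \<phi> :: "'a \<Rightarrow> complex" and \<psi> :: "'b \<Rightarrow> complex" and y z
    assume st: "state \<phi>" "state \<psi>" and le: "gns_seminorm \<phi> \<psi> y \<le> 1" "gns_seminorm \<phi> \<psi> z \<le> 1"
    have "cmod (gns_inner \<phi> \<psi> z (fs_mult xs y)) \<le> gns_seminorm \<phi> \<psi> z * gns_seminorm \<phi> \<psi> (fs_mult xs y)" by (rule gns_inner_cs[OF st])
    also have "\<dots> \<le> 1 * (B * gns_seminorm \<phi> \<psi> y)"
      using * st by (intro mult_mono le gns_seminorm_nonneg st) auto
    also have "\<dots> \<le> B" using mult_left_mono[OF le(1) assms] by simp
    finally show "cmod (gns_inner \<phi> \<psi> z (fs_mult xs y)) \<le> B" .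
  qed
  then show "norm (\<Sum>(a, b)\<leftarrow>xs. a \<otimes> b) \<le> B" by (simp add: norm_ctensor_def Rep_tensor_sum)
qed

global_interpretation complex_vector: vector_space "scaleC :: complex \<Rightarrow> 'a \<Rightarrow> 'a::cstar_algebra"
  defines cspan = complex_vector.span and csubspace = complex_vector.subspace
  by standard (simp_all add: scaleC_add_right scaleC_add_left scaleC_scaleC)

lemma tensor_limit: "\<exists>s. (\<lambda>n. \<Sum>(a, b)\<leftarrow>s n. a \<otimes> b) \<longlonglongrightarrow> x"
proof -
  obtain s where "approx s x" using approx_ex[of x] by (elim exE)
  then have "(\<lambda>n. \<Sum>(a, b)\<leftarrow>s n. a \<otimes> b) \<longlonglongrightarrow> x"
    unfolding approx_def tendsto_iff dist_ctensor_def Rep_tensor_sum .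
  then show ?thesis by (rule exI[of _ s])
qed

lemma closure_tensor: "closure (cspan {a \<otimes> b | a b. True}) = (UNIV :: ('a::cstar_algebra \<otimes> 'b::cstar_algebra) set)"
proof -
  have "x \<in> closure (cspan {a \<otimes> b | a b. True})" for x :: "'a \<otimes> 'b"
  proof -
    obtain s where s: "(\<lambda>n. \<Sum>(a, b)\<leftarrow>s n. a \<otimes> b) \<longlonglongrightarrow> x" using tensor_limit[of x] by (elim exE)
    have "(\<Sum>(a, b)\<leftarrow>xs. a \<otimes> b) \<in> cspan {a \<otimes> b | a b. True}" for xs :: "('a \<times> 'b) list"
      by (induction xs) (auto intro: complex_vector.span_zero complex_vector.span_add complex_vector.span_base)
    then show ?thesis
      unfolding closure_sequential by (intro exI[of _ "\<lambda>n. \<Sum>(a, b)\<leftarrow>s n. a \<otimes> b"] conjI allI s)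
  qed
  then show ?thesis by auto
qed

lemma norm_tensor_le: "norm (a \<otimes> b) \<le> norm a * norm b"
proof -
  have "norm (\<Sum>(a, b)\<leftarrow>[(a, b)]. a \<otimes> b) \<le> norm a * norm b"
  proof (subst norm_tensor_sum_le_iff, simp, intro allI impI)
    fix \<phi> :: "'a \<Rightarrow> complex" and \<psi> :: "'b \<Rightarrow> complex" and y assume st: "state \<phi>" "state \<psi>"
    have "fs_mult [(a, b)] y = fs_mult [(a, 1)] (fs_mult [(1, b)] y)"
      by (simp add: fs_mult_Cons comp_def case_prod_unfold)
    then show "gns_seminorm \<phi> \<psi> (fs_mult [(a, b)] y) \<le> norm a * norm b * gns_seminorm \<phi> \<psi> y"
      using gns_seminorm_mult_left[OF st, of a "fs_mult [(1, b)] y"]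
        mult_left_mono[OF gns_seminorm_mult_right[OF st, of b y] norm_ge_zero[of a]]
      by (simp add: mult.assoc)
  qed
  then show ?thesis by simp
qed

lemma bounded_linear_tensor_left: "bounded_linear (\<lambda>a. a \<otimes> b)"
  by (rule bounded_linear_intro[where K = "norm b"])
    (auto simp: tensor_add_left tensor_scaleC_left scaleR_scaleC norm_tensor_le)

definition bounded_clinear :: "('a::cstar_algebra \<Rightarrow> 'b::cstar_algebra) \<Rightarrow> bool" where
  "bounded_clinear f \<longleftrightarrow> bounded_linear f \<and> (\<forall>c x. f (c *\<^sub>C x) = c *\<^sub>C f x)"

lemma bounded_linear_tensor_eqI:
  fixes F G :: "'a::cstar_algebra \<otimes> 'b::cstar_algebra \<Rightarrow> 'c::real_normed_vector"
  assumes F: "bounded_linear F" and G: "bounded_linear G" and eq: "\<And>a b. F (a \<otimes> b) = G (a \<otimes> b)"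
  shows "F = G"
proof
  fix x :: "'a \<otimes> 'b"
  obtain s where s: "(\<lambda>n. \<Sum>(a, b)\<leftarrow>s n. a \<otimes> b) \<longlonglongrightarrow> x" using tensor_limit[of x] by (elim exE)
  have "F (\<Sum>(a, b)\<leftarrow>xs. a \<otimes> b) = G (\<Sum>(a, b)\<leftarrow>xs. a \<otimes> b)" for xs
    by (induction xs) (auto simp: eq linear_0 linear_add bounded_linear.linear F G)
  then have "(\<lambda>n. F (\<Sum>(a, b)\<leftarrow>s n. a \<otimes> b)) = (\<lambda>n. G (\<Sum>(a, b)\<leftarrow>s n. a \<otimes> b))" by simp
  then show "F x = G x"
    using bounded_linear.tendsto[OF F s] bounded_linear.tendsto[OF G s] LIMSEQ_unique by simp
qed

text \<open>The maps \<open>f \<otimes> g\<close>, the canonical isomorphism \<open>(A \<otimes> B) \<otimes> C \<cong> A \<otimes> (B \<otimes> C)\<close>, and the slice maps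
\<open>\<phi> \<otimes> id\<close> and \<open>id \<otimes> \<psi>\<close> are the unique bounded linear maps with the given values on elementary
tensors.  They exist for \<open>*\<close>-homomorphisms \<open>f\<close>, \<open>g\<close> and states \<open>\<phi>\<close>, \<open>\<psi>\<close>, the only cases in which
they are used.\<close>

definition tensor_map :: "('a \<Rightarrow> 'c) \<Rightarrow> ('b \<Rightarrow> 'd) \<Rightarrow> 'a::cstar_algebra \<otimes> 'b::cstar_algebra \<Rightarrow> 'c::cstar_algebra \<otimes> 'd::cstar_algebra" where
  "tensor_map f g = (THE F. bounded_clinear F \<and> (\<forall>a b. F (a \<otimes> b) = f a \<otimes> g b))"

definition tensor_assoc ::
    "('a::cstar_algebra \<otimes> 'b::cstar_algebra) \<otimes> 'c::cstar_algebra \<Rightarrow> 'a \<otimes> ('b \<otimes> 'c)" where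
  "tensor_assoc = (THE F. bounded_clinear F \<and> (\<forall>a b c. F ((a \<otimes> b) \<otimes> c) = a \<otimes> (b \<otimes> c)))"

definition slice_left :: "('a \<Rightarrow> complex) \<Rightarrow> 'a::cstar_algebra \<otimes> 'b::cstar_algebra \<Rightarrow> 'b" where
  "slice_left \<phi> = (THE F. bounded_clinear F \<and> (\<forall>a b. F (a \<otimes> b) = \<phi> a *\<^sub>C b))"

definition slice_right :: "('b \<Rightarrow> complex) \<Rightarrow> 'a::cstar_algebra \<otimes> 'b::cstar_algebra \<Rightarrow> 'a" where
  "slice_right \<psi> = (THE F. bounded_clinear F \<and> (\<forall>a b. F (a \<otimes> b) = \<psi> b *\<^sub>C a))"

lemma tensor_map_eqI:
  assumes "bounded_clinear F" "\<And>a b. F (a \<otimes> b) = f a \<otimes> g b"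
  shows "tensor_map f g = F"
  unfolding tensor_map_def
  by (rule the_equality) (use assms in \<open>auto simp: bounded_clinear_def intro!: bounded_linear_tensor_eqI\<close>)

lemma tensor_assoc_eqI:
  assumes F: "bounded_clinear F" "\<And>a b c. F ((a \<otimes> b) \<otimes> c) = a \<otimes> (b \<otimes> c)"
  shows "tensor_assoc = F"
  unfolding tensor_assoc_def
proof (rule the_equality)
  show "bounded_clinear F \<and> (\<forall>a b c. F ((a \<otimes> b) \<otimes> c) = a \<otimes> (b \<otimes> c))" using F by blast
  fix G :: "('a \<otimes> 'b) \<otimes> 'c \<Rightarrow> 'a \<otimes> ('b \<otimes> 'c)"
  assume G: "bounded_clinear G \<and> (\<forall>a b c. G ((a \<otimes> b) \<otimes> c) = a \<otimes> (b \<otimes> c))"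
  have left: "bounded_linear (\<lambda>x :: 'a \<otimes> 'b. x \<otimes> c)" for c :: 'c
    by (rule bounded_linear_tensor_left)
  have "(\<lambda>x. G (x \<otimes> c)) = (\<lambda>x. F (x \<otimes> c))" for c
    using F G by (intro bounded_linear_tensor_eqI bounded_linear_compose[OF _ left]) (auto simp: bounded_clinear_def)
  then have "G (x \<otimes> c) = F (x \<otimes> c)" for x c by meson
  then show "G = F"
    using F G by (intro bounded_linear_tensor_eqI) (auto simp: bounded_clinear_def)
qed

lemma slice_left_eqI:
  assumes "bounded_clinear F" "\<And>a b. F (a \<otimes> b) = \<phi> a *\<^sub>C b"
  shows "slice_left \<phi> = F"
  unfolding slice_left_def
  by (rule the_equality) (use assms in \<open>auto simp: bounded_clinear_def intro!: bounded_linear_tensor_eqI\<close>)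

lemma slice_right_eqI:
  assumes "bounded_clinear F" "\<And>a b. F (a \<otimes> b) = \<psi> b *\<^sub>C a"
  shows "slice_right \<psi> = F"
  unfolding slice_right_def
  by (rule the_equality) (use assms in \<open>auto simp: bounded_clinear_def intro!: bounded_linear_tensor_eqI\<close>)

text \<open>The minimal tensor product of $C^*$-subalgebras \<open>S\<close>, \<open>T\<close> embeds isometrically, with image the
closed span of the elementary tensors.\<close>

definition tensor_sub :: "'a set \<Rightarrow> 'b set \<Rightarrow> ('a::cstar_algebra \<otimes> 'b::cstar_algebra) set" where
  "tensor_sub S T = closure (cspan {s \<otimes> t | s t. s \<in> S \<and> t \<in> T})"

lemma tensor_sub_UNIV: "tensor_sub UNIV UNIV = UNIV"
  by (simp add: tensor_sub_def closure_tensor[simplified])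

section \<open>Compact quantum groups and their actions\<close>

definition unital_star_hom :: "('a::cstar_algebra \<Rightarrow> 'b::cstar_algebra) \<Rightarrow> bool" where
  "unital_star_hom f \<longleftrightarrow>
     (\<forall>x y. f (x + y) = f x + f y) \<and> (\<forall>c x. f (c *\<^sub>C x) = c *\<^sub>C f x) \<and>
     (\<forall>x y. f (x * y) = f x * f y) \<and> (\<forall>x. f (star x) = star (f x)) \<and> f 1 = 1"

text \<open>The underlying $C^*$-algebra of the quantum group is the whole type \<^typ>\<open>'a\<close>, so that a
compact quantum group is given by its comultiplication alone.  The three-fold tensor products
are identified along \<^const>\<open>tensor_assoc\<close>.\<close>

definition compact_quantum_group :: "('a \<Rightarrow> 'a::cstar_algebra \<otimes> 'a) \<Rightarrow> bool" where
  "compact_quantum_group \<Delta> \<longleftrightarrow>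
     unital_star_hom \<Delta> \<and>
     (\<forall>a. tensor_map id \<Delta> (\<Delta> a) = tensor_assoc (tensor_map \<Delta> id (\<Delta> a))) \<and>
     closure (cspan {\<Delta> a * (1 \<otimes> b) | a b. True}) = UNIV \<and>
     closure (cspan {\<Delta> a * (b \<otimes> 1) | a b. True}) = UNIV"

definition cqg_action ::
    "('a \<Rightarrow> 'a::cstar_algebra \<otimes> 'a) \<Rightarrow> ('b \<Rightarrow> 'b::cstar_algebra \<otimes> 'a) \<Rightarrow> bool" where
  "cqg_action \<Delta> \<alpha> \<longleftrightarrow>
     unital_star_hom \<alpha> \<and>
     (\<forall>b. tensor_assoc (tensor_map \<alpha> id (\<alpha> b)) = tensor_map id \<Delta> (\<alpha> b)) \<and>
     closure (cspan {\<alpha> b * (1 \<otimes> a) | a b. True}) = UNIV"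

definition unital_cstar_subalgebra :: "'a::cstar_algebra set \<Rightarrow> bool" where
  "unital_cstar_subalgebra Q \<longleftrightarrow>
     csubspace Q \<and> closed Q \<and> 1 \<in> Q \<and> (\<forall>x\<in>Q. \<forall>y\<in>Q. x * y \<in> Q) \<and> (\<forall>x\<in>Q. star x \<in> Q)"

definition quantum_quotient_group :: "('a \<Rightarrow> 'a::cstar_algebra \<otimes> 'a) \<Rightarrow> 'a set \<Rightarrow> bool" where
  "quantum_quotient_group \<Delta> Q \<longleftrightarrow>
     unital_cstar_subalgebra Q \<and>
     \<Delta> ` Q \<subseteq> tensor_sub Q Q \<and>
     closure (cspan {\<Delta> p * (1 \<otimes> q) | p q. p \<in> Q \<and> q \<in> Q}) = tensor_sub Q Q \<and>
     closure (cspan {\<Delta> p * (q \<otimes> 1) | p q. p \<in> Q \<and> q \<in> Q}) = tensor_sub Q Q"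

text \<open>An action \<open>\<beta> : B \<rightarrow> B \<otimes> Q\<close> of \<open>(Q, \<Delta>|Q)\<close> on \<open>B\<close>.  Since \<open>B \<otimes> Q \<subseteq> B \<otimes> A\<close> and
\<open>B \<otimes> Q \<otimes> Q \<subseteq> B \<otimes> A \<otimes> A\<close>, and the maps \<open>\<beta> \<otimes> id\<close> and \<open>id \<otimes> \<Delta>|Q\<close> on \<open>B \<otimes> Q\<close> are the restrictions
of \<open>\<beta> \<otimes> id\<close> and \<open>id \<otimes> \<Delta>\<close> on \<open>B \<otimes> A\<close>, the coaction identity can be stated in \<open>B \<otimes> A \<otimes> A\<close>.\<close>

definition quotient_group_action ::
    "('a \<Rightarrow> 'a::cstar_algebra \<otimes> 'a) \<Rightarrow> 'a set \<Rightarrow> ('b \<Rightarrow> 'b::cstar_algebra \<otimes> 'a) \<Rightarrow> bool" where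
  "quotient_group_action \<Delta> Q \<beta> \<longleftrightarrow>
     unital_star_hom \<beta> \<and> range \<beta> \<subseteq> tensor_sub UNIV Q \<and>
     (\<forall>b. tensor_assoc (tensor_map \<beta> id (\<beta> b)) = tensor_map id \<Delta> (\<beta> b)) \<and>
     closure (cspan {\<beta> b * (1 \<otimes> q) | b q. q \<in> Q}) = tensor_sub UNIV Q"

definition faithful_action ::
    "('a \<Rightarrow> 'a::cstar_algebra \<otimes> 'a) \<Rightarrow> ('b \<Rightarrow> 'b::cstar_algebra \<otimes> 'a) \<Rightarrow> bool" where
  "faithful_action \<Delta> \<alpha> \<longleftrightarrow>
     \<not> (\<exists>Q. quantum_quotient_group \<Delta> Q \<and> Q \<noteq> UNIV \<and>
          (\<exists>\<alpha>\<^sub>q. quotient_group_action \<Delta> Q \<alpha>\<^sub>q \<and> (\<forall>b. \<alpha> b = \<alpha>\<^sub>q b)))"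

definition invariant_state :: "('b \<Rightarrow> 'b::cstar_algebra \<otimes> 'a::cstar_algebra) \<Rightarrow> ('b \<Rightarrow> complex) \<Rightarrow> bool" where
  "invariant_state \<alpha> \<mu> \<longleftrightarrow> state \<mu> \<and> (\<forall>b. slice_left \<mu> (\<alpha> b) = \<mu> b *\<^sub>C 1)"

definition tracial :: "('a::cstar_algebra \<Rightarrow> complex) \<Rightarrow> bool" where
  "tracial \<mu> \<longleftrightarrow> (\<forall>a b. \<mu> (a * b) = \<mu> (b * a))"

definition faithful :: "('a::cstar_algebra \<Rightarrow> complex) \<Rightarrow> bool" where
  "faithful \<mu> \<longleftrightarrow> (\<forall>b. \<mu> (star b * b) = 0 \<longrightarrow> b = 0)"

definition haar_state :: "('a \<Rightarrow> 'a::cstar_algebra \<otimes> 'a) \<Rightarrow> ('a \<Rightarrow> complex) \<Rightarrow> bool" where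
  "haar_state \<Delta> h \<longleftrightarrow>
     state h \<and> (\<forall>a. slice_left h (\<Delta> a) = h a *\<^sub>C 1 \<and> slice_right h (\<Delta> a) = h a *\<^sub>C 1)"

text \<open>A compact quantum group has exactly one Haar state (Woronowicz).  With the existential
quantifier its existence is part of the claim; a universal one would hold vacuously if there
were none.\<close>

definition kac_algebra :: "('a \<Rightarrow> 'a::cstar_algebra \<otimes> 'a) \<Rightarrow> bool" where
  "kac_algebra \<Delta> \<longleftrightarrow> compact_quantum_group \<Delta> \<and> (\<exists>h. haar_state \<Delta> h \<and> tracial h)"

end

theory Submission imports Defs begin

text \<open>The finite-dimensional subspaces spanned by vectors with \<open>\<alpha>(e\<^sub>k) = \<Sum>\<^sub>i e\<^sub>i \<otimes> u\<^sub>i\<^sub>k\<close>, for a unitary corepresentation \<open>u\<close>,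
together span a dense subspace. A tracial invariant state that is faithful on one of them provides an orthonormal basis in which \<open>\<alpha>\<close> is
described by a corepresentation \<open>w\<close> such that both \<open>w\<close> and its entrywise conjugate are isometric. If all invariant states
are tracial, such a state is obtained by averaging a state that is faithful on the subspace. The coefficients of all
such corepresentations generate a quotient quantum group through which \<open>\<alpha>\<close> factors, so by faithfulness
of \<open>\<alpha>\<close> they are dense in \<open>A\<close>. For two of them, \<open>u\<close> and \<open>v\<close>, the matrices of the numbers \<open>h(u\<^sub>i\<^sub>j v\<^sub>k\<^sub>l\<^sup>*)\<close> and \<open>h(v\<^sub>k\<^sub>l\<^sup>* u\<^sub>i\<^sub>j)\<close>
are orthogonal projections onto the same space, because a vector fixed by \<open>u \<otimes> \<bar>v\<close> is an intertwiner and hence also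
fixed by \<open>\<bar>v \<otimes> u\<close>. Therefore \<open>h\<close> is tracial.\<close>

section \<open>States on $C^*$-algebras\<close>

text \<open>The obstacle under the first condition is faithfulness. Averaging a state against
  \<open>h\<close> gives an invariant state, but \<open>h\<close> may vanish on nonzero positive
  elements, so null vectors can appear. They are harmless on one finite-dimensional invariant
  subspace at a time: there the trace property turns a null vector b of the averaged state into a
  solution of \<open>\<omega> (b * star b) = 0\<close> for the original state \<omega>, and \<omega>
  can be chosen so that only b = 0 is possible. Two isometry conditions are imposed because the
  conjugate of a unitary corepresentation is in general unitary only up to a positive matrix, which
  measures how far \<open>h\<close> is from a trace. A tracial \<mu> makes one basis orthonormal for
  both \<open>\<mu> (star a * b)\<close> and \<open>\<mu> (a * star b)\<close>, and so trivializes
  this matrix for the corepresentation on that basis. The doubled condition is stable under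
  conjugation and tensor products, so the coefficients span an involutive algebra, and the
  comparison of fixed vectors works without an antipode and without a decomposition into
  irreducibles.\<close>

definition sublinear :: "('a::real_vector \<Rightarrow> real) \<Rightarrow> bool" where
  "sublinear p \<longleftrightarrow> (\<forall>x y. p (x + y) \<le> p x + p y) \<and> (\<forall>r x. 0 \<le> r \<longrightarrow> p (r *\<^sub>R x) = r * p x)"

lemma sublinear_add: "sublinear p \<Longrightarrow> p (x + y) \<le> p x + p y"
  and sublinear_scale: "sublinear p \<Longrightarrow> 0 \<le> r \<Longrightarrow> p (r *\<^sub>R x) = r * p x"
  by (auto simp: sublinear_def)

lemma sublinear_zero: "sublinear p \<Longrightarrow> p 0 = 0"
  using sublinear_scale[of p 0 0] by simp

lemma sublinear_minus: "sublinear p \<Longrightarrow> - p (- x) \<le> p x"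
  using sublinear_add[of p x "- x"] sublinear_zero[of p] by simp

text \<open>Directedness saves subadditivity: a near-minimizer for \<open>x\<close> and one for
  \<open>y\<close> have a common lower member, whose own subadditivity gives the estimate. This
  provides lower bounds of chains in the Zorn argument.\<close>

lemma sublinear_Inf:
  assumes "C \<noteq> {}" and sub: "\<And>q. q \<in> C \<Longrightarrow> sublinear q"
    and dir: "\<And>q r. q \<in> C \<Longrightarrow> r \<in> C \<Longrightarrow> \<exists>s\<in>C. s \<le> q \<and> s \<le> r"
    and bd: "\<And>x. bdd_below ((\<lambda>q. q x) ` C)"
  shows "sublinear (\<lambda>x. INF q\<in>C. q x)"
  unfolding sublinear_def
proof (intro conjI allI impI)
  fix x y
  show "(INF q\<in>C. q (x + y)) \<le> (INF q\<in>C. q x) + (INF q\<in>C. q y)"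
  proof (rule field_le_epsilon)
    fix e :: real assume "0 < e"
    then obtain q r where q: "q \<in> C" "q x < (INF q\<in>C. q x) + e / 2" and r: "r \<in> C" "r y < (INF q\<in>C. q y) + e / 2"
      using cINF_less_iff[OF assms(1) bd, of x "(INF q\<in>C. q x) + e / 2"]
        cINF_less_iff[OF assms(1) bd, of y "(INF q\<in>C. q y) + e / 2"] by auto
    obtain s where s: "s \<in> C" "s \<le> q" "s \<le> r" using dir[OF q(1) r(1)] by blast
    have "(INF q\<in>C. q (x + y)) \<le> s (x + y)" by (rule cINF_lower[OF bd s(1)])
    also have "\<dots> \<le> s x + s y" by (rule sublinear_add[OF sub[OF s(1)]])
    also have "\<dots> \<le> q x + r y" using s by (auto simp: le_fun_def intro: add_mono)
    finally show "(INF q\<in>C. q (x + y)) \<le> (INF q\<in>C. q x) + (INF q\<in>C. q y) + e" using q r by simp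
  qed
next
  fix t :: real and x assume t: "0 \<le> t"
  have "(INF q\<in>C. q (t *\<^sub>R x)) = (INF q\<in>C. t * q x)"
    by (rule INF_cong) (auto simp: sublinear_scale[OF sub _] t)
  also have "\<dots> = t * (INF q\<in>C. q x)"
  proof (cases "t = 0")
    case True then show ?thesis using assms(1) by simp
  next
    case False
    then have t: "0 < t" using t by simp
    show ?thesis
    proof (rule antisym)
      have "(INF q\<in>C. t * q x) / t \<le> (INF q\<in>C. q x)"
      proof (rule cINF_greatest[OF assms(1)])
        fix q assume "q \<in> C"
        moreover have "bdd_below ((\<lambda>q. t * q x) ` C)"
        proof -
          obtain M where "\<And>q. q \<in> C \<Longrightarrow> M \<le> q x" using bd[of x] by (auto simp: bdd_below_def)
          then show ?thesis using t by (intro bdd_belowI2[of _ "t * M"] mult_left_mono) auto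
        qed
        ultimately have "(INF q\<in>C. t * q x) \<le> t * q x" by (intro cINF_lower) auto
        then show "(INF q\<in>C. t * q x) / t \<le> q x" using t by (simp add: field_simps)
      qed
      then show "(INF q\<in>C. t * q x) \<le> t * (INF q\<in>C. q x)" using t by (simp add: field_simps)
      show "t * (INF q\<in>C. q x) \<le> (INF q\<in>C. t * q x)"
        using t by (intro cINF_greatest[OF assms(1)] mult_left_mono cINF_lower[OF bd]) auto
    qed
  qed
  finally show "(INF q\<in>C. q (t *\<^sub>R x)) = t * (INF q\<in>C. q x)" .
qed

text \<open>A sublinear functional that is minimal is equal to all its tilts, and therefore linear.\<close>

lemma sublinear_tilt:
  fixes a :: "'a::real_vector"
  assumes p: "sublinear p"
  defines "q \<equiv> \<lambda>x. INF t\<in>{0..}. p (x + t *\<^sub>R a) - t * p a"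
  shows "sublinear q" "q \<le> p" "q (- a) \<le> - p a"
proof -
  have bd: "bdd_below ((\<lambda>t. p (x + t *\<^sub>R a) - t * p a) ` {0..})" for x
    unfolding bdd_below_def
  proof (intro exI ballI, elim imageE)
    fix r t assume r: "r = p (x + t *\<^sub>R a) - t * p a" and t: "t \<in> {0::real..}"
    have "t * p a \<le> p (x + t *\<^sub>R a) + p (- x)"
      using sublinear_add[OF p, of "x + t *\<^sub>R a" "- x"] sublinear_scale[OF p, of t a] t by simp
    then show "- p (- x) \<le> r" using r by simp
  qed
  have le: "q x \<le> p (x + t *\<^sub>R a) - t * p a" if "0 \<le> t" for x t
    unfolding q_def by (rule cINF_lower[OF bd]) (use that in auto)
  show "q \<le> p" using le[of 0] by (auto simp: le_fun_def)
  show "q (- a) \<le> - p a" using le[of 1 "- a"] sublinear_zero[OF p] by simp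
  have gt: "\<exists>t\<ge>0. p (x + t *\<^sub>R a) - t * p a < u" if "q x < u" for x u
    using that unfolding q_def by (subst (asm) cINF_less_iff[OF _ bd]) auto
  have sc: "q (r *\<^sub>R x) \<le> r * q x" if "0 < r" for r x
  proof -
    have "q (r *\<^sub>R x) / r \<le> (INF t\<in>{0..}. p (x + t *\<^sub>R a) - t * p a)"
    proof (rule cINF_greatest)
      fix t :: real assume "t \<in> {0..}"
      then have "q (r *\<^sub>R x) \<le> p (r *\<^sub>R (x + t *\<^sub>R a)) - r * t * p a"
        using le[of "r * t" "r *\<^sub>R x"] that by (simp add: algebra_simps)
      then show "q (r *\<^sub>R x) / r \<le> p (x + t *\<^sub>R a) - t * p a"
        using that sublinear_scale[OF p, of r "x + t *\<^sub>R a"] by (simp add: field_simps)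
    qed auto
    also have "\<dots> = q x" by (simp add: q_def)
    finally show ?thesis using that by (simp add: field_simps)
  qed
  show "sublinear q"
    unfolding sublinear_def
  proof (intro conjI allI impI)
    fix x y
    show "q (x + y) \<le> q x + q y"
    proof (rule field_le_epsilon)
      fix e :: real assume "0 < e"
      then obtain s t where s: "0 \<le> s" "p (x + s *\<^sub>R a) - s * p a < q x + e / 2"
        and t: "0 \<le> t" "p (y + t *\<^sub>R a) - t * p a < q y + e / 2"
        using gt[of x "q x + e / 2"] gt[of y "q y + e / 2"] by auto
      have "q (x + y) \<le> p ((x + s *\<^sub>R a) + (y + t *\<^sub>R a)) - (s + t) * p a"
        using le[of "s + t" "x + y"] s t by (simp add: algebra_simps)
      also have "\<dots> \<le> p (x + s *\<^sub>R a) + p (y + t *\<^sub>R a) - (s + t) * p a"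
        using sublinear_add[OF p] by simp
      finally show "q (x + y) \<le> q x + q y + e" using s t by (simp add: algebra_simps)
    qed
  next
    fix r :: real and x assume r: "0 \<le> r"
    have q0: "q 0 = 0"
      unfolding q_def using sublinear_scale[OF p] by (subst INF_cong[OF refl, of _ _ "\<lambda>_. 0"]) auto
    show "q (r *\<^sub>R x) = r * q x"
    proof (cases "r = 0")
      case False
      then have r: "0 < r" using r by simp
      have "r * q ((1 / r) *\<^sub>R r *\<^sub>R x) \<le> r * ((1 / r) * q (r *\<^sub>R x))"
        using sc[of "1 / r" "r *\<^sub>R x"] r by (intro mult_left_mono) auto
      then show ?thesis using sc[OF r, of x] r by simp
    qed (simp add: q0)
  qed
qed

theorem Hahn_Banach_sublinear:
  fixes p :: "'a::real_vector \<Rightarrow> real"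
  assumes p: "sublinear p"
  obtains f where "linear f" "f \<le> p"
proof -
  define S where "S = {q. sublinear q \<and> q \<le> p}"
  have "\<exists>m\<in>S. \<forall>q\<in>S. q \<le> m \<longrightarrow> q = m"
  proof -
    have "\<exists>m\<in>S. \<forall>q\<in>S. m \<ge> q \<longrightarrow> q = m"
    \<comment> \<open>The order is reversed, so a maximal element is a minimal sublinear functional
      below \<open>p\<close>.\<close>
    proof (rule predicate_Zorn)
      show "partial_order_on S (relation_of (\<ge>) S)"
        by (auto simp: partial_order_on_def preorder_on_def refl_on_def trans_def antisym_def relation_of_def)
      fix C assume C: "C \<in> Chains (relation_of (\<ge>) S)"
      then have CS: "C \<subseteq> S" and tot: "\<And>q r. q \<in> C \<Longrightarrow> r \<in> C \<Longrightarrow> q \<le> r \<or> r \<le> q"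
        by (auto simp: Chains_def relation_of_def)
      show "\<exists>u\<in>S. \<forall>q\<in>C. q \<ge> u"
      proof (cases "C = {}")
        case True then show ?thesis using p by (auto simp: S_def)
      next
        case False
        have bd: "bdd_below ((\<lambda>q. q x) ` C)" for x
          unfolding bdd_below_def
        proof (intro exI ballI, elim imageE)
          fix r q assume r: "r = q x" and q: "q \<in> C"
          then have "sublinear q" "q (- x) \<le> p (- x)" using CS by (auto simp: S_def le_fun_def)
          then show "- p (- x) \<le> r" using sublinear_minus[of q x] r by simp
        qed
        let ?u = "\<lambda>x. INF q\<in>C. q x"
        have low: "?u \<le> q" if "q \<in> C" for q
          using that by (auto simp: le_fun_def intro: cINF_lower[OF bd])
        have "sublinear ?u"
        proof (rule sublinear_Inf[OF False _ _ bd])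
          show "\<exists>s\<in>C. s \<le> q \<and> s \<le> r" if "q \<in> C" "r \<in> C" for q r
            using tot[OF that] by (rule disjE) (use that in \<open>auto intro: bexI[of _ q] bexI[of _ r]\<close>)
        qed (use CS in \<open>auto simp: S_def\<close>)
        moreover have "?u \<le> p" using False CS low by (auto simp: S_def intro: order_trans)
        ultimately show ?thesis using low by (intro bexI[of _ ?u]) (auto simp: S_def)
      qed
    qed
    then show ?thesis by blast
  qed
  then obtain m where m: "sublinear m" "m \<le> p" and mS: "\<And>q. q \<in> S \<Longrightarrow> q \<le> m \<Longrightarrow> q = m"
    by (auto simp: S_def)
  have min: "q = m" if "sublinear q" "q \<le> m" for q
    using mS[of q] that order_trans[OF that(2) m(2)] by (simp add: S_def)
  have neg: "m (- a) = - m a" for a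
  proof -
    have "m (- a) \<le> - m a"
      using sublinear_tilt(3)[OF m(1), of a] unfolding fun_cong[OF min[OF sublinear_tilt(1,2)[OF m(1), of a]]] .
    then show ?thesis using sublinear_minus[OF m(1), of a] by simp
  qed
  have "m (x + y) = m x + m y" for x y
  proof -
    have "- m (x + y) \<le> - m x - m y"
      using sublinear_add[OF m(1), of "- x" "- y"] unfolding minus_add_distrib[symmetric] neg by simp
    then show ?thesis using sublinear_add[OF m(1), of x y] by linarith
  qed
  moreover have "m (r *\<^sub>R x) = r * m x" for r x
  proof (cases "0 \<le> r")
    case False
    then have "m (- (r *\<^sub>R x)) = - r * m x"
      using sublinear_scale[OF m(1), of "- r" x] by simp
    then show ?thesis unfolding neg by simp
  qed (rule sublinear_scale[OF m(1)])
  ultimately have "linear m" by (intro linearI) auto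
  then show ?thesis using that m(2) by blast
qed

text \<open>No extension from a subspace takes place: the norm is replaced by its tilt in direction
  \<open>a\<close>, which lies below the norm and is at most \<open>- norm a\<close> at
  \<open>- a\<close>. Every linear functional under the tilt then attains the norm at
  \<open>a\<close>.\<close>

corollary Hahn_Banach_norm:
  fixes a :: "'a::real_normed_vector"
  obtains f where "linear f" "\<And>x. f x \<le> norm x" "f a = norm a"
proof -
  have "sublinear (norm :: 'a \<Rightarrow> real)" by (auto simp: sublinear_def norm_triangle_ineq)
  note t = sublinear_tilt[OF this, of a]
  obtain f where f: "linear f" "f \<le> (\<lambda>x. INF t\<in>{0..}. norm (x + t *\<^sub>R a) - t * norm a)"
    using Hahn_Banach_sublinear[OF t(1)] by blast
  then have "f (- a) \<le> - norm a" using t(3) by (auto simp: le_fun_def intro: order_trans[of "f (- a)"])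
  then have "norm a \<le> f a" using linear_neg[OF f(1)] by simp
  moreover have le: "f x \<le> norm x" for x using order_trans[OF f(2) t(2)] by (simp add: le_fun_def)
  ultimately show ?thesis using that[OF f(1)] by (simp add: antisym)
qed

section \<open>Arithmetic of complex scalars and the involution\<close>

lemma scaleC_zero_right [simp]: "c *\<^sub>C 0 = (0 :: 'a::cstar_algebra)"
  and scaleC_zero_left [simp]: "0 *\<^sub>C x = (0 :: 'a)"
  and scaleC_minus_left: "(- c) *\<^sub>C x = - (c *\<^sub>C x)"
  and scaleC_diff_right: "c *\<^sub>C (x - y) = c *\<^sub>C x - c *\<^sub>C y"
  and scaleC_sum_right: "c *\<^sub>C (\<Sum>i\<in>I. f i) = (\<Sum>i\<in>I. c *\<^sub>C f i)"
  by (rule complex_vector.scale_zero_right complex_vector.scale_zero_left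
      complex_vector.scale_minus_left complex_vector.scale_right_diff_distrib complex_vector.scale_sum_right)+

lemma star_zero [simp]: "star 0 = (0 :: 'a::cstar_algebra)"
  using star_add[of "0::'a" 0] by simp

lemma star_minus: "star (- x) = - star (x :: 'a::cstar_algebra)"
  using star_add[of x "- x"] by (simp add: eq_neg_iff_add_eq_0 add.commute)

lemma star_diff: "star (x - y) = star x - star (y :: 'a::cstar_algebra)"
  using star_add[of x "- y"] by (simp add: star_minus)

lemma star_scaleR: "star (r *\<^sub>R x) = r *\<^sub>R star (x :: 'a::cstar_algebra)"
  by (simp add: scaleR_scaleC star_scaleC)

lemma star_sum: "star (sum f I) = (\<Sum>i\<in>I. star (f i :: 'a::cstar_algebra))"
  by (induction I rule: infinite_finite_induct) (auto simp: star_add)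

lemma bounded_linear_star: "bounded_linear (star :: 'a \<Rightarrow> 'a::cstar_algebra)"
  by (rule bounded_linear_intro[where K = 1]) (auto simp: star_add star_scaleR)

lemma bounded_linear_scaleC: "bounded_linear (\<lambda>x :: 'a::cstar_algebra. c *\<^sub>C x)"
  by (rule bounded_linear_intro[where K = "cmod c"])
    (auto simp: scaleC_add_right norm_scaleC scaleR_scaleC scaleC_scaleC mult.commute)

lemma star_eq_0_iff [simp]: "star x = 0 \<longleftrightarrow> (x :: 'a::cstar_algebra) = 0"
  by (metis star_star star_zero)

section \<open>Square roots and positivity without spectral theory\<close>

lemma norm_one_le: "norm (1 :: 'a::cstar_algebra) \<le> 1"
  using cstar_identity[of "1 :: 'a"] by (cases "norm (1 :: 'a) = 0") (simp_all add: power2_eq_square)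

lemma norm_square_self_adjoint: "star x = x \<Longrightarrow> norm (x * x) = (norm (x :: 'a::cstar_algebra))\<^sup>2"
  using cstar_identity[of x] by simp

lemma star_mult_self_eq_0_iff [simp]: "star x * x = 0 \<longleftrightarrow> (x :: 'a::cstar_algebra) = 0"
  using cstar_identity[of x] by auto

text \<open>The iteration \<open>y \<leftarrow> (x + y\<^sup>2) / 2\<close> converges to a solution of \<open>(1 - y)\<^sup>2 = 1 - x\<close>; it is dominated by the same
iteration with the number \<open>1\<close> in place of \<open>x\<close>, which is increasing and bounded.\<close>

lemma sqrt_one_minus:
  fixes x :: "'a::cstar_algebra"
  assumes sa: "star x = x" and nx: "norm x \<le> 1"
  shows "\<exists>y. star y = y \<and> y * y = 1 - x \<and> norm (1 - y) \<le> 1 \<and> (\<forall>c. c * x = x * c \<longrightarrow> c * y = y * c)"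
proof -
  define Y where "Y = rec_nat 0 (\<lambda>_ y. (1/2) *\<^sub>R (x + y * y))"
  define U where "U = rec_nat 0 (\<lambda>_ u :: real. (1 + u * u) / 2)"
  have Y0: "Y 0 = 0" and YS: "Y (Suc n) = (1/2) *\<^sub>R (x + Y n * Y n)" for n by (simp_all add: Y_def)
  have U0: "U 0 = 0" and US: "U (Suc n) = (1 + U n * U n) / 2" for n by (simp_all add: U_def)
  have U01: "0 \<le> U n \<and> U n \<le> 1" for n
    by (induction n) (auto simp: U0 US mult_le_one)
  have U_inc: "U n \<le> U (Suc n)" for n
    using sum_squares_ge_zero[of "U n - 1" 0] by (simp add: US algebra_simps)
  have comm: "c * Y n = Y n * c" if "c * x = x * c" for c n
  proof (induction n)
    case (Suc n)
    then have "c * (Y n * Y n) = (Y n * Y n) * c" by (metis mult.assoc)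
    then show ?case using that by (simp add: YS distrib_left distrib_right)
  qed (simp add: Y0)
  have YY: "Y m * Y n = Y n * Y m" for m n using comm[OF comm[of x n, symmetric, OF refl]] by simp
  have nY: "norm (Y n) \<le> U n" for n
  proof (induction n)
    case (Suc n)
    have "norm (x + Y n * Y n) \<le> 1 + U n * U n"
      using nx Suc by (intro norm_triangle_le add_mono order_trans[OF norm_mult_ineq] mult_mono) (auto simp: U01)
    then show ?case by (simp add: YS US)
  qed (simp add: Y0 U0)
  have dY: "norm (Y (Suc n) - Y n) \<le> U (Suc n) - U n" for n
  proof (induction n)
    case 0 then show ?case using nx by (simp add: YS US Y0 U0)
  next
    case (Suc n)
    have "Y (Suc (Suc n)) - Y (Suc n) = (1/2) *\<^sub>R (x + Y (Suc n) * Y (Suc n)) - (1/2) *\<^sub>R (x + Y n * Y n)"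
      by (simp only: YS[symmetric])
    also have "\<dots> = (1/2) *\<^sub>R (Y (Suc n) * Y (Suc n) - Y n * Y n)"
      unfolding scaleR_diff_right[symmetric] by simp
    also have "Y (Suc n) * Y (Suc n) - Y n * Y n = (Y (Suc n) - Y n) * (Y (Suc n) + Y n)"
      by (simp add: distrib_left left_diff_distrib YY[of n "Suc n"])
    finally have "Y (Suc (Suc n)) - Y (Suc n) = (1/2) *\<^sub>R ((Y (Suc n) - Y n) * (Y (Suc n) + Y n))" .
    moreover have "norm ((Y (Suc n) - Y n) * (Y (Suc n) + Y n)) \<le> (U (Suc n) - U n) * (U (Suc n) + U n)"
      using Suc U_inc[of n]
      by (intro order_trans[OF norm_mult_ineq] mult_mono norm_triangle_le add_mono nY) (auto simp: U01)
    moreover have "(U (Suc n) - U n) * (U (Suc n) + U n) / 2 = U (Suc (Suc n)) - U (Suc n)"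
    proof -
      have "U (Suc (Suc n)) - U (Suc n) = (1 + U (Suc n) * U (Suc n)) / 2 - (1 + U n * U n) / 2"
        by (simp only: US)
      then show ?thesis by (simp add: field_simps)
    qed
    ultimately show ?case by simp
  qed
  have dY': "norm (Y m - Y n) \<le> U m - U n" if "n \<le> m" for m n
    using that
  proof (induction m rule: dec_induct)
    case (step m)
    have "norm (Y (Suc m) - Y n) \<le> norm (Y (Suc m) - Y m) + norm (Y m - Y n)"
      using norm_triangle_ineq[of "Y (Suc m) - Y m" "Y m - Y n"] by simp
    then show ?case using dY[of m] step by simp
  qed simp
  have "incseq U" using U_inc by (rule incseq_SucI)
  then have "convergent U" using U01 by (intro Bseq_mono_convergent BseqI'[of _ 1]) (auto simp: incseq_def)
  then have CU: "Cauchy U" by (simp add: Cauchy_convergent_iff)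
  have "Cauchy Y"
  proof (rule CauchyI')
    fix e :: real assume "0 < e"
    then obtain M where M: "\<And>m n. m \<ge> M \<Longrightarrow> n \<ge> M \<Longrightarrow> norm (U m - U n) < e"
      using CauchyD[OF CU] by blast
    have "norm (Y m - Y n) < e" if "m \<ge> M" "n > m" for m n
      using dY'[of m n] M[of n m] that by (simp add: norm_minus_commute)
    then show "\<exists>M. \<forall>m\<ge>M. \<forall>n>m. dist (Y m) (Y n) < e" unfolding dist_norm by blast
  qed
  then obtain z where z: "Y \<longlonglongrightarrow> z" by (auto simp: Cauchy_convergent_iff convergent_def)
  have "(\<lambda>n. (1/2) *\<^sub>R (x + Y n * Y n)) \<longlonglongrightarrow> (1/2) *\<^sub>R (x + z * z)"
    by (intro tendsto_intros z)
  then have "(\<lambda>n. Y (Suc n)) \<longlonglongrightarrow> (1/2) *\<^sub>R (x + z * z)" by (simp only: YS)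
  from LIMSEQ_unique[OF LIMSEQ_Suc[OF z] this]
  have "2 *\<^sub>R z = 2 *\<^sub>R ((1/2) *\<^sub>R (x + z * z))" by (rule arg_cong)
  then have fix_z: "z + z = x + z * z" by (simp add: scaleR_2[of z, symmetric])
  have sY: "star (Y n) = Y n" for n
    by (induction n) (auto simp: Y0 YS star_scaleR star_add star_mult sa)
  have sz: "star z = z"
    using bounded_linear.tendsto[OF bounded_linear_star z] z unfolding sY by (rule LIMSEQ_unique)
  have nz: "norm z \<le> 1"
    by (rule LIMSEQ_le_const2[OF tendsto_norm[OF z]]) (use nY U01 order_trans in blast)
  have cz: "c * z = z * c" if "c * x = x * c" for c
  proof -
    have "(\<lambda>n. c * Y n) \<longlonglongrightarrow> c * z" "(\<lambda>n. Y n * c) \<longlonglongrightarrow> z * c" by (intro tendsto_intros z)+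
    then show ?thesis unfolding comm[OF that] by (rule LIMSEQ_unique)
  qed
  have "(1 - z) * (1 - z) = 1 - x"
    using fix_z by (simp add: algebra_simps)
  moreover have "c * (1 - z) = (1 - z) * c" if "c * x = x * c" for c
    using cz[OF that] by (simp add: algebra_simps)
  moreover have "star (1 - z) = 1 - z" "norm (1 - (1 - z)) \<le> 1" using sz nz by (simp_all add: star_diff)
  ultimately show ?thesis by blast
qed

text \<open>For self-adjoint \<open>x\<close> the bound
  \<open>norm (t *\<^sub>R 1 - x) \<le> t\<close> says, without mentioning the spectrum, that
  \<open>x\<close> is positive with spectrum in [0, 2t]. The conclusion contains the same kind of
  bound for \<open>y\<close>, so that roots can be taken repeatedly.\<close>

lemma sqrt_near_scalar:
  fixes x :: "'a::cstar_algebra"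
  assumes sa: "star x = x" and nx: "norm (t *\<^sub>R 1 - x) \<le> t"
  shows "\<exists>y. star y = y \<and> y * y = x \<and> norm (sqrt t *\<^sub>R 1 - y) \<le> sqrt t \<and> (\<forall>c. c * x = x * c \<longrightarrow> c * y = y * c)"
proof (cases "t = 0")
  case True
  then have "x = 0" using nx by simp
  then show ?thesis using True by (intro exI[of _ 0]) auto
next
  case False
  then have t: "0 < t" using norm_ge_zero[of "t *\<^sub>R 1 - x"] nx by linarith
  have "norm (1 - (1/t) *\<^sub>R x) = norm ((1/t) *\<^sub>R (t *\<^sub>R 1 - x))" using t by (simp add: scaleR_diff_right)
  also have "\<dots> = norm (t *\<^sub>R 1 - x) / t" unfolding norm_scaleR using t by simp
  also have "\<dots> \<le> 1" using nx t by simp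
  finally have n: "norm (1 - (1/t) *\<^sub>R x) \<le> 1" .
  have "star (1 - (1/t) *\<^sub>R x) = 1 - (1/t) *\<^sub>R x" using sa by (simp add: star_diff star_scaleR)
  from sqrt_one_minus[OF this n] obtain y where y: "star y = y" "y * y = 1 - (1 - (1/t) *\<^sub>R x)" "norm (1 - y) \<le> 1"
    and c: "\<And>c. c * (1 - (1/t) *\<^sub>R x) = (1 - (1/t) *\<^sub>R x) * c \<Longrightarrow> c * y = y * c" by blast
  have "c * (sqrt t *\<^sub>R y) = (sqrt t *\<^sub>R y) * c" if "c * x = x * c" for c
    using c[of c] that by (simp add: right_diff_distrib left_diff_distrib)
  moreover have "star (sqrt t *\<^sub>R y) = sqrt t *\<^sub>R y" "(sqrt t *\<^sub>R y) * (sqrt t *\<^sub>R y) = x"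
    using y t by (simp_all add: star_scaleR)
  moreover have "norm (sqrt t *\<^sub>R 1 - sqrt t *\<^sub>R y) \<le> sqrt t"
    using y t by (simp add: mult_left_le flip: scaleR_diff_right)
  ultimately show ?thesis by blast
qed

text \<open>The normal element \<open>z = p - i q\<close> has \<open>z\<^sup>* z = p\<^sup>2 + q\<^sup>2\<close> and real part \<open>p\<close>.\<close>

lemma norm_square_le_sum_squares:
  fixes p q :: "'a::cstar_algebra"
  assumes sa: "star p = p" "star q = q" and comm: "p * q = q * p"
  shows "norm (p * p) \<le> norm (p * p + q * q)"
proof -
  define z where "z = p - \<i> *\<^sub>C q"
  have sz: "star z = p + \<i> *\<^sub>C q" by (simp add: z_def star_diff star_scaleC sa scaleC_minus_left)
  have "star z * z = p * p + q * q"
    unfolding sz by (simp add: z_def algebra_simps mult_scaleC_left mult_scaleC_right scaleC_scaleC comm scaleC_minus_left)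
  then have nz: "(norm z)\<^sup>2 = norm (p * p + q * q)" using cstar_identity[of z] by simp
  have "p + p = z + star z" by (simp add: sz) (simp add: z_def)
  then have "norm (2 *\<^sub>R p) \<le> norm z + norm (star z)" by (simp only: scaleR_2 norm_triangle_ineq)
  then have "norm p \<le> norm z" by simp
  then have "(norm p)\<^sup>2 \<le> (norm z)\<^sup>2" by (intro power_mono) auto
  then show ?thesis using nz norm_square_self_adjoint[OF sa(1)] by simp
qed

text \<open>Squares of self-adjoint elements pass the positivity test of
  \<open>sqrt_near_scalar\<close>: the element \<open>t *\<^sub>R 1 - y * y\<close> lies within t of
  \<open>t *\<^sub>R 1\<close>, hence has a root w commuting with y, and w^2 + y^2 = t bounds
  w^2.\<close>

lemma norm_diff_square_le:
  fixes y :: "'a::cstar_algebra"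
  assumes sa: "star y = y" and t: "norm (y * y) \<le> t"
  shows "norm (t *\<^sub>R 1 - y * y) \<le> t"
proof -
  have "norm (t *\<^sub>R 1 - (t *\<^sub>R 1 - y * y)) \<le> t" using t by simp
  moreover have "star (t *\<^sub>R 1 - y * y) = t *\<^sub>R 1 - y * y" by (simp add: star_diff star_scaleR star_mult sa)
  ultimately obtain w where w: "star w = w" "w * w = t *\<^sub>R 1 - y * y"
    and c: "\<And>c. c * (t *\<^sub>R 1 - y * y) = (t *\<^sub>R 1 - y * y) * c \<Longrightarrow> c * w = w * c"
    using sqrt_near_scalar by blast
  have "y * w = w * y" by (rule c) (simp add: algebra_simps)
  then have "norm (w * w) \<le> norm (w * w + y * y)" by (intro norm_square_le_sum_squares w sa) simp
  also have "\<dots> = \<bar>t\<bar> * norm (1 :: 'a)" by (simp add: w)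
  also have "\<dots> \<le> t"
    using order_trans[OF norm_ge_zero t] norm_one_le[where 'a = 'a] by (simp add: mult_left_le)
  finally show ?thesis by (simp add: w)
qed

text \<open>The positivity test is additive in t, so a sum of two squares is a square even when
  \<open>p\<close> and \<open>q\<close> do not commute.\<close>

lemma sqrt_sum_squares:
  fixes p q :: "'a::cstar_algebra"
  assumes sa: "star p = p" "star q = q"
  shows "\<exists>w. star w = w \<and> w * w = p * p + q * q \<and> (\<forall>c. c * p = p * c \<longrightarrow> c * q = q * c \<longrightarrow> c * w = w * c)"
proof -
  let ?s = "norm (p * p)" and ?t = "norm (q * q)"
  have "norm ((?s *\<^sub>R 1 - p * p) + (?t *\<^sub>R 1 - q * q)) \<le> ?s + ?t"
    by (intro norm_triangle_le add_mono norm_diff_square_le sa order_refl)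
  then have "norm ((?s + ?t) *\<^sub>R 1 - (p * p + q * q)) \<le> ?s + ?t" by (simp add: algebra_simps)
  moreover have "star (p * p + q * q) = p * p + q * q" by (simp add: star_add star_mult sa)
  ultimately obtain w where w: "star w = w" "w * w = p * p + q * q"
    "\<And>c. c * (p * p + q * q) = (p * p + q * q) * c \<Longrightarrow> c * w = w * c"
    using sqrt_near_scalar by blast
  have "c * (p * p + q * q) = (p * p + q * q) * c" if "c * p = p * c" "c * q = q * c" for c
  proof -
    have "c * (p * p) = (p * p) * c" using that(1) by (metis mult.assoc)
    moreover have "c * (q * q) = (q * q) * c" using that(2) by (metis mult.assoc)
    ultimately show ?thesis by (simp only: distrib_left distrib_right)
  qed
  then show ?thesis using w by blast
qed

lemma norm_power_Suc_le: "norm (x ^ Suc n) \<le> norm (x :: 'a::cstar_algebra) ^ Suc n"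
proof (induction n)
  case (Suc n)
  have "norm (x ^ Suc (Suc n)) \<le> norm x * norm (x ^ Suc n)"
    unfolding power_Suc[of x "Suc n"] by (rule norm_mult_ineq)
  also have "\<dots> \<le> norm x * norm x ^ Suc n" by (intro mult_left_mono Suc) auto
  finally show ?case by simp
qed simp

lemma square_eq_0_self_adjoint:
  fixes x :: "'a::cstar_algebra"
  shows "star x = x \<Longrightarrow> x * x = 0 \<Longrightarrow> x = 0"
  using star_mult_self_eq_0_iff[of x] by simp

text \<open>Bernoulli's inequality with the remainder exhibited as a square. One more factor t + s^2
  leaves the terms (n + 1) t^n s^4, t w^2 and s^2 w^2, which are the squares of \<open>p\<close>,
  \<open>q\<close> and \<open>r\<close>; since all of them commute with s, their sum has a root that
  does so too.\<close>

lemma power_scalar_plus_square: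
  fixes s :: "'a::cstar_algebra"
  assumes s: "star s = s" and t: "0 \<le> t"
  shows "\<exists>w. star w = w \<and> s * w = w * s \<and>
    (t *\<^sub>R 1 + s * s) ^ Suc n = t ^ Suc n *\<^sub>R 1 + (real (Suc n) * t ^ n) *\<^sub>R (s * s) + w * w"
proof (induction n)
  case 0
  show ?case by (intro exI[of _ 0]) simp
next
  case (Suc n)
  then obtain w where w: "star w = w" "s * w = w * s"
    "(t *\<^sub>R 1 + s * s) ^ Suc n = t ^ Suc n *\<^sub>R 1 + (real (Suc n) * t ^ n) *\<^sub>R (s * s) + w * w" by blast
  define p where "p = sqrt (real (Suc n) * t ^ n) *\<^sub>R (s * s)"
  define q where "q = sqrt t *\<^sub>R w"
  define r where "r = s * w"
  have sw: "w * s = s * w" "w * (s * y) = s * (w * y)" for y using w(2) by (simp_all flip: mult.assoc)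
  have sa: "star p = p" "star q = q" "star r = r" by (simp_all add: p_def q_def r_def star_scaleR star_mult s w(1) sw)
  have c: "s * p = p * s" "s * q = q * s" "s * r = r * s"
    by (simp_all add: p_def q_def r_def mult.assoc sw)
  have sq: "sqrt a *\<^sub>R y * sqrt a *\<^sub>R y = a *\<^sub>R (y * y)" if "0 \<le> a" for a and y :: 'a
    using that by simp
  have pp: "p * p = (real (Suc n) * t ^ n) *\<^sub>R (s * s * (s * s))" and qq: "q * q = t *\<^sub>R (w * w)"
    unfolding p_def q_def using t by (simp_all only: sq mult_nonneg_nonneg of_nat_0_le_iff zero_le_power)
  have rr: "r * r = s * s * (w * w)" unfolding r_def by (simp add: mult.assoc sw)
  obtain v where v: "star v = v" "v * v = p * p + q * q" "s * v = v * s"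
    using sqrt_sum_squares[OF sa(1,2)] c by blast
  obtain u where u: "star u = u" "u * u = v * v + r * r" "s * u = u * s"
    using sqrt_sum_squares[OF v(1) sa(3)] c v(3) by blast
  have "(t *\<^sub>R 1 + s * s) ^ Suc (Suc n) = (t *\<^sub>R 1 + s * s) * (t ^ Suc n *\<^sub>R 1 + (real (Suc n) * t ^ n) *\<^sub>R (s * s) + w * w)"
    by (simp only: power_Suc[of _ "Suc n"] w(3))
  also have "\<dots> = t ^ Suc (Suc n) *\<^sub>R 1 + (real (Suc (Suc n)) * t ^ Suc n) *\<^sub>R (s * s) + u * u"
    unfolding u v pp qq rr of_nat_Suc[of "Suc n"] by (simp add: algebra_simps del: of_nat_Suc)
  finally show ?case using u by blast
qed

text \<open>If \<open>x\<^sup>* x = - s\<^sup>2\<close>, then \<open>x x\<^sup>*\<close> is a sum of squares, so that \<open>\<parallel>(t - x x\<^sup>*)\<^sup>n\<parallel> \<le> t\<^sup>n\<close>; but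
\<open>(t - x\<^sup>* x)\<^sup>n = (t + s\<^sup>2)\<^sup>n\<close> exceeds \<open>n t\<^sup>n\<^sup>-\<^sup>1 s\<^sup>2\<close>, and the two powers are intertwined by \<open>x\<close>.\<close>

lemma star_mult_self_neg_square:
  fixes x s :: "'a::cstar_algebra"
  assumes s: "star s = s" and x: "star x * x = - (s * s)"
  shows "s = 0"
proof -
  define a where "a = x * star x"
  define t where "t = norm a"
  show ?thesis
  proof (cases "t = 0")
    case True
    then have "x = 0" using star_mult_self_eq_0_iff[of "star x"] by (simp add: t_def a_def)
    then have "s * s = 0" using x by simp
    then show ?thesis by (rule square_eq_0_self_adjoint[OF s])
  next
    case False
    then have t: "0 < t" by (simp add: t_def)
    \<comment> \<open>The factor makes p^2 + q^2 equal to \<open>star x * x + x * star x\<close>;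
      with the hypothesis this exhibits \<open>a\<close> as a sum of three squares.\<close>
    define p where "p = sqrt (1/2) *\<^sub>R (x + star x)"
    define q where "q = sqrt (1/2) *\<^sub>R (\<i> *\<^sub>C (x - star x))"
    have sa: "star p = p" "star q = q"
      by (simp_all add: p_def q_def star_scaleR star_add star_scaleC star_diff scaleC_minus_left scaleC_diff_right)
    have "p * p + q * q = star x * x + x * star x"
    proof -
      have ww: "(\<i> *\<^sub>C w) * (\<i> *\<^sub>C w) = - (w * w)" for w :: 'a
        by (simp add: mult_scaleC_left mult_scaleC_right scaleC_scaleC scaleC_minus_left)
      have "p * p + q * q = (1/2) *\<^sub>R ((x + star x) * (x + star x) - (x - star x) * (x - star x))"
        unfolding p_def q_def by (simp add: ww scaleR_diff_right)
      also have "(x + star x) * (x + star x) - (x - star x) * (x - star x) = 2 *\<^sub>R (star x * x + x * star x)"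
        by (simp add: algebra_simps scaleR_2)
      finally show ?thesis by simp
    qed
    then have a: "a = p * p + q * q + s * s" using x by (simp add: a_def)
    obtain v where v: "star v = v" "v * v = p * p + q * q" using sqrt_sum_squares[OF sa] by blast
    obtain u where u: "star u = u" "u * u = a" using sqrt_sum_squares[OF v(1) s] v(2) a by metis
    have na: "norm (t *\<^sub>R 1 - a) \<le> t" using norm_diff_square_le[OF u(1), of t] u(2) by (simp add: t_def)
    define r where "r = t *\<^sub>R 1 + s * s"
    have r: "r = t *\<^sub>R 1 - star x * x" by (simp add: r_def x)
    have xr: "x * r ^ n = (t *\<^sub>R 1 - a) ^ n * x" for n
    proof (induction n)
      case (Suc n)
      have "x * r = (t *\<^sub>R 1 - a) * x" by (simp add: r a_def algebra_simps)
      then have "x * r ^ Suc n = (t *\<^sub>R 1 - a) * (x * r ^ n)" by (simp add: mult.assoc[symmetric])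
      then show ?case using Suc by (simp add: mult.assoc)
    qed simp
    \<comment> \<open>Multiplying the power of r by s^2 on both sides keeps every term of the
      expansion a square. Since s^2 = \<open>- (star x * x)\<close>, the outer factors bring in x,
      and \<open>xr\<close> moves the power over to t - a, whose norm is at most t.\<close>
    have bound: "real (Suc n) * norm (s * s * s * (s * s * s)) \<le> norm x ^ 4 * t" for n
    proof -
      obtain w where w: "star w = w" "s * w = w * s"
        "r ^ Suc n = t ^ Suc n *\<^sub>R 1 + (real (Suc n) * t ^ n) *\<^sub>R (s * s) + w * w"
        using power_scalar_plus_square[OF s, of t n] t unfolding r_def by auto
      define P where "P = sqrt (real (Suc n) * t ^ n) *\<^sub>R (s * s * s)"
      define Q where "Q = sqrt (t ^ Suc n) *\<^sub>R (s * s)"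
      define R where "R = s * s * w"
      have sw: "w * s = s * w" "w * (s * y) = s * (w * y)" for y using w(2) by (simp_all flip: mult.assoc)
      have sa: "star P = P" "star Q = Q" "star R = R"
        by (simp_all add: P_def Q_def R_def star_scaleR star_mult s w(1) mult.assoc sw)
      have c: "P * Q = Q * P" "P * R = R * P"
        by (simp_all add: P_def Q_def R_def mult.assoc sw)
      have sq: "sqrt a *\<^sub>R y * sqrt a *\<^sub>R y = a *\<^sub>R (y * y)" if "0 \<le> a" for a and y :: 'a
        using that by simp
      have PP: "P * P = (real (Suc n) * t ^ n) *\<^sub>R (s * s * s * (s * s * s))"
        and QQ: "Q * Q = t ^ Suc n *\<^sub>R (s * s * (s * s))"
        unfolding P_def Q_def using t by (simp_all only: sq mult_nonneg_nonneg of_nat_0_le_iff zero_le_power less_imp_le)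
      have nPP: "norm (P * P) = (real (Suc n) * t ^ n) * norm (s * s * s * (s * s * s))"
        unfolding PP norm_scaleR using t by (simp del: of_nat_Suc)
      have RR: "R * R = s * s * (w * w) * (s * s)" unfolding R_def by (simp add: mult.assoc sw)
      obtain V where V: "star V = V" "V * V = Q * Q + R * R" "P * V = V * P"
        using sqrt_sum_squares[OF sa(2,3)] c by blast
      have "s * s * r ^ Suc n * (s * s) = P * P + V * V"
        unfolding V PP QQ RR w(3) by (simp add: algebra_simps)
      then have "norm (P * P) \<le> norm (s * s * r ^ Suc n * (s * s))"
        using norm_square_le_sum_squares[OF sa(1) V(1,3)] by simp
      also have "s * s * r ^ Suc n * (s * s) = star x * (x * r ^ Suc n) * (star x * x)"
        using x by (simp add: mult.assoc[symmetric] minus_equation_iff[of "s * s"])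
      also have "norm \<dots> \<le> (norm x * (t ^ Suc n * norm x)) * (norm x * norm x)"
      proof -
        have "norm ((t *\<^sub>R 1 - a) ^ Suc n) \<le> t ^ Suc n"
          by (rule order_trans[OF norm_power_Suc_le power_mono[OF na]]) auto
        then show ?thesis unfolding xr
          using t by (intro order_trans[OF norm_mult_ineq] mult_mono mult_nonneg_nonneg) auto
      qed
      finally have "(real (Suc n) * t ^ n) * norm (s * s * s * (s * s * s)) \<le> t ^ n * (norm x ^ 4 * t)"
        unfolding nPP by (simp add: power4_eq_xxxx algebra_simps del: of_nat_Suc)
      then have "t ^ n * (real (Suc n) * norm (s * s * s * (s * s * s))) \<le> t ^ n * (norm x ^ 4 * t)"
        by (simp add: algebra_simps del: of_nat_Suc)
      then show ?thesis using t by (simp only: mult_le_cancel_left_pos zero_less_power)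
    qed
    have "norm (s * s * s * (s * s * s)) = 0"
    proof (rule ccontr)
      assume "norm (s * s * s * (s * s * s)) \<noteq> 0"
      then have "0 < norm (s * s * s * (s * s * s))" by simp
      then obtain n :: nat where "norm x ^ 4 * t < real n * norm (s * s * s * (s * s * s))"
        using reals_Archimedean3 by blast
      moreover have "real n * norm (s * s * s * (s * s * s)) \<le> real (Suc n) * norm (s * s * s * (s * s * s))"
        by (intro mult_right_mono) auto
      ultimately show False using bound[of n] by linarith
    qed
    then have "s * s * s * (s * s * s) = 0" by simp
    then have "s * s * s = 0" by (rule square_eq_0_self_adjoint[rotated]) (simp add: star_mult s mult.assoc)
    then have "(s * s) * (s * s) = 0" by (simp add: mult.assoc[symmetric])
    then have "s * s = 0" by (rule square_eq_0_self_adjoint[rotated]) (simp add: star_mult s)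
    then show ?thesis by (rule square_eq_0_self_adjoint[OF s])
  qed
qed

text \<open>With b = \<open>star x * x\<close> and m the root of b^2, the element d = m - b is twice
  the negative part of b. For the root r of m one finds \<open>star (x * d) * (x * d)\<close> = d b
  d = -(r d)^2, so the preceding lemma kills r d and thereby d. Hence b = m = r^2.\<close>

theorem star_mult_self_is_square:
  fixes x :: "'a::cstar_algebra"
  shows "\<exists>y. star y = y \<and> star x * x = y * y"
proof -
  define b where "b = star x * x"
  have sb: "star b = b" by (simp add: b_def star_mult)
  obtain m where m: "star m = m" "m * m = b * b" "norm (sqrt (norm (b * b)) *\<^sub>R 1 - m) \<le> sqrt (norm (b * b))"
    and mc: "\<And>c. c * (b * b) = (b * b) * c \<Longrightarrow> c * m = m * c"
  proof -
    have "star (b * b) = b * b" by (simp add: star_mult sb)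
    from sqrt_near_scalar[OF this norm_diff_square_le[OF sb order_refl]] show ?thesis using that by blast
  qed
  obtain r where r: "star r = r" "r * r = m" and rc: "\<And>c. c * m = m * c \<Longrightarrow> c * r = r * c"
    using sqrt_near_scalar[OF m(1,3)] by blast
  have bm: "b * m = m * b" by (rule mc) (simp add: mult.assoc)
  define d where "d = m - b"
  have sd: "star d = d" by (simp add: d_def star_diff m sb)
  have dr: "d * r = r * d" by (rule rc) (simp add: d_def algebra_simps bm)
  have dd: "d * d = 2 *\<^sub>R (m * d)" by (simp add: d_def algebra_simps bm m(2) scaleR_2)
  have bd: "b * d = - (m * d)" by (simp add: d_def algebra_simps bm m(2))
  have mdd: "r * d * (r * d) = d * (m * d)"
    unfolding r(2)[symmetric] by (metis dr mult.assoc)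
  have "star (x * d) * (x * d) = d * (b * d)" by (simp add: star_mult sd b_def mult.assoc)
  also have "\<dots> = - (r * d * (r * d))" unfolding bd mdd by simp
  finally have "r * d = 0" by (rule star_mult_self_neg_square[rotated]) (simp add: star_mult sd r dr)
  then have "m * d = 0" unfolding r(2)[symmetric] mult.assoc by simp
  then have "d = 0" using dd by (intro square_eq_0_self_adjoint[OF sd]) simp
  then show ?thesis using r unfolding b_def[symmetric] d_def by (intro exI[of _ r]) simp
qed

text \<open>This equality splits a norming functional: if a functional of norm at most 1 attains the
  norm at \<open>1 + y * y\<close>, it attains it at 1 and at \<open>y * y\<close> separately. With
  N the norm of the sum, the lower bound comes from writing (N - 1) 1 as y^2 + w^2.\<close>

lemma norm_one_plus_square:
  fixes y :: "'a::cstar_algebra"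
  assumes ne: "(1 :: 'a) \<noteq> 0" and sa: "star y = y"
  shows "norm (1 + y * y) = 1 + norm (y * y)"
proof -
  have n1: "norm (1 :: 'a) = 1" using cstar_identity[of "1 :: 'a"] ne by (simp add: power2_eq_square)
  define N where "N = norm (1 + y * y)"
  have N1: "1 \<le> N" unfolding N_def using norm_square_le_sum_squares[of 1 y] sa n1 by (simp add: add.commute)
  have "norm (N *\<^sub>R 1 - (N *\<^sub>R 1 - (1 + y * y))) \<le> N" by (simp add: N_def add.commute)
  moreover have "star (N *\<^sub>R 1 - (1 + y * y)) = N *\<^sub>R 1 - (1 + y * y)"
    by (simp add: star_diff star_add star_scaleR star_mult sa)
  ultimately obtain w where w: "star w = w" "w * w = N *\<^sub>R 1 - (1 + y * y)"
    "\<And>c. c * (N *\<^sub>R 1 - (1 + y * y)) = (N *\<^sub>R 1 - (1 + y * y)) * c \<Longrightarrow> c * w = w * c"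
    using sqrt_near_scalar by blast
  have "y * (N *\<^sub>R 1 - (1 + y * y)) = (N *\<^sub>R 1 - (1 + y * y)) * y" by (simp add: algebra_simps)
  then have "y * w = w * y" by (rule w(3))
  then have "norm (y * y) \<le> norm (y * y + w * w)" by (intro norm_square_le_sum_squares sa w(1))
  also have "y * y + w * w = (N - 1) *\<^sub>R 1" by (simp add: w algebra_simps)
  finally have "1 + norm (y * y) \<le> N" using N1 n1 by simp
  moreover have "N \<le> 1 + norm (y * y)" unfolding N_def using norm_triangle_ineq[of 1 "y * y"] n1 by simp
  ultimately show ?thesis by (simp add: N_def)
qed

text \<open>The functional norming \<open>1 + y * y\<close>, where \<open>star x * x\<close> = y^2,
  has the value 1 at the unit. This and the norm bound force positivity, because t - w^2 has norm at
  most t for t the norm of w^2.\<close>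

theorem norming_state:
  fixes x :: "'a::cstar_algebra"
  assumes ne: "(1 :: 'a) \<noteq> 0"
  obtains \<phi> where "state \<phi>" "\<phi> (star x * x) = complex_of_real ((norm x)\<^sup>2)"
proof -
  have n1: "norm (1 :: 'a) = 1" using cstar_identity[of "1 :: 'a"] ne by (simp add: power2_eq_square)
  obtain y where y: "star y = y" "star x * x = y * y" using star_mult_self_is_square[of x] by blast
  obtain f where f: "linear f" "\<And>z. f z \<le> norm z" "f (1 + y * y) = norm (1 + y * y)"
    using Hahn_Banach_norm[of "1 + y * y"] by blast
  have f_abs: "\<bar>f z\<bar> \<le> norm z" for z
    using f(2)[of z] f(2)[of "- z"] linear_neg[OF f(1), of z] by simp
  have "f 1 + f (y * y) = 1 + norm (y * y)"
    using f(3) linear_add[OF f(1)] norm_one_plus_square[OF ne y(1)] by simp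
  moreover have "f 1 \<le> 1" "f (y * y) \<le> norm (y * y)" using f(2)[of 1] f(2)[of "y * y"] n1 by auto
  ultimately have f1: "f 1 = 1" and fy: "f (y * y) = norm (y * y)" by auto
  have fpos: "0 \<le> f (w * w)" if "star w = w" for w
    using f(2)[of "norm (w * w) *\<^sub>R 1 - w * w"] norm_diff_square_le[OF that order_refl]
      linear_diff[OF f(1)] linear_cmul[OF f(1)] f1 by simp
  \<comment> \<open>The real functional is made to vanish on skew-adjoint elements, so that the
    imaginary part of the complexification \<phi> vanishes on \<open>star z * z\<close>.\<close>
  define g where "g z = f ((1/2) *\<^sub>R (z + star z))" for z
  have g_add: "g (a + b) = g a + g b" for a b
    unfolding g_def star_add linear_add[OF f(1), symmetric] by (simp add: algebra_simps)
  have g_scale: "g (r *\<^sub>R a) = r * g a" for r a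
  proof -
    have "(1/2) *\<^sub>R (r *\<^sub>R a + star (r *\<^sub>R a)) = r *\<^sub>R ((1/2) *\<^sub>R (a + star a))"
      by (simp add: star_scaleR scaleR_add_right)
    then show ?thesis unfolding g_def by (simp only: linear_cmul[OF f(1)] real_scaleR_def)
  qed
  have g_le: "\<bar>g z\<bar> \<le> norm z" for z
    unfolding g_def using norm_triangle_ineq[of z "star z"] by (intro order_trans[OF f_abs]) simp
  have g_sa: "g z = f z" if "star z = z" for z
    unfolding g_def that scaleR_half_double ..
  have g_skew: "g (\<i> *\<^sub>C z) = 0" if "star z = z" for z
    unfolding g_def using linear_0[OF f(1)] by (simp add: star_scaleC that scaleC_minus_left)
  define \<phi> where "\<phi> z = Complex (g z) (- g (\<i> *\<^sub>C z))" for z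
  have c_decomp: "c *\<^sub>C z = Re c *\<^sub>R z + Im c *\<^sub>R (\<i> *\<^sub>C z)" for c and z :: 'a
    by (simp add: scaleR_scaleC scaleC_scaleC mult.commute complex_eq[of c, symmetric] flip: scaleC_add_left)
  have ii: "\<i> *\<^sub>C \<i> *\<^sub>C z = - z" for z :: 'a by (simp add: scaleC_scaleC scaleC_minus_left)
  have isc: "\<i> *\<^sub>C (r *\<^sub>R a) = r *\<^sub>R (\<i> *\<^sub>C a)" for r and a :: 'a
    by (simp add: scaleR_scaleC scaleC_scaleC mult.commute)
  have g_minus: "g (- z) = - g z" for z using g_scale[of "-1" z] by simp
  have "\<phi> (c *\<^sub>C z) = c * \<phi> z" for c z
    by (simp only: c_decomp[of c z] \<phi>_def scaleC_add_right isc ii g_add g_scale g_minus)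
      (simp add: complex_eq_iff)
  moreover have "bounded_linear \<phi>"
  proof (rule bounded_linear_intro[where K = 2])
    show "\<phi> (a + b) = \<phi> a + \<phi> b" for a b by (simp add: \<phi>_def scaleC_add_right g_add complex_eq_iff)
    show "\<phi> (r *\<^sub>R a) = r *\<^sub>R \<phi> a" for r a
      by (simp add: \<phi>_def g_scale complex_eq_iff isc)
    show "norm (\<phi> a) \<le> norm a * 2" for a
      using cmod_le[of "\<phi> a"] g_le[of a] g_le[of "\<i> *\<^sub>C a"] by (simp add: \<phi>_def norm_scaleC)
  qed
  moreover have pos: "\<phi> (star z * z) = complex_of_real (g (star z * z))" for z
    using g_skew[of "star z * z"] by (simp add: \<phi>_def star_mult complex_eq_iff)
  moreover have "0 \<le> g (star z * z)" for z
  proof -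
    obtain w where "star w = w" "star z * z = w * w" using star_mult_self_is_square[of z] by blast
    then show ?thesis using fpos[of w] g_sa[of "w * w"] by (simp add: star_mult)
  qed
  moreover have "\<phi> 1 = 1" using pos[of 1] g_sa[of 1] f1 by simp
  ultimately have "state \<phi>" by (simp add: state_def)
  moreover have "\<phi> (star x * x) = complex_of_real ((norm x)\<^sup>2)"
    unfolding pos using g_sa[of "y * y"] fy y by (simp add: star_mult cstar_identity[of x, symmetric])
  ultimately show ?thesis using that by blast
qed

section \<open>The Cauchy-Schwarz inequality and the seminorm of a state\<close>

lemma cauchy_schwarz_form:
  fixes p q :: real and r :: complex
  assumes "0 \<le> p" "0 \<le> q" "\<And>c. 0 \<le> p + 2 * Re (c * r) + (cmod c)\<^sup>2 * q"
  shows "cmod r \<le> sqrt p * sqrt q"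
  using quad_disc[OF assms] by (metis real_le_rsqrt real_sqrt_mult)

lemma state_zero: "state \<phi> \<Longrightarrow> \<phi> 0 = 0"
  and state_diff: "state \<phi> \<Longrightarrow> \<phi> (x - y) = \<phi> x - \<phi> y"
  and state_one: "state \<phi> \<Longrightarrow> \<phi> 1 = 1"
  by (auto simp: state_def linear_0 linear_neg linear_diff bounded_linear.linear)

lemma state_bounded_linear: "state \<phi> \<Longrightarrow> bounded_linear \<phi>"
  by (simp add: state_def)

lemma state_star_mult_real: "state \<phi> \<Longrightarrow> \<phi> (star x * x) = complex_of_real (Re (\<phi> (star x * x)))"
  using state_pos(2) by (simp add: complex_eq_iff)

definition seminorm2 :: "('a::cstar_algebra \<Rightarrow> complex) \<Rightarrow> 'a \<Rightarrow> real" where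
  "seminorm2 \<phi> x = sqrt (Re (\<phi> (star x * x)))"

lemma seminorm2_nonneg [simp]: "state \<phi> \<Longrightarrow> 0 \<le> seminorm2 \<phi> x"
  by (simp add: seminorm2_def state_pos)

lemma seminorm2_sq: "state \<phi> \<Longrightarrow> (seminorm2 \<phi> x)\<^sup>2 = Re (\<phi> (star x * x))"
  by (simp add: seminorm2_def state_pos)

lemma state_star_mult_eq: "state \<phi> \<Longrightarrow> \<phi> (star x * x) = complex_of_real ((seminorm2 \<phi> x)\<^sup>2)"
  by (subst state_star_mult_real) (simp_all add: seminorm2_sq)

lemma state_cauchy_schwarz:
  assumes st: "state \<phi>"
  shows "cmod (\<phi> (star x * y)) \<le> seminorm2 \<phi> x * seminorm2 \<phi> y"
  unfolding seminorm2_def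
proof (rule cauchy_schwarz_form)
  fix c
  have "star (x + c *\<^sub>C y) * (x + c *\<^sub>C y) =
      star x * x + (c *\<^sub>C (star x * y) + cnj c *\<^sub>C (star y * x)) + (cnj c * c) *\<^sub>C (star y * y)"
    by (simp add: star_add star_scaleC distrib_left distrib_right mult_scaleC_left mult_scaleC_right scaleC_scaleC scaleC_add_right add.assoc mult.commute)
  then have "\<phi> (star (x + c *\<^sub>C y) * (x + c *\<^sub>C y)) =
      \<phi> (star x * x) + (c * \<phi> (star x * y) + cnj c * \<phi> (star y * x)) + (cnj c * c) * \<phi> (star y * y)"
    by (simp add: state_add[OF st] state_scale[OF st])
  also have "\<phi> (star y * x) = cnj (\<phi> (star x * y))"
    using state_star[OF st, of "star x * y"] by (simp add: star_mult)
  also have "cnj c * c = complex_of_real ((cmod c)\<^sup>2)"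
    using complex_norm_square[of c] by (simp add: mult.commute)
  finally have "Re (\<phi> (star (x + c *\<^sub>C y) * (x + c *\<^sub>C y))) =
      Re (\<phi> (star x * x)) + 2 * Re (c * \<phi> (star x * y)) + (cmod c)\<^sup>2 * Re (\<phi> (star y * y))"
    by simp
  then show "0 \<le> Re (\<phi> (star x * x)) + 2 * Re (c * \<phi> (star x * y)) + (cmod c)\<^sup>2 * Re (\<phi> (star y * y))"
    using state_pos(1)[OF st, of "x + c *\<^sub>C y"] by simp
qed (auto simp: state_pos st)

lemma seminorm2_one: "state \<phi> \<Longrightarrow> seminorm2 \<phi> 1 = 1"
  by (simp add: seminorm2_def state_one)

lemma seminorm2_le_norm:
  assumes st: "state \<phi>" shows "seminorm2 \<phi> x \<le> norm x"
proof -
  have "Re (\<phi> (star x * x)) \<le> (norm x)\<^sup>2 * 1"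
  proof (rule positive_functional_bound)
    fix y :: 'a assume y: "star y = y"
    have "(Re (\<phi> y))\<^sup>2 \<le> (cmod (\<phi> y))\<^sup>2" by (simp add: cmod_power2)
    also have "\<dots> \<le> (seminorm2 \<phi> y)\<^sup>2"
      using state_cauchy_schwarz[OF st, of 1 y] seminorm2_one[OF st] by (intro power_mono) auto
    also have "\<dots> = Re (\<phi> (y * y))" using seminorm2_sq[OF st, of y] y by simp
    finally show "(Re (\<phi> y))\<^sup>2 \<le> 1 * Re (\<phi> (y * y))" by simp
  qed (auto simp: state_pos st state_bounded_linear)
  then show ?thesis unfolding seminorm2_def by (metis mult.right_neutral norm_ge_zero real_le_lsqrt real_sqrt_le_iff real_sqrt_unique)
qed

lemma state_norm_le:
  assumes st: "state \<phi>" shows "cmod (\<phi> x) \<le> norm x"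
  using state_cauchy_schwarz[OF st, of 1 x] seminorm2_one[OF st] seminorm2_le_norm[OF st, of x] by simp

lemma states_separate:
  fixes x :: "'a::cstar_algebra"
  assumes "\<And>\<phi>. state \<phi> \<Longrightarrow> \<phi> (star x * x) = 0"
  shows "x = 0"
\<comment> \<open>The zero algebra has no states, so it is treated apart wherever a norming state is
  chosen.\<close>
proof (cases "(1 :: 'a) = 0")
  case True
  then show ?thesis by (metis mult_1 mult_zero_left)
next
  case False
  then show ?thesis using norming_state[OF False, of x] assms by (metis norm_eq_zero of_real_eq_0_iff zero_eq_power2)
qed

lemma state_nonneg_eq_0:
  assumes "state \<phi>" "\<phi> (star x * x) = 0"
  shows "\<phi> (star x * y) = 0" "\<phi> (star y * x) = 0" "\<phi> x = 0"
  using state_cauchy_schwarz[OF assms(1), of x y] state_cauchy_schwarz[OF assms(1), of y x]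
    state_cauchy_schwarz[OF assms(1), of 1 x] assms(2)
  by (auto simp: seminorm2_def)

section \<open>Bounded maps on the minimal tensor product\<close>

text \<open>The partial map is given by its graph, so it need not be known in advance to be well
  defined: applied to differences, the bound makes the values on the graph and the limits along
  convergent sequences unique.\<close>

lemma graph_extension:
  fixes G :: "('a::cstar_algebra \<times> 'b::cstar_algebra) set"
  assumes dense: "closure (fst ` G) = UNIV"
    and add: "\<And>x y x' y'. (x, y) \<in> G \<Longrightarrow> (x', y') \<in> G \<Longrightarrow> (x + x', y + y') \<in> G"
    and scale: "\<And>c x y. (x, y) \<in> G \<Longrightarrow> (c *\<^sub>C x, c *\<^sub>C y) \<in> G"
    and bound: "\<And>x y. (x, y) \<in> G \<Longrightarrow> norm y \<le> K * norm x"
  obtains F where "bounded_clinear F" "\<And>x y. (x, y) \<in> G \<Longrightarrow> F x = y" "\<And>x. norm (F x) \<le> K * norm x"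
proof -
  define R where "R x y \<longleftrightarrow> (\<exists>s t. (\<forall>n. (s n, t n) \<in> G) \<and> s \<longlonglongrightarrow> x \<and> t \<longlonglongrightarrow> y)" for x y
  have diff: "(x - x', y - y') \<in> G" if "(x, y) \<in> G" "(x', y') \<in> G" for x y x' y'
    using add[OF that(1) scale[OF that(2), of "-1"]] by (simp add: scaleC_minus_left)
  have R_bound: "norm y \<le> K * norm x" if R: "R x y" for x y
  proof -
    obtain s t where st: "\<And>n. (s n, t n) \<in> G" "s \<longlonglongrightarrow> x" "t \<longlonglongrightarrow> y" using R unfolding R_def by blast
    show ?thesis
      by (rule LIMSEQ_le[OF tendsto_norm[OF st(3)] tendsto_mult[OF tendsto_const tendsto_norm[OF st(2)]]])
        (use bound[OF st(1)] in auto)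
  qed
  have R_add: "R (x + x') (y + y')" if R: "R x y" "R x' y'" for x y x' y'
  proof -
    obtain s t where st: "\<And>n. (s n, t n) \<in> G" "s \<longlonglongrightarrow> x" "t \<longlonglongrightarrow> y" using R(1) unfolding R_def by blast
    obtain s' t' where st': "\<And>n. (s' n, t' n) \<in> G" "s' \<longlonglongrightarrow> x'" "t' \<longlonglongrightarrow> y'" using R(2) unfolding R_def by blast
    show ?thesis unfolding R_def
      by (intro exI[of _ "\<lambda>n. s n + s' n"] exI[of _ "\<lambda>n. t n + t' n"] conjI allI add tendsto_add st st')
  qed
  have R_scale: "R (c *\<^sub>C x) (c *\<^sub>C y)" if R: "R x y" for c x y
  proof -
    obtain s t where st: "\<And>n. (s n, t n) \<in> G" "s \<longlonglongrightarrow> x" "t \<longlonglongrightarrow> y" using R unfolding R_def by blast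
    show ?thesis unfolding R_def
      by (intro exI[of _ "\<lambda>n. c *\<^sub>C s n"] exI[of _ "\<lambda>n. c *\<^sub>C t n"] conjI allI scale
          bounded_linear.tendsto[OF bounded_linear_scaleC] st)
  qed
  have R_ex: "\<exists>y. R x y" for x
  proof -
    have "x \<in> closure (fst ` G)" using dense by simp
    then obtain s where s: "\<And>n. s n \<in> fst ` G" "s \<longlonglongrightarrow> x" unfolding closure_sequential by blast
    have "\<exists>y. (s n, y) \<in> G" for n using s(1)[of n] by auto
    then obtain t where t: "\<And>n. (s n, t n) \<in> G" by metis
    have "Cauchy t"
    proof (rule CauchyI)
      fix e :: real assume e: "0 < e"
      have pos: "0 < e / (\<bar>K\<bar> + 1)" using e by (simp add: pos_divide_less_eq)
      obtain M where M: "\<And>m n. m \<ge> M \<Longrightarrow> n \<ge> M \<Longrightarrow> norm (s m - s n) < e / (\<bar>K\<bar> + 1)"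
        using CauchyD[OF LIMSEQ_imp_Cauchy[OF s(2)] pos] by blast
      have "norm (t m - t n) < e" if "m \<ge> M" "n \<ge> M" for m n
      proof -
        have "norm (t m - t n) \<le> K * norm (s m - s n)" by (intro bound diff t)
        also have "\<dots> \<le> (\<bar>K\<bar> + 1) * norm (s m - s n)" by (intro mult_right_mono) auto
        also have "\<dots> < (\<bar>K\<bar> + 1) * (e / (\<bar>K\<bar> + 1))" by (intro mult_strict_left_mono M that) auto
        also have "\<dots> = e" by (simp add: add_nonneg_eq_0_iff)
        finally show ?thesis .
      qed
      then show "\<exists>M. \<forall>m\<ge>M. \<forall>n\<ge>M. norm (t m - t n) < e" by blast
    qed
    then obtain y where "t \<longlonglongrightarrow> y" by (auto simp: Cauchy_convergent_iff convergent_def)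
    then show ?thesis unfolding R_def using s t by blast
  qed
  have R_unique: "y = y'" if "R x y" "R x y'" for x y y'
    using R_bound[OF R_add[OF that(1) R_scale[OF that(2), of "-1"]]] by (simp add: scaleC_minus_left)
  define F where "F x = (THE y. R x y)" for x
  have F: "R x (F x)" for x
    unfolding F_def by (rule theI') (use R_ex R_unique in blast)
  have "bounded_linear F"
  proof (rule bounded_linear_intro[where K = K])
    show "F (x + y) = F x + F y" for x y by (rule R_unique[OF F R_add[OF F F]])
    show "F (r *\<^sub>R x) = r *\<^sub>R F x" for r x unfolding scaleR_scaleC by (rule R_unique[OF F R_scale[OF F]])
    show "norm (F x) \<le> norm x * K" for x using R_bound[OF F, of x] by (simp add: mult.commute)
  qed
  moreover have "F (c *\<^sub>C x) = c *\<^sub>C F x" for c x by (rule R_unique[OF F R_scale[OF F]])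
  moreover have "F x = y" if "(x, y) \<in> G" for x y
    by (rule R_unique[OF F]) (use that in \<open>auto simp: R_def intro!: exI[of _ "\<lambda>_. x"] exI[of _ "\<lambda>_. y"]\<close>)
  ultimately show ?thesis using that[of F] R_bound[OF F] by (auto simp: bounded_clinear_def)
qed

section \<open>Tensor sums, slice maps and product states\<close>

lemma tensor_sum_scale: "(\<Sum>(a, b)\<leftarrow>fs_scale c xs. a \<otimes> b) = c *\<^sub>C (\<Sum>(a, b)\<leftarrow>xs. a \<otimes> b)"
  by (induction xs) (auto simp: fs_scale_def tensor_scaleC_left scaleC_add_right)

lemma tensor_sum_star: "(\<Sum>(a, b)\<leftarrow>fs_star xs. a \<otimes> b) = star (\<Sum>(a, b)\<leftarrow>xs. a \<otimes> b)"
  by (induction xs) (auto simp: fs_star_def tensor_star star_add)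

lemma tensor_sum_mult:
  "(\<Sum>(a, b)\<leftarrow>fs_mult xs ys. a \<otimes> b) = (\<Sum>(a, b)\<leftarrow>xs. a \<otimes> b) * (\<Sum>(a, b)\<leftarrow>ys. a \<otimes> b)"
proof (induction xs)
  case (Cons x xs)
  have "(\<Sum>(a, b)\<leftarrow>map (\<lambda>(c, d). (fst x * c, snd x * d)) ys. a \<otimes> b) = (fst x \<otimes> snd x) * (\<Sum>(a, b)\<leftarrow>ys. a \<otimes> b)"
    by (induction ys) (auto simp: tensor_mult distrib_left)
  then show ?case using Cons by (simp add: fs_mult_Cons distrib_right case_prod_unfold)
qed simp

lemma closure_eq_UNIV_I:
  fixes S :: "'a::metric_space set"
  assumes "\<And>x. \<exists>s. (\<forall>n. s n \<in> S) \<and> s \<longlonglongrightarrow> x"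
  shows "closure S = UNIV"
  unfolding set_eq_iff closure_sequential using assms by blast

text \<open>The bound over all formal sums carries the well-definedness, including additivity of
  \<open>T\<close> in each variable: two representatives of one tensor differ by a formal sum of
  norm zero.\<close>

lemma tensor_map_extension:
  fixes T :: "'a::cstar_algebra \<Rightarrow> 'b::cstar_algebra \<Rightarrow> 'c::cstar_algebra"
  assumes scale: "\<And>c a b. T (c *\<^sub>C a) b = c *\<^sub>C T a b"
    and bound: "\<And>xs. norm (\<Sum>(a, b)\<leftarrow>xs. T a b) \<le> K * norm (\<Sum>(a, b)\<leftarrow>xs. a \<otimes> b)"
  obtains F where "bounded_clinear F" "\<And>a b. F (a \<otimes> b) = T a b" "\<And>x. norm (F x) \<le> K * norm x"
proof -
  define G where "G = {((\<Sum>(a, b)\<leftarrow>xs. a \<otimes> b), (\<Sum>(a, b)\<leftarrow>xs. T a b)) | xs. True}"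
  have dense: "closure (fst ` G) = UNIV"
  proof (rule closure_eq_UNIV_I)
    fix x :: "'a \<otimes> 'b"
    obtain s where "(\<lambda>n. \<Sum>(a, b)\<leftarrow>s n. a \<otimes> b) \<longlonglongrightarrow> x" using tensor_limit[of x] by (elim exE)
    then show "\<exists>s. (\<forall>n. s n \<in> fst ` G) \<and> s \<longlonglongrightarrow> x"
      by (intro exI[of _ "\<lambda>n. \<Sum>(a, b)\<leftarrow>s n. a \<otimes> b"]) (force simp: G_def)
  qed
  have G_add: "(x + x', y + y') \<in> G" if xy: "(x, y) \<in> G" "(x', y') \<in> G" for x y x' y'
  proof -
    obtain xs ys where "x = (\<Sum>(a, b)\<leftarrow>xs. a \<otimes> b)" "y = (\<Sum>(a, b)\<leftarrow>xs. T a b)"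
      "x' = (\<Sum>(a, b)\<leftarrow>ys. a \<otimes> b)" "y' = (\<Sum>(a, b)\<leftarrow>ys. T a b)" using xy by (auto simp: G_def)
    then show ?thesis unfolding G_def by (intro CollectI exI[of _ "xs @ ys"]) simp
  qed
  have G_scale: "(c *\<^sub>C x, c *\<^sub>C y) \<in> G" if xy: "(x, y) \<in> G" for c x y
  proof -
    obtain xs where xs: "x = (\<Sum>(a, b)\<leftarrow>xs. a \<otimes> b)" "y = (\<Sum>(a, b)\<leftarrow>xs. T a b)" using xy by (auto simp: G_def)
    have "(\<Sum>(a, b)\<leftarrow>fs_scale c xs. T a b) = c *\<^sub>C (\<Sum>(a, b)\<leftarrow>xs. T a b)"
      by (induction xs) (auto simp: fs_scale_def scale scaleC_add_right)
    then show ?thesis unfolding G_def xs by (intro CollectI exI[of _ "fs_scale c xs"]) (simp add: tensor_sum_scale)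
  qed
  have G_bound: "norm y \<le> K * norm x" if "(x, y) \<in> G" for x y using that bound by (auto simp: G_def)
  obtain F where F: "bounded_clinear F" "\<And>x y. (x, y) \<in> G \<Longrightarrow> F x = y" "\<And>x. norm (F x) \<le> K * norm x"
    by (rule graph_extension[of G K]) (use dense G_add G_scale G_bound that in blast)+
  have "F (a \<otimes> b) = T a b" for a b
    by (rule F(2)) (auto simp: G_def intro!: exI[of _ "[(a, b)]"])
  then show ?thesis using that F by blast
qed

lemma bounded_clinear_linear: "bounded_clinear F \<Longrightarrow> bounded_linear F"
  and bounded_clinear_scaleC: "bounded_clinear F \<Longrightarrow> F (c *\<^sub>C x) = c *\<^sub>C F x"
  and bounded_clinear_add: "bounded_clinear F \<Longrightarrow> F (x + y) = F x + F y"
  and bounded_clinear_zero: "bounded_clinear F \<Longrightarrow> F 0 = 0"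
  and bounded_clinear_diff: "bounded_clinear F \<Longrightarrow> F (x - y) = F x - F y"
  and bounded_clinear_sum: "bounded_clinear F \<Longrightarrow> F (\<Sum>i\<in>I. g i) = (\<Sum>i\<in>I. F (g i))"
  by (auto simp: bounded_clinear_def linear_add linear_0 linear_diff linear_sum bounded_linear.linear)

lemma linear_tensor_sum:
  assumes "linear F"
  shows "F (\<Sum>(a, b)\<leftarrow>xs. a \<otimes> b) = (\<Sum>(a, b)\<leftarrow>xs. F (a \<otimes> b))"
  by (induction xs) (auto simp: linear_0[OF assms] linear_add[OF assms])

lemma gns_inner_single_bound:
  fixes xs :: "('a::cstar_algebra \<times> 'b::cstar_algebra) list"
  assumes "state \<phi>" "state \<psi>"
  shows "cmod (gns_inner \<phi> \<psi> z (fs_mult xs y)) \<le> norm (\<Sum>(a, b)\<leftarrow>xs. a \<otimes> b) * (gns_seminorm \<phi> \<psi> z * gns_seminorm \<phi> \<psi> y)"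
  using gns_inner_gns_coeffs_le[OF assms, of z xs y] by (simp add: norm_ctensor_def Rep_tensor_sum)

lemma gns_seminorm_left: "state \<phi> \<Longrightarrow> gns_seminorm \<phi> \<psi> [(1, c)] = seminorm2 \<psi> c"
  and gns_seminorm_right: "state \<psi> \<Longrightarrow> gns_seminorm \<phi> \<psi> [(d, 1)] = seminorm2 \<phi> d"
  by (simp_all add: gns_seminorm_def gns_inner_def fs_star_def fs_mult_Cons prod_fun_def seminorm2_def state_one)

text \<open>Let c be the sliced element and \<psi> a state norming it. Then
  \<open>\<psi> (star c * c)\<close> is the matrix coefficient of the tensor sum between the vectors
  1 \<otimes> c and 1 \<otimes> 1 of the product state, hence at most the tensor norm times
  \<open>seminorm2 \<psi> c\<close>.\<close>

lemma slice_left_norm_bound: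
  fixes xs :: "('a::cstar_algebra \<times> 'b::cstar_algebra) list"
  assumes st: "state \<phi>"
  shows "norm (\<Sum>(a, b)\<leftarrow>xs. \<phi> a *\<^sub>C b) \<le> 1 * norm (\<Sum>(a, b)\<leftarrow>xs. a \<otimes> b)"
proof (cases "(1 :: 'b) = 0")
  case True
  then have "x = 0" for x :: 'b by (metis mult_1 mult_zero_left)
  then show ?thesis by (metis mult_1 norm_ge_zero norm_zero)
next
  case False
  define c where "c = (\<Sum>(a, b)\<leftarrow>xs. \<phi> a *\<^sub>C b)"
  obtain \<psi> where \<psi>: "state \<psi>" "\<psi> (star c * c) = complex_of_real ((norm c)\<^sup>2)" using norming_state[OF False] by blast
  have "gns_inner \<phi> \<psi> [(1, c)] (fs_mult xs [(1, 1)]) = \<psi> (star c * c)"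
    unfolding fs_mult_one_right gns_inner_def c_def[THEN arg_cong[where f = "\<lambda>y. star c * y"]]
    by (induction xs) (auto simp: fs_star_def fs_mult_Cons prod_fun_def state_zero[OF \<psi>(1)] distrib_left
        state_add[OF \<psi>(1)] mult_scaleC_right state_scale[OF \<psi>(1)])
  then have "(norm c)\<^sup>2 \<le> norm (\<Sum>(a, b)\<leftarrow>xs. a \<otimes> b) * (seminorm2 \<psi> c * 1)"
    using gns_inner_single_bound[OF st \<psi>(1), of "[(1, c)]" xs "[(1, 1)]"] \<psi>(2)
    by (simp add: gns_seminorm_left st seminorm2_one \<psi>(1) norm_power)
  also have "\<dots> \<le> norm (\<Sum>(a, b)\<leftarrow>xs. a \<otimes> b) * (norm c * 1)"
    by (intro mult_left_mono mult_right_mono seminorm2_le_norm \<psi>) auto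
  finally have "norm c * norm c \<le> norm (\<Sum>(a, b)\<leftarrow>xs. a \<otimes> b) * norm c" by (simp add: power2_eq_square)
  then show ?thesis unfolding c_def[symmetric] by (cases "norm c = 0") auto
qed

lemma slice_right_norm_bound:
  fixes xs :: "('a::cstar_algebra \<times> 'b::cstar_algebra) list"
  assumes st: "state \<psi>"
  shows "norm (\<Sum>(a, b)\<leftarrow>xs. \<psi> b *\<^sub>C a) \<le> 1 * norm (\<Sum>(a, b)\<leftarrow>xs. a \<otimes> b)"
proof (cases "(1 :: 'a) = 0")
  case True
  then have "x = 0" for x :: 'a by (metis mult_1 mult_zero_left)
  then show ?thesis by (metis mult_1 norm_ge_zero norm_zero)
next
  case False
  define c where "c = (\<Sum>(a, b)\<leftarrow>xs. \<psi> b *\<^sub>C a)"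
  obtain \<phi> where \<phi>: "state \<phi>" "\<phi> (star c * c) = complex_of_real ((norm c)\<^sup>2)" using norming_state[OF False] by blast
  have "gns_inner \<phi> \<psi> [(c, 1)] (fs_mult xs [(1, 1)]) = \<phi> (star c * c)"
    unfolding fs_mult_one_right gns_inner_def c_def[THEN arg_cong[where f = "\<lambda>y. star c * y"]]
    by (induction xs) (auto simp: fs_star_def fs_mult_Cons prod_fun_def state_zero[OF \<phi>(1)] distrib_left
        state_add[OF \<phi>(1)] mult_scaleC_right state_scale[OF \<phi>(1)])
  then have "(norm c)\<^sup>2 \<le> norm (\<Sum>(a, b)\<leftarrow>xs. a \<otimes> b) * (seminorm2 \<phi> c * 1)"
    using gns_inner_single_bound[OF \<phi>(1) st, of "[(c, 1)]" xs "[(1, 1)]"] \<phi>(2)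
    by (simp add: gns_seminorm_right st seminorm2_one \<phi>(1) norm_power)
  also have "\<dots> \<le> norm (\<Sum>(a, b)\<leftarrow>xs. a \<otimes> b) * (norm c * 1)"
    by (intro mult_left_mono mult_right_mono seminorm2_le_norm \<phi>) auto
  finally have "norm c * norm c \<le> norm (\<Sum>(a, b)\<leftarrow>xs. a \<otimes> b) * norm c" by (simp add: power2_eq_square)
  then show ?thesis unfolding c_def[symmetric] by (cases "norm c = 0") auto
qed

lemma slice_left_ex:
  fixes \<phi> :: "'a::cstar_algebra \<Rightarrow> complex"
  assumes st: "state \<phi>"
  shows "bounded_clinear (slice_left \<phi> :: 'a \<otimes> 'b::cstar_algebra \<Rightarrow> 'b) \<and>
    (\<forall>a (b :: 'b). slice_left \<phi> (a \<otimes> b) = \<phi> a *\<^sub>C b) \<and> (\<forall>x :: 'a \<otimes> 'b. norm (slice_left \<phi> x) \<le> norm x)"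
proof -
  obtain F :: "'a \<otimes> 'b \<Rightarrow> 'b" where F: "bounded_clinear F" "\<And>a b. F (a \<otimes> b) = \<phi> a *\<^sub>C b" "\<And>x. norm (F x) \<le> 1 * norm x"
    using tensor_map_extension[of "\<lambda>a (b :: 'b). \<phi> a *\<^sub>C b" 1] slice_left_norm_bound[OF st]
    by (auto simp: state_scale[OF st] scaleC_scaleC)
  then show ?thesis using slice_left_eqI[of F \<phi>] by simp
qed

lemma slice_right_ex:
  fixes \<psi> :: "'b::cstar_algebra \<Rightarrow> complex"
  assumes st: "state \<psi>"
  shows "bounded_clinear (slice_right \<psi> :: 'a::cstar_algebra \<otimes> 'b \<Rightarrow> 'a) \<and>
    (\<forall>(a :: 'a) b. slice_right \<psi> (a \<otimes> b) = \<psi> b *\<^sub>C a) \<and> (\<forall>x :: 'a \<otimes> 'b. norm (slice_right \<psi> x) \<le> norm x)"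
proof -
  obtain F :: "'a \<otimes> 'b \<Rightarrow> 'a" where F: "bounded_clinear F" "\<And>a b. F (a \<otimes> b) = \<psi> b *\<^sub>C a" "\<And>x. norm (F x) \<le> 1 * norm x"
    using tensor_map_extension[of "\<lambda>(a :: 'a) b. \<psi> b *\<^sub>C a" 1] slice_right_norm_bound[OF st]
    by (auto simp: scaleC_scaleC mult.commute)
  then show ?thesis using slice_right_eqI[of F \<psi>] by simp
qed

lemma slice_left_clinear: "state \<phi> \<Longrightarrow> bounded_clinear (slice_left \<phi>)"
  and slice_left_tensor [simp]: "state \<phi> \<Longrightarrow> slice_left \<phi> (a \<otimes> b) = \<phi> a *\<^sub>C b"
  using slice_left_ex by blast+

lemma slice_right_clinear: "state \<psi> \<Longrightarrow> bounded_clinear (slice_right \<psi>)"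
  and slice_right_tensor [simp]: "state \<psi> \<Longrightarrow> slice_right \<psi> (a \<otimes> b) = \<psi> b *\<^sub>C a"
  using slice_right_ex by blast+

lemmas slice_left_linear = slice_left_clinear[THEN bounded_clinear_linear]
  and slice_right_linear = slice_right_clinear[THEN bounded_clinear_linear]
  and slice_left_sum = bounded_clinear_sum[OF slice_left_clinear]
  and slice_right_sum = bounded_clinear_sum[OF slice_right_clinear]
  and slice_left_scaleC = bounded_clinear_scaleC[OF slice_left_clinear]
  and slice_right_scaleC = bounded_clinear_scaleC[OF slice_right_clinear]
  and slice_left_diff = bounded_clinear_diff[OF slice_left_clinear]

definition prod_state :: "('a \<Rightarrow> complex) \<Rightarrow> ('b \<Rightarrow> complex) \<Rightarrow> 'a::cstar_algebra \<otimes> 'b::cstar_algebra \<Rightarrow> complex" where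
  "prod_state \<phi> \<psi> x = \<psi> (slice_left \<phi> x)"

lemma prod_state_tensor [simp]: "state \<phi> \<Longrightarrow> state \<psi> \<Longrightarrow> prod_state \<phi> \<psi> (a \<otimes> b) = \<phi> a * \<psi> b"
  by (simp add: prod_state_def state_scale)

lemma prod_state_bounded_linear: "state \<phi> \<Longrightarrow> state \<psi> \<Longrightarrow> bounded_linear (prod_state \<phi> \<psi>)"
  unfolding prod_state_def by (rule bounded_linear_compose[OF state_bounded_linear slice_left_linear])

lemma prod_state_right: "state \<phi> \<Longrightarrow> state \<psi> \<Longrightarrow> prod_state \<phi> \<psi> x = \<phi> (slice_right \<psi> x)"
  by (rule fun_cong[OF bounded_linear_tensor_eqI])
    (auto intro: prod_state_bounded_linear bounded_linear_compose[OF state_bounded_linear slice_right_linear]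
      simp: state_scale mult.commute)

lemma prod_state_sum_list:
  assumes "state \<phi>" "state \<psi>" shows "prod_state \<phi> \<psi> (\<Sum>(a, b)\<leftarrow>xs. a \<otimes> b) = prod_fun \<phi> \<psi> xs"
  using linear_tensor_sum[OF bounded_linear.linear[OF prod_state_bounded_linear[OF assms]]] assms
  by (simp add: prod_fun_def)

lemma state_prod_state:
  fixes \<phi> :: "'a::cstar_algebra \<Rightarrow> complex" and \<psi> :: "'b::cstar_algebra \<Rightarrow> complex"
  assumes st: "state \<phi>" "state \<psi>"
  shows "state (prod_state \<phi> \<psi>)"
proof -
  have bl: "bounded_linear (prod_state \<phi> \<psi>)" by (rule prod_state_bounded_linear[OF st])
  have "Im (prod_state \<phi> \<psi> (star x * x)) = 0 \<and> 0 \<le> Re (prod_state \<phi> \<psi> (star x * x))" for x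
  proof -
    obtain s where s: "(\<lambda>n. \<Sum>(a, b)\<leftarrow>s n. a \<otimes> b) \<longlonglongrightarrow> x" using tensor_limit[of x] by (elim exE)
    let ?x = "\<lambda>n. \<Sum>(a, b)\<leftarrow>s n. a \<otimes> b"
    have eq: "prod_state \<phi> \<psi> (star (?x n) * ?x n) = gns_inner \<phi> \<psi> (s n) (s n)" for n
      unfolding tensor_sum_star[symmetric] tensor_sum_mult[symmetric] prod_state_sum_list[OF st] gns_inner_def ..
    have "(\<lambda>n. prod_state \<phi> \<psi> (star (?x n) * ?x n)) \<longlonglongrightarrow> prod_state \<phi> \<psi> (star x * x)"
      by (intro bounded_linear.tendsto[OF bl] tendsto_mult bounded_linear.tendsto[OF bounded_linear_star] s)
    then have lim: "(\<lambda>n. gns_inner \<phi> \<psi> (s n) (s n)) \<longlonglongrightarrow> prod_state \<phi> \<psi> (star x * x)" unfolding eq .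
    have im: "Im (gns_inner \<phi> \<psi> (s n) (s n)) = 0" for n
      using arg_cong[OF gns_inner_sym[OF st, of "s n" "s n"], of Im] by simp
    have "Im (prod_state \<phi> \<psi> (star x * x)) = 0"
      using tendsto_Im[OF lim] unfolding im by (simp add: LIMSEQ_const_iff)
    moreover have "0 \<le> Re (prod_state \<phi> \<psi> (star x * x))"
      by (rule LIMSEQ_le_const[OF tendsto_Re[OF lim]]) (use gns_inner_pos[OF st] in blast)
    ultimately show ?thesis by blast
  qed
  moreover have "prod_state \<phi> \<psi> (c *\<^sub>C x) = c * prod_state \<phi> \<psi> x" for c x
    unfolding prod_state_def slice_left_scaleC[OF st(1)] state_scale[OF st(2)] ..
  moreover have "prod_state \<phi> \<psi> 1 = 1" unfolding tensor_one using st by (simp add: state_one)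
  ultimately show ?thesis using bl by (simp add: state_def)
qed

lemma slice_left_mult_right: "state \<phi> \<Longrightarrow> slice_left \<phi> (x * (1 \<otimes> b)) = slice_left \<phi> x * b"
  by (rule fun_cong[OF bounded_linear_tensor_eqI])
    (auto intro!: bounded_linear_compose[OF slice_left_linear] bounded_linear_compose[OF bounded_linear_mult_left]
      bounded_linear_mult_left slice_left_linear simp: tensor_mult mult_scaleC_left)

lemma slice_left_mult_left: "state \<phi> \<Longrightarrow> slice_left \<phi> ((1 \<otimes> b) * x) = b * slice_left \<phi> x"
  by (rule fun_cong[OF bounded_linear_tensor_eqI])
    (auto intro!: bounded_linear_compose[OF slice_left_linear] bounded_linear_compose[OF bounded_linear_mult_right]
      bounded_linear_mult_right slice_left_linear simp: tensor_mult mult_scaleC_right)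

lemma slice_right_mult_right: "state \<psi> \<Longrightarrow> slice_right \<psi> (x * (a \<otimes> 1)) = slice_right \<psi> x * a"
  by (rule fun_cong[OF bounded_linear_tensor_eqI])
    (auto intro!: bounded_linear_compose[OF slice_right_linear] bounded_linear_compose[OF bounded_linear_mult_left]
      bounded_linear_mult_left slice_right_linear simp: tensor_mult mult_scaleC_left)

lemma slice_right_mult_left: "state \<psi> \<Longrightarrow> slice_right \<psi> ((a \<otimes> 1) * x) = a * slice_right \<psi> x"
  by (rule fun_cong[OF bounded_linear_tensor_eqI])
    (auto intro!: bounded_linear_compose[OF slice_right_linear] bounded_linear_compose[OF bounded_linear_mult_right]
      bounded_linear_mult_right slice_right_linear simp: tensor_mult mult_scaleC_right)

lemma slice_left_star: "state \<phi> \<Longrightarrow> slice_left \<phi> (star x) = star (slice_left \<phi> x)"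
  by (rule fun_cong[OF bounded_linear_tensor_eqI])
    (auto intro!: bounded_linear_compose[OF slice_left_linear] bounded_linear_compose[OF bounded_linear_star]
      bounded_linear_star slice_left_linear simp: tensor_star star_scaleC state_star)

lemma slice_right_star: "state \<psi> \<Longrightarrow> slice_right \<psi> (star x) = star (slice_right \<psi> x)"
  by (rule fun_cong[OF bounded_linear_tensor_eqI])
    (auto intro!: bounded_linear_compose[OF slice_right_linear] bounded_linear_compose[OF bounded_linear_star]
      bounded_linear_star slice_right_linear simp: tensor_star star_scaleC state_star)

lemma slice_left_one: "state \<phi> \<Longrightarrow> slice_left \<phi> 1 = 1"
  unfolding tensor_one by (simp_all add: state_one)

text \<open>The states \<open>\<phi>(a\<^sup>* \<cdot> a) / \<phi>(a\<^sup>* a)\<close>, that is, the vector states of the GNS representation.\<close>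

lemma vector_state:
  assumes st: "state \<phi>"
  shows "(\<forall>x. \<phi> (star a * x * a) = 0) \<or>
    (\<exists>\<phi>'. state \<phi>' \<and> (\<forall>x. \<phi> (star a * x * a) = complex_of_real ((seminorm2 \<phi> a)\<^sup>2) * \<phi>' x))"
proof (cases "seminorm2 \<phi> a = 0")
  case True
  then have "\<phi> (star a * a) = 0" using state_star_mult_eq[OF st, of a] by simp
  then have "\<phi> (star a * x * a) = 0" for x
    using state_nonneg_eq_0(2)[OF st, of a "star x * a"] by (simp add: star_mult mult.assoc)
  then show ?thesis by blast
next
  case False
  define r where "r = (seminorm2 \<phi> a)\<^sup>2"
  have r: "0 < r" using False by (simp add: r_def)
  define \<phi>' where "\<phi>' x = \<phi> (star a * x * a) / complex_of_real r" for x
  have bl: "bounded_linear (\<lambda>x. \<phi> (star a * x * a))"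
    by (rule bounded_linear_compose[OF state_bounded_linear[OF st]])
      (intro bounded_linear_compose[OF bounded_linear_mult_left bounded_linear_mult_right])
  have "bounded_linear \<phi>'" unfolding \<phi>'_def by (rule bounded_linear_compose[OF bounded_linear_divide bl])
  moreover have "\<phi>' (c *\<^sub>C x) = c * \<phi>' x" for c x
    by (simp add: \<phi>'_def mult_scaleC_left mult_scaleC_right state_scale[OF st])
  moreover have "Im (\<phi>' (star x * x)) = 0 \<and> 0 \<le> Re (\<phi>' (star x * x))" for x
  proof -
    have "\<phi>' (star x * x) = complex_of_real ((seminorm2 \<phi> (x * a))\<^sup>2 / r)"
      using state_star_mult_eq[OF st, of "x * a"] by (simp add: \<phi>'_def star_mult mult.assoc)
    then show ?thesis using r by simp
  qed
  moreover have "\<phi>' 1 = 1" using state_star_mult_eq[OF st, of a] r by (simp add: \<phi>'_def r_def)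
  ultimately have "state \<phi>'" by (simp add: state_def)
  moreover have "\<phi> (star a * x * a) = complex_of_real r * \<phi>' x" for x using r by (simp add: \<phi>'_def)
  ultimately show ?thesis unfolding r_def by blast
qed

text \<open>Product states are closed, up to scalars, under passing to vector states of elementary
  tensors. This is what makes statements about product states alone strong enough for the minimal
  norm.\<close>

lemma prod_vector_state:
  fixes \<phi> :: "'a::cstar_algebra \<Rightarrow> complex" and \<psi> :: "'b::cstar_algebra \<Rightarrow> complex"
  assumes st: "state \<phi>" "state \<psi>"
  shows "(\<forall>x. prod_state \<phi> \<psi> (star (a \<otimes> b) * x * (a \<otimes> b)) = 0) \<or>
    (\<exists>\<phi>' \<psi>' r. state \<phi>' \<and> state \<psi>' \<and>
      (\<forall>x. prod_state \<phi> \<psi> (star (a \<otimes> b) * x * (a \<otimes> b)) = complex_of_real r * prod_state \<phi>' \<psi>' x))"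
proof -
  have bl: "bounded_linear (\<lambda>x. prod_state \<phi> \<psi> (star (a \<otimes> b) * x * (a \<otimes> b)))"
    by (rule bounded_linear_compose[OF prod_state_bounded_linear[OF st]])
      (intro bounded_linear_compose[OF bounded_linear_mult_left bounded_linear_mult_right])
  have el: "prod_state \<phi> \<psi> (star (a \<otimes> b) * (c \<otimes> d) * (a \<otimes> b)) = \<phi> (star a * c * a) * \<psi> (star b * d * b)" for c d
    using st by (simp add: tensor_star tensor_mult)
  from vector_state[OF st(1), of a] vector_state[OF st(2), of b]
  consider "\<And>c d. prod_state \<phi> \<psi> (star (a \<otimes> b) * (c \<otimes> d) * (a \<otimes> b)) = 0"
    | \<phi>' \<psi>' where "state \<phi>'" "state \<psi>'"
      "\<And>x. \<phi> (star a * x * a) = complex_of_real ((seminorm2 \<phi> a)\<^sup>2) * \<phi>' x"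
      "\<And>x. \<psi> (star b * x * b) = complex_of_real ((seminorm2 \<psi> b)\<^sup>2) * \<psi>' x"
    unfolding el by force
  then show ?thesis
  proof cases
    case 1
    then have "(\<lambda>x. prod_state \<phi> \<psi> (star (a \<otimes> b) * x * (a \<otimes> b))) = (\<lambda>_. 0)"
      by (intro bounded_linear_tensor_eqI bl bounded_linear_zero) auto
    then show ?thesis by meson
  next
    case 2
    define r where "r = (seminorm2 \<phi> a)\<^sup>2 * (seminorm2 \<psi> b)\<^sup>2"
    have "(\<lambda>x. prod_state \<phi> \<psi> (star (a \<otimes> b) * x * (a \<otimes> b))) = (\<lambda>x. complex_of_real r * prod_state \<phi>' \<psi>' x)"
    proof (rule bounded_linear_tensor_eqI[OF bl])
      show "bounded_linear (\<lambda>x. complex_of_real r * prod_state \<phi>' \<psi>' x)"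
        by (rule bounded_linear_const_mult[OF prod_state_bounded_linear[OF 2(1,2)]])
      fix c :: 'a and d :: 'b
      show "prod_state \<phi> \<psi> (star (a \<otimes> b) * (c \<otimes> d) * (a \<otimes> b)) = complex_of_real r * prod_state \<phi>' \<psi>' (c \<otimes> d)"
        unfolding el 2(3,4) by (simp add: 2(1,2) r_def)
    qed
    then show ?thesis using 2(1,2) by meson
  qed
qed

lemma bounded_linear_apply_bcontfun: "bounded_linear (\<lambda>f :: 'i::topological_space \<Rightarrow>\<^sub>C complex. apply_bcontfun f p)"
  by (rule bounded_linear_intro[where K = 1]) (auto intro: norm_bounded)

text \<open>The norm is by construction a supremum of matrix coefficients at finite sums of
  elementary tensors; continuity of \<open>prod_state\<close> expresses these coefficients for every
  \<open>x\<close> of the completion.\<close>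

lemma norm_tensor_leI:
  fixes x :: "'a::cstar_algebra \<otimes> 'b::cstar_algebra"
  assumes B: "0 \<le> B" and le: "\<And>\<phi> \<psi> xs ys. state \<phi> \<Longrightarrow> state \<psi> \<Longrightarrow>
     cmod (prod_state \<phi> \<psi> (star (\<Sum>(a, b)\<leftarrow>ys. a \<otimes> b) * x * (\<Sum>(a, b)\<leftarrow>xs. a \<otimes> b))) \<le>
       B * (seminorm2 (prod_state \<phi> \<psi>) (\<Sum>(a, b)\<leftarrow>ys. a \<otimes> b) * seminorm2 (prod_state \<phi> \<psi>) (\<Sum>(a, b)\<leftarrow>xs. a \<otimes> b))"
  shows "norm x \<le> B"
  unfolding norm_ctensor_def
proof (rule norm_bound)
  fix p :: "('a, 'b) gns_pair"
  obtain \<phi> \<psi> y z where p: "p = GNS_Pair \<phi> \<psi> y z" by (cases p)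
  obtain s where s: "approx s x" using approx_ex[of x] by (elim exE)
  have lim: "(\<lambda>n. matrix_coeff (s n) p) \<longlonglongrightarrow> apply_bcontfun (Rep_ctensor x) p"
  proof -
    have "(\<lambda>n. apply_bcontfun (gns_coeffs (s n)) p) \<longlonglongrightarrow> apply_bcontfun (Rep_ctensor x) p"
      using s unfolding approx_def by (rule bounded_linear.tendsto[OF bounded_linear_apply_bcontfun])
    then show ?thesis by simp
  qed
  show "norm (apply_bcontfun (Rep_ctensor x) p) \<le> B"
  proof (cases "state \<phi> \<and> state \<psi> \<and> Re (gns_inner \<phi> \<psi> y y) \<le> 1 \<and> Re (gns_inner \<phi> \<psi> z z) \<le> 1")
    case True
    then have st: "state \<phi>" "state \<psi>" by auto
    let ?y = "\<Sum>(a, b)\<leftarrow>y. a \<otimes> b" and ?z = "\<Sum>(a, b)\<leftarrow>z. a \<otimes> b"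
    have inner: "prod_state \<phi> \<psi> (star (\<Sum>(a, b)\<leftarrow>u. a \<otimes> b) * (\<Sum>(a, b)\<leftarrow>v. a \<otimes> b)) = gns_inner \<phi> \<psi> u v" for u v
      unfolding tensor_sum_star[symmetric] tensor_sum_mult[symmetric] prod_state_sum_list[OF st] gns_inner_def ..
    have "(\<lambda>n. \<Sum>(a, b)\<leftarrow>s n. a \<otimes> b) \<longlonglongrightarrow> x"
      using s unfolding approx_def tendsto_iff dist_ctensor_def Rep_tensor_sum .
    then have "(\<lambda>n. prod_state \<phi> \<psi> (star ?z * (\<Sum>(a, b)\<leftarrow>s n. a \<otimes> b) * ?y)) \<longlonglongrightarrow> prod_state \<phi> \<psi> (star ?z * x * ?y)"
      by (intro bounded_linear.tendsto[OF prod_state_bounded_linear[OF st]] tendsto_intros)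
    moreover have "prod_state \<phi> \<psi> (star ?z * (\<Sum>(a, b)\<leftarrow>s n. a \<otimes> b) * ?y) = matrix_coeff (s n) p" for n
      unfolding p mult.assoc tensor_sum_mult[symmetric] inner using True by simp
    ultimately have "apply_bcontfun (Rep_ctensor x) p = prod_state \<phi> \<psi> (star ?z * x * ?y)"
      using lim by (simp add: LIMSEQ_unique)
    also have "cmod \<dots> \<le> B * (seminorm2 (prod_state \<phi> \<psi>) ?z * seminorm2 (prod_state \<phi> \<psi>) ?y)" by (rule le[OF st])
    also have "\<dots> \<le> B * 1"
      using True seminorm2_nonneg[OF state_prod_state[OF st]]
      by (intro mult_left_mono mult_le_one B) (auto simp: seminorm2_def inner gns_inner_pos)
    finally show ?thesis by simp
  next
    case False
    then have "matrix_coeff (s n) p = 0" for n unfolding p matrix_coeff.simps by (rule if_not_P)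
    then have "apply_bcontfun (Rep_ctensor x) p = 0" using lim by (simp add: LIMSEQ_const_iff)
    then show ?thesis using B by simp
  qed
qed

lemma sesquilinear_zero:
  fixes f :: "'a::cstar_algebra \<Rightarrow> 'a \<Rightarrow> complex"
  assumes add: "\<And>u v w. f (u + v) w = f u w + f v w" "\<And>u v w. f w (u + v) = f w u + f w v"
    and scale: "\<And>c u v. f (c *\<^sub>C u) v = cnj c * f u v" "\<And>c u v. f u (c *\<^sub>C v) = c * f u v"
    and diag: "\<And>u. f u u = 0"
  shows "f u v = 0"
proof -
  have 1: "f u v + f v u = 0" using diag[of "u + v"] diag[of u] diag[of v] by (simp add: add add.commute)
  have "\<i> * f u v - \<i> * f v u = 0"
    using diag[of "u + \<i> *\<^sub>C v"] diag[of u] diag[of v] by (simp add: add scale)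
  then have "f u v = f v u" by simp
  then show ?thesis using 1 by simp
qed

text \<open>The vector state of an elementary tensor is a multiple of a product state, so the
  diagonal coefficients vanish. Vector states of sums are not of this form; therefore polarization
  is done in the first leg, then in the second, and additivity gives all remaining
  coefficients.\<close>

lemma prod_states_separate_zero:
  fixes x :: "'a::cstar_algebra \<otimes> 'b::cstar_algebra"
  assumes zero: "\<And>\<phi> \<psi>. state \<phi> \<Longrightarrow> state \<psi> \<Longrightarrow> prod_state \<phi> \<psi> x = 0"
  shows "x = 0"
proof -
  have "norm x \<le> 0"
  proof (rule norm_tensor_leI)
    fix \<phi> :: "'a \<Rightarrow> complex" and \<psi> :: "'b \<Rightarrow> complex" and xs ys assume st: "state \<phi>" "state \<psi>"
    note lin = state_add[OF state_prod_state[OF st]] state_scale[OF state_prod_state[OF st]]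
    have diag: "prod_state \<phi> \<psi> (star (a \<otimes> b) * x * (a \<otimes> b)) = 0" for a b
      using prod_vector_state[OF st, of a b] zero by (elim disjE exE) auto
    have diag1: "prod_state \<phi> \<psi> (star (a \<otimes> b) * x * (a' \<otimes> b)) = 0" for a a' b
      by (rule sesquilinear_zero[of "\<lambda>a a'. prod_state \<phi> \<psi> (star (a \<otimes> b) * x * (a' \<otimes> b))"])
        (auto simp: tensor_add_left tensor_scaleC_left star_add star_scaleC distrib_left distrib_right
          mult_scaleC_left mult_scaleC_right lin diag)
    have 0: "prod_state \<phi> \<psi> (star (a \<otimes> b) * x * (a' \<otimes> b')) = 0" for a a' b b'
      by (rule sesquilinear_zero[of "\<lambda>b b'. prod_state \<phi> \<psi> (star (a \<otimes> b) * x * (a' \<otimes> b'))"])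
        (auto simp: tensor_add_right tensor_scaleC_right star_add star_scaleC distrib_left distrib_right
          mult_scaleC_left mult_scaleC_right lin diag1)
    have 1: "prod_state \<phi> \<psi> (star (a \<otimes> b) * x * (\<Sum>(a, b)\<leftarrow>xs. a \<otimes> b)) = 0" for a b
      by (induction xs) (auto simp: distrib_left lin 0 state_zero[OF state_prod_state[OF st]])
    have "prod_state \<phi> \<psi> (star (\<Sum>(a, b)\<leftarrow>ys. a \<otimes> b) * x * (\<Sum>(a, b)\<leftarrow>xs. a \<otimes> b)) = 0"
      by (induction ys) (auto simp: distrib_right star_add lin 1 state_zero[OF state_prod_state[OF st]])
    then show "cmod (prod_state \<phi> \<psi> (star (\<Sum>(a, b)\<leftarrow>ys. a \<otimes> b) * x * (\<Sum>(a, b)\<leftarrow>xs. a \<otimes> b))) \<le>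
       0 * (seminorm2 (prod_state \<phi> \<psi>) (\<Sum>(a, b)\<leftarrow>ys. a \<otimes> b) * seminorm2 (prod_state \<phi> \<psi>) (\<Sum>(a, b)\<leftarrow>xs. a \<otimes> b))"
      by simp
  qed simp
  then show ?thesis by simp
qed

lemma prod_states_eqI:
  assumes "\<And>\<phi> \<psi>. state \<phi> \<Longrightarrow> state \<psi> \<Longrightarrow> prod_state \<phi> \<psi> x = prod_state \<phi> \<psi> y"
  shows "x = y"
  using prod_states_separate_zero[of "x - y"] assms by (simp add: state_diff state_prod_state)

lemma states_eqI:
  assumes "\<And>\<phi>. state \<phi> \<Longrightarrow> \<phi> x = \<phi> y"
  shows "x = (y :: 'a::cstar_algebra)"
proof -
  define z where "z = x - y"
  have "\<phi> (star z * z) = 0" if st: "state \<phi>" for \<phi>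
  proof -
    have zero: "\<psi> z = 0" if "state \<psi>" for \<psi> using assms[OF that] by (simp add: z_def state_diff[OF that])
    have diag: "\<phi> (star a * z * a) = 0" for a
      using vector_state[OF st, of a] zero by (elim disjE exE) auto
    have "\<phi> (star z * z * 1) = 0"
      by (rule sesquilinear_zero[of "\<lambda>a b. \<phi> (star a * z * b)"])
        (auto simp: star_add star_scaleC distrib_left distrib_right mult_scaleC_left mult_scaleC_right
          state_add[OF st] state_scale[OF st] diag)
    then show ?thesis by simp
  qed
  then have "z = 0" by (rule states_separate)
  then show ?thesis by (simp add: z_def)
qed

section \<open>Homomorphisms into tensor products\<close>

lemma unital_star_hom_add: "unital_star_hom f \<Longrightarrow> f (x + y) = f x + f y"
  and unital_star_hom_scaleC: "unital_star_hom f \<Longrightarrow> f (c *\<^sub>C x) = c *\<^sub>C f x"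
  and unital_star_hom_mult: "unital_star_hom f \<Longrightarrow> f (x * y) = f x * f y"
  and unital_star_hom_star: "unital_star_hom f \<Longrightarrow> f (star x) = star (f x)"
  and unital_star_hom_one: "unital_star_hom f \<Longrightarrow> f 1 = 1"
  by (auto simp: unital_star_hom_def)

text \<open>If \<open>x\<^sup>* x = y\<^sup>2\<close> and \<open>\<parallel>x\<parallel>\<^sup>2 - y\<^sup>2 = w\<^sup>2\<close>, then \<open>f(y)\<^sup>2 + f(w)\<^sup>2 = \<parallel>x\<parallel>\<^sup>2\<close>.\<close>

lemma norm_unital_star_hom:
  assumes f: "unital_star_hom f"
  shows "norm (f x) \<le> norm x"
proof -
  obtain y where y: "star y = y" "star x * x = y * y" using star_mult_self_is_square[of x] by blast
  define t where "t = norm (y * y)"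
  have t: "t = (norm x)\<^sup>2" using cstar_identity[of x] y by (simp add: t_def)
  have "norm (t *\<^sub>R 1 - (t *\<^sub>R 1 - y * y)) \<le> t" by (simp add: t_def)
  moreover have "star (t *\<^sub>R 1 - y * y) = t *\<^sub>R 1 - y * y" by (simp add: star_diff star_scaleR star_mult y)
  ultimately obtain w where w: "star w = w" "w * w = t *\<^sub>R 1 - y * y"
    "\<And>c. c * (t *\<^sub>R 1 - y * y) = (t *\<^sub>R 1 - y * y) * c \<Longrightarrow> c * w = w * c"
    using sqrt_near_scalar by blast
  have "y * (t *\<^sub>R 1 - y * y) = (t *\<^sub>R 1 - y * y) * y" by (simp add: algebra_simps)
  then have yw: "y * w = w * y" by (rule w(3))
  have "y * y + w * w = complex_of_real t *\<^sub>C 1" by (simp add: w(2) scaleR_scaleC)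
  then have "f y * f y + f w * f w = complex_of_real t *\<^sub>C 1"
    using f by (metis unital_star_hom_add unital_star_hom_mult unital_star_hom_one unital_star_hom_scaleC)
  moreover have "norm (f y * f y) \<le> norm (f y * f y + f w * f w)"
    using yw by (intro norm_square_le_sum_squares) (metis f y(1) w(1) unital_star_hom_star unital_star_hom_mult)+
  ultimately have "norm (f y * f y) \<le> t * norm (1 :: 'b)" using t by (simp add: norm_scaleC norm_power)
  also have "\<dots> \<le> (norm x)\<^sup>2" using norm_one_le[where 'a = 'b] t by (simp add: mult_left_le)
  also have "f y * f y = star (f x) * f x" using y(2) f by (metis unital_star_hom_star unital_star_hom_mult)
  finally show ?thesis unfolding cstar_identity by (rule power2_le_imp_le) simp
qed

lemma bounded_clinear_unital_star_hom:
  assumes f: "unital_star_hom f"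
  shows "bounded_clinear f"
  unfolding bounded_clinear_def
  by (intro conjI bounded_linear_intro[where K = 1] allI)
    (auto simp: unital_star_hom_add[OF f] unital_star_hom_scaleC[OF f] scaleR_scaleC norm_unital_star_hom[OF f])

lemmas unital_star_hom_linear = bounded_clinear_unital_star_hom[THEN bounded_clinear_linear]
  and unital_star_hom_sum = bounded_clinear_sum[OF bounded_clinear_unital_star_hom]

lemma state_unital_star_hom:
  assumes "state \<phi>" "unital_star_hom f"
  shows "state (\<lambda>x. \<phi> (f x))"
  unfolding state_def
proof (intro conjI allI)
  show "bounded_linear (\<lambda>x. \<phi> (f x))"
    by (rule bounded_linear_compose[OF state_bounded_linear[OF assms(1)] unital_star_hom_linear[OF assms(2)]])
qed (simp_all add: assms unital_star_hom_scaleC unital_star_hom_mult unital_star_hom_star unital_star_hom_one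
    state_scale state_pos state_one)

lemma unital_star_hom_id: "unital_star_hom id"
  by (simp add: unital_star_hom_def)

section \<open>Extension of homomorphisms from a dense graph\<close>

lemma seminorm2_add_sq_le:
  assumes st: "state \<phi>"
  shows "(seminorm2 \<phi> (x + y))\<^sup>2 \<le> 2 * (seminorm2 \<phi> x)\<^sup>2 + 2 * (seminorm2 \<phi> y)\<^sup>2"
proof -
  have "star (x + y) * (x + y) + star (x - y) * (x - y) = (star x * x + star x * x) + (star y * y + star y * y)"
    by (simp add: star_add star_diff algebra_simps)
  then have "\<phi> (star (x + y) * (x + y)) + \<phi> (star (x - y) * (x - y)) = 2 * \<phi> (star x * x) + 2 * \<phi> (star y * y)"
    by (simp only: state_add[OF st, symmetric] mult_2)
  from arg_cong[OF this, of Re] show ?thesis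
    using state_pos(1)[OF st, of "x - y"] unfolding seminorm2_sq[OF st] by simp
qed

lemma seminorm2_mult_le:
  assumes st: "state \<phi>"
  shows "seminorm2 \<phi> (x * y) \<le> norm x * seminorm2 \<phi> y"
  using vector_state[OF st, of y]
proof (elim disjE exE conjE)
  assume "\<forall>x. \<phi> (star y * x * y) = 0"
  then have "\<phi> (star y * (star x * x) * y) = 0" by blast
  then have "seminorm2 \<phi> (x * y) = 0" by (simp add: seminorm2_def star_mult mult.assoc)
  then show ?thesis by (simp add: st)
next
  fix \<phi>' assume st': "state \<phi>'" and eq: "\<forall>x. \<phi> (star y * x * y) = complex_of_real ((seminorm2 \<phi> y)\<^sup>2) * \<phi>' x"
  have "\<phi> (star (x * y) * (x * y)) = complex_of_real ((seminorm2 \<phi> y)\<^sup>2) * \<phi>' (star x * x)"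
    using eq[rule_format, of "star x * x"] by (simp add: star_mult mult.assoc)
  then have "(seminorm2 \<phi> (x * y))\<^sup>2 = (seminorm2 \<phi> y * seminorm2 \<phi>' x)\<^sup>2"
    unfolding seminorm2_sq[OF st, of "x * y"] power_mult_distrib seminorm2_sq[OF st'] by simp
  then have "seminorm2 \<phi> (x * y) = seminorm2 \<phi> y * seminorm2 \<phi>' x"
    using st st' by (simp add: power2_eq_iff_nonneg)
  also have "\<dots> \<le> seminorm2 \<phi> y * norm x" by (intro mult_left_mono seminorm2_le_norm st') (simp add: st)
  finally show ?thesis by (simp add: mult.commute)
qed

text \<open>\<open>G\<close> stands for a homomorphism on a dense unital involutive subalgebra that
  is not yet known to be well defined. The constant in \<open>bound\<close> may depend on the two
  states; multiplicativity and the involution upgrade such bounds to contractivity.\<close>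

locale star_graph =
  fixes G :: "('d::cstar_algebra \<times> ('a::cstar_algebra \<otimes> 'b::cstar_algebra)) set"
  assumes add: "\<And>x y x' y'. (x, y) \<in> G \<Longrightarrow> (x', y') \<in> G \<Longrightarrow> (x + x', y + y') \<in> G"
    and scale: "\<And>c x y. (x, y) \<in> G \<Longrightarrow> (c *\<^sub>C x, c *\<^sub>C y) \<in> G"
    and mult: "\<And>x y x' y'. (x, y) \<in> G \<Longrightarrow> (x', y') \<in> G \<Longrightarrow> (x * x', y * y') \<in> G"
    and star: "\<And>x y. (x, y) \<in> G \<Longrightarrow> (star x, star y) \<in> G"
    and one: "(1, 1) \<in> G"
    and dense: "closure (fst ` G) = UNIV"
    and bound: "\<And>\<phi> \<psi>. state \<phi> \<Longrightarrow> state \<psi> \<Longrightarrow> \<exists>K. \<forall>x y. (x, y) \<in> G \<longrightarrow> cmod (prod_state \<phi> \<psi> y) \<le> K * norm x"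
begin

text \<open>Induction on the length of the vector: each elementary tensor contributes through its
  vector state, and the parallelogram law adds the contributions at the price of a factor 2. The
  size of \<open>K\<close> is immaterial, since only its independence of \<open>x\<close> matters
  for the iteration that follows.\<close>

lemma vector_bound:
  assumes st: "state \<phi>" "state \<psi>"
  shows "\<exists>K. \<forall>x y. (x, y) \<in> G \<longrightarrow> (seminorm2 (prod_state \<phi> \<psi>) (y * (\<Sum>(a, b)\<leftarrow>xs. a \<otimes> b)))\<^sup>2 \<le> K * (norm x)\<^sup>2"
proof (induction xs)
  case Nil
  show ?case by (intro exI[of _ 0]) (simp add: seminorm2_def state_zero state_prod_state st)
next
  case (Cons p xs)
  note s = state_prod_state[OF st]
  obtain a b where p: "p = (a, b)" by fastforce
  obtain K where K: "\<And>x y. (x, y) \<in> G \<Longrightarrow> (seminorm2 (prod_state \<phi> \<psi>) (y * (\<Sum>(a, b)\<leftarrow>xs. a \<otimes> b)))\<^sup>2 \<le> K * (norm x)\<^sup>2"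
    using Cons by blast
  have "\<exists>L. \<forall>x y. (x, y) \<in> G \<longrightarrow> (seminorm2 (prod_state \<phi> \<psi>) (y * (a \<otimes> b)))\<^sup>2 \<le> L * (norm x)\<^sup>2"
    using prod_vector_state[OF st, of a b]
  proof (elim disjE exE conjE)
    assume zero: "\<forall>x. prod_state \<phi> \<psi> (star (a \<otimes> b) * x * (a \<otimes> b)) = 0"
    have "(seminorm2 (prod_state \<phi> \<psi>) (y * (a \<otimes> b)))\<^sup>2 \<le> 0 * (norm x)\<^sup>2" for x :: 'd and y
      using zero[rule_format, of "star y * y"] unfolding seminorm2_sq[OF s] by (simp add: star_mult mult.assoc)
    then show ?thesis by blast
  next
    fix \<phi>' \<psi>' r assume st': "state \<phi>'" "state \<psi>'"
      and eq: "\<forall>x. prod_state \<phi> \<psi> (star (a \<otimes> b) * x * (a \<otimes> b)) = complex_of_real r * prod_state \<phi>' \<psi>' x"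
    obtain M where M: "\<And>x y. (x, y) \<in> G \<Longrightarrow> cmod (prod_state \<phi>' \<psi>' y) \<le> M * norm x" using bound[OF st'] by blast
    have "(seminorm2 (prod_state \<phi> \<psi>) (y * (a \<otimes> b)))\<^sup>2 \<le> (\<bar>r\<bar> * M) * (norm x)\<^sup>2" if xy: "(x, y) \<in> G" for x y
    proof -
      have "(seminorm2 (prod_state \<phi> \<psi>) (y * (a \<otimes> b)))\<^sup>2 = Re (complex_of_real r * prod_state \<phi>' \<psi>' (star y * y))"
        using eq[rule_format, of "star y * y"] unfolding seminorm2_sq[OF s] by (simp add: star_mult mult.assoc)
      also have "\<dots> \<le> cmod (complex_of_real r * prod_state \<phi>' \<psi>' (star y * y))" by (rule complex_Re_le_cmod)
      also have "\<dots> \<le> \<bar>r\<bar> * (M * norm (star x * x))"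
        unfolding norm_mult norm_of_real by (intro mult_left_mono M mult star xy) auto
      finally show ?thesis by (simp add: cstar_identity)
    qed
    then show ?thesis by blast
  qed
  then obtain L where L: "\<And>x y. (x, y) \<in> G \<Longrightarrow> (seminorm2 (prod_state \<phi> \<psi>) (y * (a \<otimes> b)))\<^sup>2 \<le> L * (norm x)\<^sup>2" by blast
  have "(seminorm2 (prod_state \<phi> \<psi>) (y * (\<Sum>(a, b)\<leftarrow>p # xs. a \<otimes> b)))\<^sup>2 \<le> (2 * L + 2 * K) * (norm x)\<^sup>2"
    if xy: "(x, y) \<in> G" for x y
    using seminorm2_add_sq_le[OF s, of "y * (a \<otimes> b)" "y * (\<Sum>(a, b)\<leftarrow>xs. a \<otimes> b)"] K[OF xy] L[OF xy]
    by (simp add: p distrib_left distrib_right)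
  then show ?case by blast
qed

text \<open>The preceding bound improves to the constant \<open>1\<close> by iterating \<open>x \<mapsto> x\<^sup>* x\<close>.\<close>

lemma vector_contraction:
  fixes xs :: "('a \<times> 'b) list"
  assumes st: "state \<phi>" "state \<psi>" and xy: "(x, y) \<in> G"
  defines "s \<equiv> prod_state \<phi> \<psi>" and "v \<equiv> \<Sum>(a, b)\<leftarrow>xs. a \<otimes> b"
  shows "(seminorm2 s (y * v))\<^sup>2 \<le> (norm x)\<^sup>2 * (seminorm2 s v)\<^sup>2"
proof -
  have s: "state s" unfolding s_def by (rule state_prod_state[OF st])
  obtain K where K: "\<And>x y. (x, y) \<in> G \<Longrightarrow> (seminorm2 s (y * v))\<^sup>2 \<le> K * (norm x)\<^sup>2"
    using vector_bound[OF st, of xs] unfolding s_def v_def by blast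
  define X where "X = rec_nat x (\<lambda>_ z. star z * z)"
  define Y where "Y = rec_nat y (\<lambda>_ z. star z * z)"
  have X: "X 0 = x" "X (Suc n) = star (X n) * X n" and Y: "Y 0 = y" "Y (Suc n) = star (Y n) * Y n" for n
    by (simp_all add: X_def Y_def)
  have XY: "(X n, Y n) \<in> G" for n by (induction n) (auto simp: X Y xy intro: mult star)
  have nX: "norm (X n) = norm x ^ (2 ^ n)" for n
    by (induction n) (auto simp: X cstar_identity power_mult[symmetric] mult.commute)
  define t where "t n = (seminorm2 s (Y n * v))\<^sup>2" for n
  define q where "q = (seminorm2 s v)\<^sup>2"
  have t0: "0 \<le> t n" for n by (simp add: t_def)
  have step: "(t n)\<^sup>2 \<le> q * t (Suc n)" for n
  proof -
    have "t n = Re (s (star v * (Y (Suc n) * v)))"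
      unfolding t_def seminorm2_sq[OF s] by (simp add: Y star_mult mult.assoc)
    also have "\<dots> \<le> seminorm2 s v * seminorm2 s (Y (Suc n) * v)"
      by (rule order_trans[OF complex_Re_le_cmod state_cauchy_schwarz[OF s]])
    finally have "(t n)\<^sup>2 \<le> (seminorm2 s v * seminorm2 s (Y (Suc n) * v))\<^sup>2" using t0 by (intro power_mono)
    then show ?thesis by (simp add: t_def q_def power_mult_distrib)
  qed
  show ?thesis
  proof (cases "q = 0")
    case True
    then show ?thesis using step[of 0] by (simp add: t_def Y q_def)
  next
    case False
    then have q: "0 < q" by (simp add: q_def)
    have ge: "(t 0 / q) ^ (2 ^ n) \<le> t n / q" for n
    proof (induction n)
      case (Suc n)
      have "(t 0 / q) ^ (2 ^ Suc n) = ((t 0 / q) ^ (2 ^ n))\<^sup>2" by (simp add: power_mult[symmetric] mult.commute)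
      also have "\<dots> \<le> (t n / q)\<^sup>2" using Suc t0 q by (intro power_mono) auto
      also have "\<dots> \<le> t (Suc n) / q" using step[of n] q by (simp add: power2_eq_square field_simps)
      finally show ?case .
    qed simp
    have "t 0 / q \<le> (norm x)\<^sup>2"
    proof (rule power_le_imp_le_limit)
      fix n
      have "(t 0 / q) ^ (2 ^ n) \<le> t n / q" by (rule ge)
      also have "\<dots> \<le> K * (norm (X n))\<^sup>2 / q" unfolding t_def using q by (intro divide_right_mono K XY) auto
      also have "(norm (X n))\<^sup>2 = ((norm x)\<^sup>2) ^ (2 ^ n)" by (simp add: nX power_mult[symmetric] mult.commute)
      finally show "(t 0 / q) ^ (2 ^ n) \<le> K / q * ((norm x)\<^sup>2) ^ (2 ^ n)" by simp
    qed (use t0 q in auto)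
    then show ?thesis using q by (simp add: t_def Y q_def field_simps)
  qed
qed

lemma graph_contraction:
  assumes xy: "(x, y) \<in> G"
  shows "norm y \<le> 1 * norm x"
proof -
  have "norm y \<le> norm x"
  proof (rule norm_tensor_leI)
    fix \<phi> :: "'a \<Rightarrow> complex" and \<psi> :: "'b \<Rightarrow> complex" and xs ys :: "('a \<times> 'b) list"
    assume st: "state \<phi>" "state \<psi>"
    let ?s = "prod_state \<phi> \<psi>" and ?u = "\<Sum>(a, b)\<leftarrow>ys. a \<otimes> b" and ?v = "\<Sum>(a, b)\<leftarrow>xs. a \<otimes> b"
    note s = state_prod_state[OF st]
    have "cmod (?s (star ?u * y * ?v)) \<le> seminorm2 ?s ?u * seminorm2 ?s (y * ?v)"
      unfolding mult.assoc by (rule state_cauchy_schwarz[OF s])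
    also have "(seminorm2 ?s (y * ?v))\<^sup>2 \<le> (norm x * seminorm2 ?s ?v)\<^sup>2"
      using vector_contraction[OF st xy] by (simp add: power_mult_distrib)
    then have "seminorm2 ?s (y * ?v) \<le> norm x * seminorm2 ?s ?v"
      by (rule power2_le_imp_le) (simp add: s)
    then have "seminorm2 ?s ?u * seminorm2 ?s (y * ?v) \<le> seminorm2 ?s ?u * (norm x * seminorm2 ?s ?v)"
      by (intro mult_left_mono) (auto simp: s)
    finally show "cmod (?s (star ?u * y * ?v)) \<le> norm x * (seminorm2 ?s ?u * seminorm2 ?s ?v)"
      by (simp add: mult.left_commute)
  qed simp
  then show ?thesis by simp
qed

theorem star_hom_extension:
  obtains F where "unital_star_hom F" "\<And>x y. (x, y) \<in> G \<Longrightarrow> F x = y"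
proof -
  obtain F where F: "bounded_clinear F" "\<And>x y. (x, y) \<in> G \<Longrightarrow> F x = y"
    by (rule graph_extension[of G 1]) (use dense add scale graph_contraction that in blast)+
  have cont: "continuous_on UNIV F" by (rule linear_continuous_on[OF bounded_clinear_linear[OF F(1)]])
  have ind: "P x" if "closed {x. P x}" "\<And>x. x \<in> fst ` G \<Longrightarrow> P x" for P and x :: 'd
    using closure_minimal[of "fst ` G" "{x. P x}"] that dense by auto
  have mult1: "F (x * x') = F x * F x'" if x': "x' \<in> fst ` G" for x x'
  proof (rule ind[of "\<lambda>x. F (x * x') = F x * F x'"])
    show "closed {x. F (x * x') = F x * F x'}"
      by (intro closed_Collect_eq continuous_intros continuous_on_compose2[OF cont]) auto
    show "F (x * x') = F x * F x'" if "x \<in> fst ` G" for x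
      using that x' F(2) mult by fastforce
  qed
  have "F (x * x') = F x * F x'" for x x'
  proof (rule ind[of "\<lambda>x'. F (x * x') = F x * F x'"])
    show "closed {x'. F (x * x') = F x * F x'}"
      by (intro closed_Collect_eq continuous_intros continuous_on_compose2[OF cont]) auto
  qed (rule mult1)
  moreover have "F (star x) = star (F x)" for x
  proof (rule ind[of "\<lambda>x. F (star x) = star (F x)"])
    show "closed {x. F (star x) = star (F x)}"
      by (intro closed_Collect_eq continuous_on_compose2[OF cont] cont
          continuous_on_compose2[OF linear_continuous_on[OF bounded_linear_star, of UNIV] cont]
          linear_continuous_on[OF bounded_linear_star]) auto
    show "F (star x) = star (F x)" if "x \<in> fst ` G" for x
      using that F(2) star by fastforce
  qed
  moreover have "F 1 = 1" by (rule F(2)[OF one])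
  ultimately have "unital_star_hom F"
    by (simp add: unital_star_hom_def bounded_clinear_add[OF F(1)] bounded_clinear_scaleC[OF F(1)])
  then show ?thesis using that F(2) by blast
qed

end

section \<open>Tensor products of homomorphisms and the associativity isomorphism\<close>

lemma tensor_zero_left [simp]: "0 \<otimes> b = 0" and tensor_zero_right [simp]: "a \<otimes> 0 = 0"
  using tensor_scaleC_left[of 0 0 b] tensor_scaleC_right[of a 0 0] by simp_all

lemma tensor_sum_map_prod: "fs_mult (map (map_prod f g) xs) (map (map_prod f g) ys) = map (map_prod f g) (fs_mult xs ys)"
  if "unital_star_hom f" "unital_star_hom g"
  by (induction xs) (auto simp: fs_mult_Cons unital_star_hom_mult[OF that(1)] unital_star_hom_mult[OF that(2)])

text \<open>States composed with \<open>f\<close> and \<open>g\<close> are again states, so a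
  product state on the target pulls back to a product state on the source; this gives the bound
  required by \<open>star_graph\<close> with constant 1.\<close>

lemma unital_star_hom_tensor_map_ex:
  fixes f :: "'a::cstar_algebra \<Rightarrow> 'c::cstar_algebra" and g :: "'b::cstar_algebra \<Rightarrow> 'd::cstar_algebra"
  assumes f: "unital_star_hom f" and g: "unital_star_hom g"
  obtains F where "unital_star_hom F" "\<And>a b. F (a \<otimes> b) = f a \<otimes> g b"
proof -
  define L where "L xs = (\<Sum>(a, b)\<leftarrow>xs. a \<otimes> b)" for xs :: "('a \<times> 'b) list"
  define R where "R xs = (\<Sum>(a, b)\<leftarrow>map (map_prod f g) xs. a \<otimes> b)" for xs
  define G where "G = {(L xs, R xs) | xs. True}"
  have mem: "(L xs, R xs) \<in> G" for xs by (auto simp: G_def)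
  interpret star_graph G
  proof
    fix x y x' y' c assume "(x, y) \<in> G" "(x', y') \<in> G"
    then obtain xs ys where xs: "x = L xs" "y = R xs" "x' = L ys" "y' = R ys" by (auto simp: G_def)
    have "L (xs @ ys) = L xs + L ys" "R (xs @ ys) = R xs + R ys" by (simp_all add: L_def R_def)
    then show "(x + x', y + y') \<in> G" using mem[of "xs @ ys"] xs by simp
    have "L (fs_mult xs ys) = L xs * L ys" "R (fs_mult xs ys) = R xs * R ys"
      unfolding L_def R_def tensor_sum_map_prod[OF f g, symmetric] tensor_sum_mult by simp_all
    then show "(x * x', y * y') \<in> G" using mem[of "fs_mult xs ys"] xs by simp
  next
    fix x y c assume "(x, y) \<in> G"
    then obtain xs where xs: "x = L xs" "y = R xs" by (auto simp: G_def)
    have "map (map_prod f g) (fs_scale c xs) = fs_scale c (map (map_prod f g) xs)"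
      by (induction xs) (auto simp: fs_scale_def unital_star_hom_scaleC[OF f])
    then have "L (fs_scale c xs) = c *\<^sub>C L xs" "R (fs_scale c xs) = c *\<^sub>C R xs"
      unfolding L_def R_def tensor_sum_scale[symmetric] by simp_all
    then show "(c *\<^sub>C x, c *\<^sub>C y) \<in> G" using mem[of "fs_scale c xs"] xs by simp
    have "map (map_prod f g) (fs_star xs) = fs_star (map (map_prod f g) xs)"
      by (induction xs) (auto simp: fs_star_def unital_star_hom_star[OF f] unital_star_hom_star[OF g])
    then have "L (fs_star xs) = star (L xs)" "R (fs_star xs) = star (R xs)"
      unfolding L_def R_def tensor_sum_star[symmetric] by simp_all
    then show "(star x, star y) \<in> G" using mem[of "fs_star xs"] xs by simp
  next
    have "L [(1, 1)] = 1" "R [(1, 1)] = 1"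
      using tensor_one[where 'a = 'a and 'b = 'b] tensor_one[where 'a = 'c and 'b = 'd]
      by (simp_all add: L_def R_def unital_star_hom_one[OF f] unital_star_hom_one[OF g])
    then show "(1, 1) \<in> G" using mem[of "[(1, 1)]"] by simp
    show "closure (fst ` G) = UNIV"
    proof (rule closure_eq_UNIV_I)
      fix x :: "'a \<otimes> 'b"
      obtain s where "(\<lambda>n. \<Sum>(a, b)\<leftarrow>s n. a \<otimes> b) \<longlonglongrightarrow> x" using tensor_limit[of x] by (elim exE)
      then show "\<exists>s. (\<forall>n. s n \<in> fst ` G) \<and> s \<longlonglongrightarrow> x"
        by (intro exI[of _ "\<lambda>n. L (s n)"]) (force simp: G_def L_def)
    qed
    fix \<phi> :: "'c \<Rightarrow> complex" and \<psi> :: "'d \<Rightarrow> complex" assume st: "state \<phi>" "state \<psi>"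
    note st' = state_unital_star_hom[OF st(1) f] state_unital_star_hom[OF st(2) g]
    have "prod_state \<phi> \<psi> (R xs) = prod_state (\<lambda>x. \<phi> (f x)) (\<lambda>x. \<psi> (g x)) (L xs)" for xs
      unfolding R_def L_def prod_state_sum_list[OF st] prod_state_sum_list[OF st']
      by (simp add: prod_fun_def case_prod_unfold comp_def)
    then have "cmod (prod_state \<phi> \<psi> (R xs)) \<le> 1 * norm (L xs)" for xs
      using state_norm_le[OF state_prod_state[OF st'], of "L xs"] by simp
    then show "\<exists>K. \<forall>x y. (x, y) \<in> G \<longrightarrow> cmod (prod_state \<phi> \<psi> y) \<le> K * norm x"
      unfolding G_def by blast
  qed
  obtain F where F: "unital_star_hom F" "\<And>x y. (x, y) \<in> G \<Longrightarrow> F x = y" by (rule star_hom_extension) (rule that)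
  have "F (a \<otimes> b) = f a \<otimes> g b" for a b
    using F(2)[OF mem[of "[(a, b)]"]] by (simp add: L_def R_def)
  then show ?thesis using that F(1) by blast
qed

lemma tensor_map_hom:
  assumes "unital_star_hom f" "unital_star_hom g"
  shows "unital_star_hom (tensor_map f g) \<and> (\<forall>a b. tensor_map f g (a \<otimes> b) = f a \<otimes> g b)"
proof -
  obtain F where F: "unital_star_hom F" "\<And>a b. F (a \<otimes> b) = f a \<otimes> g b"
    by (rule unital_star_hom_tensor_map_ex[OF assms]) (rule that)
  then show ?thesis using tensor_map_eqI[OF bounded_clinear_unital_star_hom[OF F(1)] F(2)] by simp
qed

lemma unital_star_hom_tensor_map: "unital_star_hom f \<Longrightarrow> unital_star_hom g \<Longrightarrow> unital_star_hom (tensor_map f g)"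
  and tensor_map_tensor [simp]: "unital_star_hom f \<Longrightarrow> unital_star_hom g \<Longrightarrow> tensor_map f g (a \<otimes> b) = f a \<otimes> g b"
  using tensor_map_hom by blast+

lemma unital_star_hom_one_tensor: "unital_star_hom (\<lambda>b :: 'b::cstar_algebra. (1 :: 'a::cstar_algebra) \<otimes> b)"
  using tensor_one
  by (auto simp: unital_star_hom_def tensor_add_right tensor_scaleC_right tensor_mult tensor_star)

text \<open>The slice by \<phi> stays contractive after tensoring with a third algebra. Inserting 1
  in the first leg through \<open>J\<close> embeds the vectors isometrically into the larger GNS
  space, and the sliced element acts as a compression to this subspace.\<close>

lemma slice_left_tensor_id_bound:
  fixes xs :: "(('a::cstar_algebra \<otimes> 'b::cstar_algebra) \<times> 'c::cstar_algebra) list"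
  assumes st: "state \<phi>"
  shows "norm (\<Sum>(x, c)\<leftarrow>xs. slice_left \<phi> x \<otimes> c) \<le> 1 * norm (\<Sum>(x, c)\<leftarrow>xs. x \<otimes> c)"
proof -
  define J where "J = tensor_map (\<lambda>b :: 'b. (1 :: 'a) \<otimes> b) (id :: 'c \<Rightarrow> 'c)"
  note homs = unital_star_hom_one_tensor[where 'a = 'a and 'b = 'b] unital_star_hom_id[where 'a = 'c]
  have J: "unital_star_hom J" unfolding J_def by (rule unital_star_hom_tensor_map[OF homs])
  have J_tensor: "J (b \<otimes> c) = (1 \<otimes> b) \<otimes> c" for b c unfolding J_def using homs by simp
  define X where "X = (\<Sum>(x, c)\<leftarrow>xs. x \<otimes> c)"
  define Y where "Y = (\<Sum>(x, c)\<leftarrow>xs. slice_left \<phi> x \<otimes> c)"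
  have "norm Y \<le> norm X"
  proof (rule norm_tensor_leI)
    fix \<psi> :: "'b \<Rightarrow> complex" and \<theta> :: "'c \<Rightarrow> complex" and us vs :: "('b \<times> 'c) list"
    assume st2: "state \<psi>" "state \<theta>"
    note pst = state_prod_state[OF st st2(1)]
    note S = state_prod_state[OF pst st2(2)]
    note s = state_prod_state[OF st2]
    let ?S = "prod_state (prod_state \<phi> \<psi>) \<theta>" and ?s = "prod_state \<psi> \<theta>"
    have el: "?S (J (b' \<otimes> d') * (x \<otimes> c) * J (b \<otimes> d)) = ?s ((b' \<otimes> d') * (slice_left \<phi> x \<otimes> c) * (b \<otimes> d))" for b' d' x c b d
      using st st2 pst by (simp add: J_tensor tensor_mult prod_state_def slice_left_mult_left slice_left_mult_right)
    have bl: "bounded_linear (\<lambda>y. ?S (z * J y))" "bounded_linear (\<lambda>y. ?S (J y * z))"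
      "bounded_linear (\<lambda>y. ?s (w * y))" "bounded_linear (\<lambda>y. ?s (y * w))" for z w
      by (intro bounded_linear_compose[OF state_bounded_linear[OF S]] bounded_linear_compose[OF state_bounded_linear[OF s]]
          bounded_linear_compose[OF bounded_linear_mult_right] bounded_linear_compose[OF bounded_linear_mult_left]
          unital_star_hom_linear[OF J] bounded_linear_mult_right bounded_linear_mult_left)+
    have el2: "?S (J (b' \<otimes> d') * (x \<otimes> c) * J y) = ?s ((b' \<otimes> d') * (slice_left \<phi> x \<otimes> c) * y)" for b' d' x c y
      by (rule fun_cong[OF bounded_linear_tensor_eqI[OF bl(1) bl(3)]]) (rule el)
    have el3: "?S (J z * (x \<otimes> c) * J y) = ?s (z * (slice_left \<phi> x \<otimes> c) * y)" for z x c y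
      unfolding mult.assoc
      by (rule fun_cong[OF bounded_linear_tensor_eqI[OF bl(2) bl(4)]]) (use el2 in \<open>simp add: mult.assoc\<close>)
    have el4: "?S (J z * (\<Sum>(x, c)\<leftarrow>zs. x \<otimes> c) * J y) = ?s (z * (\<Sum>(x, c)\<leftarrow>zs. slice_left \<phi> x \<otimes> c) * y)" for z y zs
      by (induction zs) (auto simp: distrib_left distrib_right state_add[OF S] state_add[OF s] el3 state_zero[OF S] state_zero[OF s])
    have n: "seminorm2 ?S (J y) = seminorm2 ?s y" for y
      using el3[of "star y" 1 1 y] st tensor_one[where 'a = "'a \<otimes> 'b" and 'b = 'c] tensor_one[where 'a = 'b and 'b = 'c]
      by (simp add: seminorm2_def unital_star_hom_star[OF J] slice_left_one)
    let ?u = "\<Sum>(a, b)\<leftarrow>us. a \<otimes> b" and ?v = "\<Sum>(a, b)\<leftarrow>vs. a \<otimes> b"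
    have "?s (star ?v * Y * ?u) = ?S (star (J ?v) * (X * J ?u))"
      unfolding X_def Y_def el4[symmetric] by (simp add: unital_star_hom_star[OF J] mult.assoc)
    also have "cmod \<dots> \<le> seminorm2 ?S (J ?v) * seminorm2 ?S (X * J ?u)" by (rule state_cauchy_schwarz[OF S])
    also have "\<dots> \<le> seminorm2 ?S (J ?v) * (norm X * seminorm2 ?S (J ?u))"
      by (intro mult_left_mono seminorm2_mult_le S) (simp add: S)
    finally show "cmod (?s (star ?v * Y * ?u)) \<le> norm X * (seminorm2 ?s ?v * seminorm2 ?s ?u)"
      by (simp add: n mult.left_commute)
  qed simp
  then show ?thesis by (simp add: X_def Y_def)
qed

inductive_set assoc_graph ::
    "((('a::cstar_algebra \<otimes> 'b::cstar_algebra) \<otimes> 'c::cstar_algebra) \<times> ('a \<otimes> ('b \<otimes> 'c))) set" where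
  base: "((a \<otimes> b) \<otimes> c, a \<otimes> (b \<otimes> c)) \<in> assoc_graph"
| add: "(x, y) \<in> assoc_graph \<Longrightarrow> (x', y') \<in> assoc_graph \<Longrightarrow> (x + x', y + y') \<in> assoc_graph"

lemma assoc_graph_scale: "(x, y) \<in> assoc_graph \<Longrightarrow> (c *\<^sub>C x, c *\<^sub>C y) \<in> assoc_graph"
  by (induction rule: assoc_graph.induct)
    (auto simp: scaleC_add_right intro: assoc_graph.intros simp flip: tensor_scaleC_left)

lemma assoc_graph_star: "(x, y) \<in> assoc_graph \<Longrightarrow> (star x, star y) \<in> assoc_graph"
  by (induction rule: assoc_graph.induct) (auto simp: star_add tensor_star intro: assoc_graph.intros)

lemma assoc_graph_mult:
  assumes "(x, y) \<in> assoc_graph" "(x', y') \<in> assoc_graph"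
  shows "(x * x', y * y') \<in> assoc_graph"
  using assms(1)
proof (induction rule: assoc_graph.induct)
  case (base a b c)
  show ?case using assms(2)
    by (induction rule: assoc_graph.induct) (auto simp: distrib_left tensor_mult intro: assoc_graph.intros)
qed (auto simp: distrib_right intro: assoc_graph.intros)

lemma assoc_graph_dense: "closure (fst ` assoc_graph) = UNIV"
proof -
  define S where "S = fst ` (assoc_graph :: ((('a \<otimes> 'b) \<otimes> 'c) \<times> ('a \<otimes> ('b \<otimes> 'c))) set)"
  have add: "x + y \<in> S" if xy: "x \<in> S" "y \<in> S" for x y
  proof -
    obtain x' y' where "(x, x') \<in> assoc_graph" "(y, y') \<in> assoc_graph" using xy by (auto simp: S_def)
    from assoc_graph.add[OF this] show ?thesis unfolding S_def by (rule image_eqI[rotated]) simp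
  qed
  have add_closure: "x + y \<in> closure S" if xy: "x \<in> closure S" "y \<in> closure S" for x y
  proof -
    obtain s t where "\<And>n. s n \<in> S" "s \<longlonglongrightarrow> x" "\<And>n. t n \<in> S" "t \<longlonglongrightarrow> y"
      using xy unfolding closure_sequential by blast
    then show ?thesis unfolding closure_sequential
      by (intro exI[of _ "\<lambda>n. s n + t n"] conjI allI add tendsto_add)
  qed
  have zero: "0 \<in> S" using assoc_graph.base[of 0 0 0] by (force simp: S_def tensor_zero_left)
  have base: "(\<Sum>(a, b)\<leftarrow>xs. a \<otimes> b) \<otimes> c \<in> S" for xs c
  proof (induction xs)
    case (Cons p xs)
    have "(fst p \<otimes> snd p) \<otimes> c \<in> S" using assoc_graph.base[of "fst p" "snd p" c] unfolding S_def by force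
    then show ?case using add[OF _ Cons] by (simp add: tensor_add_left case_prod_unfold)
  qed (simp add: tensor_zero_left zero)
  have elem: "x \<otimes> c \<in> closure S" for x c
  proof -
    obtain s where "(\<lambda>n. \<Sum>(a, b)\<leftarrow>s n. a \<otimes> b) \<longlonglongrightarrow> x" using tensor_limit[of x] by (elim exE)
    then have "(\<lambda>n. (\<Sum>(a, b)\<leftarrow>s n. a \<otimes> b) \<otimes> c) \<longlonglongrightarrow> x \<otimes> c"
      by (rule bounded_linear.tendsto[OF bounded_linear_tensor_left])
    then show ?thesis unfolding closure_sequential
      by (intro exI[of _ "\<lambda>n. (\<Sum>(a, b)\<leftarrow>s n. a \<otimes> b) \<otimes> c"] conjI allI base)
  qed
  have sum: "(\<Sum>(x, c)\<leftarrow>xs. x \<otimes> c) \<in> closure S" for xs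
    by (induction xs) (auto intro: add_closure elem subsetD[OF closure_subset zero])
  have "x \<in> closure S" for x
  proof -
    obtain s where s: "(\<lambda>n. \<Sum>(a, b)\<leftarrow>s n. a \<otimes> b) \<longlonglongrightarrow> x" using tensor_limit[of x] by (elim exE)
    show ?thesis by (rule closed_sequentially[OF closed_closure _ s]) (rule sum)
  qed
  then show ?thesis unfolding S_def by auto
qed

text \<open>The bound in \<open>star_graph\<close> involves a state \<psi> on all of B \<otimes> C,
  in general not a product state. For this reason the slice in the first leg has to be contractive
  into B \<otimes> C: \<psi> is evaluated at the slice \<open>F x\<close>.\<close>

lemma tensor_assoc_hom:
  shows "unital_star_hom (tensor_assoc :: ('a::cstar_algebra \<otimes> 'b::cstar_algebra) \<otimes> 'c::cstar_algebra \<Rightarrow> _) \<and>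
    (\<forall>(a :: 'a) (b :: 'b) (c :: 'c). tensor_assoc ((a \<otimes> b) \<otimes> c) = a \<otimes> (b \<otimes> c))"
proof -
  let ?G = "assoc_graph :: ((('a \<otimes> 'b) \<otimes> 'c) \<times> ('a \<otimes> ('b \<otimes> 'c))) set"
  interpret star_graph ?G
  proof
    show "(1, 1) \<in> ?G" using assoc_graph.base[of 1 1 1] by (simp flip: tensor_one)
    show "closure (fst ` ?G) = UNIV" by (rule assoc_graph_dense)
    fix \<phi> :: "'a \<Rightarrow> complex" and \<psi> :: "'b \<otimes> 'c \<Rightarrow> complex" assume st: "state \<phi>" "state \<psi>"
    obtain F :: "('a \<otimes> 'b) \<otimes> 'c \<Rightarrow> 'b \<otimes> 'c" where F: "bounded_clinear F"
      "\<And>x c. F (x \<otimes> c) = slice_left \<phi> x \<otimes> c" "\<And>x. norm (F x) \<le> 1 * norm x"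
      using tensor_map_extension[of "\<lambda>x c. slice_left \<phi> x \<otimes> c" 1] slice_left_tensor_id_bound[OF st(1)]
      by (auto simp: slice_left_scaleC[OF st(1)] tensor_scaleC_left)
    have "prod_state \<phi> \<psi> y = \<psi> (F x)" if "(x, y) \<in> ?G" for x y
      using that
      by (induction rule: assoc_graph.induct)
        (auto simp: F(2) st tensor_scaleC_left state_scale state_add state_prod_state bounded_clinear_add[OF F(1)])
    then have "cmod (prod_state \<phi> \<psi> y) \<le> 1 * norm x" if "(x, y) \<in> ?G" for x y
      using that state_norm_le[OF st(2), of "F x"] F(3)[of x] by simp
    then show "\<exists>K. \<forall>x y. (x, y) \<in> ?G \<longrightarrow> cmod (prod_state \<phi> \<psi> y) \<le> K * norm x" by blast
  qed (auto intro: assoc_graph.add assoc_graph_scale assoc_graph_mult assoc_graph_star)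
  obtain F where F: "unital_star_hom F" "\<And>x y. (x, y) \<in> ?G \<Longrightarrow> F x = y" by (rule star_hom_extension) (rule that)
  have el: "F ((a \<otimes> b) \<otimes> c) = a \<otimes> (b \<otimes> c)" for a b c by (rule F(2)[OF assoc_graph.base])
  show ?thesis using tensor_assoc_eqI[OF bounded_clinear_unital_star_hom[OF F(1)] el] F(1) el by simp
qed

lemma unital_star_hom_tensor_assoc: "unital_star_hom tensor_assoc"
  and tensor_assoc_tensor [simp]: "tensor_assoc ((a \<otimes> b) \<otimes> c) = a \<otimes> (b \<otimes> c)"
  using tensor_assoc_hom by blast+

lemma bounded_linear_tensor_assoc_eqI:
  fixes F G :: "('a::cstar_algebra \<otimes> 'b::cstar_algebra) \<otimes> 'c::cstar_algebra \<Rightarrow> 'd::real_normed_vector"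
  assumes F: "bounded_linear F" and G: "bounded_linear G"
    and eq: "\<And>a b c. F ((a \<otimes> b) \<otimes> c) = G ((a \<otimes> b) \<otimes> c)"
  shows "F = G"
proof (rule bounded_linear_tensor_eqI[OF F G])
  fix x :: "'a \<otimes> 'b" and c :: 'c
  have "(\<lambda>x. F (x \<otimes> c)) = (\<lambda>x. G (x \<otimes> c))"
    by (intro bounded_linear_tensor_eqI bounded_linear_compose[OF F] bounded_linear_compose[OF G]
        bounded_linear_tensor_left eq)
  then show "F (x \<otimes> c) = G (x \<otimes> c)" by meson
qed

lemma prod_state_tensor_assoc:
  assumes "state \<phi>" "state \<psi>" "state \<theta>"
  shows "prod_state \<phi> (prod_state \<psi> \<theta>) (tensor_assoc x) = prod_state (prod_state \<phi> \<psi>) \<theta> x"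
  by (rule fun_cong[OF bounded_linear_tensor_assoc_eqI])
    (auto intro!: state_bounded_linear state_unital_star_hom[OF _ unital_star_hom_tensor_assoc] state_prod_state assms
      simp: assms state_prod_state)

section \<open>The Haar state\<close>

lemma dense_span_induct:
  fixes V :: "'a::cstar_algebra set"
  assumes "closure (cspan S) = UNIV" "csubspace V" "closed V" "S \<subseteq> V"
  shows "x \<in> V"
  using closure_minimal[OF complex_vector.span_minimal[OF assms(4,2)] assms(3)] assms(1) by auto

lemma bounded_clinear_eq_on_dense:
  fixes F G :: "'a::cstar_algebra \<Rightarrow> 'b::cstar_algebra"
  assumes "closure (cspan S) = UNIV" and F: "bounded_clinear F" and G: "bounded_clinear G"
    and eq: "\<And>x. x \<in> S \<Longrightarrow> F x = G x"
  shows "F x = G x"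
proof -
  have "closed {x. F x = G x}"
    by (intro closed_Collect_eq linear_continuous_on bounded_clinear_linear F G)
  moreover have "csubspace {x. F x = G x}"
    by (auto simp: complex_vector.subspace_def bounded_clinear_add[OF F] bounded_clinear_add[OF G]
        bounded_clinear_scaleC[OF F] bounded_clinear_scaleC[OF G] bounded_clinear_zero[OF F] bounded_clinear_zero[OF G])
  ultimately show ?thesis using dense_span_induct[OF assms(1), of "{x. F x = G x}"] eq by blast
qed

lemma states_eq_on_dense:
  assumes "closure (cspan S) = UNIV" and F: "state \<phi>" and G: "state \<psi>" and eq: "\<And>x. x \<in> S \<Longrightarrow> \<phi> x = \<psi> x"
  shows "\<phi> x = \<psi> x"
proof -
  have "closed {x. \<phi> x = \<psi> x}"
    by (intro closed_Collect_eq linear_continuous_on state_bounded_linear F G)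
  moreover have "csubspace {x. \<phi> x = \<psi> x}"
    by (auto simp: complex_vector.subspace_def state_add[OF F] state_add[OF G] state_scale[OF F] state_scale[OF G]
        state_zero[OF F] state_zero[OF G])
  ultimately show ?thesis using dense_span_induct[OF assms(1), of "{x. \<phi> x = \<psi> x}"] eq by blast
qed

lemma csubspace_closure:
  fixes V :: "'a::cstar_algebra set"
  assumes V: "csubspace V"
  shows "csubspace (closure V)"
proof -
  have "x + y \<in> closure V" if xy: "x \<in> closure V" "y \<in> closure V" for x y
  proof -
    obtain s t where "\<And>n. s n \<in> V" "s \<longlonglongrightarrow> x" "\<And>n. t n \<in> V" "t \<longlonglongrightarrow> y"
      using xy unfolding closure_sequential by blast
    then show ?thesis unfolding closure_sequential
      by (intro exI[of _ "\<lambda>n. s n + t n"] conjI allI tendsto_add complex_vector.subspace_add[OF V])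
  qed
  moreover have "c *\<^sub>C x \<in> closure V" if x: "x \<in> closure V" for c x
  proof -
    obtain s where "\<And>n. s n \<in> V" "s \<longlonglongrightarrow> x" using x unfolding closure_sequential by blast
    then show ?thesis unfolding closure_sequential
      by (intro exI[of _ "\<lambda>n. c *\<^sub>C s n"] conjI allI bounded_linear.tendsto[OF bounded_linear_scaleC]
          complex_vector.subspace_scale[OF V])
  qed
  moreover have "0 \<in> closure V" using complex_vector.subspace_0[OF V] closure_subset by blast
  ultimately show ?thesis by (simp add: complex_vector.subspace_def)
qed

lemma dense_span_star:
  fixes S :: "'a::cstar_algebra set"
  assumes "closure (cspan S) = UNIV"
  shows "closure (cspan (star ` S)) = UNIV"
proof -
  have "{x. star x \<in> closure (cspan (star ` S))} = UNIV"
  proof -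
    have sub: "csubspace (closure (cspan (star ` S)))" by (rule csubspace_closure) (rule complex_vector.subspace_span)
    have "closed {x :: 'a. star x \<in> closure (cspan (star ` S))}"
      by (rule continuous_closed_vimage[OF closed_closure, unfolded vimage_def])
        (rule linear_continuous_at[OF bounded_linear_star])
    moreover have "csubspace {x :: 'a. star x \<in> closure (cspan (star ` S))}"
      using sub by (auto simp: complex_vector.subspace_def star_add star_scaleC)
    moreover have "S \<subseteq> {x. star x \<in> closure (cspan (star ` S))}"
      by (auto intro: subsetD[OF closure_subset] complex_vector.span_base)
    ultimately show ?thesis using dense_span_induct[OF assms] by blast
  qed
  then have "star (star x) \<in> closure (cspan (star ` S))" for x by blast
  then show ?thesis by auto
qed

text \<open>Banach-Alaoglu for states: in the topology of pointwise convergence the product of the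
  discs of radius \<open>norm x\<close> is compact, all conditions in \<open>C\<close> are closed,
  and boundedness is recovered from the discs.\<close>

lemma compact_states: "compact {\<phi> :: 'a::cstar_algebra \<Rightarrow> complex. state \<phi>}"
proof -
  define K where "K = (PiE UNIV (\<lambda>x :: 'a. cball (0 :: complex) (norm x)))"
  have "compactin (product_topology (\<lambda>_. euclidean) UNIV) K"
    unfolding K_def by (simp add: compactin_PiE)
  then have K: "compact K" by (simp add: euclidean_product_topology)
  define C where "C = {\<phi> :: 'a \<Rightarrow> complex. (\<forall>x y. \<phi> (x + y) = \<phi> x + \<phi> y) \<and> (\<forall>c x. \<phi> (c *\<^sub>C x) = c * \<phi> x) \<and>
     (\<forall>x. Im (\<phi> (star x * x)) = 0 \<and> 0 \<le> Re (\<phi> (star x * x))) \<and> \<phi> 1 = 1}"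
  have ev: "continuous_on UNIV (\<lambda>\<phi> :: 'a \<Rightarrow> complex. \<phi> x)" for x
    by (rule continuous_on_product_coordinates)
  have "closed C"
    unfolding C_def
    by (intro closed_Collect_conj closed_Collect_all closed_Collect_eq closed_Collect_le continuous_intros ev)
  have "{\<phi>. state \<phi>} = K \<inter> C"
  proof (intro equalityI subsetI)
    fix \<phi> :: "'a \<Rightarrow> complex" assume "\<phi> \<in> {\<phi>. state \<phi>}"
    then have "state \<phi>" by simp
    then show "\<phi> \<in> K \<inter> C"
      by (auto simp: K_def C_def state_add state_scale state_pos state_one state_norm_le)
  next
    fix \<phi> :: "'a \<Rightarrow> complex" assume "\<phi> \<in> K \<inter> C"
    then have bd: "cmod (\<phi> x) \<le> norm x" and C: "\<phi> \<in> C" for x by (auto simp: K_def)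
    have "bounded_linear \<phi>"
    proof (rule bounded_linear_intro[where K = 1])
      show "\<phi> (x + y) = \<phi> x + \<phi> y" for x y using C by (simp add: C_def)
      show "\<phi> (r *\<^sub>R x) = r *\<^sub>R \<phi> x" for r x using C by (simp add: C_def scaleR_scaleC scaleR_conv_of_real)
    qed (simp add: bd)
    then show "\<phi> \<in> {\<phi>. state \<phi>}" using C by (simp add: C_def state_def)
  qed
  then show ?thesis using compact_Int_closed[OF K \<open>closed C\<close>] by simp
qed

lemma state_convex:
  assumes "state \<phi>" "state \<psi>" "0 \<le> t" "t \<le> 1"
  shows "state (\<lambda>x. complex_of_real t * \<phi> x + complex_of_real (1 - t) * \<psi> x)"
  unfolding state_def
proof (intro conjI allI)
  show "bounded_linear (\<lambda>x. complex_of_real t * \<phi> x + complex_of_real (1 - t) * \<psi> x)"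
    by (intro bounded_linear_add bounded_linear_const_mult state_bounded_linear assms)
  fix x
  have "0 \<le> t * Re (\<phi> (star x * x)) + (1 - t) * Re (\<psi> (star x * x))"
    by (intro add_nonneg_nonneg mult_nonneg_nonneg state_pos) (use assms in auto)
  then show "0 \<le> Re (complex_of_real t * \<phi> (star x * x) + complex_of_real (1 - t) * \<psi> (star x * x))"
    by simp
qed (use assms in \<open>simp_all add: state_scale state_pos state_one algebra_simps\<close>)

lemma prod_state_convex_left:
  assumes "state \<phi>" "state \<psi>" "state \<theta>" "0 \<le> t" "t \<le> 1"
  shows "prod_state (\<lambda>x. complex_of_real t * \<phi> x + complex_of_real (1 - t) * \<psi> x) \<theta> x =
    complex_of_real t * prod_state \<phi> \<theta> x + complex_of_real (1 - t) * prod_state \<psi> \<theta> x"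
  by (simp only: prod_state_right[OF state_convex[OF assms(1,2,4,5)] assms(3)]
      prod_state_right[OF assms(1,3)] prod_state_right[OF assms(2,3)])

lemma prod_state_convex_right:
  assumes "state \<phi>" "state \<psi>" "state \<theta>" "0 \<le> t" "t \<le> 1"
  shows "prod_state \<theta> (\<lambda>x. complex_of_real t * \<phi> x + complex_of_real (1 - t) * \<psi> x) x =
    complex_of_real t * prod_state \<theta> \<phi> x + complex_of_real (1 - t) * prod_state \<theta> \<psi> x"
  by (simp add: prod_state_def)

lemma prod_state_tensor_map:
  assumes st: "state \<phi>" "state \<psi>" and homs: "unital_star_hom f" "unital_star_hom g"
  shows "prod_state \<phi> \<psi> (tensor_map f g x) = prod_state (\<lambda>x. \<phi> (f x)) (\<lambda>x. \<psi> (g x)) x"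
proof (rule fun_cong[OF bounded_linear_tensor_eqI])
  note st' = state_unital_star_hom[OF st(1) homs(1)] state_unital_star_hom[OF st(2) homs(2)]
  show "bounded_linear (\<lambda>x. prod_state \<phi> \<psi> (tensor_map f g x))"
    by (rule state_bounded_linear[OF state_unital_star_hom[OF state_prod_state[OF st] unital_star_hom_tensor_map[OF homs]]])
  show "bounded_linear (prod_state (\<lambda>x. \<phi> (f x)) (\<lambda>x. \<psi> (g x)))"
    by (rule state_bounded_linear[OF state_prod_state[OF st']])
  show "prod_state \<phi> \<psi> (tensor_map f g (a \<otimes> b)) = prod_state (\<lambda>x. \<phi> (f x)) (\<lambda>x. \<psi> (g x)) (a \<otimes> b)" for a b
    by (simp only: tensor_map_tensor[OF homs] prod_state_tensor[OF st] prod_state_tensor[OF st'])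
qed

lemma prod_state_mult_left: "state \<phi> \<Longrightarrow> state \<psi> \<Longrightarrow> prod_state \<phi> \<psi> ((a \<otimes> 1) * x) = \<phi> (a * slice_right \<psi> x)"
  and prod_state_mult_right: "state \<phi> \<Longrightarrow> state \<psi> \<Longrightarrow> prod_state \<phi> \<psi> ((1 \<otimes> b) * x) = \<psi> (b * slice_left \<phi> x)"
  and prod_state_mult_left': "state \<phi> \<Longrightarrow> state \<psi> \<Longrightarrow> prod_state \<phi> \<psi> (x * (a \<otimes> 1)) = \<phi> (slice_right \<psi> x * a)"
  and prod_state_mult_right': "state \<phi> \<Longrightarrow> state \<psi> \<Longrightarrow> prod_state \<phi> \<psi> (x * (1 \<otimes> b)) = \<psi> (slice_left \<phi> x * b)"
  by (simp_all add: prod_state_right slice_right_mult_left slice_right_mult_right)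
    (simp_all add: prod_state_def slice_left_mult_left slice_left_mult_right flip: prod_state_right)

section \<open>Convolution of states and the existence of an invariant state\<close>

locale cqg =
  fixes \<Delta> :: "'a::{cstar_algebra, zero_neq_one} \<Rightarrow> 'a \<otimes> 'a"
  assumes cqg: "compact_quantum_group \<Delta>"
begin

lemma hom: "unital_star_hom \<Delta>"
  and coassoc: "tensor_map id \<Delta> (\<Delta> a) = tensor_assoc (tensor_map \<Delta> id (\<Delta> a))"
  and dense_right: "closure (cspan {\<Delta> a * (1 \<otimes> b) | a b. True}) = UNIV"
  and dense_left: "closure (cspan {\<Delta> a * (b \<otimes> 1) | a b. True}) = UNIV"
  using cqg by (auto simp: compact_quantum_group_def)

lemma dense_right': "closure (cspan {(1 \<otimes> b) * \<Delta> a | a b. True}) = UNIV"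
proof -
  have "star (\<Delta> a * (1 \<otimes> b)) = (1 \<otimes> star b) * \<Delta> (star a)" for a b
    by (simp add: star_mult tensor_star unital_star_hom_star[OF hom])
  then have "star ` {\<Delta> a * (1 \<otimes> b) | a b. True} \<subseteq> {(1 \<otimes> b) * \<Delta> a | a b. True}" by blast
  from closure_mono[OF complex_vector.span_mono[OF this]] show ?thesis using dense_span_star[OF dense_right] by auto
qed

lemma dense_left': "closure (cspan {(b \<otimes> 1) * \<Delta> a | a b. True}) = UNIV"
proof -
  have "star (\<Delta> a * (b \<otimes> 1)) = (star b \<otimes> 1) * \<Delta> (star a)" for a b
    by (simp add: star_mult tensor_star unital_star_hom_star[OF hom])
  then have "star ` {\<Delta> a * (b \<otimes> 1) | a b. True} \<subseteq> {(b \<otimes> 1) * \<Delta> a | a b. True}" by blast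
  from closure_mono[OF complex_vector.span_mono[OF this]] show ?thesis using dense_span_star[OF dense_left] by auto
qed

definition conv :: "('a \<Rightarrow> complex) \<Rightarrow> ('a \<Rightarrow> complex) \<Rightarrow> 'a \<Rightarrow> complex" where
  "conv \<phi> \<psi> a = prod_state \<phi> \<psi> (\<Delta> a)"

lemma state_conv: "state \<phi> \<Longrightarrow> state \<psi> \<Longrightarrow> state (conv \<phi> \<psi>)"
  unfolding conv_def[abs_def] by (rule state_unital_star_hom[OF state_prod_state hom])

lemma conv_left: "conv \<phi> \<psi> a = \<psi> (slice_left \<phi> (\<Delta> a))"
  by (simp add: conv_def prod_state_def)

lemma conv_right: "state \<phi> \<Longrightarrow> state \<psi> \<Longrightarrow> conv \<phi> \<psi> a = \<phi> (slice_right \<psi> (\<Delta> a))"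
  by (simp add: conv_def prod_state_right)

lemma conv_assoc:
  assumes "state \<phi>" "state \<psi>" "state \<theta>"
  shows "conv (conv \<phi> \<psi>) \<theta> = conv \<phi> (conv \<psi> \<theta>)"
proof
  fix a
  have "conv \<phi> (conv \<psi> \<theta>) a = prod_state \<phi> (prod_state \<psi> \<theta>) (tensor_map id \<Delta> (\<Delta> a))"
    using assms by (simp add: prod_state_tensor_map state_prod_state unital_star_hom_id hom conv_def[abs_def])
  also have "\<dots> = prod_state (prod_state \<phi> \<psi>) \<theta> (tensor_map \<Delta> id (\<Delta> a))"
    by (simp only: coassoc prod_state_tensor_assoc[OF assms])
  also have "\<dots> = conv (conv \<phi> \<psi>) \<theta> a"
    using assms by (simp add: prod_state_tensor_map state_prod_state unital_star_hom_id hom conv_def[abs_def])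
  finally show "conv (conv \<phi> \<psi>) \<theta> a = conv \<phi> (conv \<psi> \<theta>) a" by simp
qed

lemma slice_right_slice_right:
  assumes "state \<phi>" "state \<psi>"
  shows "slice_right \<phi> (\<Delta> (slice_right \<psi> (\<Delta> a))) = slice_right (conv \<phi> \<psi>) (\<Delta> a)"
proof (rule states_eqI)
  fix \<sigma> :: "'a \<Rightarrow> complex" assume \<sigma>: "state \<sigma>"
  have "\<sigma> (slice_right \<phi> (\<Delta> (slice_right \<psi> (\<Delta> a)))) = conv (conv \<sigma> \<phi>) \<psi> a"
    using \<sigma> assms by (simp add: conv_right[OF state_conv] conv_right[OF \<sigma>])
  then show "\<sigma> (slice_right \<phi> (\<Delta> (slice_right \<psi> (\<Delta> a)))) = \<sigma> (slice_right (conv \<phi> \<psi>) (\<Delta> a))"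
    using \<sigma> assms by (simp add: conv_assoc conv_right state_conv)
qed

lemma slice_left_slice_left:
  assumes "state \<phi>" "state \<psi>"
  shows "slice_left \<phi> (\<Delta> (slice_left \<psi> (\<Delta> a))) = slice_left (conv \<psi> \<phi>) (\<Delta> a)"
proof (rule states_eqI)
  fix \<sigma> :: "'a \<Rightarrow> complex" assume \<sigma>: "state \<sigma>"
  have "\<sigma> (slice_left \<phi> (\<Delta> (slice_left \<psi> (\<Delta> a)))) = conv \<psi> (conv \<phi> \<sigma>) a"
    by (simp add: conv_left)
  then show "\<sigma> (slice_left \<phi> (\<Delta> (slice_left \<psi> (\<Delta> a)))) = \<sigma> (slice_left (conv \<psi> \<phi>) (\<Delta> a))"
    using \<sigma> assms by (simp flip: conv_assoc add: conv_left)
qed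

text \<open>For \<open>b = (id \<otimes> h)\<Delta>(a)\<close> invariance under \<open>\<omega>\<close> gives \<open>(h \<otimes> \<omega>)(Y\<^sup>* Y) = 0\<close> with
\<open>Y = \<Delta>(b) - b \<otimes> 1\<close>, and this passes to the summands of a convex combination \<open>\<omega>\<close>.\<close>

lemma invariant_convex_right:
  assumes h: "state h" and \<rho>: "state \<rho>" and \<rho>': "state \<rho>'"
  defines "\<omega> \<equiv> \<lambda>x. complex_of_real (1/2) * \<rho> x + complex_of_real (1 - 1/2) * \<rho>' x"
  assumes inv: "conv \<omega> h = h" "conv h \<omega> = h"
  shows "conv \<rho> h = h" "conv \<rho>' h = h"
proof -
  have \<omega>: "state \<omega>" unfolding \<omega>_def by (rule state_convex) (use \<rho> \<rho>' in auto)
  have zero: "prod_state h \<rho> (star Y * Y) = 0 \<and> prod_state h \<rho>' (star Y * Y) = 0"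
    if Y: "Y = \<Delta> b - b \<otimes> 1" and b: "b = slice_right h (\<Delta> a)" for a b Y
  proof -
    have sb: "slice_right \<omega> (\<Delta> b) = b" unfolding b using slice_right_slice_right[OF \<omega> h] inv by simp
    have "star Y * Y = \<Delta> (star b * b) - star (\<Delta> b) * (b \<otimes> 1) - (star b \<otimes> 1) * \<Delta> b + (star b * b) \<otimes> 1"
      unfolding Y by (simp add: star_diff tensor_star left_diff_distrib right_diff_distrib tensor_mult
          unital_star_hom_mult[OF hom] unital_star_hom_star[OF hom] algebra_simps)
    moreover have "prod_state h \<omega> (\<Delta> (star b * b)) = h (star b * b)"
      using inv(2) by (simp flip: conv_def)
    moreover have "prod_state h \<omega> (star (\<Delta> b) * (b \<otimes> 1)) = h (star b * b)"
      using h \<omega> by (simp add: prod_state_mult_left' slice_right_star sb)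
    moreover have "prod_state h \<omega> ((star b \<otimes> 1) * \<Delta> b) = h (star b * b)"
      using h \<omega> by (simp add: prod_state_mult_left sb)
    moreover have "prod_state h \<omega> ((star b * b) \<otimes> 1) = h (star b * b)"
      using h \<omega> by (simp add: state_one)
    ultimately have "prod_state h \<omega> (star Y * Y) = 0"
      using state_prod_state[OF h \<omega>] by (simp add: state_add state_diff)
    then have sum: "complex_of_real (1/2) * prod_state h \<rho> (star Y * Y) + complex_of_real (1 - 1/2) * prod_state h \<rho>' (star Y * Y) = 0"
      unfolding \<omega>_def by (subst (asm) prod_state_convex_right) (use h \<rho> \<rho>' in auto)
    show ?thesis
      using arg_cong[OF sum, of Re] state_pos[OF state_prod_state[OF h \<rho>], of Y] state_pos[OF state_prod_state[OF h \<rho>'], of Y]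
      by (auto simp: complex_eq_iff)
  qed
  have main: "conv \<sigma> h = h" if \<sigma>: "state \<sigma>"
    and z: "\<And>a b Y. Y = \<Delta> b - b \<otimes> 1 \<Longrightarrow> b = slice_right h (\<Delta> a) \<Longrightarrow> prod_state h \<sigma> (star Y * Y) = 0" for \<sigma>
  proof
    fix x
    note st = state_conv[OF \<sigma> h]
    \<comment> \<open>The vanishing of \<open>prod_state h \<sigma> (star Y * Y)\<close> gives
      equality only against elements (c \<otimes> 1)\<Delta>(a). Their span is dense, so the
      equality extends to 1 \<otimes> x, where the first leg disappears.\<close>
    have "prod_state h (conv \<sigma> h) y = prod_state h h y" for y
    proof (rule states_eq_on_dense[OF dense_left' state_prod_state[OF h st] state_prod_state[OF h h]])
      fix y assume "y \<in> {(b \<otimes> 1) * \<Delta> a | a b. True}"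
      then obtain a c where y: "y = (c \<otimes> 1) * \<Delta> a" by blast
      define b where "b = slice_right h (\<Delta> a)"
      have "prod_state h \<sigma> (star (star c \<otimes> 1) * (\<Delta> b - b \<otimes> 1)) = 0"
        by (rule state_nonneg_eq_0(2)[OF state_prod_state[OF h \<sigma>] z[OF refl b_def]])
      then have "prod_state h \<sigma> ((c \<otimes> 1) * \<Delta> b) = prod_state h \<sigma> ((c \<otimes> 1) * (b \<otimes> 1))"
        using state_prod_state[OF h \<sigma>] by (simp add: tensor_star right_diff_distrib state_diff)
      then have "h (c * slice_right \<sigma> (\<Delta> b)) = h (c * b)"
        using h \<sigma> by (simp add: prod_state_mult_left tensor_mult state_one)
      then show "prod_state h (conv \<sigma> h) y = prod_state h h y"
        using h \<sigma> st unfolding y b_def by (simp add: prod_state_mult_left slice_right_slice_right)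
    qed
    from this[of "1 \<otimes> x"] show "conv \<sigma> h x = h x" using h st by (simp add: state_one)
  qed
  show "conv \<rho> h = h" "conv \<rho>' h = h" using main[OF \<rho>] main[OF \<rho>'] zero by blast+
qed

text \<open>Mirror image of the preceding lemma, with left slices, Y = \<Delta>(b) - 1 \<otimes> b
  and the other density condition.\<close>

lemma invariant_convex_left:
  assumes h: "state h" and \<rho>: "state \<rho>" and \<rho>': "state \<rho>'"
  defines "\<omega> \<equiv> \<lambda>x. complex_of_real (1/2) * \<rho> x + complex_of_real (1 - 1/2) * \<rho>' x"
  assumes inv: "conv \<omega> h = h" "conv h \<omega> = h"
  shows "conv h \<rho> = h" "conv h \<rho>' = h"
proof -
  have \<omega>: "state \<omega>" unfolding \<omega>_def by (rule state_convex) (use \<rho> \<rho>' in auto)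
  have zero: "prod_state \<rho> h (star Y * Y) = 0 \<and> prod_state \<rho>' h (star Y * Y) = 0"
    if Y: "Y = \<Delta> b - 1 \<otimes> b" and b: "b = slice_left h (\<Delta> a)" for a b Y
  proof -
    have sb: "slice_left \<omega> (\<Delta> b) = b" unfolding b using slice_left_slice_left[OF \<omega> h] inv by simp
    have "star Y * Y = \<Delta> (star b * b) - star (\<Delta> b) * (1 \<otimes> b) - (1 \<otimes> star b) * \<Delta> b + 1 \<otimes> (star b * b)"
      unfolding Y by (simp add: star_diff tensor_star left_diff_distrib right_diff_distrib tensor_mult
          unital_star_hom_mult[OF hom] unital_star_hom_star[OF hom] algebra_simps)
    moreover have "prod_state \<omega> h (\<Delta> (star b * b)) = h (star b * b)"
      using inv(1) by (simp flip: conv_def)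
    moreover have "prod_state \<omega> h (star (\<Delta> b) * (1 \<otimes> b)) = h (star b * b)"
      using h \<omega> by (simp add: prod_state_mult_right' slice_left_star sb)
    moreover have "prod_state \<omega> h ((1 \<otimes> star b) * \<Delta> b) = h (star b * b)"
      using h \<omega> by (simp add: prod_state_mult_right sb)
    moreover have "prod_state \<omega> h (1 \<otimes> (star b * b)) = h (star b * b)"
      using h \<omega> by (simp add: state_one)
    ultimately have "prod_state \<omega> h (star Y * Y) = 0"
      using state_prod_state[OF \<omega> h] by (simp add: state_add state_diff)
    then have sum: "complex_of_real (1/2) * prod_state \<rho> h (star Y * Y) + complex_of_real (1 - 1/2) * prod_state \<rho>' h (star Y * Y) = 0"
      unfolding \<omega>_def by (subst (asm) prod_state_convex_left) (use h \<rho> \<rho>' in auto)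
    show ?thesis
      using arg_cong[OF sum, of Re] state_pos[OF state_prod_state[OF \<rho> h], of Y] state_pos[OF state_prod_state[OF \<rho>' h], of Y]
      by (auto simp: complex_eq_iff)
  qed
  have main: "conv h \<sigma> = h" if \<sigma>: "state \<sigma>"
    and z: "\<And>a b Y. Y = \<Delta> b - 1 \<otimes> b \<Longrightarrow> b = slice_left h (\<Delta> a) \<Longrightarrow> prod_state \<sigma> h (star Y * Y) = 0" for \<sigma>
  proof
    fix x
    note st = state_conv[OF h \<sigma>]
    have "prod_state (conv h \<sigma>) h y = prod_state h h y" for y
    proof (rule states_eq_on_dense[OF dense_right' state_prod_state[OF st h] state_prod_state[OF h h]])
      fix y assume "y \<in> {(1 \<otimes> b) * \<Delta> a | a b. True}"
      then obtain a c where y: "y = (1 \<otimes> c) * \<Delta> a" by blast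
      define b where "b = slice_left h (\<Delta> a)"
      have "prod_state \<sigma> h (star (1 \<otimes> star c) * (\<Delta> b - 1 \<otimes> b)) = 0"
        by (rule state_nonneg_eq_0(2)[OF state_prod_state[OF \<sigma> h] z[OF refl b_def]])
      then have "prod_state \<sigma> h ((1 \<otimes> c) * \<Delta> b) = prod_state \<sigma> h ((1 \<otimes> c) * (1 \<otimes> b))"
        using state_prod_state[OF \<sigma> h] by (simp add: tensor_star right_diff_distrib state_diff)
      then have "h (c * slice_left \<sigma> (\<Delta> b)) = h (c * b)"
        using h \<sigma> by (simp add: prod_state_mult_right tensor_mult state_one)
      then show "prod_state (conv h \<sigma>) h y = prod_state h h y"
        using h \<sigma> st unfolding y b_def by (simp add: prod_state_mult_right slice_left_slice_left)
    qed
    from this[of "x \<otimes> 1"] show "conv h \<sigma> x = h x" using h st by (simp add: state_one)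
  qed
  show "conv h \<rho> = h" "conv h \<rho>' = h" using main[OF \<rho>] main[OF \<rho>'] zero by blast+
qed

text \<open>Mean ergodic argument: convolution with \<omega> moves the mean of the first n + 1
  convolution powers by at most 2/(n + 1) in norm, on either side, so a pointwise cluster point of
  the means is invariant.\<close>

lemma invariant_state_exists:
  assumes \<omega>: "state \<omega>"
  shows "\<exists>h. state h \<and> conv \<omega> h = h \<and> conv h \<omega> = h"
proof -
  define W where "W = rec_nat \<omega> (\<lambda>_ \<phi>. conv \<omega> \<phi>)"
  have W: "W 0 = \<omega>" "W (Suc n) = conv \<omega> (W n)" for n by (simp_all add: W_def)
  have stW: "state (W n)" for n by (induction n) (auto simp: W \<omega> state_conv)
  have W': "W (Suc n) = conv (W n) \<omega>" for n
  proof (induction n)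
    case (Suc n)
    then show ?case using conv_assoc[OF \<omega> stW[of n] \<omega>] by (simp add: W)
  qed (simp add: W)
  define A where "A n x = (\<Sum>k\<le>n. W k x) / of_nat (Suc n)" for n x
  have stA: "state (A n)" for n
    unfolding state_def
  proof (intro conjI allI)
    show "bounded_linear (A n)"
      unfolding A_def by (intro bounded_linear_compose[OF bounded_linear_divide] bounded_linear_sum state_bounded_linear stW)
    show "A n (c *\<^sub>C x) = c * A n x" for c x
      by (simp add: A_def state_scale[OF stW] sum_distrib_left)
    fix x
    have "A n (star x * x) = complex_of_real ((\<Sum>k\<le>n. (seminorm2 (W k) x)\<^sup>2) / real (Suc n))"
      by (simp add: A_def state_star_mult_eq[OF stW])
    then show "Im (A n (star x * x)) = 0" "0 \<le> Re (A n (star x * x))" by (simp_all add: sum_nonneg del: of_real_divide)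
    show "A n 1 = 1" unfolding A_def state_one[OF stW] by (simp del: of_nat_Suc)
  qed
  have Wn: "cmod (W n x) \<le> norm x" for n x by (rule state_norm_le[OF stW])
  have telescope: "cmod (A n y - A n x) \<le> 2 * norm x / real (Suc n)"
    if "\<And>k. W k y = W (Suc k) x" for n x y
  proof -
    have "(\<Sum>k\<le>n. W k y) - (\<Sum>k\<le>n. W k x) = W (Suc n) x - W 0 x"
      unfolding that by (induction n) (auto simp: algebra_simps)
    then have "A n y - A n x = (W (Suc n) x - W 0 x) / of_nat (Suc n)" by (simp only: A_def diff_divide_distrib[symmetric])
    then have "cmod (A n y - A n x) = cmod (W (Suc n) x - W 0 x) / real (Suc n)" by (simp only: norm_divide norm_of_nat)
    also have "cmod (W (Suc n) x - W 0 x) \<le> 2 * norm x"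
      using norm_triangle_ineq4[of "W (Suc n) x" "W 0 x"] Wn[of "Suc n" x] Wn[of 0 x] by linarith
    finally show ?thesis by (simp add: divide_right_mono)
  qed
  \<comment> \<open>\<open>T n\<close> collects the functionals invariant up to 2/(n + 1). These
    sets are closed and contain all later means, so the finite intersection property gives a common
    point without choosing a subnet.\<close>
  define T where "T n = {\<phi> :: 'a \<Rightarrow> complex. (\<forall>a. cmod (\<phi> (slice_left \<omega> (\<Delta> a)) - \<phi> a) \<le> 2 * norm a / real (Suc n)) \<and>
     (\<forall>a. cmod (\<phi> (slice_right \<omega> (\<Delta> a)) - \<phi> a) \<le> 2 * norm a / real (Suc n))}" for n
  have AT: "A m \<in> T n" if "n \<le> m" for m n
  proof -
    have "2 * norm a / real (Suc m) \<le> 2 * norm a / real (Suc n)" for a :: 'a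
      using that by (intro divide_left_mono) auto
    moreover have "cmod (A m (slice_left \<omega> (\<Delta> a)) - A m a) \<le> 2 * norm a / real (Suc m)" for a
      by (rule telescope) (simp add: W conv_left)
    moreover have "cmod (A m (slice_right \<omega> (\<Delta> a)) - A m a) \<le> 2 * norm a / real (Suc m)" for a
      by (rule telescope) (simp add: W' conv_right[OF stW \<omega>])
    ultimately show ?thesis unfolding T_def using order_trans by blast
  qed
  have ev: "continuous_on UNIV (\<lambda>\<phi> :: 'a \<Rightarrow> complex. \<phi> x)" for x
    by (rule continuous_on_product_coordinates)
  have "{\<phi>. state \<phi>} \<inter> \<Inter>(range T) \<noteq> {}"
  proof (rule compact_imp_fip[OF compact_states])
    show "closed S" if "S \<in> range T" for S
      using that unfolding T_def
      by (auto intro!: closed_Collect_conj closed_Collect_all closed_Collect_le continuous_intros ev)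
    fix F assume F: "finite F" "F \<subseteq> range T"
    then obtain N where N: "finite N" "F = T ` N" by (meson finite_subset_image)
    have "A (Max (insert 0 N)) \<in> T n" if "n \<in> N" for n using N that by (intro AT) simp
    then show "{\<phi>. state \<phi>} \<inter> \<Inter>F \<noteq> {}" using N(2) stA by blast
  qed
  then obtain h where h: "state h" "\<And>n. h \<in> T n" by auto
  have small: "z = 0" if "\<And>n. cmod z \<le> c / real (Suc n)" for z c
  proof -
    have "(\<lambda>n. c / real (Suc n)) \<longlonglongrightarrow> 0"
      using tendsto_mult[OF tendsto_const LIMSEQ_inverse_real_of_nat, of c] by (simp add: divide_inverse)
    then have "cmod z \<le> 0"
      by (rule LIMSEQ_le_const) (use that in blast)
    then show ?thesis by simp
  qed
  have "h (slice_left \<omega> (\<Delta> a)) - h a = 0" "h (slice_right \<omega> (\<Delta> a)) - h a = 0" for a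
    by (rule small[of _ "2 * norm a"], use h(2) in \<open>simp add: T_def\<close>)+
  then have "conv \<omega> h = h" "conv h \<omega> = h"
    using h \<omega> by (auto simp: conv_left fun_eq_iff) (simp flip: conv_left add: conv_right)
  then show ?thesis using h by blast
qed

text \<open>A state invariant under the midpoint of two states is invariant under both. Iterated
  midpoints therefore handle finitely many states at once, and compactness of the state space gives
  one state invariant under all of them.\<close>

theorem haar_state_exists: "\<exists>h. haar_state \<Delta> h"
proof -
  define M where "M \<omega> = {\<phi> :: 'a \<Rightarrow> complex. (\<forall>a. \<phi> (slice_left \<omega> (\<Delta> a)) = \<phi> a) \<and> (\<forall>a. \<phi> (slice_right \<omega> (\<Delta> a)) = \<phi> a)}" for \<omega>
  have M: "h \<in> M \<omega> \<longleftrightarrow> conv \<omega> h = h \<and> conv h \<omega> = h" if "state h" "state \<omega>" for h \<omega>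
    using that by (auto simp: M_def conv_left fun_eq_iff) (auto simp flip: conv_left simp: conv_right)
  have ev: "continuous_on UNIV (\<lambda>\<phi> :: 'a \<Rightarrow> complex. \<phi> x)" for x
    by (rule continuous_on_product_coordinates)
  obtain \<omega>0 :: "'a \<Rightarrow> complex" where \<omega>0: "state \<omega>0"
    by (rule norming_state[OF one_neq_zero])
  have "{\<phi>. state \<phi>} \<inter> \<Inter>(M ` {\<phi>. state \<phi>}) \<noteq> {}"
  proof (rule compact_imp_fip[OF compact_states])
    show "closed S" if "S \<in> M ` {\<phi>. state \<phi>}" for S
      using that unfolding M_def
      by (auto intro!: closed_Collect_conj closed_Collect_all closed_Collect_eq continuous_intros ev)
    fix F assume "finite F" "F \<subseteq> M ` {\<phi>. state \<phi>}"
    then obtain N where N: "finite N" "N \<subseteq> {\<phi>. state \<phi>}" "F = M ` N" by (meson finite_subset_image)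
    from N(1,2) have "\<exists>\<omega>. state \<omega> \<and> (\<forall>h. state h \<longrightarrow> h \<in> M \<omega> \<longrightarrow> (\<forall>\<rho>\<in>N. h \<in> M \<rho>))"
    proof (induction rule: finite_induct)
      case empty then show ?case using \<omega>0 by auto
    next
      case (insert \<rho> N)
      then obtain \<omega> where \<omega>: "state \<omega>" "\<And>h. state h \<Longrightarrow> h \<in> M \<omega> \<Longrightarrow> \<forall>\<rho>\<in>N. h \<in> M \<rho>" by auto
      have \<rho>: "state \<rho>" using insert by simp
      define \<omega>' where "\<omega>' = (\<lambda>x. complex_of_real (1/2) * \<rho> x + complex_of_real (1 - 1/2) * \<omega> x)"
      have st: "state \<omega>'" unfolding \<omega>'_def by (rule state_convex) (use \<rho> \<omega> in auto)
      have "h \<in> M \<rho> \<and> h \<in> M \<omega>" if h: "state h" "h \<in> M \<omega>'" for h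
        using invariant_convex_right[OF h(1) \<rho> \<omega>(1)] invariant_convex_left[OF h(1) \<rho> \<omega>(1)] h(2)
        unfolding M[OF h(1) \<rho>] M[OF h(1) \<omega>(1)] M[OF h(1) st] unfolding \<omega>'_def by blast
      then show ?case using st \<omega>(2) by (intro exI[of _ \<omega>']) blast
    qed
    then obtain \<omega> where \<omega>: "state \<omega>" "\<And>h. state h \<Longrightarrow> h \<in> M \<omega> \<Longrightarrow> \<forall>\<rho>\<in>N. h \<in> M \<rho>" by blast
    obtain h where "state h" "h \<in> M \<omega>" using invariant_state_exists[OF \<omega>(1)] M[OF _ \<omega>(1)] by blast
    then show "{\<phi>. state \<phi>} \<inter> \<Inter>F \<noteq> {}" using \<omega>(2) N(3) by blast
  qed
  then obtain h where h: "state h" "\<And>\<omega>. state \<omega> \<Longrightarrow> h \<in> M \<omega>" by auto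
  have "slice_left h (\<Delta> a) = h a *\<^sub>C 1" for a
  proof (rule states_eqI)
    fix \<omega> :: "'a \<Rightarrow> complex" assume \<omega>: "state \<omega>"
    have "conv h \<omega> a = h a" using h(2)[OF \<omega>] M[OF h(1) \<omega>] by simp
    then show "\<omega> (slice_left h (\<Delta> a)) = \<omega> (h a *\<^sub>C 1)" using \<omega> by (simp add: conv_left state_scale state_one)
  qed
  moreover have "slice_right h (\<Delta> a) = h a *\<^sub>C 1" for a
  proof (rule states_eqI)
    fix \<omega> :: "'a \<Rightarrow> complex" assume \<omega>: "state \<omega>"
    have "conv \<omega> h a = h a" using h(2)[OF \<omega>] M[OF h(1) \<omega>] by simp
    then show "\<omega> (slice_right h (\<Delta> a)) = \<omega> (h a *\<^sub>C 1)" using \<omega> h(1) by (simp add: conv_right state_scale state_one)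
  qed
  ultimately show ?thesis unfolding haar_state_def using h(1) by blast
qed

end

section \<open>Finite-dimensional corepresentations\<close>

lemma compact_closure_approx:
  fixes S :: "'a::banach set"
  assumes "\<And>e. 0 < e \<Longrightarrow> \<exists>K. compact K \<and> (\<forall>x\<in>S. \<exists>y\<in>K. dist x y < e)"
  shows "compact (closure S)"
proof -
  have "\<exists>k. finite k \<and> closure S \<subseteq> (\<Union>x\<in>k. ball x e)" if e: "0 < e" for e
  proof -
    obtain K where K: "compact K" "\<And>x. x \<in> S \<Longrightarrow> \<exists>y\<in>K. dist x y < e / 4" using assms[of "e / 4"] e by auto
    obtain k where k: "finite k" "K \<subseteq> (\<Union>x\<in>k. ball x (e / 4))"
      using K(1) e unfolding compact_eq_totally_bounded by (metis zero_less_divide_iff zero_less_numeral)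
    have "S \<subseteq> (\<Union>x\<in>k. cball x (e / 2))"
    proof
      fix x assume "x \<in> S"
      then obtain y where y: "y \<in> K" "dist x y < e / 4" using K(2) by blast
      then obtain z where z: "z \<in> k" "dist z y < e / 4" using k(2) by auto
      have "dist z x \<le> e / 2" using dist_triangle[of z x y] y z by (simp add: dist_commute)
      then show "x \<in> (\<Union>x\<in>k. cball x (e / 2))" using z by auto
    qed
    moreover have "closed (\<Union>x\<in>k. cball x (e / 2))" using k by (intro closed_UN) auto
    ultimately have "closure S \<subseteq> (\<Union>x\<in>k. cball x (e / 2))" by (rule closure_minimal)
    also have "\<dots> \<subseteq> (\<Union>x\<in>k. ball x e)" using e by fastforce
    finally show ?thesis using k(1) by blast
  qed
  then show ?thesis unfolding compact_eq_totally_bounded by (simp add: complete_eq_closed)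
qed

lemma compact_combinations:
  fixes xs :: "('b \<times> 'a::cstar_algebra) list"
  shows "\<exists>K. compact K \<and> (\<forall>c. (\<forall>p\<in>set xs. cmod (c (fst p)) \<le> M (fst p)) \<longrightarrow> (\<Sum>(s, t)\<leftarrow>xs. c s *\<^sub>C t) \<in> K)"
proof (induction xs)
  case Nil
  show ?case by (intro exI[of _ "{0}"]) auto
next
  case (Cons p xs)
  then obtain K where K: "compact K"
    "\<And>c. (\<forall>p\<in>set xs. cmod (c (fst p)) \<le> M (fst p)) \<Longrightarrow> (\<Sum>(s, t)\<leftarrow>xs. c s *\<^sub>C t) \<in> K" by blast
  define K' where "K' = (\<lambda>c. c *\<^sub>C snd p) ` cball 0 (M (fst p))"
  have bl: "bounded_linear (\<lambda>c. c *\<^sub>C snd p)"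
    by (rule bounded_linear_intro[where K = "norm (snd p)"])
      (auto simp: scaleC_add_left norm_scaleC scaleR_scaleC scaleC_scaleC scaleR_conv_of_real)
  have "compact K'"
    unfolding K'_def by (intro compact_continuous_image linear_continuous_on bl compact_cball)
  then have "compact {x + y | x y. x \<in> K' \<and> y \<in> K}" by (rule compact_sums) (rule K)
  moreover have "(\<Sum>(s, t)\<leftarrow>p # xs. c s *\<^sub>C t) \<in> {x + y | x y. x \<in> K' \<and> y \<in> K}"
    if "\<forall>p\<in>set (p # xs). cmod (c (fst p)) \<le> M (fst p)" for c
  proof -
    have "c (fst p) *\<^sub>C snd p \<in> K'" unfolding K'_def using that by (intro imageI) simp
    then show ?thesis using K(2)[of c] that by (auto simp: case_prod_unfold)
  qed
  ultimately show ?case by blast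
qed

text \<open>Cauchy-Schwarz with a state norming the slice. The estimate is mixed: the pre-Hilbert
  seminorm of \<open>b\<close> controls the algebra norm of the result, and this is what later lets
  eigenvectors converge in norm.\<close>

lemma norm_slice_right_mult_le:
  fixes x :: "'a::cstar_algebra \<otimes> 'b::cstar_algebra"
  assumes st: "state \<psi>"
  shows "norm (slice_right \<psi> (x * (1 \<otimes> b))) \<le> norm x * seminorm2 \<psi> b"
proof (cases "(1 :: 'a) = 0")
  case True
  then have "y = 0" for y :: 'a by (metis mult_1 mult_zero_left)
  then show ?thesis by (metis norm_zero mult_nonneg_nonneg norm_ge_zero seminorm2_nonneg[OF st])
next
  case False
  define c where "c = slice_right \<psi> (x * (1 \<otimes> b))"
  obtain \<phi> where \<phi>: "state \<phi>" "\<phi> (star c * c) = complex_of_real ((norm c)\<^sup>2)" using norming_state[OF False] by blast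
  note s = state_prod_state[OF \<phi>(1) st]
  have n: "seminorm2 (prod_state \<phi> \<psi>) (1 \<otimes> b) = seminorm2 \<psi> b"
    using \<phi> st by (simp add: seminorm2_def tensor_star tensor_mult state_one)
  have "complex_of_real ((norm c)\<^sup>2) = prod_state \<phi> \<psi> (star (star x * (c \<otimes> 1)) * (1 \<otimes> b))"
    using \<phi> st prod_state_mult_left[OF \<phi>(1) st, of "star c" "x * (1 \<otimes> b)"]
    by (simp add: c_def[symmetric] star_mult tensor_star mult.assoc)
  then have "(norm c)\<^sup>2 \<le> seminorm2 (prod_state \<phi> \<psi>) (star x * (c \<otimes> 1)) * seminorm2 \<psi> b"
    using state_cauchy_schwarz[OF s, of "star x * (c \<otimes> 1)" "1 \<otimes> b"] unfolding n
    by (metis norm_of_real abs_of_nonneg zero_le_power2)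
  also have "\<dots> \<le> (norm x * norm c) * seminorm2 \<psi> b"
  proof (intro mult_right_mono)
    have "seminorm2 (prod_state \<phi> \<psi>) (star x * (c \<otimes> 1)) \<le> norm (star x) * seminorm2 (prod_state \<phi> \<psi>) (c \<otimes> 1)"
      by (rule seminorm2_mult_le[OF s])
    also have "seminorm2 (prod_state \<phi> \<psi>) (c \<otimes> 1) = seminorm2 \<phi> c"
      using \<phi> st by (simp add: seminorm2_def tensor_star tensor_mult state_one)
    also have "norm (star x) * seminorm2 \<phi> c \<le> norm x * norm c"
      using seminorm2_le_norm[OF \<phi>(1)] by (simp add: mult_left_mono)
    finally show "seminorm2 (prod_state \<phi> \<psi>) (star x * (c \<otimes> 1)) \<le> norm x * norm c" .
  qed (simp add: st)
  finally have "norm c * norm c \<le> (norm x * seminorm2 \<psi> b) * norm c" by (simp add: power2_eq_square mult.commute mult.left_commute)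
  then show ?thesis unfolding c_def[symmetric]
    by (cases "norm c = 0") (auto simp: st)
qed

lemma norm_slice_left_mult_le:
  fixes x :: "'a::cstar_algebra \<otimes> 'b::cstar_algebra"
  assumes st: "state \<phi>"
  shows "norm (slice_left \<phi> (x * (a \<otimes> 1))) \<le> norm x * seminorm2 \<phi> a"
proof (cases "(1 :: 'b) = 0")
  case True
  then have "y = 0" for y :: 'b by (metis mult_1 mult_zero_left)
  then show ?thesis by (metis norm_zero mult_nonneg_nonneg norm_ge_zero seminorm2_nonneg[OF st])
next
  case False
  define c where "c = slice_left \<phi> (x * (a \<otimes> 1))"
  obtain \<psi> where \<psi>: "state \<psi>" "\<psi> (star c * c) = complex_of_real ((norm c)\<^sup>2)" using norming_state[OF False] by blast
  note s = state_prod_state[OF st \<psi>(1)]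
  have n: "seminorm2 (prod_state \<phi> \<psi>) (a \<otimes> 1) = seminorm2 \<phi> a"
    using \<psi> st by (simp add: seminorm2_def tensor_star tensor_mult state_one)
  have "complex_of_real ((norm c)\<^sup>2) = prod_state \<phi> \<psi> (star (star x * (1 \<otimes> c)) * (a \<otimes> 1))"
    using \<psi> st prod_state_mult_right[OF st \<psi>(1), of "star c" "x * (a \<otimes> 1)"]
    by (simp add: c_def[symmetric] star_mult tensor_star mult.assoc)
  then have "(norm c)\<^sup>2 \<le> seminorm2 (prod_state \<phi> \<psi>) (star x * (1 \<otimes> c)) * seminorm2 \<phi> a"
    using state_cauchy_schwarz[OF s, of "star x * (1 \<otimes> c)" "a \<otimes> 1"] unfolding n
    by (metis norm_of_real abs_of_nonneg zero_le_power2)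
  also have "\<dots> \<le> (norm x * norm c) * seminorm2 \<phi> a"
  proof (intro mult_right_mono)
    have "seminorm2 (prod_state \<phi> \<psi>) (star x * (1 \<otimes> c)) \<le> norm (star x) * seminorm2 (prod_state \<phi> \<psi>) (1 \<otimes> c)"
      by (rule seminorm2_mult_le[OF s])
    also have "seminorm2 (prod_state \<phi> \<psi>) (1 \<otimes> c) = seminorm2 \<psi> c"
      using \<psi> st by (simp add: seminorm2_def tensor_star tensor_mult state_one)
    also have "norm (star x) * seminorm2 \<psi> c \<le> norm x * norm c"
      using seminorm2_le_norm[OF \<psi>(1)] by (simp add: mult_left_mono)
    finally show "seminorm2 (prod_state \<phi> \<psi>) (star x * (1 \<otimes> c)) \<le> norm x * norm c" .
  qed (simp add: st)
  finally have "norm c * norm c \<le> (norm x * seminorm2 \<phi> a) * norm c" by (simp add: power2_eq_square mult.commute mult.left_commute)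
  then show ?thesis unfolding c_def[symmetric]
    by (cases "norm c = 0") (auto simp: st)
qed

text \<open>If \<open>x\<close> is replaced by a finite sum of elementary tensors, the operator has
  finite rank and bounded coefficients. By \<open>norm_slice_left_mult_le\<close> the error of the
  replacement is uniform on seminorm balls, so the image is totally bounded.\<close>

lemma compact_slice_left:
  fixes x :: "'a::cstar_algebra \<otimes> 'b::cstar_algebra"
  assumes st: "state \<phi>"
  shows "compact (closure {slice_left \<phi> (x * (a \<otimes> 1)) | a. seminorm2 \<phi> a \<le> r})"
proof (rule compact_closure_approx)
  fix e :: real assume e: "0 < e"
  obtain s where s: "(\<lambda>n. \<Sum>(a, b)\<leftarrow>s n. a \<otimes> b) \<longlonglongrightarrow> x" using tensor_limit[of x] by (elim exE)
  have "0 < e / (\<bar>r\<bar> + 1)" using e by (simp add: pos_divide_less_eq)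
  then obtain n where n: "norm ((\<Sum>(a, b)\<leftarrow>s n. a \<otimes> b) - x) < e / (\<bar>r\<bar> + 1)"
    using LIMSEQ_D[OF s] by blast
  define X where "X = (\<Sum>(a, b)\<leftarrow>s n. a \<otimes> b)"
  obtain K where K: "compact K"
    "\<And>c. (\<forall>p\<in>set (s n). cmod (c (fst p)) \<le> seminorm2 \<phi> (star (fst p)) * \<bar>r\<bar>) \<Longrightarrow> (\<Sum>(u, t)\<leftarrow>s n. c u *\<^sub>C t) \<in> K"
    using compact_combinations[of "s n" "\<lambda>u. seminorm2 \<phi> (star u) * \<bar>r\<bar>"] by blast
  have "\<exists>y\<in>K. dist (slice_left \<phi> (x * (a \<otimes> 1))) y < e" if a: "seminorm2 \<phi> a \<le> r" for a
  proof (rule bexI)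
    have "slice_left \<phi> ((\<Sum>(a, b)\<leftarrow>zs. a \<otimes> b) * (a \<otimes> 1)) = (\<Sum>(u, t)\<leftarrow>zs. \<phi> (u * a) *\<^sub>C t)" for zs :: "('a \<times> 'b) list"
      by (induction zs) (auto simp: distrib_right bounded_clinear_add[OF slice_left_clinear[OF st]]
          bounded_clinear_zero[OF slice_left_clinear[OF st]] tensor_mult st)
    then have "slice_left \<phi> (X * (a \<otimes> 1)) = (\<Sum>(u, t)\<leftarrow>s n. \<phi> (u * a) *\<^sub>C t)" by (simp add: X_def)
    moreover have "\<forall>p\<in>set (s n). cmod (\<phi> (fst p * a)) \<le> seminorm2 \<phi> (star (fst p)) * \<bar>r\<bar>"
    proof
      fix p
      have "cmod (\<phi> (fst p * a)) \<le> seminorm2 \<phi> (star (fst p)) * seminorm2 \<phi> a"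
        using state_cauchy_schwarz[OF st, of "star (fst p)" a] by simp
      also have "\<dots> \<le> seminorm2 \<phi> (star (fst p)) * \<bar>r\<bar>" using a by (intro mult_left_mono) (auto simp: st)
      finally show "cmod (\<phi> (fst p * a)) \<le> seminorm2 \<phi> (star (fst p)) * \<bar>r\<bar>" .
    qed
    ultimately show "slice_left \<phi> (X * (a \<otimes> 1)) \<in> K" using K(2)[of "\<lambda>u. \<phi> (u * a)"] by simp
    have "dist (slice_left \<phi> (x * (a \<otimes> 1))) (slice_left \<phi> (X * (a \<otimes> 1))) = norm (slice_left \<phi> ((x - X) * (a \<otimes> 1)))"
      by (simp add: dist_norm left_diff_distrib slice_left_diff[OF st])
    also have "\<dots> \<le> norm (x - X) * seminorm2 \<phi> a" by (rule norm_slice_left_mult_le[OF st])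
    also have "\<dots> \<le> norm (x - X) * (\<bar>r\<bar> + 1)" using a by (intro mult_left_mono) auto
    also have "\<dots> < e / (\<bar>r\<bar> + 1) * (\<bar>r\<bar> + 1)"
      using n unfolding X_def by (intro mult_strict_right_mono) (auto simp: norm_minus_commute)
    also have "\<dots> = e" by (simp add: add_nonneg_eq_0_iff)
    finally show "dist (slice_left \<phi> (x * (a \<otimes> 1))) (slice_left \<phi> (X * (a \<otimes> 1))) < e" .
  qed
  then show "\<exists>K. compact K \<and> (\<forall>x\<in>{slice_left \<phi> (x * (a \<otimes> 1)) | a. seminorm2 \<phi> a \<le> r}. \<exists>y\<in>K. dist x y < e)"
    using K(1) by blast
qed

section \<open>Orthonormal systems and compact operators on the pre-Hilbert space of a state\<close>

lemma seminorm2_scaleC: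
  assumes "state \<phi>"
  shows "seminorm2 \<phi> (c *\<^sub>C x) = cmod c * seminorm2 \<phi> x"
proof -
  have "star (c *\<^sub>C x) * (c *\<^sub>C x) = (cnj c * c) *\<^sub>C (star x * x)"
    by (simp add: star_scaleC mult_scaleC_left mult_scaleC_right scaleC_scaleC mult.commute)
  also have "cnj c * c = complex_of_real ((cmod c)\<^sup>2)" using complex_norm_square[of c] by (simp add: mult.commute)
  finally show ?thesis by (simp add: seminorm2_def state_scale[OF assms] real_sqrt_mult)
qed

definition orthonormal :: "('a::cstar_algebra \<Rightarrow> complex) \<Rightarrow> 'a set \<Rightarrow> bool" where
  "orthonormal \<phi> E \<longleftrightarrow> finite E \<and> (\<forall>e\<in>E. \<forall>f\<in>E. \<phi> (star e * f) = (if e = f then 1 else 0))"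

lemma orthonormal_sum:
  assumes \<phi>: "state \<phi>" and E: "orthonormal \<phi> E" and f: "f \<in> E"
  shows "\<phi> (star f * (\<Sum>e\<in>E. c e *\<^sub>C e)) = c f"
proof -
  have "\<phi> (star f * (\<Sum>e\<in>E. c e *\<^sub>C e)) = (\<Sum>e\<in>E. c e * \<phi> (star f * e))"
    by (simp add: sum_distrib_left mult_scaleC_right state_sum[OF \<phi>] state_scale[OF \<phi>])
  also have "\<dots> = (\<Sum>e\<in>E. if f = e then c e else 0)"
    by (intro sum.cong refl) (use E f in \<open>auto simp: orthonormal_def\<close>)
  finally show ?thesis using E f by (simp add: orthonormal_def)
qed

text \<open>A system of largest cardinality is complete, since a residue of nonzero seminorm could
  be normalized and added. Completeness holds only up to seminorm zero, because \<phi> may have null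
  vectors.\<close>

lemma maximal_orthonormal:
  assumes \<phi>: "state \<phi>" and W: "csubspace W"
    and bound: "\<And>E. orthonormal \<phi> E \<Longrightarrow> E \<subseteq> W \<Longrightarrow> card E \<le> m"
  obtains E where "orthonormal \<phi> E" "E \<subseteq> W"
    "\<And>z. z \<in> W \<Longrightarrow> seminorm2 \<phi> (z - (\<Sum>e\<in>E. \<phi> (star e * z) *\<^sub>C e)) = 0"
proof -
  define P where "P E \<longleftrightarrow> orthonormal \<phi> E \<and> E \<subseteq> W" for E
  have "P {}" by (simp add: P_def orthonormal_def)
  have "\<exists>E. P E \<and> (\<forall>E'. P E' \<longrightarrow> card E' \<le> card E)"
    by (rule ex_has_greatest_nat[of P "{}" card "Suc m"]) (auto simp: \<open>P {}\<close> less_Suc_eq_le bound, simp add: P_def bound)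
  then obtain E where E: "P E" and max: "\<And>E'. P E' \<Longrightarrow> card E' \<le> card E" by blast
  have on: "orthonormal \<phi> E" and EW: "E \<subseteq> W" and fin: "finite E" using E by (auto simp: P_def orthonormal_def)
  have "seminorm2 \<phi> (z - (\<Sum>e\<in>E. \<phi> (star e * z) *\<^sub>C e)) = 0" if z: "z \<in> W" for z
  proof (rule ccontr)
    define r where "r = z - (\<Sum>e\<in>E. \<phi> (star e * z) *\<^sub>C e)"
    assume "seminorm2 \<phi> (z - (\<Sum>e\<in>E. \<phi> (star e * z) *\<^sub>C e)) \<noteq> 0"
    then have N: "0 < seminorm2 \<phi> r" using seminorm2_nonneg[OF \<phi>, of r] unfolding r_def by linarith
    have rW: "r \<in> W" unfolding r_def using z EW
      by (intro complex_vector.subspace_diff[OF W] complex_vector.subspace_sum[OF W] complex_vector.subspace_scale[OF W]) auto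
    have orth: "\<phi> (star f * r) = 0" if f: "f \<in> E" for f
      using orthonormal_sum[OF \<phi> on f, of "\<lambda>e. \<phi> (star e * z)"] by (simp add: r_def right_diff_distrib state_diff[OF \<phi>])
    define r' where "r' = complex_of_real (1 / seminorm2 \<phi> r) *\<^sub>C r"
    have r'1: "\<phi> (star r' * r') = 1"
      unfolding state_star_mult_eq[OF \<phi>] r'_def seminorm2_scaleC[OF \<phi>] norm_of_real using N by simp
    have orth': "\<phi> (star f * r') = 0" "\<phi> (star r' * f) = 0" if "f \<in> E" for f
    proof -
      show 1: "\<phi> (star f * r') = 0" using orth[OF that] by (simp add: r'_def mult_scaleC_right state_scale[OF \<phi>])
      show "\<phi> (star r' * f) = 0" using state_star[OF \<phi>, of "star f * r'"] 1 by (simp add: star_mult)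
    qed
    have "r' \<notin> E" using r'1 orth'(1) by force
    moreover have "orthonormal \<phi> (insert r' E)"
      using on r'1 orth' \<open>r' \<notin> E\<close> by (auto simp: orthonormal_def)
    moreover have "r' \<in> W" unfolding r'_def by (rule complex_vector.subspace_scale[OF W rW])
    ultimately show False using max[of "insert r' E"] fin EW by (simp add: P_def)
  qed
  then show ?thesis using that on EW by blast
qed

text \<open>The spectral theorem for the compact operator \<open>T = v\<^sup>* v\<close>, without completing the space: since \<open>v\<close> and
its adjoint map the pre-Hilbert space of \<open>h\<close> boundedly into the Banach space, eigenvectors are limits
in the norm of the algebra.\<close>

locale compact_adjoint_pair =
  fixes h :: "'a::cstar_algebra \<Rightarrow> complex" and v w :: "'a \<Rightarrow> 'a" and C :: real
  assumes st: "state h"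
    and v: "bounded_clinear v" and w: "bounded_clinear w"
    and adjoint: "h (star x * w y) = h (star (v x) * y)"
    and v_bound: "norm (v x) \<le> C * seminorm2 h x" and w_bound: "norm (w x) \<le> C * seminorm2 h x"
    and v_compact: "compact (closure {v a | a. seminorm2 h a \<le> r})"
begin

definition T where "T x = w (v x)"

lemma C_nonneg: "0 \<le> C"
  using order_trans[OF norm_ge_zero v_bound[of 1]] by (simp add: seminorm2_one st)

lemma T_clinear: "bounded_clinear T"
  unfolding T_def bounded_clinear_def
  using bounded_linear_compose[OF bounded_clinear_linear[OF w] bounded_clinear_linear[OF v]]
  by (simp add: bounded_clinear_scaleC[OF v] bounded_clinear_scaleC[OF w])

lemma inner_T: "h (star x * T y) = h (star (v x) * v y)"
  by (simp add: T_def adjoint)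

lemma inner_sym: "h (star y * x) = cnj (h (star x * y))"
  using state_star[OF st, of "star x * y"] by (simp add: star_mult)

lemma T_symmetric: "h (star (T x) * y) = h (star x * T y)"
  by (metis inner_T inner_sym)

lemma inner_T_self: "h (star x * T x) = complex_of_real ((seminorm2 h (v x))\<^sup>2)"
  by (simp only: inner_T state_star_mult_eq[OF st])

lemma T_bound: "norm (T x) \<le> C * C * seminorm2 h x"
proof -
  have "norm (T x) \<le> C * norm (v x)"
    unfolding T_def by (rule order_trans[OF w_bound]) (intro mult_left_mono seminorm2_le_norm st C_nonneg)
  also have "\<dots> \<le> C * (C * seminorm2 h x)" by (intro mult_left_mono v_bound C_nonneg)
  finally show ?thesis by simp
qed

lemma T_seminorm_zero: "seminorm2 h x = 0 \<Longrightarrow> T x = 0"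
  using T_bound[of x] by simp

lemma convergent_subsequence:
  assumes "\<And>n. seminorm2 h (a n) \<le> r"
  obtains s y where "strict_mono (s :: nat \<Rightarrow> nat)" "(\<lambda>n. v (a (s n))) \<longlonglongrightarrow> y" "(\<lambda>n. T (a (s n))) \<longlonglongrightarrow> w y"
proof -
  have "\<forall>n. v (a n) \<in> closure {v a | a. seminorm2 h a \<le> r}"
    using assms by (auto intro!: subsetD[OF closure_subset])
  then obtain y s where s: "strict_mono (s :: nat \<Rightarrow> nat)" "((\<lambda>n. v (a n)) \<circ> s) \<longlonglongrightarrow> y"
    using v_compact[of r] unfolding compact_def by meson
  then have "(\<lambda>n. v (a (s n))) \<longlonglongrightarrow> y" by (simp add: comp_def)
  moreover from this have "(\<lambda>n. T (a (s n))) \<longlonglongrightarrow> w y"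
    unfolding T_def by (rule bounded_linear.tendsto[OF bounded_clinear_linear[OF w]])
  ultimately show ?thesis using that s(1) by blast
qed

text \<open>Variational principle: M is the supremum of \<open>seminorm2 h (v x)\<close>^2 over the
  unit ball of V. For a maximizing sequence \<open>a n\<close> the seminorm of
  \<open>T (a n)\<close> - M \<open>a n\<close> tends to 0, and \<open>T\<close> turns convergence
  in seminorm into convergence in norm.\<close>

lemma eigenvector_exists:
  assumes V: "csubspace V" "closed V" "\<And>x. x \<in> V \<Longrightarrow> T x \<in> V" and x0: "x0 \<in> V" "seminorm2 h (v x0) \<noteq> 0"
  shows "\<exists>y\<in>V. \<exists>l>0. y \<noteq> 0 \<and> T y = complex_of_real l *\<^sub>C y"
proof -
  let ?N = "seminorm2 h"
  define S where "S = {(?N (v x))\<^sup>2 | x. x \<in> V \<and> ?N x \<le> 1}"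
  have bdd: "bdd_above S"
  proof (rule bdd_aboveI)
    fix t assume "t \<in> S"
    then obtain x where x: "t = (?N (v x))\<^sup>2" "?N x \<le> 1" by (auto simp: S_def)
    have "?N (v x) \<le> C * 1"
      by (rule order_trans[OF seminorm2_le_norm[OF st] order_trans[OF v_bound mult_left_mono[OF x(2) C_nonneg]]])
    then show "t \<le> C\<^sup>2" unfolding x(1) by (intro power_mono) (auto simp: st)
  qed
  have N0: "?N x0 \<noteq> 0" using x0(2) seminorm2_le_norm[OF st, of "v x0"] v_bound[of x0] seminorm2_nonneg[OF st, of "v x0"] by auto
  define M where "M = Sup S"
  have q_le: "(?N (v x))\<^sup>2 \<le> M * (?N x)\<^sup>2" if x: "x \<in> V" for x
  proof (cases "?N x = 0")
    case True
    then have "v x = 0" using v_bound[of x] by simp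
    then show ?thesis using True by (simp add: seminorm2_def state_zero[OF st])
  next
    case False
    then have pos: "0 < ?N x" using seminorm2_nonneg[OF st, of x] by linarith
    define c where "c = complex_of_real (1 / ?N x)"
    have "c *\<^sub>C x \<in> V" "?N (c *\<^sub>C x) \<le> 1"
      using complex_vector.subspace_scale[OF V(1) x] pos by (auto simp: seminorm2_scaleC[OF st] c_def norm_divide)
    then have "(?N (v (c *\<^sub>C x)))\<^sup>2 \<le> M" unfolding M_def using bdd by (intro cSup_upper) (auto simp: S_def)
    then show ?thesis using pos
      by (simp add: bounded_clinear_scaleC[OF v] seminorm2_scaleC[OF st] c_def norm_divide power_mult_distrib power_divide field_simps)
  qed
  have M: "0 < M"
  proof -
    have "0 < (?N (v x0))\<^sup>2" using x0(2) by simp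
    also have "\<dots> \<le> M * (?N x0)\<^sup>2" by (rule q_le[OF x0(1)])
    finally show ?thesis by (simp add: zero_less_mult_iff)
  qed
  have "\<exists>x. x \<in> V \<and> ?N x \<le> 1 \<and> M - 1 / real (Suc n) < (?N (v x))\<^sup>2" for n
  proof -
    have "S \<noteq> {}" using complex_vector.subspace_0[OF V(1)] by (auto simp: S_def seminorm2_def state_zero[OF st] intro!: exI[of _ 0])
    moreover have "M - 1 / real (Suc n) < Sup S" by (simp add: M_def)
    ultimately obtain t where "t \<in> S" "M - 1 / real (Suc n) < t" using less_cSup_iff[OF _ bdd] by blast
    then show ?thesis by (auto simp: S_def)
  qed
  then obtain a where a: "\<And>n. a n \<in> V" "\<And>n. ?N (a n) \<le> 1" "\<And>n. M - 1 / real (Suc n) < (?N (v (a n)))\<^sup>2" by metis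
  obtain s y where s: "strict_mono (s :: nat \<Rightarrow> nat)" "(\<lambda>n. v (a (s n))) \<longlonglongrightarrow> y" "(\<lambda>n. T (a (s n))) \<longlonglongrightarrow> w y"
    by (rule convergent_subsequence[of a 1, OF a(2)]) (rule that)
  \<comment> \<open>The eigenvector is the limit of \<open>T (a (s n))\<close>; the maximizing
    sequence itself need not converge.\<close>
  define z where "z = w y"
  have zV: "z \<in> V" unfolding z_def by (rule closed_sequentially[OF V(2) _ s(3)]) (intro V(3) a(1))
  have NT: "(?N (T x))\<^sup>2 \<le> M * (?N (v x))\<^sup>2" if x: "x \<in> V" for x
  proof (cases "?N (T x) = 0")
    case False
    then have pos: "0 < ?N (T x)" using seminorm2_nonneg[OF st, of "T x"] by linarith
    have "complex_of_real ((?N (T x))\<^sup>2) = h (star (v (T x)) * v x)"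
      by (simp only: inner_T[symmetric] state_star_mult_eq[OF st])
    then have "(?N (T x))\<^sup>2 \<le> ?N (v (T x)) * ?N (v x)"
      using state_cauchy_schwarz[OF st, of "v (T x)" "v x"] by (metis norm_of_real abs_of_nonneg zero_le_power2)
    then have "((?N (T x))\<^sup>2)\<^sup>2 \<le> (?N (v (T x)))\<^sup>2 * (?N (v x))\<^sup>2"
      unfolding power_mult_distrib[symmetric] by (intro power_mono) auto
    also have "\<dots> \<le> (M * (?N (T x))\<^sup>2) * (?N (v x))\<^sup>2" by (intro mult_right_mono q_le V(3) x) auto
    finally have "(?N (T x))\<^sup>2 * (?N (T x))\<^sup>2 \<le> (?N (T x))\<^sup>2 * (M * (?N (v x))\<^sup>2)" by (simp add: power2_eq_square algebra_simps)
    then show ?thesis using pos by (simp only: mult_le_cancel_left_pos zero_less_power)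
  qed (use M in auto)
  have small: "(?N (T (a n) - complex_of_real M *\<^sub>C a n))\<^sup>2 \<le> M * (1 / real (Suc n))" for n
  proof -
    let ?a = "a n" and ?M = "complex_of_real M"
    have "star (T ?a - ?M *\<^sub>C ?a) * (T ?a - ?M *\<^sub>C ?a) =
        star (T ?a) * T ?a - ?M *\<^sub>C (star (T ?a) * ?a) - ?M *\<^sub>C (star ?a * T ?a) + (?M * ?M) *\<^sub>C (star ?a * ?a)"
      by (simp add: star_diff star_scaleC left_diff_distrib right_diff_distrib mult_scaleC_left mult_scaleC_right scaleC_scaleC scaleC_diff_right)
    then have "h (star (T ?a - ?M *\<^sub>C ?a) * (T ?a - ?M *\<^sub>C ?a)) =
        h (star (T ?a) * T ?a) - ?M * h (star (T ?a) * ?a) - ?M * h (star ?a * T ?a) + (?M * ?M) * h (star ?a * ?a)"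
      by (simp add: state_add[OF st] state_diff[OF st] state_scale[OF st])
    also have "\<dots> = complex_of_real ((?N (T ?a))\<^sup>2 - 2 * M * (?N (v ?a))\<^sup>2 + M * M * (?N ?a)\<^sup>2)"
      unfolding T_symmetric inner_T_self state_star_mult_eq[OF st] by simp
    finally have "(?N (T ?a - ?M *\<^sub>C ?a))\<^sup>2 = (?N (T ?a))\<^sup>2 - 2 * M * (?N (v ?a))\<^sup>2 + M * M * (?N ?a)\<^sup>2"
      unfolding seminorm2_sq[OF st] by simp
    also have "\<dots> \<le> M * (?N (v ?a))\<^sup>2 - 2 * M * (?N (v ?a))\<^sup>2 + M * M * 1"
      using M a(2)[of n] by (intro add_mono diff_mono NT a mult_left_mono power_le_one) (auto simp: st)
    also have "\<dots> = M * (M - (?N (v ?a))\<^sup>2)" by (simp add: algebra_simps)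
    also have "\<dots> \<le> M * (1 / real (Suc n))" using M a(3)[of n] by (intro mult_left_mono) auto
    finally show ?thesis .
  qed
  have N_lim: "(\<lambda>n. ?N (T (a (s n)) - complex_of_real M *\<^sub>C a (s n))) \<longlonglongrightarrow> 0"
  proof -
    have "(\<lambda>n. 1 / real (Suc n)) \<longlonglongrightarrow> 0" using LIMSEQ_inverse_real_of_nat by (simp add: divide_inverse)
    then have "(\<lambda>n. 1 / real (Suc (s n))) \<longlonglongrightarrow> 0" using LIMSEQ_subseq_LIMSEQ[OF _ s(1)] by (auto simp: comp_def)
    from tendsto_mult[OF tendsto_const this, of M]
    have lim0: "(\<lambda>n. M * (1 / real (Suc (s n)))) \<longlonglongrightarrow> 0" by simp
    have "(\<lambda>n. (?N (T (a (s n)) - complex_of_real M *\<^sub>C a (s n)))\<^sup>2) \<longlonglongrightarrow> 0"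
      by (rule tendsto_sandwich[OF _ _ tendsto_const lim0]) (use small in \<open>auto intro: always_eventually simp del: of_nat_Suc\<close>)
    from tendsto_real_sqrt[OF this] show ?thesis by (simp add: st)
  qed
  have "(\<lambda>n. T (T (a (s n)) - complex_of_real M *\<^sub>C a (s n))) \<longlonglongrightarrow> 0"
  proof (rule Lim_null_comparison[OF always_eventually[OF allI]])
    show "norm (T (T (a (s n)) - complex_of_real M *\<^sub>C a (s n))) \<le> C * C * ?N (T (a (s n)) - complex_of_real M *\<^sub>C a (s n))" for n
      by (rule T_bound)
    show "(\<lambda>n. C * C * ?N (T (a (s n)) - complex_of_real M *\<^sub>C a (s n))) \<longlonglongrightarrow> 0"
      using tendsto_mult[OF tendsto_const N_lim, of "C * C"] by simp
  qed
  moreover have "(\<lambda>n. T (T (a (s n)) - complex_of_real M *\<^sub>C a (s n))) \<longlonglongrightarrow> T z - complex_of_real M *\<^sub>C z"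
    unfolding bounded_clinear_diff[OF T_clinear] bounded_clinear_scaleC[OF T_clinear] z_def
    by (intro tendsto_diff bounded_linear.tendsto[OF bounded_clinear_linear[OF T_clinear]]
        bounded_linear.tendsto[OF bounded_linear_scaleC] s(3))
  ultimately have eig: "T z = complex_of_real M *\<^sub>C z" using LIMSEQ_unique by fastforce
  \<comment> \<open>This excludes z = 0: Cauchy-Schwarz bounds \<open>norm (T (a n))\<close> from
    below by the nearly maximal value at \<open>a n\<close>.\<close>
  have "M \<le> norm z"
  proof (rule LIMSEQ_le[OF _ tendsto_norm[OF s(3)[folded z_def]]])
    have "(\<lambda>n. 1 / real (Suc n)) \<longlonglongrightarrow> 0" using LIMSEQ_inverse_real_of_nat by (simp add: divide_inverse)
    then have "(\<lambda>n. 1 / real (Suc (s n))) \<longlonglongrightarrow> 0" using LIMSEQ_subseq_LIMSEQ[OF _ s(1)] by (auto simp: comp_def)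
    from tendsto_diff[OF tendsto_const this, of M] show "(\<lambda>n. M - 1 / real (Suc (s n))) \<longlonglongrightarrow> M" by simp
    have "M - 1 / real (Suc n) \<le> norm (T (a n))" for n
    proof -
      have "(?N (v (a n)))\<^sup>2 \<le> ?N (a n) * ?N (T (a n))"
        using state_cauchy_schwarz[OF st, of "a n" "T (a n)"] unfolding inner_T_self norm_of_real by simp
      also have "\<dots> \<le> 1 * norm (T (a n))"
        by (intro mult_mono a seminorm2_le_norm st) (auto simp: st)
      finally show ?thesis using a(3)[of n] by linarith
    qed
    then show "\<exists>N. \<forall>n\<ge>N. M - 1 / real (Suc (s n)) \<le> norm (T (a (s n)))" by blast
  qed
  then have "z \<noteq> 0" using M by auto
  then show ?thesis using zV M eig by blast
qed

definition eigenvectors where "eigenvectors = {z. \<exists>l>0. T z = complex_of_real l *\<^sub>C z}"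

lemma T_span_eigenvectors: "f \<in> cspan eigenvectors \<Longrightarrow> T f \<in> cspan eigenvectors"
proof (induction rule: complex_vector.span_induct_alt)
  case base show ?case by (simp add: bounded_clinear_zero[OF T_clinear] complex_vector.span_zero)
next
  case (step c x y)
  obtain l where "T x = complex_of_real l *\<^sub>C x" using step by (auto simp: eigenvectors_def)
  then have "T x \<in> cspan eigenvectors" using step by (simp add: complex_vector.span_scale complex_vector.span_base)
  then show ?case
    using step by (simp add: bounded_clinear_add[OF T_clinear] bounded_clinear_scaleC[OF T_clinear]
        complex_vector.span_add complex_vector.span_scale)
qed

text \<open>The vectors orthogonal to all eigenvectors form a closed subspace invariant under
  \<open>T\<close>. If \<open>v\<close> did not vanish on it in seminorm, it would contain a nonzero
  eigenvector orthogonal to itself; \<open>T\<close> sends such a null vector to 0, against l >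
  0.\<close>

lemma orthogonal_eigenvectors:
  assumes "\<And>f. f \<in> cspan eigenvectors \<Longrightarrow> h (star f * x) = 0"
  shows "seminorm2 h (v x) = 0"
proof (rule ccontr)
  assume x: "seminorm2 h (v x) \<noteq> 0"
  define V where "V = {x. \<forall>f\<in>cspan eigenvectors. h (star f * x) = 0}"
  have bl: "bounded_linear (\<lambda>x. h (star f * x))" for f
    by (rule bounded_linear_compose[OF state_bounded_linear[OF st] bounded_linear_mult_right])
  have "csubspace V"
    by (auto simp: V_def complex_vector.subspace_def distrib_left mult_scaleC_right state_add[OF st] state_scale[OF st] state_zero[OF st])
  moreover have "closed V"
    unfolding V_def Ball_def
    by (intro closed_Collect_all closed_Collect_imp open_Collect_const closed_Collect_eq linear_continuous_on bl continuous_on_const)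
  moreover have "T y \<in> V" if "y \<in> V" for y
    using that T_span_eigenvectors by (auto simp: V_def T_symmetric[symmetric])
  moreover have "x \<in> V" using assms by (simp add: V_def)
  ultimately obtain y l where y: "y \<in> V" "l > 0" "y \<noteq> 0" "T y = complex_of_real l *\<^sub>C y"
    using eigenvector_exists[of V x] x by blast
  then have "y \<in> cspan eigenvectors" by (auto simp: eigenvectors_def intro: complex_vector.span_base)
  then have "h (star y * y) = 0" using y(1) by (auto simp: V_def)
  then have "T y = 0" by (intro T_seminorm_zero) (simp add: seminorm2_def)
  then show False using y by simp
qed

text \<open>An orthogonal projection onto the span of the eigenvectors may fail to exist in an
  incomplete space. A sequence \<open>f n\<close> minimizing the seminorm distance to
  \<open>a\<close> replaces it: the residues \<open>b n\<close> become orthogonal to the span in the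
  limit, and along a subsequence \<open>T (b n)\<close> tends to 0 in norm, so
  \<open>T (f n)\<close> tends to \<open>T a\<close>.\<close>

lemma T_in_closure_eigenvectors: "T a \<in> closure (cspan eigenvectors)"
proof -
  let ?F = "cspan eigenvectors" and ?N = "seminorm2 h"
  define D where "D = {(?N (a - f))\<^sup>2 | f. f \<in> ?F}"
  have D: "D \<noteq> {}" "bdd_below D" "0 \<le> Inf D"
  proof -
    show "D \<noteq> {}" using complex_vector.span_zero by (auto simp: D_def)
    show "bdd_below D" by (rule bdd_belowI[of _ 0]) (auto simp: D_def)
    show "0 \<le> Inf D" by (rule cInf_greatest[OF \<open>D \<noteq> {}\<close>]) (auto simp: D_def)
  qed
  have "\<exists>f. f \<in> ?F \<and> (?N (a - f))\<^sup>2 < Inf D + 1 / real (Suc n)" for n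
  proof -
    obtain t where "t \<in> D" "t < Inf D + 1 / real (Suc n)"
      using cInf_less_iff[OF D(1,2), of "Inf D + 1 / real (Suc n)"] by auto
    then show ?thesis by (auto simp: D_def)
  qed
  then obtain f where f: "\<And>n. f n \<in> ?F" "\<And>n. (?N (a - f n))\<^sup>2 < Inf D + 1 / real (Suc n)" by metis
  define b where "b n = a - f n" for n
  \<comment> \<open>Near-minimality of the distance says that a quadratic expression in c is
    nonnegative up to 1/(n + 1); its discriminant bounds the inner product with g.\<close>
  have small: "(cmod (h (star (b n) * g)))\<^sup>2 \<le> (1 / real (Suc n)) * (?N g)\<^sup>2" if g: "g \<in> ?F" for g n
  proof (rule quad_disc)
    fix c
    have "f n - c *\<^sub>C g \<in> ?F" using f g by (intro complex_vector.span_diff complex_vector.span_scale)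
    then have "(?N (a - (f n - c *\<^sub>C g)))\<^sup>2 \<in> D" unfolding D_def by blast
    then have "Inf D \<le> (?N (a - (f n - c *\<^sub>C g)))\<^sup>2" by (rule cInf_lower[OF _ D(2)])
    also have "a - (f n - c *\<^sub>C g) = b n + c *\<^sub>C g" by (simp add: b_def)
    also have "(?N (b n + c *\<^sub>C g))\<^sup>2 = (?N (b n))\<^sup>2 + 2 * Re (c * h (star (b n) * g)) + (cmod c)\<^sup>2 * (?N g)\<^sup>2"
    proof -
      have "star (b n + c *\<^sub>C g) * (b n + c *\<^sub>C g) =
          star (b n) * b n + (c *\<^sub>C (star (b n) * g) + cnj c *\<^sub>C (star g * b n)) + (cnj c * c) *\<^sub>C (star g * g)"
        by (simp add: star_add star_scaleC distrib_left distrib_right mult_scaleC_left mult_scaleC_right scaleC_scaleC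
            scaleC_add_right add.assoc mult.commute)
      then have "h (star (b n + c *\<^sub>C g) * (b n + c *\<^sub>C g)) =
          h (star (b n) * b n) + (c * h (star (b n) * g) + cnj c * cnj (h (star (b n) * g))) + (cnj c * c) * h (star g * g)"
        by (simp add: state_add[OF st] state_scale[OF st] inner_sym[where y = g and x = "b n"])
      moreover have "cnj c * c = complex_of_real ((cmod c)\<^sup>2)" using complex_norm_square[of c] by (simp add: mult.commute)
      ultimately show ?thesis unfolding seminorm2_sq[OF st] by simp
    qed
    finally show "0 \<le> 1 / real (Suc n) + 2 * Re (c * h (star (b n) * g)) + (cmod c)\<^sup>2 * (?N g)\<^sup>2"
      using f(2)[of n] by (simp add: b_def)
  qed auto
  have b_le: "?N (b n) \<le> sqrt (Inf D + 1)" for n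
  proof (rule real_le_rsqrt)
    have "1 / real (Suc n) \<le> 1" by simp
    then show "(?N (b n))\<^sup>2 \<le> Inf D + 1" using f(2)[of n] unfolding b_def by linarith
  qed
  obtain s u where s: "strict_mono (s :: nat \<Rightarrow> nat)" "(\<lambda>n. v (b (s n))) \<longlonglongrightarrow> u" "(\<lambda>n. T (b (s n))) \<longlonglongrightarrow> w u"
    by (rule convergent_subsequence[of b, OF b_le]) (rule that)
  define y where "y = w u"
  have bl: "bounded_linear (\<lambda>x. h (star g * x))" for g
    by (rule bounded_linear_compose[OF state_bounded_linear[OF st] bounded_linear_mult_right])
  have y_orth: "h (star g * y) = 0" if g: "g \<in> ?F" for g
  proof -
    have "(\<lambda>n. 1 / real (Suc n)) \<longlonglongrightarrow> 0" using LIMSEQ_inverse_real_of_nat by (simp add: divide_inverse)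
    then have "(\<lambda>n. 1 / real (Suc (s n))) \<longlonglongrightarrow> 0" using LIMSEQ_subseq_LIMSEQ[OF _ s(1)] by (auto simp: comp_def)
    from tendsto_mult[OF this tendsto_const, of "(?N (T g))\<^sup>2"]
    have lim0: "(\<lambda>n. (1 / real (Suc (s n))) * (?N (T g))\<^sup>2) \<longlonglongrightarrow> 0" by simp
    have eq: "cmod (h (star g * T (b n))) = cmod (h (star (b n) * T g))" for n
      by (metis T_symmetric inner_sym complex_mod_cnj)
    have "(\<lambda>n. (cmod (h (star g * T (b (s n)))))\<^sup>2) \<longlonglongrightarrow> 0"
      unfolding eq
      by (rule tendsto_sandwich[OF _ _ tendsto_const lim0])
        (use small[OF T_span_eigenvectors[OF g]] in \<open>auto intro: always_eventually simp del: of_nat_Suc\<close>)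
    moreover have "(\<lambda>n. (cmod (h (star g * T (b (s n)))))\<^sup>2) \<longlonglongrightarrow> (cmod (h (star g * y)))\<^sup>2"
      unfolding y_def by (intro tendsto_power tendsto_norm bounded_linear.tendsto[OF bl] s(3))
    ultimately show ?thesis using LIMSEQ_unique by fastforce
  qed
  \<comment> \<open>Since y is a limit of \<open>T (b n)\<close>, the inner product of y with itself
    can be computed through \<open>v y\<close> and vanishes with it.\<close>
  have vy: "?N (v y) = 0" by (rule orthogonal_eigenvectors) (rule y_orth)
  have Ny: "?N y = 0"
  proof -
    have "h (star (v y) * v (b n)) = 0" for n
      using state_cauchy_schwarz[OF st, of "v y" "v (b n)"] vy by simp
    then have "h (star y * T (b n)) = 0" for n by (simp add: inner_T)
    then have "(\<lambda>n. 0) \<longlonglongrightarrow> h (star y * y)"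
      using bounded_linear.tendsto[OF bl s(3), of y] by (simp add: y_def)
    then have "h (star y * y) = 0" by (simp add: LIMSEQ_const_iff)
    then show ?thesis by (simp add: seminorm2_def)
  qed
  have "(\<lambda>n. ?N (v (b (s n)))) \<longlonglongrightarrow> 0"
  proof -
    have "(\<lambda>n. ?N (T (b (s n)))) \<longlonglongrightarrow> ?N y"
      unfolding seminorm2_def y_def
      by (intro tendsto_real_sqrt tendsto_Re bounded_linear.tendsto[OF state_bounded_linear[OF st]] tendsto_mult
          bounded_linear.tendsto[OF bounded_linear_star] s(3))
    from tendsto_mult[OF tendsto_const this, of "sqrt (Inf D + 1)"]
    have lim0: "(\<lambda>n. sqrt (Inf D + 1) * ?N (T (b (s n)))) \<longlonglongrightarrow> 0" using Ny by simp
    have "(?N (v (b n)))\<^sup>2 \<le> sqrt (Inf D + 1) * ?N (T (b n))" for n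
    proof -
      have "(?N (v (b n)))\<^sup>2 \<le> ?N (b n) * ?N (T (b n))"
        using state_cauchy_schwarz[OF st, of "b n" "T (b n)"] unfolding inner_T_self norm_of_real by simp
      also have "\<dots> \<le> sqrt (Inf D + 1) * ?N (T (b n))" by (intro mult_right_mono b_le) (simp add: st)
      finally show ?thesis .
    qed
    then have "(\<lambda>n. (?N (v (b (s n))))\<^sup>2) \<longlonglongrightarrow> 0"
      by (intro tendsto_sandwich[OF _ _ tendsto_const lim0]) (auto intro: always_eventually)
    from tendsto_real_sqrt[OF this] show ?thesis by (simp add: st)
  qed
  from tendsto_mult[OF tendsto_const this, of C]
  have "(\<lambda>n. C * ?N (v (b (s n)))) \<longlonglongrightarrow> 0" by simp
  then have "(\<lambda>n. T (b (s n))) \<longlonglongrightarrow> 0"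
    unfolding T_def by (rule Lim_null_comparison[OF always_eventually[OF allI], rotated]) (rule w_bound)
  from tendsto_diff[OF tendsto_const this, of "T a"]
  have "(\<lambda>n. T (f (s n))) \<longlonglongrightarrow> T a" by (simp add: b_def bounded_clinear_diff[OF T_clinear])
  then show ?thesis
    unfolding closure_sequential using T_span_eigenvectors[OF f(1)] by (intro exI[of _ "\<lambda>n. T (f (s n))"]) auto
qed

text \<open>Distinct orthonormal eigenvectors e, f satisfy \<open>seminorm2 h (v (e - f))\<close>^2
  = 2 l, so \<open>v e\<close> and \<open>v f\<close> cannot share a ball of radius sqrt l / 2. A
  finite cover of the compact image by such balls bounds the size of orthonormal systems.\<close>

lemma eigenspace_basis:
  assumes l: "0 < l"
  obtains E where "finite E" "\<And>e. e \<in> E \<Longrightarrow> T e = complex_of_real l *\<^sub>C e"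
    "\<And>e f. e \<in> E \<Longrightarrow> f \<in> E \<Longrightarrow> h (star e * f) = (if e = f then 1 else 0)"
    "\<And>z. T z = complex_of_real l *\<^sub>C z \<Longrightarrow> z = (\<Sum>e\<in>E. h (star e * z) *\<^sub>C e)"
proof -
  let ?N = "seminorm2 h"
  define W where "W = {z. T z = complex_of_real l *\<^sub>C z}"
  have W: "csubspace W"
    by (auto simp: W_def complex_vector.subspace_def bounded_clinear_add[OF T_clinear] bounded_clinear_scaleC[OF T_clinear]
        bounded_clinear_zero[OF T_clinear] scaleC_add_right scaleC_scaleC mult.commute)
  \<comment> \<open>On the eigenspace the seminorm is a norm, because \<open>T\<close> sends null
    vectors to 0; this makes the expansion in \<open>E\<close> exact.\<close>
  have NW: "?N z \<noteq> 0" if "z \<in> W" "z \<noteq> 0" for z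
    using T_seminorm_zero[of z] that l by (auto simp: W_def complex_vector.scale_eq_0_iff)
  obtain k where k: "finite k" "closure {v a | a. ?N a \<le> 1} \<subseteq> (\<Union>x\<in>k. ball x (sqrt l / 2))"
  proof -
    have "0 < sqrt l / 2" using l by simp
    then show ?thesis using v_compact[of 1] that unfolding compact_eq_totally_bounded by blast
  qed
  have card: "card E \<le> card k" if E: "orthonormal h E" "E \<subseteq> W" for E
  proof -
    have N1: "?N e = 1" if "e \<in> E" for e using E that by (simp add: orthonormal_def seminorm2_def)
    have "\<exists>x\<in>k. v e \<in> ball x (sqrt l / 2)" if "e \<in> E" for e
      using k(2) subsetD[OF closure_subset, of "v e" "{v a | a. ?N a \<le> 1}"] N1[OF that] by fastforce
    then obtain c where c: "\<And>e. e \<in> E \<Longrightarrow> c e \<in> k \<and> v e \<in> ball (c e) (sqrt l / 2)" by metis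
    have "inj_on c E"
    proof (rule inj_onI, rule ccontr)
      fix e f assume ef: "e \<in> E" "f \<in> E" "c e = c f" "e \<noteq> f"
      have "star (e - f) * (e - f) = star e * e - star e * f - star f * e + star f * f"
        by (simp add: star_diff algebra_simps)
      then have h2: "h (star (e - f) * (e - f)) = 2"
        using E ef by (simp add: orthonormal_def state_add[OF st] state_diff[OF st])
      have "e - f \<in> W" using E ef by (auto intro: complex_vector.subspace_diff[OF W])
      then have "complex_of_real ((?N (v (e - f)))\<^sup>2) = complex_of_real (l * 2)"
        using inner_T_self[of "e - f"] h2 by (simp add: W_def mult_scaleC_right state_scale[OF st])
      then have "(?N (v (e - f)))\<^sup>2 = l * 2" by (simp only: of_real_eq_iff)
      then have "sqrt l \<le> ?N (v (e - f))" using l by (intro real_le_lsqrt) (auto simp: st)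
      also have "\<dots> \<le> dist (v e) (v f)" using seminorm2_le_norm[OF st, of "v (e - f)"] by (simp add: dist_norm bounded_clinear_diff[OF v])
      also have "\<dots> \<le> dist (v e) (c e) + dist (c e) (v f)" by (rule dist_triangle)
      also have "\<dots> < sqrt l / 2 + sqrt l / 2"
        using c[OF ef(1)] c[OF ef(2)] ef(3) by (intro add_strict_mono) (auto simp: dist_commute)
      finally show False by simp
    qed
    then show ?thesis using c k(1) by (intro card_inj_on_le) auto
  qed
  obtain E where E: "orthonormal h E" "E \<subseteq> W" "\<And>z. z \<in> W \<Longrightarrow> ?N (z - (\<Sum>e\<in>E. h (star e * z) *\<^sub>C e)) = 0"
    by (rule maximal_orthonormal[OF st W card]) (assumption+, rule that)
  have "z = (\<Sum>e\<in>E. h (star e * z) *\<^sub>C e)" if z: "z \<in> W" for z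
  proof -
    have "z - (\<Sum>e\<in>E. h (star e * z) *\<^sub>C e) \<in> W" using z E(2)
      by (intro complex_vector.subspace_diff[OF W] complex_vector.subspace_sum[OF W] complex_vector.subspace_scale[OF W]) auto
    then show ?thesis using NW E(3)[OF z] by force
  qed
  then show ?thesis using that[of E] E by (auto simp: W_def orthonormal_def)
qed

end

section \<open>Corepresentations and the integral operators of the Haar state\<close>

definition corepresentation ::
    "('a \<Rightarrow> 'a::cstar_algebra \<otimes> 'a) \<Rightarrow> 'i set \<Rightarrow> ('i \<Rightarrow> 'i \<Rightarrow> 'a) \<Rightarrow> bool" where
  "corepresentation \<Delta> I u \<longleftrightarrow> finite I \<and> (\<forall>i\<in>I. \<forall>j\<in>I. \<Delta> (u i j) = (\<Sum>k\<in>I. u i k \<otimes> u k j))"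

definition unitary_matrix :: "'i set \<Rightarrow> ('i \<Rightarrow> 'i \<Rightarrow> 'a::cstar_algebra) \<Rightarrow> bool" where
  "unitary_matrix I u \<longleftrightarrow>
     (\<forall>i\<in>I. \<forall>j\<in>I. (\<Sum>k\<in>I. star (u k i) * u k j) = (if i = j then 1 else 0)) \<and>
     (\<forall>i\<in>I. \<forall>j\<in>I. (\<Sum>k\<in>I. u i k * star (u j k)) = (if i = j then 1 else 0))"

lemma tensor_sum_left: "(\<Sum>i\<in>I. f i) \<otimes> b = (\<Sum>i\<in>I. f i \<otimes> b)"
  and tensor_sum_right: "a \<otimes> (\<Sum>i\<in>I. g i) = (\<Sum>i\<in>I. a \<otimes> g i)"
  by (induction I rule: infinite_finite_induct) (auto simp: tensor_add_left tensor_add_right)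

lemma bounded_clinear_compose: "bounded_clinear f \<Longrightarrow> bounded_clinear g \<Longrightarrow> bounded_clinear (\<lambda>x. f (g x))"
  by (auto simp: bounded_clinear_def intro: bounded_linear_compose)

lemma bounded_clinear_mult_right: "bounded_clinear (\<lambda>x. a * x)"
  and bounded_clinear_mult_left: "bounded_clinear (\<lambda>x. x * a)"
  by (auto simp: bounded_clinear_def mult_scaleC_left mult_scaleC_right intro: bounded_linear_mult_right bounded_linear_mult_left)

lemma bounded_clinear_tensor_left: "bounded_clinear (\<lambda>a. a \<otimes> b)"
  by (auto simp: bounded_clinear_def tensor_scaleC_left intro: bounded_linear_tensor_left)

lemma bounded_clinear_tensor_right: "bounded_clinear (\<lambda>b. a \<otimes> b)"
proof -
  have "norm (a \<otimes> b) \<le> norm b * norm a" for b using norm_tensor_le[of a b] by (simp add: mult.commute)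
  then have "bounded_linear (\<lambda>b. a \<otimes> b)"
    by (intro bounded_linear_intro[where K = "norm a"]) (simp_all add: tensor_add_right tensor_scaleC_right scaleR_scaleC)
  then show ?thesis by (simp add: bounded_clinear_def tensor_scaleC_right)
qed

locale haar = cqg +
  fixes h :: "'a \<Rightarrow> complex"
  assumes haar: "haar_state \<Delta> h"
begin

lemma h: "state h"
  and h_left: "slice_left h (\<Delta> a) = h a *\<^sub>C 1"
  and h_right: "slice_right h (\<Delta> a) = h a *\<^sub>C 1"
  using haar by (auto simp: haar_state_def)

text \<open>Matrix coefficient of the regular corepresentation: a state \<rho> maps it to the
  \<open>h\<close>-inner product of \<open>x\<close> with the \<rho>-translate of
  \<open>y\<close>.\<close>

definition coeff :: "'a \<Rightarrow> 'a \<Rightarrow> 'a" where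
  "coeff x y = slice_left h ((star x \<otimes> 1) * \<Delta> y)"

definition translate :: "('a \<Rightarrow> complex) \<Rightarrow> 'a \<Rightarrow> 'a" where
  "translate \<rho> a = slice_right \<rho> (\<Delta> a)"

text \<open>Adjoint, for the inner product of \<open>h\<close>, of the integral operator
  \<open>int_op g\<close> with kernel \<Delta>(g).\<close>

definition adj_op :: "'a \<Rightarrow> 'a \<Rightarrow> 'a" where
  "adj_op g a = slice_left h (\<Delta> (star g) * (a \<otimes> 1))"

definition int_op :: "'a \<Rightarrow> 'a \<Rightarrow> 'a" where
  "int_op g a = slice_right h (\<Delta> g * (1 \<otimes> a))"

lemma state_coeff: "state \<rho> \<Longrightarrow> \<rho> (coeff x y) = h (star x * translate \<rho> y)"
  using prod_state_mult_left[OF h, of \<rho> "star x" "\<Delta> y"] by (simp add: coeff_def translate_def prod_state_def)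

lemma adj_op_clinear: "bounded_clinear (adj_op g)"
  unfolding adj_op_def[abs_def]
  by (rule bounded_clinear_compose[OF slice_left_clinear[OF h] bounded_clinear_compose[OF bounded_clinear_mult_right bounded_clinear_tensor_left]])

lemma int_op_clinear: "bounded_clinear (int_op g)"
  unfolding int_op_def[abs_def]
  by (rule bounded_clinear_compose[OF slice_right_clinear[OF h] bounded_clinear_compose[OF bounded_clinear_mult_right bounded_clinear_tensor_right]])

lemma pair: "compact_adjoint_pair h (adj_op g) (int_op g) (norm g)"
proof
  show "state h" by (rule h)
  show "bounded_clinear (adj_op g)" "bounded_clinear (int_op g)" by (rule adj_op_clinear int_op_clinear)+
  have ng: "norm (\<Delta> (star g)) \<le> norm g" "norm (\<Delta> g) \<le> norm g"
    using norm_unital_star_hom[OF hom, of "star g"] norm_unital_star_hom[OF hom, of g] by simp_all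
  fix x y :: 'a and r :: real
  show "norm (adj_op g x) \<le> norm g * seminorm2 h x"
    unfolding adj_op_def by (rule order_trans[OF norm_slice_left_mult_le[OF h] mult_right_mono[OF ng(1)]]) (simp add: h)
  show "norm (int_op g x) \<le> norm g * seminorm2 h x"
    unfolding int_op_def by (rule order_trans[OF norm_slice_right_mult_le[OF h] mult_right_mono[OF ng(2)]]) (simp add: h)
  show "compact (closure {adj_op g a | a. seminorm2 h a \<le> r})"
    unfolding adj_op_def by (rule compact_slice_left[OF h])
  have "star (adj_op g x) = slice_left h ((star x \<otimes> 1) * \<Delta> g)"
    by (simp add: adj_op_def slice_left_star[OF h, symmetric] star_mult tensor_star unital_star_hom_star[OF hom])
  then have "h (star (adj_op g x) * y) = prod_state h h ((star x \<otimes> 1) * \<Delta> g * (1 \<otimes> y))"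
    by (simp add: prod_state_mult_right'[OF h h])
  also have "\<dots> = h (star x * int_op g y)"
    unfolding mult.assoc prod_state_mult_left[OF h h] int_op_def ..
  finally show "h (star x * int_op g y) = h (star (adj_op g x) * y)" by simp
qed

text \<open>One functional \<Psi> is evaluated at (\<Delta> \<otimes> id)\<Delta>(y) and at (id
  \<otimes> \<Delta>)\<Delta>(y), where y = \<open>star g\<close>. In the first form left invariance
  of \<open>h\<close> applies to \<open>\<Delta> (s * a)\<close>, in the second right invariance
  applies to \<open>\<Delta> (q * t)\<close>, and coassociativity identifies the results.\<close>

lemma adj_op_translate:
  assumes \<rho>: "state \<rho>"
  shows "prod_state \<rho> h (\<Delta> q * (1 \<otimes> adj_op g a)) = h (q * adj_op g (translate \<rho> a))"
proof -
  define y where "y = star g"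
  note \<rho>h = state_prod_state[OF \<rho> h]
  note S = state_prod_state[OF h \<rho>h]
  \<comment> \<open>In leg notation this is (h \<otimes> \<rho> \<otimes> h)((1 \<otimes>
    \<Delta>(q)) W (\<Delta>(a) \<otimes> 1)).\<close>
  define \<Psi> where "\<Psi> W = prod_state h (prod_state \<rho> h) ((1 \<otimes> \<Delta> q) * W * tensor_assoc (\<Delta> a \<otimes> 1))" for W
  have \<Psi>_lin: "bounded_linear \<Psi>"
    unfolding \<Psi>_def by (rule bounded_linear_compose[OF state_bounded_linear[OF S]])
      (rule bounded_linear_compose[OF bounded_linear_mult_left bounded_linear_mult_right])
  note homs = unital_star_hom_tensor_map[OF unital_star_hom_id hom] unital_star_hom_tensor_map[OF hom unital_star_hom_id]
    unital_star_hom_tensor_assoc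
  have A1: "prod_state h (prod_state \<rho> h) ((1 \<otimes> Q) * tensor_assoc (X \<otimes> t)) = prod_state \<rho> h (Q * (slice_left h X \<otimes> t))" for Q X t
  proof -
    have "(\<lambda>X. prod_state h (prod_state \<rho> h) ((1 \<otimes> Q) * tensor_assoc (X \<otimes> t))) = (\<lambda>X. prod_state \<rho> h (Q * (slice_left h X \<otimes> t)))"
    proof (rule bounded_linear_tensor_eqI)
      show "bounded_linear (\<lambda>X. prod_state h (prod_state \<rho> h) ((1 \<otimes> Q) * tensor_assoc (X \<otimes> t)))"
        by (intro bounded_linear_compose[OF state_bounded_linear[OF S]] bounded_linear_compose[OF bounded_linear_mult_right]
            bounded_linear_compose[OF unital_star_hom_linear[OF homs(3)]] bounded_linear_tensor_left)
      show "bounded_linear (\<lambda>X. prod_state \<rho> h (Q * (slice_left h X \<otimes> t)))"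
        by (intro bounded_linear_compose[OF state_bounded_linear[OF \<rho>h]] bounded_linear_compose[OF bounded_linear_mult_right]
            bounded_linear_compose[OF bounded_linear_tensor_left] slice_left_linear[OF h])
      show "prod_state h (prod_state \<rho> h) ((1 \<otimes> Q) * tensor_assoc ((b \<otimes> c) \<otimes> t)) = prod_state \<rho> h (Q * (slice_left h (b \<otimes> c) \<otimes> t))" for b c
        by (simp add: tensor_mult h \<rho>h tensor_scaleC_left mult_scaleC_right state_scale[OF \<rho>h])
    qed
    then show ?thesis by meson
  qed
  have A2: "prod_state h (prod_state \<rho> h) ((s \<otimes> Q) * tensor_assoc (X \<otimes> 1)) = prod_state h \<rho> ((s \<otimes> slice_right h Q) * X)" for Q X s
  proof -
    have "(\<lambda>X. prod_state h (prod_state \<rho> h) ((s \<otimes> Q) * tensor_assoc (X \<otimes> 1))) = (\<lambda>X. prod_state h \<rho> ((s \<otimes> slice_right h Q) * X))"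
    proof (rule bounded_linear_tensor_eqI)
      show "bounded_linear (\<lambda>X. prod_state h (prod_state \<rho> h) ((s \<otimes> Q) * tensor_assoc (X \<otimes> 1)))"
        by (intro bounded_linear_compose[OF state_bounded_linear[OF S]] bounded_linear_compose[OF bounded_linear_mult_right]
            bounded_linear_compose[OF unital_star_hom_linear[OF homs(3)]] bounded_linear_tensor_left)
      show "bounded_linear (\<lambda>X. prod_state h \<rho> ((s \<otimes> slice_right h Q) * X))"
        by (intro bounded_linear_compose[OF state_bounded_linear[OF state_prod_state[OF h \<rho>]]] bounded_linear_mult_right)
      show "prod_state h (prod_state \<rho> h) ((s \<otimes> Q) * tensor_assoc ((b \<otimes> c) \<otimes> 1)) = prod_state h \<rho> ((s \<otimes> slice_right h Q) * (b \<otimes> c))" for b c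
        using prod_state_mult_left'[OF \<rho> h, of Q c] by (simp add: tensor_mult h \<rho> \<rho>h)
    qed
    then show ?thesis by meson
  qed
  have "prod_state \<rho> h (\<Delta> q * (1 \<otimes> adj_op g a)) = \<Psi> (tensor_assoc (tensor_map \<Delta> id (\<Delta> y)))"
  proof -
    have "(\<lambda>Z. prod_state \<rho> h (\<Delta> q * (1 \<otimes> slice_left h (Z * (a \<otimes> 1))))) = (\<lambda>Z. \<Psi> (tensor_assoc (tensor_map \<Delta> id Z)))"
    proof (rule bounded_linear_tensor_eqI)
      show "bounded_linear (\<lambda>Z. prod_state \<rho> h (\<Delta> q * (1 \<otimes> slice_left h (Z * (a \<otimes> 1)))))"
        by (intro bounded_linear_compose[OF state_bounded_linear[OF \<rho>h]] bounded_linear_compose[OF bounded_linear_mult_right]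
            bounded_linear_compose[OF bounded_clinear_linear[OF bounded_clinear_tensor_right]]
            bounded_linear_compose[OF slice_left_linear[OF h]] bounded_linear_mult_left)
      show "bounded_linear (\<lambda>Z. \<Psi> (tensor_assoc (tensor_map \<Delta> id Z)))"
        by (intro bounded_linear_compose[OF \<Psi>_lin] bounded_linear_compose[OF unital_star_hom_linear[OF homs(3)]]
            unital_star_hom_linear[OF homs(2)])
      fix s t
      have "\<Psi> (tensor_assoc (tensor_map \<Delta> id (s \<otimes> t))) =
          prod_state h (prod_state \<rho> h) ((1 \<otimes> \<Delta> q) * (tensor_assoc (\<Delta> s \<otimes> t) * tensor_assoc (\<Delta> a \<otimes> 1)))"
        by (simp add: \<Psi>_def hom unital_star_hom_id mult.assoc)
      also have "tensor_assoc (\<Delta> s \<otimes> t) * tensor_assoc (\<Delta> a \<otimes> 1) = tensor_assoc (\<Delta> (s * a) \<otimes> t)"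
        by (simp add: unital_star_hom_mult[OF homs(3), symmetric] tensor_mult unital_star_hom_mult[OF hom])
      finally have eq: "\<Psi> (tensor_assoc (tensor_map \<Delta> id (s \<otimes> t))) = prod_state \<rho> h (\<Delta> q * (slice_left h (\<Delta> (s * a)) \<otimes> t))"
        unfolding A1 .
      show "prod_state \<rho> h (\<Delta> q * (1 \<otimes> slice_left h ((s \<otimes> t) * (a \<otimes> 1)))) = \<Psi> (tensor_assoc (tensor_map \<Delta> id (s \<otimes> t)))"
        unfolding eq by (simp add: h_left tensor_mult h tensor_scaleC_left tensor_scaleC_right)
    qed
    from fun_cong[OF this, of "\<Delta> y"] show ?thesis by (simp add: adj_op_def y_def)
  qed
  also have "tensor_assoc (tensor_map \<Delta> id (\<Delta> y)) = tensor_map id \<Delta> (\<Delta> y)" by (simp add: coassoc)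
  also have "\<Psi> (tensor_map id \<Delta> (\<Delta> y)) = h (q * adj_op g (translate \<rho> a))"
  proof -
    have "(\<lambda>Z. \<Psi> (tensor_map id \<Delta> Z)) = (\<lambda>Z. h (q * slice_left h (Z * (translate \<rho> a \<otimes> 1))))"
    proof (rule bounded_linear_tensor_eqI)
      show "bounded_linear (\<lambda>Z. \<Psi> (tensor_map id \<Delta> Z))"
        by (intro bounded_linear_compose[OF \<Psi>_lin] unital_star_hom_linear[OF homs(1)])
      show "bounded_linear (\<lambda>Z. h (q * slice_left h (Z * (translate \<rho> a \<otimes> 1))))"
        by (intro bounded_linear_compose[OF state_bounded_linear[OF h]] bounded_linear_compose[OF bounded_linear_mult_right]
            bounded_linear_compose[OF slice_left_linear[OF h]] bounded_linear_mult_left)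
      fix s t
      have "\<Psi> (tensor_map id \<Delta> (s \<otimes> t)) = prod_state h (prod_state \<rho> h) ((s \<otimes> \<Delta> (q * t)) * tensor_assoc (\<Delta> a \<otimes> 1))"
        by (simp add: \<Psi>_def hom unital_star_hom_id tensor_mult unital_star_hom_mult[OF hom])
      also have "\<dots> = h (q * t) * prod_state h \<rho> ((s \<otimes> 1) * \<Delta> a)"
        by (simp add: A2 h_right tensor_scaleC_right mult_scaleC_left state_scale[OF state_prod_state[OF h \<rho>]])
      also have "prod_state h \<rho> ((s \<otimes> 1) * \<Delta> a) = h (s * translate \<rho> a)"
        by (simp add: prod_state_mult_left[OF h \<rho>] translate_def)
      finally have eq: "\<Psi> (tensor_map id \<Delta> (s \<otimes> t)) = h (q * t) * h (s * translate \<rho> a)" .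
      show "\<Psi> (tensor_map id \<Delta> (s \<otimes> t)) = h (q * slice_left h ((s \<otimes> t) * (translate \<rho> a \<otimes> 1)))"
        unfolding eq by (simp add: tensor_mult h mult_scaleC_right state_scale[OF h])
    qed
    from fun_cong[OF this, of "\<Delta> y"] show ?thesis by (simp add: adj_op_def y_def)
  qed
  finally show ?thesis .
qed

text \<open>Coassociativity moves the translation past \<open>int_op g\<close>, and
  \<open>adj_op_translate\<close> moves it past the adjoint. Since the composite commutes with
  translations, its eigenspaces are translation invariant, which makes them finite-dimensional
  subcomodules.\<close>

lemma translate_int_op:
  assumes \<rho>: "state \<rho>"
  shows "translate \<rho> (int_op g (adj_op g a)) = int_op g (adj_op g (translate \<rho> a))"
proof (rule states_eqI)
  fix \<sigma> :: "'a \<Rightarrow> complex" assume \<sigma>: "state \<sigma>"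
  note st = state_prod_state[OF \<sigma> state_prod_state[OF \<rho> h]] state_prod_state[OF \<sigma> \<rho>] state_prod_state[OF \<rho> h] state_prod_state[OF \<sigma> h]
  note homs = unital_star_hom_tensor_map[OF unital_star_hom_id hom] unital_star_hom_tensor_map[OF hom unital_star_hom_id]
    unital_star_hom_tensor_assoc
  let ?v = "adj_op g a"
  have "\<sigma> (translate \<rho> (int_op g ?v)) = prod_state \<sigma> \<rho> (\<Delta> (slice_right h (\<Delta> g * (1 \<otimes> ?v))))"
    by (simp add: translate_def int_op_def prod_state_right[OF \<sigma> \<rho>])
  also have "\<dots> = prod_state (\<lambda>x. prod_state \<sigma> \<rho> (\<Delta> x)) h (\<Delta> g * (1 \<otimes> ?v))"
    by (simp add: prod_state_right[OF state_unital_star_hom[OF st(2) hom] h])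
  also have "\<dots> = prod_state (prod_state \<sigma> \<rho>) h (tensor_map \<Delta> id (\<Delta> g * (1 \<otimes> ?v)))"
    by (simp add: prod_state_tensor_map[OF st(2) h hom unital_star_hom_id])
  also have "\<dots> = prod_state \<sigma> (prod_state \<rho> h) (tensor_assoc (tensor_map \<Delta> id (\<Delta> g * (1 \<otimes> ?v))))"
    by (simp add: prod_state_tensor_assoc[OF \<sigma> \<rho> h])
  also have "tensor_assoc (tensor_map \<Delta> id (\<Delta> g * (1 \<otimes> ?v))) = tensor_map id \<Delta> (\<Delta> g) * (1 \<otimes> (1 \<otimes> ?v))"
    by (simp add: unital_star_hom_mult[OF homs(2)] unital_star_hom_mult[OF homs(3)] coassoc hom unital_star_hom_id
        unital_star_hom_one[OF hom] tensor_one[where 'a = 'a and 'b = 'a])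
  also have "prod_state \<sigma> (prod_state \<rho> h) (tensor_map id \<Delta> (\<Delta> g) * (1 \<otimes> (1 \<otimes> ?v))) =
      prod_state \<sigma> h (\<Delta> g * (1 \<otimes> adj_op g (translate \<rho> a)))"
  proof -
    have "(\<lambda>X. prod_state \<sigma> (prod_state \<rho> h) (tensor_map id \<Delta> X * (1 \<otimes> (1 \<otimes> ?v)))) =
        (\<lambda>X. prod_state \<sigma> h (X * (1 \<otimes> adj_op g (translate \<rho> a))))"
    proof (rule bounded_linear_tensor_eqI)
      show "bounded_linear (\<lambda>X. prod_state \<sigma> (prod_state \<rho> h) (tensor_map id \<Delta> X * (1 \<otimes> (1 \<otimes> ?v))))"
        by (intro bounded_linear_compose[OF state_bounded_linear[OF st(1)]] bounded_linear_compose[OF bounded_linear_mult_left]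
            unital_star_hom_linear[OF homs(1)])
      show "bounded_linear (\<lambda>X. prod_state \<sigma> h (X * (1 \<otimes> adj_op g (translate \<rho> a))))"
        by (intro bounded_linear_compose[OF state_bounded_linear[OF st(4)]] bounded_linear_mult_left)
      show "prod_state \<sigma> (prod_state \<rho> h) (tensor_map id \<Delta> (p \<otimes> q) * (1 \<otimes> (1 \<otimes> ?v))) =
          prod_state \<sigma> h ((p \<otimes> q) * (1 \<otimes> adj_op g (translate \<rho> a)))" for p q
        using \<sigma> h st by (simp add: hom unital_star_hom_id tensor_mult adj_op_translate[OF \<rho>])
    qed
    then show ?thesis by meson
  qed
  also have "\<dots> = \<sigma> (int_op g (adj_op g (translate \<rho> a)))"
    by (simp add: prod_state_right[OF \<sigma> h] int_op_def)
  finally show "\<sigma> (translate \<rho> (int_op g ?v)) = \<sigma> (int_op g (adj_op g (translate \<rho> a)))" .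
qed

end

section \<open>Corepresentations arising from coactions\<close>

lemma closed_preimage: "bounded_clinear F \<Longrightarrow> closed S \<Longrightarrow> closed {x. F x \<in> S}"
  by (rule continuous_closed_vimage[unfolded vimage_def]) (auto intro: linear_continuous_at bounded_clinear_linear)

lemma csubspace_preimage: "bounded_clinear F \<Longrightarrow> csubspace S \<Longrightarrow> csubspace {x. F x \<in> S}"
  by (auto simp: complex_vector.subspace_def bounded_clinear_add bounded_clinear_scaleC bounded_clinear_zero)

context cqg
begin

text \<open>Orthonormality lets the slice against \<open>star e\<close> read off the coefficient of
  e on both sides of the coaction identity. It is applied to \<Delta>, as the action of the quantum
  group on itself, and to a general action.\<close>

lemma corepresentation_of_coaction:
  fixes \<alpha> :: "'b::cstar_algebra \<Rightarrow> 'b \<otimes> 'a"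
  assumes \<alpha>: "unital_star_hom \<alpha>" and coaction: "\<And>b. tensor_assoc (tensor_map \<alpha> id (\<alpha> b)) = tensor_map id \<Delta> (\<alpha> b)"
    and \<mu>: "state \<mu>" and E: "finite E" and on: "\<And>e f. e \<in> E \<Longrightarrow> f \<in> E \<Longrightarrow> \<mu> (star e * f) = (if e = f then 1 else 0)"
    and u: "\<And>f. f \<in> E \<Longrightarrow> \<alpha> f = (\<Sum>e\<in>E. e \<otimes> u e f)"
  shows "corepresentation \<Delta> E u"
  unfolding corepresentation_def
proof (intro conjI ballI E)
  fix e f assume e: "e \<in> E" and f: "f \<in> E"
  note homs = unital_star_hom_tensor_map[OF unital_star_hom_id hom] unital_star_hom_tensor_map[OF \<alpha> unital_star_hom_id]
    unital_star_hom_tensor_assoc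
  have pick: "slice_left \<mu> ((star e \<otimes> 1) * (\<Sum>k\<in>E. k \<otimes> c k)) = c e" for c :: "'b \<Rightarrow> 'a \<otimes> 'a"
  proof -
    have "slice_left \<mu> ((star e \<otimes> 1) * (\<Sum>k\<in>E. k \<otimes> c k)) = (\<Sum>k\<in>E. \<mu> (star e * k) *\<^sub>C c k)"
      by (simp add: sum_distrib_left tensor_mult slice_left_sum[OF \<mu>] \<mu>)
    also have "\<dots> = (\<Sum>k\<in>E. if e = k then c k else 0)"
      by (intro sum.cong refl) (simp add: on e)
    finally show ?thesis using E e by simp
  qed
  have "tensor_map id \<Delta> (\<alpha> f) = (\<Sum>e\<in>E. e \<otimes> \<Delta> (u e f))"
    by (simp add: u f unital_star_hom_sum[OF homs(1)] hom unital_star_hom_id)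
  moreover have "tensor_assoc (tensor_map \<alpha> id (\<alpha> f)) = (\<Sum>e\<in>E. e \<otimes> (\<Sum>k\<in>E. u e k \<otimes> u k f))"
  proof -
    have "tensor_assoc (tensor_map \<alpha> id (\<alpha> f)) = (\<Sum>k\<in>E. tensor_assoc (\<alpha> k \<otimes> u k f))"
      by (simp add: u[OF f] unital_star_hom_sum[OF homs(2)] unital_star_hom_sum[OF homs(3)] \<alpha> unital_star_hom_id)
    also have "\<dots> = (\<Sum>k\<in>E. \<Sum>e\<in>E. e \<otimes> (u e k \<otimes> u k f))"
      by (intro sum.cong refl) (simp add: u tensor_sum_left unital_star_hom_sum[OF homs(3)])
    also have "\<dots> = (\<Sum>e\<in>E. \<Sum>k\<in>E. e \<otimes> (u e k \<otimes> u k f))" by (rule sum.swap)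
    finally show ?thesis by (simp add: tensor_sum_right)
  qed
  ultimately have "(\<Sum>e\<in>E. e \<otimes> \<Delta> (u e f)) = (\<Sum>e\<in>E. e \<otimes> (\<Sum>k\<in>E. u e k \<otimes> u k f))" using coaction by metis
  from arg_cong[OF this, of "\<lambda>X. slice_left \<mu> ((star e \<otimes> 1) * X)"]
  show "\<Delta> (u e f) = (\<Sum>k\<in>E. u e k \<otimes> u k f)" unfolding pick .
qed

lemma isometric_of_coaction:
  fixes \<alpha> :: "'b::cstar_algebra \<Rightarrow> 'b \<otimes> 'a"
  assumes \<alpha>: "unital_star_hom \<alpha>" and inv: "\<And>b. slice_left \<mu> (\<alpha> b) = \<mu> b *\<^sub>C 1"
    and \<mu>: "state \<mu>" and E: "finite E" and on: "\<And>e f. e \<in> E \<Longrightarrow> f \<in> E \<Longrightarrow> \<mu> (star e * f) = (if e = f then 1 else 0)"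
    and u: "\<And>f. f \<in> E \<Longrightarrow> \<alpha> f = (\<Sum>e\<in>E. e \<otimes> u e f)" and e: "e \<in> E" and f: "f \<in> E"
  shows "(\<Sum>k\<in>E. star (u k e) * u k f) = (if e = f then 1 else 0)"
proof -
  have "slice_left \<mu> (star (\<alpha> e) * \<alpha> f) = (if e = f then 1 else 0)"
    using inv[of "star e * f"] by (simp add: unital_star_hom_mult[OF \<alpha>] unital_star_hom_star[OF \<alpha>] on e f)
  moreover have "slice_left \<mu> (star (\<alpha> e) * \<alpha> f) = (\<Sum>k\<in>E. \<Sum>l\<in>E. \<mu> (star k * l) *\<^sub>C (star (u k e) * u l f))"
    by (simp add: u e f star_sum sum_product tensor_star tensor_mult slice_left_sum[OF \<mu>] \<mu>)
  moreover have "\<dots> = (\<Sum>k\<in>E. \<Sum>l\<in>E. if k = l then star (u k e) * u l f else 0)"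
    by (intro sum.cong refl) (simp add: on)
  ultimately show ?thesis using E by simp
qed

text \<open>Traciality makes \<open>E\<close> orthonormal also for
  \<open>\<mu> (a * star b)\<close>. Invariance at \<open>e * star f\<close>, in place of
  \<open>star e * f\<close>, then yields the isometry relation of the entrywise conjugate.\<close>

lemma conjugate_isometric_of_coaction:
  fixes \<alpha> :: "'b::cstar_algebra \<Rightarrow> 'b \<otimes> 'a"
  assumes \<alpha>: "unital_star_hom \<alpha>" and inv: "\<And>b. slice_left \<mu> (\<alpha> b) = \<mu> b *\<^sub>C 1" and tr: "tracial \<mu>"
    and \<mu>: "state \<mu>" and E: "finite E" and on: "\<And>e f. e \<in> E \<Longrightarrow> f \<in> E \<Longrightarrow> \<mu> (star e * f) = (if e = f then 1 else 0)"
    and u: "\<And>f. f \<in> E \<Longrightarrow> \<alpha> f = (\<Sum>e\<in>E. e \<otimes> u e f)" and e: "e \<in> E" and f: "f \<in> E"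
  shows "(\<Sum>k\<in>E. u k e * star (u k f)) = (if e = f then 1 else 0)"
proof -
  have on': "\<mu> (a * star b) = (if a = b then 1 else 0)" if "a \<in> E" "b \<in> E" for a b
    using tr on[OF that(2,1)] by (auto simp: tracial_def)
  have "slice_left \<mu> (\<alpha> e * star (\<alpha> f)) = (if e = f then 1 else 0)"
    using inv[of "e * star f"] by (simp add: unital_star_hom_mult[OF \<alpha>] unital_star_hom_star[OF \<alpha>] on' e f)
  moreover have "slice_left \<mu> (\<alpha> e * star (\<alpha> f)) = (\<Sum>k\<in>E. \<Sum>l\<in>E. \<mu> (k * star l) *\<^sub>C (u k e * star (u l f)))"
    by (simp add: u e f star_sum sum_product tensor_star tensor_mult slice_left_sum[OF \<mu>] \<mu>)
  moreover have "\<dots> = (\<Sum>k\<in>E. \<Sum>l\<in>E. if k = l then u k e * star (u l f) else 0)"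
    by (intro sum.cong refl) (simp add: on')
  ultimately show ?thesis using E by simp
qed

end

section \<open>Eigenspaces as corepresentations, and density of their coefficients\<close>

context haar
begin

lemma translate_clinear: "state \<rho> \<Longrightarrow> bounded_clinear (translate \<rho>)"
  unfolding translate_def[abs_def]
  by (rule bounded_clinear_compose[OF slice_right_clinear bounded_clinear_unital_star_hom[OF hom]])

lemma coeff_clinear: "bounded_clinear (coeff x)"
  unfolding coeff_def[abs_def]
  by (rule bounded_clinear_compose[OF slice_left_clinear[OF h]
        bounded_clinear_compose[OF bounded_clinear_mult_right bounded_clinear_unital_star_hom[OF hom]]])

context
  fixes g :: 'a and l :: real and E :: "'a set"
  assumes l: "0 < l" and fin: "finite E"
    and eig: "\<And>e. e \<in> E \<Longrightarrow> int_op g (adj_op g e) = complex_of_real l *\<^sub>C e"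
    and on: "\<And>e f. e \<in> E \<Longrightarrow> f \<in> E \<Longrightarrow> h (star e * f) = (if e = f then 1 else 0)"
    and basis: "\<And>z. int_op g (adj_op g z) = complex_of_real l *\<^sub>C z \<Longrightarrow> z = (\<Sum>e\<in>E. h (star e * z) *\<^sub>C e)"
begin

interpretation compact_adjoint_pair h "adj_op g" "int_op g" "norm g"
  by (rule pair)

text \<open>Translates of \<open>f\<close> stay in the eigenspace by
  \<open>translate_int_op\<close>, so they expand in \<open>E\<close>; the coefficients of the
  expansion are the values of the state \<rho> at \<open>coeff e f\<close>.\<close>

lemma coproduct_eigenvector:
  assumes f: "f \<in> E"
  shows "\<Delta> f = (\<Sum>e\<in>E. e \<otimes> coeff e f)"
proof (rule prod_states_eqI)
  fix \<sigma> \<rho> :: "'a \<Rightarrow> complex" assume st: "state \<sigma>" "state \<rho>"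
  have "int_op g (adj_op g (translate \<rho> f)) = complex_of_real l *\<^sub>C translate \<rho> f"
    using translate_int_op[OF st(2), of g f] eig[OF f] bounded_clinear_scaleC[OF translate_clinear[OF st(2)]] by simp
  from basis[OF this] have "\<sigma> (translate \<rho> f) = (\<Sum>e\<in>E. h (star e * translate \<rho> f) * \<sigma> e)"
    by (metis (no_types, lifting) state_scale[OF st(1)] state_sum[OF st(1)] sum.cong)
  then show "prod_state \<sigma> \<rho> (\<Delta> f) = prod_state \<sigma> \<rho> (\<Sum>e\<in>E. e \<otimes> coeff e f)"
    using st by (simp add: prod_state_right translate_def[symmetric] slice_right_sum state_sum state_scale state_coeff mult.commute)
qed

text \<open>The difference D of the two sides satisfies D(T x) = l D(x). This forces D = 0 on
  eigenvectors for other eigenvalues, while on the eigenspace of l the expansion in \<open>E\<close>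
  does. By density D(T x) = 0 for all x, and l > 0 gives D(x) = 0.\<close>

lemma coeff_expand:
  assumes e: "e \<in> E"
  shows "coeff e x = (\<Sum>j\<in>E. h (star j * x) *\<^sub>C coeff e j)"
proof -
  define D where "D x = coeff e x - (\<Sum>j\<in>E. h (star j * x) *\<^sub>C coeff e j)" for x
  have lin: "D (x + y) = D x + D y" "D (c *\<^sub>C x) = c *\<^sub>C D x" for c x y
    by (simp_all add: D_def bounded_clinear_add[OF coeff_clinear] bounded_clinear_scaleC[OF coeff_clinear] distrib_left
        mult_scaleC_right state_add[OF h] state_scale[OF h] scaleC_add_left sum.distrib scaleC_diff_right
        scaleC_sum_right scaleC_scaleC)
  have DT: "D (T x) = complex_of_real l *\<^sub>C D x" for x
  proof -
    have star_eig: "star (T j) = complex_of_real l *\<^sub>C star j" if "j \<in> E" for j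
      using eig[OF that] by (simp add: T_def star_scaleC)
    have "coeff e (T x) = complex_of_real l *\<^sub>C coeff e x"
    proof (rule states_eqI)
      fix \<rho> :: "'a \<Rightarrow> complex" assume \<rho>: "state \<rho>"
      have "\<rho> (coeff e (T x)) = h (star e * T (translate \<rho> x))"
        by (simp add: state_coeff[OF \<rho>] T_def translate_int_op[OF \<rho>])
      also have "\<dots> = complex_of_real l * h (star e * translate \<rho> x)"
        by (simp add: T_symmetric[symmetric] star_eig[OF e] mult_scaleC_left state_scale[OF h])
      finally show "\<rho> (coeff e (T x)) = \<rho> (complex_of_real l *\<^sub>C coeff e x)"
        by (simp add: state_coeff[OF \<rho>] state_scale[OF \<rho>])
    qed
    moreover have "h (star j * T x) = complex_of_real l * h (star j * x)" if "j \<in> E" for j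
      by (simp add: T_symmetric[symmetric] star_eig[OF that] mult_scaleC_left state_scale[OF h])
    ultimately show ?thesis
      by (simp add: D_def scaleC_diff_right scaleC_sum_right scaleC_scaleC)
  qed
  have D_eig: "D z = 0" if "z \<in> eigenvectors" for z
  proof -
    obtain m where m: "0 < m" "T z = complex_of_real m *\<^sub>C z" using \<open>z \<in> eigenvectors\<close> by (auto simp: eigenvectors_def)
    show ?thesis
    proof (cases "m = l")
      case True
      then have "z = (\<Sum>j\<in>E. h (star j * z) *\<^sub>C j)" using basis[of z] m(2) by (simp add: T_def)
      then have "coeff e z = (\<Sum>j\<in>E. h (star j * z) *\<^sub>C coeff e j)"
        by (metis (no_types, lifting) bounded_clinear_sum[OF coeff_clinear] bounded_clinear_scaleC[OF coeff_clinear] sum.cong)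
      then show ?thesis by (simp add: D_def)
    next
      case False
      have "complex_of_real m *\<^sub>C D z = complex_of_real l *\<^sub>C D z" using DT[of z] m(2) lin(2) by simp
      then have "complex_of_real (m - l) *\<^sub>C D z = 0" by (simp add: complex_vector.scale_left_diff_distrib)
      then show ?thesis using False by (simp add: complex_vector.scale_eq_0_iff)
    qed
  qed
  have D0: "D 0 = 0" using lin(2)[of 0 0] by simp
  have "closed {x. D x = 0}"
    unfolding D_def
  proof (intro closed_Collect_eq continuous_on_diff continuous_on_sum linear_continuous_on continuous_on_const)
    show "bounded_linear (coeff e)" by (rule bounded_clinear_linear[OF coeff_clinear])
    fix j
    have "bounded_linear (\<lambda>x. h (star j * x))"
      by (rule bounded_linear_compose[OF state_bounded_linear[OF h] bounded_linear_mult_right])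
    moreover have "bounded_linear (\<lambda>c. c *\<^sub>C coeff e j)"
      by (rule bounded_linear_intro[where K = "norm (coeff e j)"])
        (auto simp: scaleC_add_left norm_scaleC scaleR_scaleC scaleC_scaleC scaleR_conv_of_real)
    ultimately show "bounded_linear (\<lambda>x. h (star j * x) *\<^sub>C coeff e j)" by (rule bounded_linear_compose[rotated])
  qed (rule bounded_linear_zero)
  moreover have "cspan eigenvectors \<subseteq> {x. D x = 0}"
    using D_eig lin D0 by (intro complex_vector.span_minimal) (auto simp: complex_vector.subspace_def)
  ultimately have "D (T x) = 0" using closure_minimal[of "cspan eigenvectors" "{x. D x = 0}"] T_in_closure_eigenvectors by blast
  then have "D x = 0" using DT l by (simp add: complex_vector.scale_eq_0_iff)
  then show ?thesis by (simp add: D_def)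
qed

lemma corepresentation_coeff: "corepresentation \<Delta> E coeff"
  by (rule corepresentation_of_coaction[OF hom coassoc[symmetric] h fin on coproduct_eigenvector])

text \<open>The isometry relation is invariance of \<open>h\<close>. For the other one, the slice
  \<open>\<Phi> e\<close> is compared with \<open>\<Psi> e\<close>, its modification by u u^*. On
  \<open>\<Delta> a * (1 \<otimes> b)\<close> they agree by \<open>coeff_expand\<close> and the
  isometry relation; density carries this to \<open>f \<otimes> 1\<close>, where it reads u u^* =
  1.\<close>

lemma unitary_coeff: "unitary_matrix E coeff"
proof -
  have iso: "(\<Sum>k\<in>E. star (coeff k e) * coeff k f) = (if e = f then 1 else 0)" if "e \<in> E" "f \<in> E" for e f
    by (rule isometric_of_coaction[OF hom h_left h fin on coproduct_eigenvector that])
  define \<Phi> where "\<Phi> e Z = slice_left h ((star e \<otimes> 1) * Z)" for e and Z :: "'a \<otimes> 'a"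
  have \<Phi>: "bounded_clinear (\<Phi> e)" for e
    unfolding \<Phi>_def[abs_def] by (rule bounded_clinear_compose[OF slice_left_clinear[OF h] bounded_clinear_mult_right])
  define \<Psi> where "\<Psi> e Z = (\<Sum>j\<in>E. coeff e j * (\<Sum>k\<in>E. star (coeff k j) * \<Phi> k Z))" for e Z
  have \<Psi>: "bounded_clinear (\<Psi> e)" for e
    unfolding bounded_clinear_def
  proof (intro conjI allI)
    show "bounded_linear (\<Psi> e)"
      unfolding \<Psi>_def[abs_def]
      by (intro bounded_linear_sum bounded_linear_compose[OF bounded_linear_mult_right] bounded_clinear_linear \<Phi>)
    show "\<Psi> e (c *\<^sub>C Z) = c *\<^sub>C \<Psi> e Z" for c Z
      by (simp add: \<Psi>_def bounded_clinear_scaleC[OF \<Phi>] mult_scaleC_right flip: scaleC_sum_right)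
  qed
  have eq: "\<Phi> e Z = \<Psi> e Z" if e: "e \<in> E" for e Z
  proof (rule bounded_clinear_eq_on_dense[OF dense_right \<Phi> \<Psi>])
    fix Z assume "Z \<in> {\<Delta> a * (1 \<otimes> b) | a b. True}"
    then obtain a b where Z: "Z = \<Delta> a * (1 \<otimes> b)" by blast
    have \<Phi>Z: "\<Phi> k Z = coeff k a * b" for k
      unfolding \<Phi>_def Z mult.assoc[symmetric] by (simp add: slice_left_mult_right[OF h] coeff_def)
    have inner: "(\<Sum>k\<in>E. star (coeff k j) * \<Phi> k Z) = h (star j * a) *\<^sub>C b" if j: "j \<in> E" for j
    proof -
      have "(\<Sum>k\<in>E. star (coeff k j) * \<Phi> k Z) =
          (\<Sum>k\<in>E. \<Sum>m\<in>E. h (star m * a) *\<^sub>C (star (coeff k j) * coeff k m)) * b"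
        unfolding sum_distrib_right
      proof (intro sum.cong refl)
        fix k assume k: "k \<in> E"
        have "star (coeff k j) * \<Phi> k Z = star (coeff k j) * ((\<Sum>m\<in>E. h (star m * a) *\<^sub>C coeff k m) * b)"
          unfolding \<Phi>Z using coeff_expand[OF k, of a] by simp
        then show "star (coeff k j) * \<Phi> k Z = (\<Sum>m\<in>E. h (star m * a) *\<^sub>C (star (coeff k j) * coeff k m) * b)"
          by (simp add: sum_distrib_left sum_distrib_right mult_scaleC_right mult_scaleC_left mult.assoc)
      qed
      also have "(\<Sum>k\<in>E. \<Sum>m\<in>E. h (star m * a) *\<^sub>C (star (coeff k j) * coeff k m)) =
          (\<Sum>m\<in>E. \<Sum>k\<in>E. h (star m * a) *\<^sub>C (star (coeff k j) * coeff k m))" by (rule sum.swap)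
      also have "\<dots> = (\<Sum>m\<in>E. if j = m then h (star m * a) *\<^sub>C 1 else 0)"
        by (intro sum.cong refl) (simp add: scaleC_sum_right[symmetric] iso j)
      also have "\<dots> = h (star j * a) *\<^sub>C 1" using fin j by simp
      finally show ?thesis by (simp add: mult_scaleC_left)
    qed
    have "\<Psi> e Z = (\<Sum>j\<in>E. h (star j * a) *\<^sub>C coeff e j) * b"
      unfolding \<Psi>_def sum_distrib_right by (intro sum.cong refl) (simp add: inner mult_scaleC_right mult_scaleC_left)
    then show "\<Phi> e Z = \<Psi> e Z" unfolding \<Phi>Z using coeff_expand[OF e, of a] by simp
  qed
  have coiso: "(\<Sum>j\<in>E. coeff e j * star (coeff f j)) = (if e = f then 1 else 0)" if e: "e \<in> E" and f: "f \<in> E" for e f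
  proof -
    have \<Phi>f: "\<Phi> k (f \<otimes> 1) = (if k = f then 1 else 0)" if "k \<in> E" for k
      by (simp add: \<Phi>_def tensor_mult h on f that)
    have "(\<Sum>k\<in>E. star (coeff k j) * \<Phi> k (f \<otimes> 1)) = star (coeff f j)" for j
    proof -
      have "(\<Sum>k\<in>E. star (coeff k j) * \<Phi> k (f \<otimes> 1)) = (\<Sum>k\<in>E. if k = f then star (coeff k j) else 0)"
        by (intro sum.cong refl) (simp add: \<Phi>f)
      then show ?thesis using fin f by simp
    qed
    then show ?thesis using eq[OF e, of "f \<otimes> 1"] \<Phi>f[OF e] by (simp add: \<Psi>_def)
  qed
  show ?thesis unfolding unitary_matrix_def using iso coiso by blast
qed

end

text \<open>The index type has to be fixed; it is that of A itself, because the eigenbases that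
  provide the corepresentations are finite subsets of A and serve as their own index sets.\<close>

definition matrix_coeffs :: "'a set" where
  "matrix_coeffs = {u i j | I (u :: 'a \<Rightarrow> 'a \<Rightarrow> 'a) i j. corepresentation \<Delta> I u \<and> unitary_matrix I u \<and> i \<in> I \<and> j \<in> I}"

text \<open>\<open>Z\<close> consists of the z all of whose coefficients \<open>coeff x z\<close>
  lie in the closed span. It contains the eigenvectors of each composite operator and hence, by
  compactness, the ranges of these operators. Polarization and the density conditions enlarge this
  to all of A; density of the elements (b \<otimes> 1)\<Delta>(a) then recovers A from the
  coefficients.\<close>

theorem matrix_coeffs_dense: "closure (cspan matrix_coeffs) = UNIV"
proof -
  define C where "C = closure (cspan matrix_coeffs)"
  have C: "csubspace C" "closed C" unfolding C_def by (rule csubspace_closure complex_vector.subspace_span closed_closure)+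
  have C_base: "x \<in> C" if "x \<in> matrix_coeffs" for x
    unfolding C_def by (rule subsetD[OF closure_subset complex_vector.span_base[OF that]])
  define Z where "Z = {z. \<forall>x. coeff x z \<in> C}"
  have Z_sub: "csubspace Z"
    using C(1) by (auto simp: Z_def complex_vector.subspace_def bounded_clinear_add[OF coeff_clinear]
        bounded_clinear_scaleC[OF coeff_clinear] bounded_clinear_zero[OF coeff_clinear])
  have Z_closed: "closed Z"
    unfolding Z_def
  proof (intro closed_Collect_all)
    show "closed {z. coeff x z \<in> C}" for x
      by (rule closed_preimage[OF coeff_clinear C(2)])
  qed
  have TZ: "int_op g (adj_op g a) \<in> Z" for g a
  proof -
    interpret compact_adjoint_pair h "adj_op g" "int_op g" "norm g" by (rule pair)
    have "z \<in> Z" if "z \<in> eigenvectors" for z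
    proof -
      obtain l where l: "0 < l" "T z = complex_of_real l *\<^sub>C z" using \<open>z \<in> eigenvectors\<close> by (auto simp: eigenvectors_def)
      obtain E where E: "finite E" "\<And>e. e \<in> E \<Longrightarrow> T e = complex_of_real l *\<^sub>C e"
        "\<And>e f. e \<in> E \<Longrightarrow> f \<in> E \<Longrightarrow> h (star e * f) = (if e = f then 1 else 0)"
        "\<And>z. T z = complex_of_real l *\<^sub>C z \<Longrightarrow> z = (\<Sum>e\<in>E. h (star e * z) *\<^sub>C e)"
        by (rule eigenspace_basis[OF l(1)]) (rule that)
      note E' = l(1) E[unfolded T_def]
      have mem: "coeff e f \<in> C" if "e \<in> E" "f \<in> E" for e f
        using corepresentation_coeff[OF E'] unitary_coeff[OF E'] that
        by (intro C_base) (auto simp: matrix_coeffs_def)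
      have "f \<in> Z" if f: "f \<in> E" for f
      proof -
        have eq: "coeff x f = (\<Sum>e\<in>E. h (star x * e) *\<^sub>C coeff e f)" for x
          by (simp add: coeff_def[of x] coproduct_eigenvector[OF E' f] sum_distrib_left tensor_mult slice_left_sum[OF h] h)
        have "coeff x f \<in> C" for x
          unfolding eq[of x] by (intro complex_vector.subspace_sum[OF C(1)] complex_vector.subspace_scale[OF C(1)] mem f)
        then show ?thesis unfolding Z_def by blast
      qed
      then have "(\<Sum>e\<in>E. h (star e * z) *\<^sub>C e) \<in> Z"
        by (intro complex_vector.subspace_sum[OF Z_sub] complex_vector.subspace_scale[OF Z_sub])
      then show ?thesis using E(4)[OF l(2)] by simp
    qed
    then have "cspan eigenvectors \<subseteq> Z" by (intro complex_vector.span_minimal Z_sub) blast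
    then have "closure (cspan eigenvectors) \<subseteq> Z" by (rule closure_minimal[OF _ Z_closed])
    then show ?thesis using T_in_closure_eigenvectors[of a] by (auto simp: T_def)
  qed
  have int_add: "int_op (g + g') y = int_op g y + int_op g' y" "int_op (c *\<^sub>C g) y = c *\<^sub>C int_op g y" for g g' y c
    by (simp_all add: int_op_def unital_star_hom_add[OF hom] unital_star_hom_scaleC[OF hom] distrib_right mult_scaleC_left
        bounded_clinear_add[OF slice_right_clinear[OF h]] slice_right_scaleC[OF h])
  have adj_add: "adj_op (g + g') y = adj_op g y + adj_op g' y" "adj_op (c *\<^sub>C g) y = cnj c *\<^sub>C adj_op g y" for g g' y c
    by (simp_all add: adj_op_def unital_star_hom_add[OF hom] unital_star_hom_scaleC[OF hom] distrib_right mult_scaleC_left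
        star_add star_scaleC bounded_clinear_add[OF slice_left_clinear[OF h]] slice_left_scaleC[OF h])
  note sub = complex_vector.subspace_add[OF Z_sub] complex_vector.subspace_diff[OF Z_sub] complex_vector.subspace_scale[OF Z_sub]
  \<comment> \<open>\<open>int_op\<close> is linear and \<open>adj_op\<close> conjugate linear in
    the kernel, so the kernels g + g' and g + i g' separate the two mixed terms.\<close>
  have polar: "int_op g (adj_op g' a) \<in> Z" for g g' a
  proof -
    let ?p = "int_op g (adj_op g' a)" and ?q = "int_op g' (adj_op g a)"
    note lin = int_add adj_add bounded_clinear_add[OF int_op_clinear] bounded_clinear_scaleC[OF int_op_clinear]
    have "int_op (g + g') (adj_op (g + g') a) - int_op g (adj_op g a) - int_op g' (adj_op g' a) = ?p + ?q"
      by (simp add: lin)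
    then have 1: "?p + ?q \<in> Z" using TZ sub(2) by metis
    have "int_op (g + \<i> *\<^sub>C g') (adj_op (g + \<i> *\<^sub>C g') a) - int_op g (adj_op g a) - int_op g' (adj_op g' a) = (- \<i>) *\<^sub>C ?p + \<i> *\<^sub>C ?q"
      by (simp add: lin scaleC_add_right scaleC_scaleC scaleC_minus_left scaleC_diff_right bounded_clinear_diff[OF int_op_clinear])
    then have "(- \<i>) *\<^sub>C ?p + \<i> *\<^sub>C ?q \<in> Z" using TZ sub(2) by metis
    from sub(3)[OF this, of \<i>] have 2: "?p - ?q \<in> Z"
      by (simp add: scaleC_add_right scaleC_scaleC scaleC_minus_left scaleC_diff_right)
    have "(1/2) *\<^sub>C ((?p + ?q) + (?p - ?q)) \<in> Z" by (rule sub(3)[OF sub(1)[OF 1 2]])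
    moreover have "(1/2) *\<^sub>C ((?p + ?q) + (?p - ?q)) = (1/2) *\<^sub>C (?p + ?p)" by simp
    moreover have "\<dots> = ?p" by (simp add: scaleC_add_right scaleC_add_left[symmetric])
    ultimately show ?thesis by simp
  qed
  \<comment> \<open>The slice of \<open>\<Delta> a * (b \<otimes> 1)\<close> by \<open>h\<close> is
    a value of \<open>adj_op\<close> with kernel \<open>star a\<close>, so density of these products
    replaces that value by an arbitrary y.\<close>
  have int_Z: "int_op g y \<in> Z" for g y
  proof -
    have V: "csubspace {X. int_op g (slice_left h X) \<in> Z}" "closed {X. int_op g (slice_left h X) \<in> Z}"
      by (intro csubspace_preimage closed_preimage bounded_clinear_compose[OF int_op_clinear slice_left_clinear[OF h]] Z_sub Z_closed)+
    have "{\<Delta> a * (b \<otimes> 1) | a b. True} \<subseteq> {X. int_op g (slice_left h X) \<in> Z}"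
      using polar[of g "star _"] by (auto simp: adj_op_def)
    from dense_span_induct[OF dense_left V this, of "1 \<otimes> y"] show ?thesis by (simp add: h state_one)
  qed
  have Z_UNIV: "y \<in> Z" for y
  proof -
    have V: "csubspace {X. slice_right h X \<in> Z}" "closed {X. slice_right h X \<in> Z}"
      by (intro csubspace_preimage closed_preimage slice_right_clinear[OF h] Z_sub Z_closed C)+
    have "{\<Delta> a * (1 \<otimes> b) | a b. True} \<subseteq> {X. slice_right h X \<in> Z}"
      using int_Z by (auto simp: int_op_def)
    from dense_span_induct[OF dense_right V this, of "y \<otimes> 1"] show ?thesis by (simp add: h state_one)
  qed
  have "y \<in> C" for y
  proof -
    have V: "csubspace {X. slice_left h X \<in> C}" "closed {X. slice_left h X \<in> C}"
      by (intro csubspace_preimage closed_preimage slice_left_clinear[OF h] Z_sub Z_closed C)+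
    have "slice_left h ((b \<otimes> 1) * \<Delta> a) \<in> C" for a b
      using Z_UNIV[of a] unfolding Z_def coeff_def by (metis (mono_tags, lifting) mem_Collect_eq star_star)
    then have "{(b \<otimes> 1) * \<Delta> a | a b. True} \<subseteq> {X. slice_left h X \<in> C}" by blast
    from dense_span_induct[OF dense_left' V this, of "1 \<otimes> y"] show ?thesis by (simp add: h state_one)
  qed
  then show ?thesis by (auto simp: C_def)
qed

end

section \<open>Spectral subspaces of an action\<close>

text \<open>The second condition says that the entrywise conjugate of \<open>u\<close> is isometric; it holds for all unitary
corepresentations only if the compact quantum group is of Kac type.\<close>

definition biisometric :: "'i set \<Rightarrow> ('i \<Rightarrow> 'i \<Rightarrow> 'a::cstar_algebra) \<Rightarrow> bool" where
  "biisometric I u \<longleftrightarrow>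
     (\<forall>i\<in>I. \<forall>j\<in>I. (\<Sum>k\<in>I. star (u k i) * u k j) = (if i = j then 1 else 0)) \<and>
     (\<forall>i\<in>I. \<forall>j\<in>I. (\<Sum>k\<in>I. u k i * star (u k j)) = (if i = j then 1 else 0))"

lemma orthonormal_basis_span:
  fixes F :: "'a::cstar_algebra set"
  assumes \<phi>: "state \<phi>" and F: "finite F"
  obtains E where "orthonormal \<phi> E" "E \<subseteq> cspan F"
    "\<And>z. z \<in> cspan F \<Longrightarrow> seminorm2 \<phi> (z - (\<Sum>e\<in>E. \<phi> (star e * z) *\<^sub>C e)) = 0"
proof (rule maximal_orthonormal[OF \<phi> complex_vector.subspace_span])
  fix E assume on: "orthonormal \<phi> E" and E: "E \<subseteq> cspan F"
  have fin: "finite E" using on by (simp add: orthonormal_def)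
  have "complex_vector.independent E"
  proof (subst complex_vector.independent_explicit_finite_subsets, intro allI impI ballI)
    fix A c v assume A: "A \<subseteq> E" "finite A" "(\<Sum>v\<in>A. c v *\<^sub>C v) = 0" and v: "v \<in> A"
    have "orthonormal \<phi> A" using on A(1,2) unfolding orthonormal_def by blast
    from orthonormal_sum[OF \<phi> this v, of c] A(3) show "c v = 0" by (simp add: state_zero[OF \<phi>])
  qed
  then show "card E \<le> card F" using complex_vector.independent_span_bound[OF F _ E] by blast
qed (use that in blast)

text \<open>If enlarging the span by \<open>x\<close> creates a null vector b0, all others are
  multiples of it, and averaging with a state that does not vanish on \<open>b0 * star b0\<close>
  removes them. The order \<open>b * star b\<close> matches the conclusion of
  \<open>null_averaged\<close>.\<close>

lemma state_faithful_on_span: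
  fixes F :: "'a::cstar_algebra set"
  assumes ne: "(1 :: 'a) \<noteq> 0" and F: "finite F"
  shows "\<exists>\<omega>. state \<omega> \<and> (\<forall>b\<in>cspan F. \<omega> (b * star b) = 0 \<longrightarrow> b = 0)"
  using F
proof (induction rule: finite_induct)
  case empty
  obtain \<omega> :: "'a \<Rightarrow> complex" where "state \<omega>" by (rule norming_state[OF ne])
  then show ?case by auto
next
  case (insert x F)
  then obtain \<omega> where \<omega>: "state \<omega>" "\<And>b. b \<in> cspan F \<Longrightarrow> \<omega> (b * star b) = 0 \<Longrightarrow> b = 0" by blast
  show ?case
  proof (cases "\<forall>b\<in>cspan (insert x F). \<omega> (b * star b) = 0 \<longrightarrow> b = 0")
    case True then show ?thesis using \<omega> by blast
  next
    case False
    then obtain b0 where b0: "b0 \<in> cspan (insert x F)" "\<omega> (b0 * star b0) = 0" "b0 \<noteq> 0" by blast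
    obtain \<rho> where \<rho>: "state \<rho>" "\<rho> (star (star b0) * star b0) = complex_of_real ((norm (star b0))\<^sup>2)"
      by (rule norming_state[OF ne])
    obtain c0 where c0: "b0 - c0 *\<^sub>C x \<in> cspan F" using b0(1) complex_vector.span_breakdown_eq by blast
    have "c0 \<noteq> 0" using c0 \<omega>(2)[of b0] b0 by auto
    define \<omega>' where "\<omega>' = (\<lambda>x. complex_of_real (1/2) * \<omega> x + complex_of_real (1 - 1/2) * \<rho> x)"
    have st: "state \<omega>'" unfolding \<omega>'_def by (rule state_convex) (use \<omega> \<rho> in auto)
    have "b = 0" if b: "b \<in> cspan (insert x F)" "\<omega>' (b * star b) = 0" for b
    proof -
      have "Re (\<omega> (b * star b)) + Re (\<rho> (b * star b)) = 0"
        using arg_cong[OF b(2), of Re] by (simp add: \<omega>'_def)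
      then have zero: "\<omega> (b * star b) = 0" "\<rho> (b * star b) = 0"
        using state_pos[OF \<omega>(1), of "star b"] state_pos[OF \<rho>(1), of "star b"] by (auto simp: complex_eq_iff)
      obtain c where c: "b - c *\<^sub>C x \<in> cspan F" using b(1) complex_vector.span_breakdown_eq by blast
      \<comment> \<open>The scalar cancels the component along \<open>x\<close>, so d lies in
        \<open>cspan F\<close>; null vectors of \<omega> are closed under combinations, hence d is
        null and vanishes.\<close>
      define d where "d = b - (c / c0) *\<^sub>C b0"
      have "d = (b - c *\<^sub>C x) - (c / c0) *\<^sub>C (b0 - c0 *\<^sub>C x)"
        using \<open>c0 \<noteq> 0\<close> by (simp add: d_def scaleC_diff_right scaleC_scaleC)
      then have "d \<in> cspan F" using c c0 by (simp add: complex_vector.span_diff complex_vector.span_scale)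
      moreover have "\<omega> (d * star d) = 0"
      proof -
        have "\<omega> (b * y) = 0" "\<omega> (b0 * y) = 0" for y
          using state_nonneg_eq_0(1)[OF \<omega>(1), of "star b" y] state_nonneg_eq_0(1)[OF \<omega>(1), of "star b0" y] zero b0(2) by simp_all
        then show ?thesis
          by (simp add: d_def left_diff_distrib mult_scaleC_left state_diff[OF \<omega>(1)] state_scale[OF \<omega>(1)])
      qed
      ultimately have b_eq: "b = (c / c0) *\<^sub>C b0" using \<omega>(2)[of d] by (simp add: d_def)
      then have "\<rho> (b * star b) = (c / c0) * cnj (c / c0) * \<rho> (star (star b0) * star b0)"
        by (simp add: star_scaleC mult_scaleC_left mult_scaleC_right scaleC_scaleC state_scale[OF \<rho>(1)] mult.commute mult.left_commute)
      then have "c / c0 = 0" using zero(2) b0(3) \<rho>(2) by auto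
      then show "b = 0" using b_eq by simp
    qed
    then show ?thesis using st by blast
  qed
qed

context haar
begin

text \<open>Let \<open>p = 1 - w w\<^sup>*\<close>.  Applying \<open>h \<otimes> id\<close> to \<open>\<Delta>(p\<^sub>i\<^sub>l)\<close> gives \<open>\<Sum>\<^sub>a\<^sub>b h(w\<^sub>i\<^sub>a w\<^sub>l\<^sub>b\<^sup>*) p\<^sub>a\<^sub>b = 0\<close>, and summing over
\<open>i = l\<close> gives \<open>\<Sum>\<^sub>a p\<^sub>a\<^sub>a = 0\<close>.\<close>

lemma biisometric_unitary:
  assumes u: "corepresentation \<Delta> I u" and bi: "biisometric I u"
  shows "unitary_matrix I u"
proof -
  have fin: "finite I" and \<Delta>u: "\<And>i j. i \<in> I \<Longrightarrow> j \<in> I \<Longrightarrow> \<Delta> (u i j) = (\<Sum>k\<in>I. u i k \<otimes> u k j)"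
    using u by (auto simp: corepresentation_def)
  have iso: "\<And>i j. i \<in> I \<Longrightarrow> j \<in> I \<Longrightarrow> (\<Sum>k\<in>I. star (u k i) * u k j) = (if i = j then 1 else 0)"
    and coiso: "\<And>i j. i \<in> I \<Longrightarrow> j \<in> I \<Longrightarrow> (\<Sum>k\<in>I. u k i * star (u k j)) = (if i = j then 1 else 0)"
    using bi by (auto simp: biisometric_def)
  define q where "q a b = (\<Sum>k\<in>I. u a k * star (u b k))" for a b
  define p where "p a b = (if a = b then 1 else 0) - q a b" for a b
  have star_q: "star (q a b) = q b a" for a b by (simp add: q_def star_sum star_mult)
  have \<Delta>q: "\<Delta> (q i l) = (\<Sum>a\<in>I. \<Sum>b\<in>I. (u i a * star (u l b)) \<otimes> q a b)" if i: "i \<in> I" and l: "l \<in> I" for i l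
  proof -
    have "\<Delta> (q i l) = (\<Sum>k\<in>I. \<Sum>a\<in>I. \<Sum>b\<in>I. (u i a * star (u l b)) \<otimes> (u a k * star (u b k)))"
      by (simp add: q_def unital_star_hom_sum[OF hom] unital_star_hom_mult[OF hom] unital_star_hom_star[OF hom] \<Delta>u i l
          star_sum sum_product tensor_star tensor_mult)
    also have "\<dots> = (\<Sum>a\<in>I. \<Sum>k\<in>I. \<Sum>b\<in>I. (u i a * star (u l b)) \<otimes> (u a k * star (u b k)))" by (rule sum.swap)
    also have "\<dots> = (\<Sum>a\<in>I. \<Sum>b\<in>I. \<Sum>k\<in>I. (u i a * star (u l b)) \<otimes> (u a k * star (u b k)))"
      by (intro sum.cong refl sum.swap)
    finally show ?thesis by (simp add: q_def tensor_sum_right)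
  qed
  have zero: "(\<Sum>a\<in>I. \<Sum>b\<in>I. h (u i a * star (u l b)) *\<^sub>C p a b) = 0" if i: "i \<in> I" and l: "l \<in> I" for i l
  proof -
    have "h (q i l) *\<^sub>C (1 :: 'a) = (\<Sum>a\<in>I. \<Sum>b\<in>I. h (u i a * star (u l b)) *\<^sub>C q a b)"
      using h_left[of "q i l"] by (simp add: \<Delta>q i l slice_left_sum[OF h] h)
    moreover have "h (q i l) *\<^sub>C (1 :: 'a) = (\<Sum>a\<in>I. \<Sum>b\<in>I. h (u i a * star (u l b)) *\<^sub>C (if a = b then 1 else 0))"
    proof -
      have "h (q i l) *\<^sub>C (1 :: 'a) = (\<Sum>a\<in>I. h (u i a * star (u l a)) *\<^sub>C (1 :: 'a))"
        by (simp add: q_def state_sum[OF h] complex_vector.scale_sum_left)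
      also have "\<dots> = (\<Sum>a\<in>I. \<Sum>b\<in>I. h (u i a * star (u l b)) *\<^sub>C (if a = b then 1 else 0))"
        using fin by (intro sum.cong refl) (simp add: if_distrib cong: if_cong)
      finally show ?thesis .
    qed
    ultimately show ?thesis by (simp add: p_def scaleC_diff_right sum_subtractf)
  qed
  have "(\<Sum>a\<in>I. p a a) = 0"
  proof -
    have "0 = (\<Sum>i\<in>I. \<Sum>a\<in>I. \<Sum>b\<in>I. h (u i a * star (u i b)) *\<^sub>C p a b)" by (simp add: zero)
    also have "\<dots> = (\<Sum>a\<in>I. \<Sum>i\<in>I. \<Sum>b\<in>I. h (u i a * star (u i b)) *\<^sub>C p a b)" by (rule sum.swap)
    also have "\<dots> = (\<Sum>a\<in>I. \<Sum>b\<in>I. \<Sum>i\<in>I. h (u i a * star (u i b)) *\<^sub>C p a b)" by (intro sum.cong refl sum.swap)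
    also have "\<dots> = (\<Sum>a\<in>I. \<Sum>b\<in>I. if a = b then p a b else 0)"
    proof (intro sum.cong refl)
      fix a b assume "a \<in> I" "b \<in> I"
      have "(\<Sum>i\<in>I. h (u i a * star (u i b)) *\<^sub>C p a b) = h (\<Sum>i\<in>I. u i a * star (u i b)) *\<^sub>C p a b"
        by (simp add: state_sum[OF h] complex_vector.scale_sum_left)
      then show "(\<Sum>i\<in>I. h (u i a * star (u i b)) *\<^sub>C p a b) = (if a = b then p a b else 0)"
        using coiso[OF \<open>a \<in> I\<close> \<open>b \<in> I\<close>] by (simp add: state_one[OF h] state_zero[OF h])
    qed
    finally show ?thesis using fin by simp
  qed
  \<comment> \<open>By \<open>iso\<close> the matrix \<open>q\<close> is a self-adjoint idempotent,
    and so is \<open>p\<close>. The diagonal of \<open>p\<close> is thus a sum of positive elements,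
    and its vanishing trace kills every entry.\<close>
  moreover have "p a a = (\<Sum>b\<in>I. p a b * star (p a b))" if a: "a \<in> I" for a
  proof -
    have qq: "(\<Sum>b\<in>I. q a b * q b a) = q a a"
    proof -
      have "(\<Sum>b\<in>I. q a b * q b a) = (\<Sum>b\<in>I. \<Sum>k\<in>I. \<Sum>m\<in>I. u a k * ((star (u b k) * u b m) * star (u a m)))"
        by (simp add: q_def sum_product mult.assoc)
      also have "\<dots> = (\<Sum>k\<in>I. \<Sum>b\<in>I. \<Sum>m\<in>I. u a k * ((star (u b k) * u b m) * star (u a m)))" by (rule sum.swap)
      also have "\<dots> = (\<Sum>k\<in>I. \<Sum>m\<in>I. \<Sum>b\<in>I. u a k * ((star (u b k) * u b m) * star (u a m)))" by (intro sum.cong refl sum.swap)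
      also have "\<dots> = (\<Sum>k\<in>I. \<Sum>m\<in>I. if k = m then u a k * star (u a m) else 0)"
        by (intro sum.cong refl) (simp add: sum_distrib_left[symmetric] sum_distrib_right[symmetric] iso)
      also have "\<dots> = q a a" using fin by (simp add: q_def)
      finally show ?thesis .
    qed
    have "(\<Sum>b\<in>I. p a b * star (p a b)) = (\<Sum>b\<in>I. if a = b then 1 - q a b - q b a else 0) + (\<Sum>b\<in>I. q a b * q b a)"
      unfolding sum.distrib[symmetric]
      by (intro sum.cong refl) (auto simp: p_def star_diff star_q algebra_simps)
    then show ?thesis using fin a by (simp add: qq p_def)
  qed
  ultimately have sum0: "(\<Sum>a\<in>I. \<Sum>b\<in>I. p a b * star (p a b)) = 0" by simp
  have "p a b = 0" if a: "a \<in> I" and b: "b \<in> I" for a b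
  proof -
    have "star (p a b) = 0"
    proof (rule states_separate)
      fix \<phi> :: "'a \<Rightarrow> complex" assume \<phi>: "state \<phi>"
      have nonneg: "0 \<le> Re (\<phi> (p a b * star (p a b)))" for a b
        using state_pos(1)[OF \<phi>, of "star (p a b)"] by simp
      have "(\<Sum>a\<in>I. \<Sum>b\<in>I. Re (\<phi> (p a b * star (p a b)))) = 0"
        using arg_cong[OF sum0, of "\<lambda>x. Re (\<phi> x)"] by (simp add: state_sum[OF \<phi>] state_zero[OF \<phi>])
      then have "(\<Sum>b\<in>I. Re (\<phi> (p a b * star (p a b)))) = 0"
        using fin a nonneg by (subst (asm) sum_nonneg_eq_0_iff) (auto intro: sum_nonneg)
      then have "Re (\<phi> (p a b * star (p a b))) = 0"
        using fin b nonneg by (subst (asm) sum_nonneg_eq_0_iff) auto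
      then show "\<phi> (star (star (p a b)) * star (p a b)) = 0"
        using state_pos(2)[OF \<phi>, of "star (p a b)"] by (simp add: complex_eq_iff)
    qed
    then show ?thesis by simp
  qed
  then show ?thesis using iso unfolding unitary_matrix_def by (auto simp: p_def q_def)
qed

end

section \<open>Spectral vectors and averaged states of an action\<close>

locale coaction = haar +
  fixes \<alpha> :: "'b::cstar_algebra \<Rightarrow> 'b \<otimes> 'a"
  assumes action: "cqg_action \<Delta> \<alpha>"
begin

lemma \<alpha>: "unital_star_hom \<alpha>"
  and coaction: "tensor_assoc (tensor_map \<alpha> id (\<alpha> b)) = tensor_map id \<Delta> (\<alpha> b)"
  and dense_action: "closure (cspan {\<alpha> b * (1 \<otimes> a) | a b. True}) = UNIV"
  using action by (auto simp: cqg_action_def)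

text \<open>The coaction identity moves the slice by \<open>h\<close> from B \<otimes> A to the last
  leg of B \<otimes> A \<otimes> A, where invariance of \<open>h\<close> can act.\<close>

lemma coaction_slice:
  assumes \<beta>: "state \<beta>" and \<rho>: "state \<rho>"
  shows "prod_state \<beta> \<rho> (\<alpha> (slice_right h (\<alpha> b * (1 \<otimes> p)))) =
    prod_state \<beta> (prod_state \<rho> h) (tensor_map id \<Delta> (\<alpha> b) * (1 \<otimes> (1 \<otimes> p)))"
proof -
  note st = state_prod_state[OF \<beta> \<rho>]
  note homs = unital_star_hom_tensor_map[OF \<alpha> unital_star_hom_id[where 'a = 'a]]
    unital_star_hom_tensor_assoc[where 'a = 'b and 'b = 'a and 'c = 'a]
  have "prod_state \<beta> \<rho> (\<alpha> (slice_right h (\<alpha> b * (1 \<otimes> p)))) = prod_state (\<lambda>x. prod_state \<beta> \<rho> (\<alpha> x)) h (\<alpha> b * (1 \<otimes> p))"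
    by (simp add: prod_state_right[OF state_unital_star_hom[OF st \<alpha>] h])
  also have "\<dots> = prod_state (prod_state \<beta> \<rho>) h (tensor_map \<alpha> id (\<alpha> b * (1 \<otimes> p)))"
    by (simp add: prod_state_tensor_map[OF st h \<alpha> unital_star_hom_id])
  also have "\<dots> = prod_state \<beta> (prod_state \<rho> h) (tensor_assoc (tensor_map \<alpha> id (\<alpha> b * (1 \<otimes> p))))"
    by (simp add: prod_state_tensor_assoc[OF \<beta> \<rho> h])
  also have "tensor_assoc (tensor_map \<alpha> id (\<alpha> b * (1 \<otimes> p))) = tensor_map id \<Delta> (\<alpha> b) * (1 \<otimes> (1 \<otimes> p))"
    by (simp add: unital_star_hom_mult[OF homs(1)] unital_star_hom_mult[OF homs(2)] coaction \<alpha> unital_star_hom_id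
        unital_star_hom_one[OF \<alpha>] tensor_one[where 'a = 'b and 'b = 'a])
  finally show ?thesis .
qed

lemma slice_invariant:
  assumes \<beta>: "state \<beta>" and \<rho>: "state \<rho>"
  shows "prod_state \<beta> (prod_state \<rho> h) (tensor_map id \<Delta> X * (1 \<otimes> (r \<otimes> 1))) = \<beta> (slice_right h X) * \<rho> r"
proof -
  have "(\<lambda>X. prod_state \<beta> (prod_state \<rho> h) (tensor_map id \<Delta> X * (1 \<otimes> (r \<otimes> 1)))) = (\<lambda>X. \<beta> (slice_right h X) * \<rho> r)"
  proof (rule bounded_linear_tensor_eqI)
    show "bounded_linear (\<lambda>X. prod_state \<beta> (prod_state \<rho> h) (tensor_map id \<Delta> X * (1 \<otimes> (r \<otimes> 1))))"
      by (intro bounded_linear_compose[OF state_bounded_linear[OF state_prod_state[OF \<beta> state_prod_state[OF \<rho> h]]]]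
          bounded_linear_compose[OF bounded_linear_mult_left]
          unital_star_hom_linear[OF unital_star_hom_tensor_map[OF unital_star_hom_id hom]])
    show "bounded_linear (\<lambda>X. \<beta> (slice_right h X) * \<rho> r)"
      by (intro bounded_linear_mult_const bounded_linear_compose[OF state_bounded_linear[OF \<beta>]] slice_right_linear[OF h])
    show "prod_state \<beta> (prod_state \<rho> h) (tensor_map id \<Delta> (b \<otimes> a) * (1 \<otimes> (r \<otimes> 1))) = \<beta> (slice_right h (b \<otimes> a)) * \<rho> r" for b a
      using prod_state_mult_left'[OF \<rho> h, of "\<Delta> a" r] \<beta> \<rho> h
      by (simp add: hom unital_star_hom_id tensor_mult state_prod_state h_right mult_scaleC_left state_scale)
  qed
  then show ?thesis by meson
qed

text \<open>These slices lie in Podles' spectral subspace of \<open>u\<close>; \<open>b\<close> and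
  \<open>j\<close> only label copies, and \<open>k\<close> is the index that transforms under
  \<alpha>.\<close>

definition spectral_vector :: "('i \<Rightarrow> 'i \<Rightarrow> 'a) \<Rightarrow> 'b \<Rightarrow> 'i \<Rightarrow> 'i \<Rightarrow> 'b" where
  "spectral_vector u b j k = slice_right h (\<alpha> b * (1 \<otimes> star (u k j)))"

text \<open>Unitarity writes \<open>1 \<otimes> star (u k j)\<close> as the sum over i of
  \<open>\<Delta> (star (u i j)) * (u i k \<otimes> 1)\<close>. Under the slice by \<open>h\<close>
  the factors containing \<Delta> collapse by right invariance and leave the spectral vectors as
  coefficients of \<open>u i k\<close>.\<close>

lemma action_spectral_vector:
  assumes u: "corepresentation \<Delta> I u" "unitary_matrix I u" and j: "j \<in> I" and k: "k \<in> I"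
  shows "\<alpha> (spectral_vector u b j k) = (\<Sum>i\<in>I. spectral_vector u b j i \<otimes> u i k)"
proof (rule prod_states_eqI)
  fix \<beta> :: "'b \<Rightarrow> complex" and \<rho> :: "'a \<Rightarrow> complex" assume st: "state \<beta>" "state \<rho>"
  have fin: "finite I" and \<Delta>u: "\<And>i j. i \<in> I \<Longrightarrow> j \<in> I \<Longrightarrow> \<Delta> (u i j) = (\<Sum>k\<in>I. u i k \<otimes> u k j)"
    using u by (auto simp: corepresentation_def)
  note homs = unital_star_hom_tensor_map[OF unital_star_hom_id[where 'a = 'b] hom]
  have "(\<Sum>i\<in>I. \<Delta> (star (u i j)) * (u i k \<otimes> 1)) = (\<Sum>i\<in>I. \<Sum>l\<in>I. (star (u i l) * u i k) \<otimes> star (u l j))"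
    by (intro sum.cong refl) (simp add: unital_star_hom_star[OF hom] \<Delta>u j star_sum tensor_star sum_distrib_right tensor_mult)
  also have "\<dots> = (\<Sum>l\<in>I. (\<Sum>i\<in>I. star (u i l) * u i k) \<otimes> star (u l j))"
    by (subst sum.swap) (simp add: tensor_sum_left)
  also have "\<dots> = (\<Sum>l\<in>I. if l = k then 1 \<otimes> star (u l j) else 0)"
    by (intro sum.cong refl) (use u(2) k in \<open>simp add: unitary_matrix_def\<close>)
  also have "\<dots> = 1 \<otimes> star (u k j)" using fin k by simp
  finally have one: "1 \<otimes> star (u k j) = (\<Sum>i\<in>I. \<Delta> (star (u i j)) * (u i k \<otimes> 1))" by simp
  have "tensor_map id \<Delta> (\<alpha> b) * (1 \<otimes> (1 \<otimes> star (u k j))) =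
      (\<Sum>i\<in>I. tensor_map id \<Delta> (\<alpha> b) * ((1 \<otimes> \<Delta> (star (u i j))) * (1 \<otimes> (u i k \<otimes> 1))))"
    unfolding one by (simp add: tensor_sum_right sum_distrib_left tensor_mult)
  also have "\<dots> = (\<Sum>i\<in>I. tensor_map id \<Delta> (\<alpha> b * (1 \<otimes> star (u i j))) * (1 \<otimes> (u i k \<otimes> 1)))"
    by (simp add: unital_star_hom_mult[OF homs] hom unital_star_hom_id mult.assoc)
  finally have "prod_state \<beta> \<rho> (\<alpha> (spectral_vector u b j k)) =
      prod_state \<beta> (prod_state \<rho> h) (\<Sum>i\<in>I. tensor_map id \<Delta> (\<alpha> b * (1 \<otimes> star (u i j))) * (1 \<otimes> (u i k \<otimes> 1)))"
    unfolding spectral_vector_def coaction_slice[OF st] by simp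
  also have "\<dots> = (\<Sum>i\<in>I. \<beta> (spectral_vector u b j i) * \<rho> (u i k))"
    by (simp add: state_sum[OF state_prod_state[OF st(1) state_prod_state[OF st(2) h]]] slice_invariant[OF st] spectral_vector_def)
  also have "\<dots> = prod_state \<beta> \<rho> (\<Sum>i\<in>I. spectral_vector u b j i \<otimes> u i k)"
    using st by (simp add: state_sum[OF state_prod_state[OF st]])
  finally show "prod_state \<beta> \<rho> (\<alpha> (spectral_vector u b j k)) = prod_state \<beta> \<rho> (\<Sum>i\<in>I. spectral_vector u b j i \<otimes> u i k)" .
qed

text \<open>Stars of matrix coefficients span a dense subspace of A, so the closure contains the
  slices of \<open>\<alpha> b * (1 \<otimes> a)\<close> for every a. The density condition of the
  action then reaches \<open>b \<otimes> 1\<close>, whose slice is b.\<close>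

lemma spectral_vectors_dense:
  "closure (cspan {spectral_vector u b j k | I (u :: 'a \<Rightarrow> 'a \<Rightarrow> 'a) b j k.
     corepresentation \<Delta> I u \<and> unitary_matrix I u \<and> j \<in> I \<and> k \<in> I}) = UNIV"
  (is "closure (cspan ?S) = UNIV")
proof -
  define D where "D = closure (cspan ?S)"
  have D: "csubspace D" "closed D" unfolding D_def by (rule csubspace_closure complex_vector.subspace_span closed_closure)+
  have base: "x \<in> D" if "x \<in> ?S" for x
    unfolding D_def by (rule subsetD[OF closure_subset complex_vector.span_base[OF that]])
  have gen: "slice_right h (\<alpha> b * (1 \<otimes> a)) \<in> D" for a b
  proof -
    have cl: "bounded_clinear (\<lambda>a. slice_right h (\<alpha> b * (1 \<otimes> a)))"
      by (rule bounded_clinear_compose[OF slice_right_clinear[OF h]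
            bounded_clinear_compose[OF bounded_clinear_mult_right bounded_clinear_tensor_right]])
    have "star ` matrix_coeffs \<subseteq> {a. slice_right h (\<alpha> b * (1 \<otimes> a)) \<in> D}"
      unfolding matrix_coeffs_def using base by (fastforce simp: spectral_vector_def)
    then show ?thesis
      using dense_span_induct[OF dense_span_star[OF matrix_coeffs_dense] csubspace_preimage[OF cl D(1)] closed_preimage[OF cl D(2)]]
      by blast
  qed
  have "b \<in> D" for b
  proof -
    note cl = slice_right_clinear[OF h]
    have "{\<alpha> b * (1 \<otimes> a) | a b. True} \<subseteq> {X. slice_right h X \<in> D}" using gen by blast
    from dense_span_induct[OF dense_action csubspace_preimage[OF cl D(1)] closed_preimage[OF cl D(2)] this, of "b \<otimes> 1"]
    show ?thesis by (simp add: h state_one)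
  qed
  then show ?thesis by (auto simp: D_def)
qed

text \<open>This inverts the coaction on one unitary block, by u u^* = 1. Both the analysis of null
  vectors and the density condition for the quotient action rest on it.\<close>

lemma unitary_tensor_one:
  fixes e :: "'i \<Rightarrow> 'b"
  assumes u: "corepresentation \<Delta> I u" "unitary_matrix I u" and e: "\<And>k. k \<in> I \<Longrightarrow> \<alpha> (e k) = (\<Sum>i\<in>I. e i \<otimes> u i k)"
    and k: "k \<in> I"
  shows "e k \<otimes> 1 = (\<Sum>j\<in>I. \<alpha> (e j) * (1 \<otimes> star (u k j)))"
proof -
  have fin: "finite I" using u by (simp add: corepresentation_def)
  have "(\<Sum>j\<in>I. \<alpha> (e j) * (1 \<otimes> star (u k j))) = (\<Sum>j\<in>I. \<Sum>i\<in>I. e i \<otimes> (u i j * star (u k j)))"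
    by (intro sum.cong refl) (simp add: e sum_distrib_right tensor_mult)
  also have "\<dots> = (\<Sum>i\<in>I. e i \<otimes> (\<Sum>j\<in>I. u i j * star (u k j)))"
    by (subst sum.swap) (simp add: tensor_sum_right)
  also have "\<dots> = (\<Sum>i\<in>I. if i = k then e i \<otimes> 1 else 0)"
    by (intro sum.cong refl) (use u(2) k in \<open>simp add: unitary_matrix_def\<close>)
  finally show ?thesis using fin k by simp
qed

definition averaged :: "('b \<Rightarrow> complex) \<Rightarrow> 'b \<Rightarrow> complex" where
  "averaged \<omega> b = prod_state \<omega> h (\<alpha> b)"

lemma state_averaged: "state \<omega> \<Longrightarrow> state (averaged \<omega>)"
  unfolding averaged_def[abs_def] by (rule state_unital_star_hom[OF state_prod_state[OF _ h] \<alpha>])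

text \<open>The coaction identity puts \<open>h\<close> into the middle leg, where left invariance
  absorbs the test state \<rho> in the last one.\<close>

lemma invariant_averaged:
  assumes \<omega>: "state \<omega>"
  shows "invariant_state \<alpha> (averaged \<omega>)"
  unfolding invariant_state_def
proof (intro conjI allI state_averaged \<omega>, rule states_eqI)
  fix b and \<rho> :: "'a \<Rightarrow> complex" assume \<rho>: "state \<rho>"
  have conv: "(\<lambda>x. prod_state h \<rho> (\<Delta> x)) = h"
  proof
    fix x show "prod_state h \<rho> (\<Delta> x) = h x"
      using \<rho> by (simp add: prod_state_def h_left state_scale state_one)
  qed
  have "\<rho> (slice_left (averaged \<omega>) (\<alpha> b)) = prod_state (\<lambda>x. prod_state \<omega> h (\<alpha> x)) \<rho> (\<alpha> b)"
    by (simp add: prod_state_def[of _ \<rho>] averaged_def[abs_def])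
  also have "\<dots> = prod_state (prod_state \<omega> h) \<rho> (tensor_map \<alpha> id (\<alpha> b))"
    by (simp add: prod_state_tensor_map[OF state_prod_state[OF \<omega> h] \<rho> \<alpha> unital_star_hom_id])
  also have "\<dots> = prod_state \<omega> (prod_state h \<rho>) (tensor_map id \<Delta> (\<alpha> b))"
    by (simp add: prod_state_tensor_assoc[OF \<omega> h \<rho>, symmetric] coaction)
  also have "\<dots> = prod_state \<omega> h (\<alpha> b)"
    by (simp add: prod_state_tensor_map[OF \<omega> state_prod_state[OF h \<rho>] unital_star_hom_id hom] conv)
  finally show "\<rho> (slice_left (averaged \<omega>) (\<alpha> b)) = \<rho> (averaged \<omega> b *\<^sub>C 1)"
    using \<rho> by (simp add: averaged_def state_scale state_one)
qed

end

section \<open>Null vectors of averaged states, and regular vectors\<close>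

context coaction
begin

text \<open>The vectors \<open>\<alpha>(\<nu>\<^sub>j)\<close> with \<open>\<nu>\<^sub>j\<close> in the null space generate \<open>b \<otimes> 1\<close>: writing \<open>b \<otimes> 1 = \<Sum>\<^sub>j \<alpha>(e\<^sub>j)(1 \<otimes> y\<^sub>j)\<close> and splitting each
\<open>e\<^sub>j\<close> into an orthonormal part and a null vector \<open>\<nu>\<^sub>j\<close>, the orthonormal part is removed by slicing with
\<open>\<mu>(\<alpha>(f)\<^sup>* \<cdot>)\<close>. The trace property turns \<open>\<mu>(\<nu>\<^sub>j\<^sup>* \<nu>\<^sub>j) = 0\<close> into \<open>\<mu>(\<nu>\<^sub>j \<nu>\<^sub>j\<^sup>*) = 0\<close>.\<close>

lemma null_averaged:
  fixes e :: "'i \<Rightarrow> 'b"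
  assumes u: "corepresentation \<Delta> I u" "unitary_matrix I u" and e: "\<And>k. k \<in> I \<Longrightarrow> \<alpha> (e k) = (\<Sum>i\<in>I. e i \<otimes> u i k)"
    and \<omega>: "state \<omega>" and tr: "tracial (averaged \<omega>)"
    and b: "b \<in> cspan (e ` I)" and null: "averaged \<omega> (star b * b) = 0"
  shows "\<omega> (b * star b) = 0"
proof -
  define \<mu> where "\<mu> = averaged \<omega>"
  have \<mu>: "state \<mu>" and inv: "\<And>x. slice_left \<mu> (\<alpha> x) = \<mu> x *\<^sub>C 1"
    using invariant_averaged[OF \<omega>] by (auto simp: \<mu>_def invariant_state_def)
  have fin: "finite I" using u by (simp add: corepresentation_def)
  \<comment> \<open>\<open>R\<close> collects the b for which \<open>b \<otimes> 1\<close> lies in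
    the right A-module generated by the \<open>\<alpha> (e j)\<close>; by unitarity it contains the
    whole span.\<close>
  define R where "R = {b. \<exists>y. b \<otimes> 1 = (\<Sum>j\<in>I. \<alpha> (e j) * (1 \<otimes> y j))}"
  have "csubspace R"
    unfolding complex_vector.subspace_def
  proof (intro conjI ballI allI)
    show "0 \<in> R" by (auto simp: R_def intro!: exI[of _ "\<lambda>_. 0"])
    fix x y c assume x: "x \<in> R"
    then obtain y1 where y1: "x \<otimes> 1 = (\<Sum>j\<in>I. \<alpha> (e j) * (1 \<otimes> y1 j))" by (auto simp: R_def)
    have "(c *\<^sub>C x) \<otimes> 1 = (\<Sum>j\<in>I. \<alpha> (e j) * (1 \<otimes> (c *\<^sub>C y1 j)))"
      by (simp add: tensor_scaleC_left tensor_scaleC_right y1 scaleC_sum_right mult_scaleC_right)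
    then show "c *\<^sub>C x \<in> R" by (auto simp: R_def)
    assume y: "y \<in> R"
    then obtain y2 where y2: "y \<otimes> 1 = (\<Sum>j\<in>I. \<alpha> (e j) * (1 \<otimes> y2 j))" by (auto simp: R_def)
    have "(x + y) \<otimes> 1 = (\<Sum>j\<in>I. \<alpha> (e j) * (1 \<otimes> (y1 j + y2 j)))"
      by (simp add: tensor_add_left tensor_add_right y1 y2 sum.distrib distrib_left)
    then show "x + y \<in> R" by (auto simp: R_def)
  qed
  moreover have "e ` I \<subseteq> R" using unitary_tensor_one[OF u e] by (auto simp: R_def)
  ultimately have "b \<in> R" using b complex_vector.span_minimal by blast
  then obtain y where y: "b \<otimes> 1 = (\<Sum>j\<in>I. \<alpha> (e j) * (1 \<otimes> y j))" by (auto simp: R_def)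
  obtain E where E: "orthonormal \<mu> E" "E \<subseteq> cspan (e ` I)"
    "\<And>z. z \<in> cspan (e ` I) \<Longrightarrow> seminorm2 \<mu> (z - (\<Sum>f\<in>E. \<mu> (star f * z) *\<^sub>C f)) = 0"
    using orthonormal_basis_span[OF \<mu> finite_imageI[OF fin]] by blast
  define \<nu> where "\<nu> j = e j - (\<Sum>f\<in>E. \<mu> (star f * e j) *\<^sub>C f)" for j
  have \<nu>: "\<mu> (star (\<nu> j) * \<nu> j) = 0" if "j \<in> I" for j
    using E(3)[of "e j"] that unfolding \<nu>_def state_star_mult_eq[OF \<mu>] by (auto intro: complex_vector.span_base)
  define y' where "y' f = (\<Sum>j\<in>I. \<mu> (star f * e j) *\<^sub>C y j)" for f
  have decomp: "b \<otimes> 1 = (\<Sum>f\<in>E. \<alpha> f * (1 \<otimes> y' f)) + (\<Sum>j\<in>I. \<alpha> (\<nu> j) * (1 \<otimes> y j))"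
  proof -
    have "\<alpha> (e j) * (1 \<otimes> y j) = (\<Sum>f\<in>E. \<alpha> f * (1 \<otimes> (\<mu> (star f * e j) *\<^sub>C y j))) + \<alpha> (\<nu> j) * (1 \<otimes> y j)" for j
    proof -
      have "e j = (\<Sum>f\<in>E. \<mu> (star f * e j) *\<^sub>C f) + \<nu> j" by (simp add: \<nu>_def)
      then have "\<alpha> (e j) = (\<Sum>f\<in>E. \<mu> (star f * e j) *\<^sub>C \<alpha> f) + \<alpha> (\<nu> j)"
        by (metis (no_types, lifting) unital_star_hom_add[OF \<alpha>] unital_star_hom_sum[OF \<alpha>] unital_star_hom_scaleC[OF \<alpha>] sum.cong)
      then show ?thesis
        by (simp add: distrib_right sum_distrib_right mult_scaleC_left mult_scaleC_right tensor_scaleC_right)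
    qed
    then have "b \<otimes> 1 = (\<Sum>j\<in>I. \<Sum>f\<in>E. \<alpha> f * (1 \<otimes> (\<mu> (star f * e j) *\<^sub>C y j))) + (\<Sum>j\<in>I. \<alpha> (\<nu> j) * (1 \<otimes> y j))"
      unfolding y by (simp only: sum.distrib)
    then show ?thesis by (subst (asm) sum.swap) (simp add: y'_def tensor_sum_right sum_distrib_left)
  qed
  have pair: "slice_left \<mu> (star (\<alpha> f) * (\<alpha> x * (1 \<otimes> c))) = \<mu> (star f * x) *\<^sub>C c" for f x c
  proof -
    have "star (\<alpha> f) * (\<alpha> x * (1 \<otimes> c)) = \<alpha> (star f * x) * (1 \<otimes> c)"
      by (simp add: unital_star_hom_mult[OF \<alpha>] unital_star_hom_star[OF \<alpha>] mult.assoc)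
    then show ?thesis by (simp add: slice_left_mult_right[OF \<mu>] inv mult_scaleC_left)
  qed
  \<comment> \<open>The slice against \<open>star (\<alpha> g)\<close> isolates \<open>y' g\<close>,
    because the null vectors \<open>\<nu> j\<close> have zero inner product with g. The slice itself
    vanishes, because \<open>b \<otimes> 1\<close> is null for the product of \<mu> with any
    state.\<close>
  have "y' g = 0" if g: "g \<in> E" for g
  proof -
    have "slice_left \<mu> (star (\<alpha> g) * (b \<otimes> 1)) = 0"
    proof (rule states_eqI)
      fix \<rho> :: "'a \<Rightarrow> complex" assume \<rho>: "state \<rho>"
      have "prod_state \<mu> \<rho> (star (b \<otimes> 1) * (b \<otimes> 1)) = 0"
        using null \<rho> \<mu> by (simp add: tensor_star tensor_mult \<mu>_def)
      from state_nonneg_eq_0(2)[OF state_prod_state[OF \<mu> \<rho>] this]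
      show "\<rho> (slice_left \<mu> (star (\<alpha> g) * (b \<otimes> 1))) = \<rho> 0" by (simp add: prod_state_def state_zero[OF \<rho>])
    qed
    moreover have "slice_left \<mu> (star (\<alpha> g) * (b \<otimes> 1)) = (\<Sum>f\<in>E. \<mu> (star g * f) *\<^sub>C y' f) + (\<Sum>j\<in>I. \<mu> (star g * \<nu> j) *\<^sub>C y j)"
      unfolding decomp by (simp add: distrib_left sum_distrib_left bounded_clinear_add[OF slice_left_clinear[OF \<mu>]] slice_left_sum[OF \<mu>] pair)
    moreover have "(\<Sum>j\<in>I. \<mu> (star g * \<nu> j) *\<^sub>C y j) = 0"
      using state_nonneg_eq_0(2)[OF \<mu> \<nu>] by (simp add: sum.neutral)
    moreover have "(\<Sum>f\<in>E. \<mu> (star g * f) *\<^sub>C y' f) = (\<Sum>f\<in>E. if g = f then y' f else 0)"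
      by (intro sum.cong refl) (use E(1) g in \<open>auto simp: orthonormal_def\<close>)
    ultimately show ?thesis using E(1) g by (simp add: orthonormal_def)
  qed
  then have b1: "b \<otimes> 1 = (\<Sum>j\<in>I. \<alpha> (\<nu> j) * (1 \<otimes> y j))" using decomp by simp
  have zero: "prod_state \<omega> h (\<alpha> (\<nu> j) * Z) = 0" if j: "j \<in> I" for j Z
  proof -
    have "\<mu> (\<nu> j * star (\<nu> j)) = 0" using \<nu>[OF j] tr by (simp add: tracial_def \<mu>_def)
    then have "prod_state \<omega> h (star (star (\<alpha> (\<nu> j))) * star (\<alpha> (\<nu> j))) = 0"
      by (simp add: \<mu>_def averaged_def unital_star_hom_mult[OF \<alpha>] unital_star_hom_star[OF \<alpha>])
    from state_nonneg_eq_0(1)[OF state_prod_state[OF \<omega> h] this, of Z] show ?thesis by simp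
  qed
  have "\<omega> (b * star b) = prod_state \<omega> h ((b \<otimes> 1) * (star b \<otimes> 1))"
    using \<omega> h by (simp add: tensor_mult state_one)
  also have "\<dots> = (\<Sum>j\<in>I. prod_state \<omega> h (\<alpha> (\<nu> j) * ((1 \<otimes> y j) * (star b \<otimes> 1))))"
    unfolding b1 by (simp add: sum_distrib_right state_sum[OF state_prod_state[OF \<omega> h]] mult.assoc)
  also have "\<dots> = 0" by (intro sum.neutral ballI zero)
  finally show ?thesis .
qed

text \<open>The finite set \<open>E\<close> serves both as the basis of an invariant subspace and as
  the index set of the corepresentation \<open>w\<close> on it.\<close>

definition regular_vectors :: "'b set" where
  "regular_vectors = {f. \<exists>E w. f \<in> E \<and> corepresentation \<Delta> E w \<and> biisometric E w \<and> (\<forall>k\<in>E. \<alpha> k = (\<Sum>e\<in>E. e \<otimes> w e k))}"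

text \<open>Faithfulness on the span makes the expansion in an orthonormal basis exact instead of
  valid up to null vectors. The basis therefore carries a corepresentation, and invariance and trace
  give its two isometry conditions.\<close>

lemma span_regular_vectors:
  fixes e :: "'i \<Rightarrow> 'b"
  assumes I: "finite I" and e: "\<And>k. k \<in> I \<Longrightarrow> \<alpha> (e k) = (\<Sum>i\<in>I. e i \<otimes> u i k)"
    and \<mu>: "invariant_state \<alpha> \<mu>" "tracial \<mu>" and faithful: "\<And>b. b \<in> cspan (e ` I) \<Longrightarrow> \<mu> (star b * b) = 0 \<Longrightarrow> b = 0"
    and k: "k \<in> I"
  shows "e k \<in> cspan regular_vectors"
proof -
  have st: "state \<mu>" and inv: "\<And>x. slice_left \<mu> (\<alpha> x) = \<mu> x *\<^sub>C 1" using \<mu> by (auto simp: invariant_state_def)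
  obtain E where E: "orthonormal \<mu> E" "E \<subseteq> cspan (e ` I)"
    "\<And>z. z \<in> cspan (e ` I) \<Longrightarrow> seminorm2 \<mu> (z - (\<Sum>f\<in>E. \<mu> (star f * z) *\<^sub>C f)) = 0"
    using orthonormal_basis_span[OF st finite_imageI[OF I]] by blast
  have fin: "finite E" and on: "\<And>a b. a \<in> E \<Longrightarrow> b \<in> E \<Longrightarrow> \<mu> (star a * b) = (if a = b then 1 else 0)"
    using E(1) by (auto simp: orthonormal_def)
  have expand: "z = (\<Sum>f\<in>E. \<mu> (star f * z) *\<^sub>C f)" if z: "z \<in> cspan (e ` I)" for z
  proof -
    have "z - (\<Sum>f\<in>E. \<mu> (star f * z) *\<^sub>C f) = 0"
    proof (rule faithful)
      show "z - (\<Sum>f\<in>E. \<mu> (star f * z) *\<^sub>C f) \<in> cspan (e ` I)"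
        using z E(2) by (intro complex_vector.span_diff complex_vector.span_sum complex_vector.span_scale) auto
      show "\<mu> (star (z - (\<Sum>f\<in>E. \<mu> (star f * z) *\<^sub>C f)) * (z - (\<Sum>f\<in>E. \<mu> (star f * z) *\<^sub>C f))) = 0"
        using E(3)[OF z] unfolding state_star_mult_eq[OF st] by simp
    qed
    then show ?thesis by simp
  qed
  define w where "w f x = slice_left \<mu> ((star f \<otimes> 1) * \<alpha> x)" for f x
  have w: "bounded_clinear (w f)" for f
    unfolding w_def[abs_def] by (rule bounded_clinear_compose[OF slice_left_clinear[OF st]
          bounded_clinear_compose[OF bounded_clinear_mult_right bounded_clinear_unital_star_hom[OF \<alpha>]]])
  have "cspan (e ` I) \<subseteq> {x. \<alpha> x = (\<Sum>f\<in>E. f \<otimes> w f x)}"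
  proof (rule complex_vector.span_minimal)
    show "csubspace {x. \<alpha> x = (\<Sum>f\<in>E. f \<otimes> w f x)}"
      by (auto simp: complex_vector.subspace_def unital_star_hom_add[OF \<alpha>] unital_star_hom_scaleC[OF \<alpha>]
          bounded_clinear_zero[OF bounded_clinear_unital_star_hom[OF \<alpha>]] bounded_clinear_zero[OF w]
          bounded_clinear_add[OF w] bounded_clinear_scaleC[OF w] tensor_add_right tensor_scaleC_right sum.distrib scaleC_sum_right)
    have "\<alpha> (e k) = (\<Sum>f\<in>E. f \<otimes> w f (e k))" if k: "k \<in> I" for k
    proof -
      have "\<alpha> (e k) = (\<Sum>i\<in>I. (\<Sum>f\<in>E. \<mu> (star f * e i) *\<^sub>C f) \<otimes> u i k)"
        unfolding e[OF k] by (intro sum.cong refl arg_cong[of _ _ "\<lambda>x. x \<otimes> _"] expand complex_vector.span_base) auto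
      also have "\<dots> = (\<Sum>f\<in>E. f \<otimes> (\<Sum>i\<in>I. \<mu> (star f * e i) *\<^sub>C u i k))"
        unfolding tensor_sum_left tensor_sum_right by (subst sum.swap) (simp add: tensor_scaleC_left tensor_scaleC_right)
      also have "\<dots> = (\<Sum>f\<in>E. f \<otimes> w f (e k))"
        by (intro sum.cong refl) (simp add: w_def e k sum_distrib_left tensor_mult slice_left_sum[OF st] st)
      finally show ?thesis .
    qed
    then show "e ` I \<subseteq> {x. \<alpha> x = (\<Sum>f\<in>E. f \<otimes> w f x)}" by blast
  qed
  then have act: "\<alpha> f = (\<Sum>a\<in>E. a \<otimes> w a f)" if "f \<in> E" for f using that E(2) by blast
  have "corepresentation \<Delta> E w" by (rule corepresentation_of_coaction[OF \<alpha> coaction st fin on act])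
  moreover have "biisometric E w"
    unfolding biisometric_def
    using isometric_of_coaction[OF \<alpha> inv st fin on act] conjugate_isometric_of_coaction[OF \<alpha> inv \<mu>(2) st fin on act] by blast
  ultimately have reg: "E \<subseteq> regular_vectors" using act unfolding regular_vectors_def by blast
  have ek: "e k = (\<Sum>f\<in>E. \<mu> (star f * e k) *\<^sub>C f)" using k by (intro expand complex_vector.span_base) auto
  have "(\<Sum>f\<in>E. \<mu> (star f * e k) *\<^sub>C f) \<in> cspan regular_vectors"
    using reg by (intro complex_vector.span_sum complex_vector.span_scale complex_vector.span_base) blast
  then show ?thesis by (rule ssubst[OF ek])
qed

text \<open>Each block of spectral vectors receives a tracial invariant state without null vectors
  on its span: the given one under the second condition, and under the first the average of a state
  that is faithful there in the sense of \<open>state_faithful_on_span\<close>.\<close>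

lemma regular_vectors_dense:
  assumes "(\<forall>\<mu>. invariant_state \<alpha> \<mu> \<longrightarrow> tracial \<mu>) \<or> (\<exists>\<mu>. invariant_state \<alpha> \<mu> \<and> tracial \<mu> \<and> faithful \<mu>)"
  shows "closure (cspan regular_vectors) = UNIV"
\<comment> \<open>The zero algebra is separated because it carries no state to average.\<close>
proof (cases "(1 :: 'b) = 0")
  case True
  have "x = 0" for x :: 'b using True by (metis mult_1 mult_zero_left)
  then have "x \<in> closure (cspan regular_vectors)" for x
    by (metis closure_subset complex_vector.span_zero subsetD)
  then show ?thesis by auto
next
  case False
  have "spectral_vector u b j k \<in> cspan regular_vectors"
    if u: "corepresentation \<Delta> I u" "unitary_matrix I u" and jk: "j \<in> I" "k \<in> I" for I and u :: "'a \<Rightarrow> 'a \<Rightarrow> 'a" and b j k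
  proof -
    define e where "e = spectral_vector u b j"
    have e: "\<alpha> (e k) = (\<Sum>i\<in>I. e i \<otimes> u i k)" if "k \<in> I" for k
      unfolding e_def by (rule action_spectral_vector[OF u jk(1) that])
    have fin: "finite I" using u by (simp add: corepresentation_def)
    have "\<exists>\<mu>. invariant_state \<alpha> \<mu> \<and> tracial \<mu> \<and> (\<forall>b\<in>cspan (e ` I). \<mu> (star b * b) = 0 \<longrightarrow> b = 0)"
      using assms
    proof
      assume tr: "\<forall>\<mu>. invariant_state \<alpha> \<mu> \<longrightarrow> tracial \<mu>"
      obtain \<omega> where \<omega>: "state \<omega>" "\<And>b. b \<in> cspan (e ` I) \<Longrightarrow> \<omega> (b * star b) = 0 \<Longrightarrow> b = 0"
        using state_faithful_on_span[OF False finite_imageI[OF fin, of e]] by blast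
      have t: "tracial (averaged \<omega>)" using tr invariant_averaged[OF \<omega>(1)] by blast
      show ?thesis
        using invariant_averaged[OF \<omega>(1)] t null_averaged[OF u e \<omega>(1) t] \<omega>(2) by blast
    next
      assume "\<exists>\<mu>. invariant_state \<alpha> \<mu> \<and> tracial \<mu> \<and> faithful \<mu>"
      then show ?thesis by (auto simp: faithful_def)
    qed
    then obtain \<mu> where \<mu>: "invariant_state \<alpha> \<mu>" "tracial \<mu>" and faithful: "\<forall>b\<in>cspan (e ` I). \<mu> (star b * b) = 0 \<longrightarrow> b = 0"
      by (elim exE conjE) (rule that)
    have "e k \<in> cspan regular_vectors"
      by (rule span_regular_vectors[OF fin e \<mu> faithful[rule_format] jk(2)])
    then show ?thesis unfolding e_def .
  qed
  then have "{spectral_vector u b j k | I (u :: 'a \<Rightarrow> 'a \<Rightarrow> 'a) b j k.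
     corepresentation \<Delta> I u \<and> unitary_matrix I u \<and> j \<in> I \<and> k \<in> I} \<subseteq> cspan regular_vectors" by blast
  then have "cspan {spectral_vector u b j k | I (u :: 'a \<Rightarrow> 'a \<Rightarrow> 'a) b j k.
     corepresentation \<Delta> I u \<and> unitary_matrix I u \<and> j \<in> I \<and> k \<in> I} \<subseteq> cspan regular_vectors"
    by (rule complex_vector.span_minimal[OF _ complex_vector.subspace_span])
  from closure_mono[OF this] show ?thesis using spectral_vectors_dense by auto
qed

end

section \<open>The quotient group generated by biisometric corepresentations\<close>

lemma corepresentation_reindex:
  assumes "bij_betw \<phi> J I" "corepresentation \<Delta> I u"
  shows "corepresentation \<Delta> J (\<lambda>a b. u (\<phi> a) (\<phi> b))"
proof -
  have "(\<Sum>k\<in>J. u i (\<phi> k) \<otimes> u (\<phi> k) j) = (\<Sum>k\<in>I. u i k \<otimes> u k j)" for i j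
    by (rule sum.reindex_bij_betw[OF assms(1)])
  then show ?thesis using assms bij_betwE[OF assms(1)] bij_betw_finite[OF assms(1)] by (simp add: corepresentation_def)
qed

lemma biisometric_reindex:
  assumes \<phi>: "bij_betw \<phi> J I" and u: "biisometric I u"
  shows "biisometric J (\<lambda>a b. u (\<phi> a) (\<phi> b))"
proof -
  have "(\<Sum>k\<in>J. star (u (\<phi> k) i) * u (\<phi> k) j) = (\<Sum>k\<in>I. star (u k i) * u k j)"
    "(\<Sum>k\<in>J. u (\<phi> k) i * star (u (\<phi> k) j)) = (\<Sum>k\<in>I. u k i * star (u k j))" for i j
    by (rule sum.reindex_bij_betw[OF \<phi>])+
  moreover have "\<phi> a = \<phi> b \<longleftrightarrow> a = b" if "a \<in> J" "b \<in> J" for a b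
    using that \<phi> by (auto simp: bij_betw_def inj_on_def)
  ultimately show ?thesis using u bij_betwE[OF \<phi>] by (simp add: biisometric_def)
qed

lemma biisometric_conjugate: "biisometric I u \<Longrightarrow> biisometric I (\<lambda>i j. star (u i j))"
  by (simp add: biisometric_def)

text \<open>The inner factor collapses first: \<open>star (u a i) * u a j\<close> in the first
  relation, \<open>v b k * star (v b l)\<close> in the second. All sums run over row indices, so
  each condition for the product follows from the same condition for the two factors.\<close>

lemma biisometric_product:
  assumes fin: "finite I" "finite J" and u: "biisometric I u" and v: "biisometric J v"
  shows "biisometric (I \<times> J) (\<lambda>(i, k) (j, l). u i j * v k l)"
proof -
  have 1: "(\<Sum>(a, b)\<in>I \<times> J. star (u a i * v b k) * (u a j * v b l)) = (if (i, k) = (j, l) then 1 else 0)"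
    if "i \<in> I" "k \<in> J" "j \<in> I" "l \<in> J" for i k j l
  proof -
    have "(\<Sum>(a, b)\<in>I \<times> J. star (u a i * v b k) * (u a j * v b l)) =
        (\<Sum>a\<in>I. \<Sum>b\<in>J. star (v b k) * ((star (u a i) * u a j) * v b l))"
      by (simp add: sum.cartesian_product star_mult mult.assoc)
    also have "\<dots> = (\<Sum>b\<in>J. star (v b k) * ((\<Sum>a\<in>I. star (u a i) * u a j) * v b l))"
      by (subst sum.swap) (simp add: sum_distrib_left sum_distrib_right)
    also have "\<dots> = (if i = j then (\<Sum>b\<in>J. star (v b k) * v b l) else 0)" using u that by (simp add: biisometric_def)
    finally show ?thesis using v that by (auto simp: biisometric_def)
  qed
  have 2: "(\<Sum>(a, b)\<in>I \<times> J. (u a i * v b k) * star (u a j * v b l)) = (if (i, k) = (j, l) then 1 else 0)"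
    if "i \<in> I" "k \<in> J" "j \<in> I" "l \<in> J" for i k j l
  proof -
    have "(\<Sum>(a, b)\<in>I \<times> J. (u a i * v b k) * star (u a j * v b l)) =
        (\<Sum>a\<in>I. \<Sum>b\<in>J. u a i * ((v b k * star (v b l)) * star (u a j)))"
      by (simp add: sum.cartesian_product star_mult mult.assoc)
    also have "\<dots> = (\<Sum>a\<in>I. u a i * ((\<Sum>b\<in>J. v b k * star (v b l)) * star (u a j)))"
      by (simp add: sum_distrib_left sum_distrib_right)
    also have "\<dots> = (if k = l then (\<Sum>a\<in>I. u a i * star (u a j)) else 0)" using v that by (simp add: biisometric_def)
    finally show ?thesis using u that by (auto simp: biisometric_def)
  qed
  show ?thesis unfolding biisometric_def using 1 2 by (auto simp: case_prod_unfold)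
qed

section \<open>The algebra spanned by the biisometric coefficients\<close>

context cqg
begin

lemma corepresentation_conjugate:
  "corepresentation \<Delta> I u \<Longrightarrow> corepresentation \<Delta> I (\<lambda>i j. star (u i j))"
  by (simp add: corepresentation_def unital_star_hom_star[OF hom] star_sum tensor_star)

lemma corepresentation_product:
  assumes u: "corepresentation \<Delta> I u" and v: "corepresentation \<Delta> J v"
  shows "corepresentation \<Delta> (I \<times> J) (\<lambda>(i, k) (j, l). u i j * v k l)"
  using assms
  by (auto simp: corepresentation_def unital_star_hom_mult[OF hom] sum_product tensor_mult sum.cartesian_product case_prod_unfold)

text \<open>Indices are taken from \<open>nat\<close> to have one fixed index type;
  \<open>kac_coeffsI\<close> transfers coefficients from any other finite index set.\<close>

definition kac_coeffs :: "'a set" where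
  "kac_coeffs = {u i j | I (u :: nat \<Rightarrow> nat \<Rightarrow> 'a) i j. corepresentation \<Delta> I u \<and> biisometric I u \<and> i \<in> I \<and> j \<in> I}"

definition kac_part :: "'a set" where
  "kac_part = closure (cspan kac_coeffs)"

lemma kac_coeffsI:
  assumes u: "corepresentation \<Delta> I u" "biisometric I u" and ij: "i \<in> I" "j \<in> I"
  shows "u i j \<in> kac_coeffs"
proof -
  have "finite I" using u by (simp add: corepresentation_def)
  then obtain \<phi> where \<phi>: "bij_betw \<phi> {0..<card I} I" using ex_bij_betw_nat_finite by blast
  then obtain a b where ab: "a \<in> {0..<card I}" "b \<in> {0..<card I}" "i = \<phi> a" "j = \<phi> b"
    using ij by (metis bij_betw_imp_surj_on imageE)
  define v where "v = (\<lambda>a b. u (\<phi> a) (\<phi> b))"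
  have "corepresentation \<Delta> {0..<card I} v" "biisometric {0..<card I} v"
    unfolding v_def by (rule corepresentation_reindex[OF \<phi> u(1)] biisometric_reindex[OF \<phi> u(2)])+
  then have "v a b \<in> kac_coeffs" unfolding kac_coeffs_def using ab(1,2) by blast
  then show ?thesis by (simp add: v_def ab(3,4))
qed

lemma kac_part_induct:
  assumes "x \<in> kac_part" "csubspace V" "closed V" "kac_coeffs \<subseteq> V"
  shows "x \<in> V"
  using closure_minimal[OF complex_vector.span_minimal[OF assms(4,2)] assms(3)] assms(1) by (auto simp: kac_part_def)

lemma kac_part_base: "x \<in> kac_coeffs \<Longrightarrow> x \<in> kac_part"
  unfolding kac_part_def by (rule subsetD[OF closure_subset complex_vector.span_base])

lemma csubspace_kac_part: "csubspace kac_part" and closed_kac_part: "closed kac_part"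
  unfolding kac_part_def by (rule csubspace_closure complex_vector.subspace_span closed_closure)+

lemma kac_coeffs_star: "x \<in> kac_coeffs \<Longrightarrow> star x \<in> kac_coeffs"
  unfolding kac_coeffs_def
  using corepresentation_conjugate biisometric_conjugate by fastforce

lemma kac_coeffs_mult:
  assumes "x \<in> kac_coeffs" "y \<in> kac_coeffs" shows "x * y \<in> kac_coeffs"
proof -
  obtain I J i j k l and u v :: "nat \<Rightarrow> nat \<Rightarrow> 'a" where
    u: "corepresentation \<Delta> I u" "biisometric I u" "i \<in> I" "j \<in> I" "x = u i j" and
    v: "corepresentation \<Delta> J v" "biisometric J v" "k \<in> J" "l \<in> J" "y = v k l"
    using assms unfolding kac_coeffs_def by blast
  have "finite I" "finite J" using u v by (auto simp: corepresentation_def)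
  then show ?thesis
    using kac_coeffsI[OF corepresentation_product[OF u(1) v(1)] biisometric_product[OF _ _ u(2) v(2)], of "(i, k)" "(j, l)"] u v by simp
qed

lemma kac_part_mult:
  assumes "x \<in> kac_part" "y \<in> kac_part" shows "x * y \<in> kac_part"
proof -
  have 1: "x * y \<in> kac_part" if "x \<in> kac_coeffs" "y \<in> kac_part" for x y
  proof -
    have "y \<in> {y. x * y \<in> kac_part}"
      using that(1) kac_coeffs_mult kac_part_base
      by (intro kac_part_induct[OF that(2)] csubspace_preimage[OF bounded_clinear_mult_right csubspace_kac_part]
          closed_preimage[OF bounded_clinear_mult_right closed_kac_part]) auto
    then show ?thesis by simp
  qed
  have "x \<in> {x. x * y \<in> kac_part}"
    using 1[OF _ assms(2)]
    by (intro kac_part_induct[OF assms(1)] csubspace_preimage[OF bounded_clinear_mult_left csubspace_kac_part]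
        closed_preimage[OF bounded_clinear_mult_left closed_kac_part]) auto
  then show ?thesis by simp
qed

lemma kac_part_star:
  assumes "x \<in> kac_part" shows "star x \<in> kac_part"
proof -
  have "x \<in> {x. star x \<in> kac_part}"
  proof (rule kac_part_induct[OF assms])
    show "csubspace {x. star x \<in> kac_part}"
      using csubspace_kac_part by (auto simp: complex_vector.subspace_def star_add star_scaleC)
    show "closed {x. star x \<in> kac_part}"
      by (rule continuous_closed_vimage[OF closed_kac_part, unfolded vimage_def])
        (rule linear_continuous_at[OF bounded_linear_star])
  qed (use kac_coeffs_star kac_part_base in auto)
  then show ?thesis by simp
qed

lemma kac_part_one: "1 \<in> kac_part"
proof (rule kac_part_base)
  have "corepresentation \<Delta> {0 :: nat} (\<lambda>_ _. 1)" "biisometric {0 :: nat} (\<lambda>_ _. 1 :: 'a)"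
    by (simp_all add: corepresentation_def biisometric_def unital_star_hom_one[OF hom] tensor_one[symmetric])
  from kac_coeffsI[OF this, of 0 0] show "1 \<in> kac_coeffs" by simp
qed

end

section \<open>Closed tensor subspaces\<close>

lemma tensor_sub_base: "s \<in> S \<Longrightarrow> t \<in> T \<Longrightarrow> s \<otimes> t \<in> tensor_sub S T"
  unfolding tensor_sub_def by (rule subsetD[OF closure_subset complex_vector.span_base]) blast

lemma csubspace_tensor_sub: "csubspace (tensor_sub S T)" and closed_tensor_sub: "closed (tensor_sub S T)"
  unfolding tensor_sub_def by (rule csubspace_closure complex_vector.subspace_span closed_closure)+

lemma tensor_sub_minimal:
  assumes "csubspace V" "closed V" "\<And>s t. s \<in> S \<Longrightarrow> t \<in> T \<Longrightarrow> s \<otimes> t \<in> V"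
  shows "tensor_sub S T \<subseteq> V"
  unfolding tensor_sub_def using assms by (intro closure_minimal complex_vector.span_minimal) auto

lemma tensor_sub_mult_right:
  assumes "X \<in> tensor_sub S T" "\<And>s t. s \<in> S \<Longrightarrow> t \<in> T \<Longrightarrow> (s \<otimes> t) * Y \<in> tensor_sub S T"
  shows "X * Y \<in> tensor_sub S T"
proof -
  have "tensor_sub S T \<subseteq> {X. X * Y \<in> tensor_sub S T}"
    by (rule tensor_sub_minimal[OF csubspace_preimage[OF bounded_clinear_mult_left csubspace_tensor_sub]
          closed_preimage[OF bounded_clinear_mult_left closed_tensor_sub]]) (use assms(2) in blast)
  then show ?thesis using assms(1) by blast
qed

context haar
begin

text \<open>Elementary tensors are recovered as finite sums. For the products with 1 \<otimes> q
  this uses u u^* = 1, supplied by \<open>biisometric_unitary\<close>; for those with q \<otimes> 1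
  it uses the second isometry condition, that of the conjugate.\<close>

lemma quantum_quotient_group_kac_part: "quantum_quotient_group \<Delta> kac_part"
proof -
  have \<Delta>Q: "\<Delta> x \<in> tensor_sub kac_part kac_part" if "x \<in> kac_part" for x
  proof -
    have "x \<in> {x. \<Delta> x \<in> tensor_sub kac_part kac_part}"
    proof (rule kac_part_induct[OF that csubspace_preimage[OF bounded_clinear_unital_star_hom[OF hom] csubspace_tensor_sub]
          closed_preimage[OF bounded_clinear_unital_star_hom[OF hom] closed_tensor_sub]], rule subsetI)
      fix x assume "x \<in> kac_coeffs"
      then obtain I i j and u :: "nat \<Rightarrow> nat \<Rightarrow> 'a" where
        u: "corepresentation \<Delta> I u" "biisometric I u" "i \<in> I" "j \<in> I" "x = u i j" unfolding kac_coeffs_def by blast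
      have "\<Delta> x = (\<Sum>k\<in>I. u i k \<otimes> u k j)" using u by (simp add: corepresentation_def)
      also have "\<dots> \<in> tensor_sub kac_part kac_part"
        by (intro complex_vector.subspace_sum[OF csubspace_tensor_sub] tensor_sub_base kac_part_base kac_coeffsI[OF u(1,2)] u(3,4))
      finally show "x \<in> {x. \<Delta> x \<in> tensor_sub kac_part kac_part}" by simp
    qed
    then show ?thesis by simp
  qed
  have right: "closure (cspan {\<Delta> p * (1 \<otimes> q) | p q. p \<in> kac_part \<and> q \<in> kac_part}) = tensor_sub kac_part kac_part" (is "?R = _")
  proof
    have "\<Delta> p * (1 \<otimes> q) \<in> tensor_sub kac_part kac_part" if "p \<in> kac_part" "q \<in> kac_part" for p q
      by (rule tensor_sub_mult_right[OF \<Delta>Q[OF that(1)]]) (simp add: tensor_mult tensor_sub_base kac_part_mult that)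
    then show "?R \<subseteq> tensor_sub kac_part kac_part"
      by (intro closure_minimal complex_vector.span_minimal csubspace_tensor_sub closed_tensor_sub) auto
    have R: "csubspace ?R" "closed ?R" by (rule csubspace_closure complex_vector.subspace_span closed_closure)+
    have base: "\<Delta> p * (1 \<otimes> q) \<in> ?R" if "p \<in> kac_part" "q \<in> kac_part" for p q
      by (rule subsetD[OF closure_subset complex_vector.span_base]) (use that in blast)
    show "tensor_sub kac_part kac_part \<subseteq> ?R"
    proof (rule tensor_sub_minimal[OF R])
      fix s t assume s: "s \<in> kac_part" and t: "t \<in> kac_part"
      have "s \<in> {s. s \<otimes> t \<in> ?R}"
      proof (rule kac_part_induct[OF s csubspace_preimage[OF bounded_clinear_tensor_left R(1)]
            closed_preimage[OF bounded_clinear_tensor_left R(2)]], rule subsetI)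
        fix x assume "x \<in> kac_coeffs"
        then obtain I i k and u :: "nat \<Rightarrow> nat \<Rightarrow> 'a" where
          u: "corepresentation \<Delta> I u" "biisometric I u" "i \<in> I" "k \<in> I" "x = u i k" unfolding kac_coeffs_def by blast
        have fin: "finite I" using u by (simp add: corepresentation_def)
        have "(\<Sum>j\<in>I. \<Delta> (u i j) * (1 \<otimes> (star (u k j) * t))) = (\<Sum>j\<in>I. \<Sum>l\<in>I. u i l \<otimes> (u l j * star (u k j) * t))"
          by (intro sum.cong refl) (use u in \<open>simp add: corepresentation_def sum_distrib_right tensor_mult mult.assoc\<close>)
        also have "\<dots> = (\<Sum>l\<in>I. u i l \<otimes> ((\<Sum>j\<in>I. u l j * star (u k j)) * t))"
          by (subst sum.swap) (simp add: tensor_sum_right sum_distrib_right)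
        also have "\<dots> = (\<Sum>l\<in>I. if l = k then u i l \<otimes> t else 0)"
          by (intro sum.cong refl) (use biisometric_unitary[OF u(1,2)] u(4) in \<open>simp add: unitary_matrix_def\<close>)
        also have "\<dots> = x \<otimes> t" using fin u by simp
        finally have "x \<otimes> t = (\<Sum>j\<in>I. \<Delta> (u i j) * (1 \<otimes> (star (u k j) * t)))" by simp
        also have "\<dots> \<in> ?R"
          by (intro complex_vector.subspace_sum[OF R(1)] base kac_part_mult kac_part_star kac_part_base kac_coeffsI[OF u(1,2)] u(3,4) t)
        finally show "x \<in> {s. s \<otimes> t \<in> ?R}" by simp
      qed
      then show "s \<otimes> t \<in> ?R" by simp
    qed
  qed
  have left: "closure (cspan {\<Delta> p * (q \<otimes> 1) | p q. p \<in> kac_part \<and> q \<in> kac_part}) = tensor_sub kac_part kac_part" (is "?R = _")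
  proof
    have "\<Delta> p * (q \<otimes> 1) \<in> tensor_sub kac_part kac_part" if "p \<in> kac_part" "q \<in> kac_part" for p q
      by (rule tensor_sub_mult_right[OF \<Delta>Q[OF that(1)]]) (simp add: tensor_mult tensor_sub_base kac_part_mult that)
    then show "?R \<subseteq> tensor_sub kac_part kac_part"
      by (intro closure_minimal complex_vector.span_minimal csubspace_tensor_sub closed_tensor_sub) auto
    have R: "csubspace ?R" "closed ?R" by (rule csubspace_closure complex_vector.subspace_span closed_closure)+
    have base: "\<Delta> p * (q \<otimes> 1) \<in> ?R" if "p \<in> kac_part" "q \<in> kac_part" for p q
      by (rule subsetD[OF closure_subset complex_vector.span_base]) (use that in blast)
    show "tensor_sub kac_part kac_part \<subseteq> ?R"
    proof (rule tensor_sub_minimal[OF R])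
      fix s t assume s: "s \<in> kac_part" and t: "t \<in> kac_part"
      have "t \<in> {t. s \<otimes> t \<in> ?R}"
      proof (rule kac_part_induct[OF t csubspace_preimage[OF bounded_clinear_tensor_right R(1)]
            closed_preimage[OF bounded_clinear_tensor_right R(2)]], rule subsetI)
        fix x assume "x \<in> kac_coeffs"
        then obtain I k j and u :: "nat \<Rightarrow> nat \<Rightarrow> 'a" where
          u: "corepresentation \<Delta> I u" "biisometric I u" "k \<in> I" "j \<in> I" "x = u k j" unfolding kac_coeffs_def by blast
        have fin: "finite I" using u by (simp add: corepresentation_def)
        have "(\<Sum>i\<in>I. \<Delta> (u i j) * ((star (u i k) * s) \<otimes> 1)) = (\<Sum>i\<in>I. \<Sum>l\<in>I. (u i l * star (u i k) * s) \<otimes> u l j)"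
          by (intro sum.cong refl) (use u in \<open>simp add: corepresentation_def sum_distrib_right tensor_mult mult.assoc\<close>)
        also have "\<dots> = (\<Sum>l\<in>I. ((\<Sum>i\<in>I. u i l * star (u i k)) * s) \<otimes> u l j)"
          by (subst sum.swap) (simp add: tensor_sum_left sum_distrib_right)
        also have "\<dots> = (\<Sum>l\<in>I. if l = k then s \<otimes> u l j else 0)"
          by (intro sum.cong refl) (use u in \<open>simp add: biisometric_def\<close>)
        also have "\<dots> = s \<otimes> x" using fin u by simp
        finally have "s \<otimes> x = (\<Sum>i\<in>I. \<Delta> (u i j) * ((star (u i k) * s) \<otimes> 1))" by simp
        also have "\<dots> \<in> ?R"
          by (intro complex_vector.subspace_sum[OF R(1)] base kac_part_mult kac_part_star kac_part_base kac_coeffsI[OF u(1,2)] u(3,4) s)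
        finally show "x \<in> {t. s \<otimes> t \<in> ?R}" by simp
      qed
      then show "s \<otimes> t \<in> ?R" by simp
    qed
  qed
  show ?thesis
    unfolding quantum_quotient_group_def unital_cstar_subalgebra_def
    using csubspace_kac_part closed_kac_part kac_part_one kac_part_mult kac_part_star \<Delta>Q right left by blast
qed

text \<open>The matrix \<open>h(w\<^sub>a\<^sub>b)\<close> is the orthogonal projection onto the fixed vectors of an isometric corepresentation \<open>w\<close>.\<close>

lemma haar_matrix:
  assumes w: "corepresentation \<Delta> I w" and iso: "\<And>a b. a \<in> I \<Longrightarrow> b \<in> I \<Longrightarrow> (\<Sum>k\<in>I. star (w k a) * w k b) = (if a = b then 1 else 0)"
  shows "a \<in> I \<Longrightarrow> b \<in> I \<Longrightarrow> (\<Sum>k\<in>I. h (w k b) *\<^sub>C w a k) = h (w a b) *\<^sub>C 1"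
    and "a \<in> I \<Longrightarrow> b \<in> I \<Longrightarrow> h (w b a) = cnj (h (w a b))"
proof -
  have fin: "finite I" and \<Delta>w: "\<And>a b. a \<in> I \<Longrightarrow> b \<in> I \<Longrightarrow> \<Delta> (w a b) = (\<Sum>k\<in>I. w a k \<otimes> w k b)"
    using w by (auto simp: corepresentation_def)
  have fix_w: "(\<Sum>k\<in>I. h (w k b) *\<^sub>C w a k) = h (w a b) *\<^sub>C 1" if "a \<in> I" "b \<in> I" for a b
    using h_right[of "w a b"] \<Delta>w[OF that] by (simp add: slice_right_sum[OF h] h)
  \<comment> \<open>Pairing the fixed columns with the isometry w gives P = P^* P for the matrix P
    of the values of \<open>h\<close>, which makes P self-adjoint and idempotent.\<close>
  have P: "h (w a b) = (\<Sum>c\<in>I. cnj (h (w c a)) * h (w c b))" if a: "a \<in> I" and b: "b \<in> I" for a b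
  proof -
    have "(\<Sum>c\<in>I. h (w c b) *\<^sub>C star (w c a)) = (\<Sum>c\<in>I. star (w c a) * (\<Sum>k\<in>I. h (w k b) *\<^sub>C w c k))"
      by (intro sum.cong refl) (simp add: fix_w b mult_scaleC_right)
    also have "\<dots> = (\<Sum>k\<in>I. h (w k b) *\<^sub>C (\<Sum>c\<in>I. star (w c a) * w c k))"
      unfolding sum_distrib_left scaleC_sum_right by (subst sum.swap) (simp add: mult_scaleC_right)
    also have "\<dots> = (\<Sum>k\<in>I. if a = k then h (w k b) *\<^sub>C 1 else 0)"
      by (intro sum.cong refl) (simp add: iso a)
    also have "\<dots> = h (w a b) *\<^sub>C 1" using fin a by simp
    finally have "h (\<Sum>c\<in>I. h (w c b) *\<^sub>C star (w c a)) = h (w a b)" by (simp add: state_scale[OF h] state_one[OF h])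
    then show ?thesis by (simp add: state_sum[OF h] state_scale[OF h] state_star[OF h] mult.commute)
  qed
  show "(\<Sum>k\<in>I. h (w k b) *\<^sub>C w a k) = h (w a b) *\<^sub>C 1" if "a \<in> I" "b \<in> I" using fix_w[OF that] .
  show "h (w b a) = cnj (h (w a b))" if "a \<in> I" "b \<in> I"
    unfolding P[OF that(2,1)] P[OF that] by (simp add: mult.commute)
qed

text \<open>Write P1 and P2 for the matrices of \<open>h\<close> on the two products. Equality of
  their ranges enters as P1 P2 = P2 and P2 P1 = P1; since both are self-adjoint, P1 equals the
  adjoint of P2 P1, that is P1 P2 = P2.\<close>

lemma haar_trace_coeffs:
  assumes u: "corepresentation \<Delta> I u" "biisometric I u" and v: "corepresentation \<Delta> J v" "biisometric J v"
    and ij: "i \<in> I" "j \<in> I" and kl: "k \<in> J" "l \<in> J"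
  shows "h (u i j * star (v k l)) = h (star (v k l) * u i j)"
proof -
  have fin: "finite I" "finite J" using u v by (auto simp: corepresentation_def)
  define vc where "vc = (\<lambda>k l. star (v k l))"
  have vc: "corepresentation \<Delta> J vc" "biisometric J vc"
    unfolding vc_def by (rule corepresentation_conjugate[OF v(1)] biisometric_conjugate[OF v(2)])+
  \<comment> \<open>Passing from fixed vectors to intertwiners and back cancels v on the left or on
    the right, in both orders; this takes all four relations, the last two from unitarity of
    \<open>v\<close> and of its conjugate.\<close>
  have v1: "(\<Sum>k\<in>J. star (v k a) * v k b) = (if a = b then 1 else 0)"
    and v2: "(\<Sum>k\<in>J. v k a * star (v k b)) = (if a = b then 1 else 0)"
    and v3: "(\<Sum>k\<in>J. v a k * star (v b k)) = (if a = b then 1 else 0)"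
    and v4: "(\<Sum>k\<in>J. star (v a k) * v b k) = (if a = b then 1 else 0)" if "a \<in> J" "b \<in> J" for a b
    using v(2) biisometric_unitary[OF v] biisometric_unitary[OF vc] that
    by (auto simp: biisometric_def unitary_matrix_def vc_def)
  define w1 where "w1 = (\<lambda>(i, k) (j, l). u i j * vc k l)"
  \<comment> \<open>The flip puts the product in the opposite order on the same index set as
    \<open>w1\<close>, so that the two matrices can be multiplied.\<close>
  define w2 where "w2 = (\<lambda>a b. (\<lambda>(k, i) (l, j). vc k l * u i j) (prod.swap a) (prod.swap b))"
  have w1: "corepresentation \<Delta> (I \<times> J) w1" "biisometric (I \<times> J) w1"
    unfolding w1_def by (rule corepresentation_product[OF u(1) vc(1)] biisometric_product[OF fin u(2) vc(2)])+
  have sw: "bij_betw prod.swap (I \<times> J) (J \<times> I)" by (rule bij_betwI[of _ _ _ prod.swap]) auto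
  have w2: "corepresentation \<Delta> (I \<times> J) w2" "biisometric (I \<times> J) w2"
    unfolding w2_def
    by (rule corepresentation_reindex[OF sw corepresentation_product[OF vc(1) u(1)]]
        biisometric_reindex[OF sw biisometric_product[OF fin(2,1) vc(2) u(2)]])+
  have w_eq: "w1 (i, k) (j, l) = u i j * star (v k l)" "w2 (i, k) (j, l) = star (v k l) * u i j" for i j k l
    by (simp_all add: w1_def w2_def vc_def)
  note H1 = haar_matrix[OF w1(1)] and H2 = haar_matrix[OF w2(1)]
  have iso1: "(\<Sum>k\<in>I \<times> J. star (w1 k a) * w1 k b) = (if a = b then 1 else 0)" if "a \<in> I \<times> J" "b \<in> I \<times> J" for a b
    using w1(2) that unfolding biisometric_def by blast
  have iso2: "(\<Sum>k\<in>I \<times> J. star (w2 k a) * w2 k b) = (if a = b then 1 else 0)" if "a \<in> I \<times> J" "b \<in> I \<times> J" for a b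
    using w2(2) that unfolding biisometric_def by blast
  have split: "(\<Sum>c\<in>I \<times> J. F c) = (\<Sum>l\<in>J. \<Sum>j\<in>I. F (j, l))" for F :: "_ \<Rightarrow> 'a"
    by (subst sum.swap) (simp add: sum.cartesian_product)
  have fix21: "(\<Sum>c\<in>I \<times> J. X c *\<^sub>C w1 a c) = X a *\<^sub>C 1"
    if X: "\<And>a. a \<in> I \<times> J \<Longrightarrow> (\<Sum>c\<in>I \<times> J. X c *\<^sub>C w2 a c) = X a *\<^sub>C 1" and a: "a \<in> I \<times> J" for X a
  proof -
    obtain i k where ik: "a = (i, k)" "i \<in> I" "k \<in> J" using a by auto
    \<comment> \<open>With X read as a matrix, \<open>A l\<close> is an entry of u X, and
      \<open>A2\<close> below is the intertwining relation u X = X v.\<close>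
    define A where "A l = (\<Sum>j\<in>I. X (j, l) *\<^sub>C u i j)" for l
    have A1: "(\<Sum>l\<in>J. star (v k l) * A l) = X (i, k) *\<^sub>C 1" if "k \<in> J" for k
      using X[of "(i, k)"] that ik by (simp add: split w_eq A_def sum_distrib_left mult_scaleC_right)
    have A2: "A m = (\<Sum>k\<in>J. X (i, k) *\<^sub>C v k m)" if m: "m \<in> J" for m
    proof -
      have "(\<Sum>k\<in>J. X (i, k) *\<^sub>C v k m) = (\<Sum>k\<in>J. v k m * (\<Sum>l\<in>J. star (v k l) * A l))"
        by (intro sum.cong refl) (simp add: A1 mult_scaleC_right)
      also have "\<dots> = (\<Sum>l\<in>J. (\<Sum>k\<in>J. v k m * star (v k l)) * A l)"
        unfolding sum_distrib_left sum_distrib_right by (subst sum.swap) (simp add: mult.assoc)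
      also have "\<dots> = (\<Sum>l\<in>J. if m = l then A l else 0)" by (intro sum.cong refl) (simp add: v2 m)
      finally show ?thesis using fin m by simp
    qed
    have "(\<Sum>c\<in>I \<times> J. X c *\<^sub>C w1 a c) = (\<Sum>l\<in>J. A l * star (v k l))"
      by (simp add: ik split w_eq A_def sum_distrib_right mult_scaleC_left)
    also have "\<dots> = (\<Sum>l\<in>J. \<Sum>k'\<in>J. X (i, k') *\<^sub>C (v k' l * star (v k l)))"
      by (intro sum.cong refl) (simp add: A2 sum_distrib_right mult_scaleC_left)
    also have "\<dots> = (\<Sum>k'\<in>J. X (i, k') *\<^sub>C (\<Sum>l\<in>J. v k' l * star (v k l)))"
      by (subst sum.swap) (simp add: scaleC_sum_right)
    also have "\<dots> = (\<Sum>k'\<in>J. if k' = k then X (i, k') *\<^sub>C 1 else 0)" by (intro sum.cong refl) (simp add: v3 ik)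
    finally show ?thesis using fin ik by simp
  qed
  have fix12: "(\<Sum>c\<in>I \<times> J. X c *\<^sub>C w2 a c) = X a *\<^sub>C 1"
    if X: "\<And>a. a \<in> I \<times> J \<Longrightarrow> (\<Sum>c\<in>I \<times> J. X c *\<^sub>C w1 a c) = X a *\<^sub>C 1" and a: "a \<in> I \<times> J" for X a
  proof -
    obtain i k where ik: "a = (i, k)" "i \<in> I" "k \<in> J" using a by auto
    define A where "A l = (\<Sum>j\<in>I. X (j, l) *\<^sub>C u i j)" for l
    have A1: "(\<Sum>l\<in>J. A l * star (v k l)) = X (i, k) *\<^sub>C 1" if "k \<in> J" for k
      using X[of "(i, k)"] that ik by (simp add: split w_eq A_def sum_distrib_right mult_scaleC_left)
    have A2: "A m = (\<Sum>k\<in>J. X (i, k) *\<^sub>C v k m)" if m: "m \<in> J" for m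
    proof -
      have "(\<Sum>k\<in>J. X (i, k) *\<^sub>C v k m) = (\<Sum>k\<in>J. (\<Sum>l\<in>J. A l * star (v k l)) * v k m)"
        by (intro sum.cong refl) (simp add: A1 mult_scaleC_left)
      also have "\<dots> = (\<Sum>l\<in>J. A l * (\<Sum>k\<in>J. star (v k l) * v k m))"
        unfolding sum_distrib_left sum_distrib_right by (subst sum.swap) (simp add: mult.assoc)
      also have "\<dots> = (\<Sum>l\<in>J. if l = m then A l else 0)" by (intro sum.cong refl) (simp add: v1 m)
      finally show ?thesis using fin m by simp
    qed
    have "(\<Sum>c\<in>I \<times> J. X c *\<^sub>C w2 a c) = (\<Sum>l\<in>J. star (v k l) * A l)"
      by (simp add: ik split w_eq A_def sum_distrib_left mult_scaleC_right)
    also have "\<dots> = (\<Sum>l\<in>J. \<Sum>k'\<in>J. X (i, k') *\<^sub>C (star (v k l) * v k' l))"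
      by (intro sum.cong refl) (simp add: A2 sum_distrib_left mult_scaleC_right)
    also have "\<dots> = (\<Sum>k'\<in>J. X (i, k') *\<^sub>C (\<Sum>l\<in>J. star (v k l) * v k' l))"
      by (subst sum.swap) (simp add: scaleC_sum_right)
    also have "\<dots> = (\<Sum>k'\<in>J. if k = k' then X (i, k') *\<^sub>C 1 else 0)" by (intro sum.cong refl) (simp add: v4 ik)
    finally show ?thesis using fin ik by simp
  qed
  have P12: "(\<Sum>c\<in>I \<times> J. h (w1 a c) * h (w2 c b)) = h (w2 a b)" if a: "a \<in> I \<times> J" and b: "b \<in> I \<times> J" for a b
  proof -
    have "(\<Sum>c\<in>I \<times> J. h (w2 c b) *\<^sub>C w1 a c) = h (w2 a b) *\<^sub>C 1"
      by (rule fix21[OF _ a]) (rule H2(1)[OF iso2 _ b])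
    from arg_cong[OF this, of h] show ?thesis
      by (simp add: state_sum[OF h] state_scale[OF h] state_one[OF h] mult.commute)
  qed
  have P21: "(\<Sum>c\<in>I \<times> J. h (w2 a c) * h (w1 c b)) = h (w1 a b)" if a: "a \<in> I \<times> J" and b: "b \<in> I \<times> J" for a b
  proof -
    have "(\<Sum>c\<in>I \<times> J. h (w1 c b) *\<^sub>C w2 a c) = h (w1 a b) *\<^sub>C 1"
      by (rule fix12[OF _ a]) (rule H1(1)[OF iso1 _ b])
    from arg_cong[OF this, of h] show ?thesis
      by (simp add: state_sum[OF h] state_scale[OF h] state_one[OF h] mult.commute)
  qed
  have "h (w1 a b) = h (w2 a b)" if a: "a \<in> I \<times> J" and b: "b \<in> I \<times> J" for a b
  proof -
    have "h (w1 a b) = (\<Sum>c\<in>I \<times> J. h (w2 a c) * h (w1 c b))" by (rule P21[OF a b, symmetric])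
    also have "\<dots> = (\<Sum>c\<in>I \<times> J. cnj (h (w1 b c) * h (w2 c a)))"
      by (intro sum.cong refl) (simp add: H1(2)[OF iso1 b] H2(2)[OF iso2 _ a] mult.commute)
    also have "\<dots> = cnj (h (w2 b a))" by (simp add: P12[OF b a, symmetric])
    also have "\<dots> = h (w2 a b)" by (rule H2(2)[OF iso2 b a, symmetric])
    finally show ?thesis .
  qed
  from this[of "(i, k)" "(j, l)"] show ?thesis using ij kl by (simp add: w_eq)
qed

text \<open>The coefficients are stable under the involution, so the second factor can be written as
  a starred coefficient; continuity in one variable after the other extends the identity to the
  closed span.\<close>

lemma haar_tracial_on_kac_part:
  assumes "x \<in> kac_part" "y \<in> kac_part"
  shows "h (x * y) = h (y * x)"
proof -
  have 0: "h (x * y) = h (y * x)" if "x \<in> kac_coeffs" "y \<in> kac_coeffs" for x y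
  proof -
    have "x \<in> kac_coeffs" "star y \<in> kac_coeffs" by (rule that(1), rule kac_coeffs_star[OF that(2)])
    then obtain I J i j k l and u v :: "nat \<Rightarrow> nat \<Rightarrow> 'a" where
      u: "corepresentation \<Delta> I u" "biisometric I u" "i \<in> I" "j \<in> I" "x = u i j" and
      v: "corepresentation \<Delta> J v" "biisometric J v" "k \<in> J" "l \<in> J" "star y = v k l"
      unfolding kac_coeffs_def by blast
    show ?thesis using haar_trace_coeffs[OF u(1,2) v(1,2) u(3,4) v(3,4)] unfolding u(5)[symmetric] v(5)[symmetric] by simp
  qed
  have V: "csubspace {y. h (x * y) = h (y * x)}" "closed {y. h (x * y) = h (y * x)}" for x
  proof -
    show "csubspace {y. h (x * y) = h (y * x)}"
      by (auto simp: complex_vector.subspace_def distrib_left distrib_right mult_scaleC_left mult_scaleC_right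
          state_add[OF h] state_scale[OF h])
    show "closed {y. h (x * y) = h (y * x)}"
      by (intro closed_Collect_eq linear_continuous_on bounded_linear_compose[OF state_bounded_linear[OF h]]
          bounded_linear_mult_left bounded_linear_mult_right)
  qed
  have 1: "h (x * y) = h (y * x)" if "x \<in> kac_coeffs" "y \<in> kac_part" for x y
    using kac_part_induct[OF that(2) V[of x]] 0[OF that(1)] by blast
  have "kac_coeffs \<subseteq> {x. h (y * x) = h (x * y)}" using 1[OF _ assms(2)] by auto
  from kac_part_induct[OF assms(1) V[of y] this] show ?thesis by simp
qed

end

section \<open>Factorization of the action through the quotient\<close>

context coaction
begin

text \<open>On regular vectors \<alpha> visibly takes values in B \<otimes> Q. Conversely
  \<open>unitary_tensor_one\<close> expresses \<open>f \<otimes> t\<close> through elements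
  \<open>\<alpha> j * (1 \<otimes> q)\<close> with q in Q, because Q is closed under involution and
  products. Density of the regular vectors does the rest.\<close>

lemma quotient_group_action_kac_part:
  assumes dense: "closure (cspan regular_vectors) = UNIV"
  shows "quotient_group_action \<Delta> kac_part \<alpha>"
proof -
  let ?S = "tensor_sub UNIV kac_part :: ('b \<otimes> 'a) set"
  have \<alpha>S: "\<alpha> b \<in> ?S" for b
  proof -
    have "regular_vectors \<subseteq> {b. \<alpha> b \<in> ?S}"
    proof
      fix f assume "f \<in> regular_vectors"
      then obtain E w where E: "f \<in> E" "corepresentation \<Delta> E w" "biisometric E w" "\<And>k. k \<in> E \<Longrightarrow> \<alpha> k = (\<Sum>e\<in>E. e \<otimes> w e k)"
        unfolding regular_vectors_def by blast
      have "(\<Sum>e\<in>E. e \<otimes> w e f) \<in> ?S"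
        by (intro complex_vector.subspace_sum[OF csubspace_tensor_sub] tensor_sub_base UNIV_I kac_part_base kac_coeffsI[OF E(2,3)] E(1))
      then show "f \<in> {b. \<alpha> b \<in> ?S}" using E(1,4) by simp
    qed
    from dense_span_induct[OF dense csubspace_preimage[OF bounded_clinear_unital_star_hom[OF \<alpha>] csubspace_tensor_sub]
        closed_preimage[OF bounded_clinear_unital_star_hom[OF \<alpha>] closed_tensor_sub] this, of b]
    show ?thesis by simp
  qed
  have "closure (cspan {\<alpha> b * (1 \<otimes> q) | b q. q \<in> kac_part}) = ?S" (is "?R = _")
  proof
    have "\<alpha> b * (1 \<otimes> q) \<in> ?S" if "q \<in> kac_part" for b q
      by (rule tensor_sub_mult_right[OF \<alpha>S]) (simp add: tensor_mult tensor_sub_base kac_part_mult that)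
    then show "?R \<subseteq> ?S"
      by (intro closure_minimal complex_vector.span_minimal csubspace_tensor_sub closed_tensor_sub) auto
    have R: "csubspace ?R" "closed ?R" by (rule csubspace_closure complex_vector.subspace_span closed_closure)+
    have base: "\<alpha> b * (1 \<otimes> q) \<in> ?R" if "q \<in> kac_part" for b q
      by (rule subsetD[OF closure_subset complex_vector.span_base]) (use that in blast)
    show "?S \<subseteq> ?R"
    proof (rule tensor_sub_minimal[OF R])
      fix s :: 'b and t assume t: "t \<in> kac_part"
      have "regular_vectors \<subseteq> {s. s \<otimes> t \<in> ?R}"
      proof
        fix f assume "f \<in> regular_vectors"
        then obtain E w where E: "f \<in> E" "corepresentation \<Delta> E w" "biisometric E w" "\<And>k. k \<in> E \<Longrightarrow> \<alpha> k = (\<Sum>e\<in>E. e \<otimes> w e k)"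
          unfolding regular_vectors_def by blast
        have "f \<otimes> t = (f \<otimes> 1) * (1 \<otimes> t)" by (simp add: tensor_mult)
        also have "f \<otimes> 1 = (\<Sum>j\<in>E. \<alpha> j * (1 \<otimes> star (w f j)))"
          by (rule unitary_tensor_one[where e = "\<lambda>x. x", OF E(2) biisometric_unitary[OF E(2,3)] E(4,1)])
        also have "\<dots> * (1 \<otimes> t) = (\<Sum>j\<in>E. \<alpha> j * (1 \<otimes> (star (w f j) * t)))"
          by (simp add: sum_distrib_right mult.assoc tensor_mult)
        also have "\<dots> \<in> ?R"
          by (intro complex_vector.subspace_sum[OF R(1)] base kac_part_mult kac_part_star kac_part_base kac_coeffsI[OF E(2,3)] E(1) t)
        finally show "f \<in> {s. s \<otimes> t \<in> ?R}" by simp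
      qed
      from dense_span_induct[OF dense csubspace_preimage[OF bounded_clinear_tensor_left R(1)]
          closed_preimage[OF bounded_clinear_tensor_left R(2)] this, of s]
      show "s \<otimes> t \<in> ?R" by simp
    qed
  qed
  then show ?thesis unfolding quotient_group_action_def using \<alpha> coaction \<alpha>S by blast
qed

end

theorem theorem3p23:
  fixes \<Delta> :: "'a::{cstar_algebra, zero_neq_one} \<Rightarrow> 'a \<otimes> 'a"
    and \<alpha> :: "'b::cstar_algebra \<Rightarrow> 'b \<otimes> 'a"
  assumes "compact_quantum_group \<Delta>"
    and "cqg_action \<Delta> \<alpha>"
    and "faithful_action \<Delta> \<alpha>"
    and "(\<forall>\<mu>. invariant_state \<alpha> \<mu> \<longrightarrow> tracial \<mu>) \<or>
         (\<exists>\<mu>. invariant_state \<alpha> \<mu> \<and> tracial \<mu> \<and> faithful \<mu>)"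
  shows "kac_algebra \<Delta>"
proof -
  interpret cqg \<Delta> by standard (rule assms(1))
  obtain h where haar: "haar_state \<Delta> h" using haar_state_exists by blast
  interpret coaction \<Delta> h \<alpha> by standard (rule haar, rule assms(2))
  have "quotient_group_action \<Delta> kac_part \<alpha>"
    by (rule quotient_group_action_kac_part[OF regular_vectors_dense[OF assms(4)]])
  then have "kac_part = UNIV"
    using assms(3) quantum_quotient_group_kac_part unfolding faithful_action_def by blast
  then have "tracial h" using haar_tracial_on_kac_part by (simp add: tracial_def)
  then show ?thesis using assms(1) haar unfolding kac_algebra_def by blast
qed

end
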